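(* Let $\mathbf{k}$ be a differential field of characteristic $0$ with derivation $\partial$, let $G$ be a linear differential algebraic group over $\mathbf{k}$ with differential coordinate ring $A=\mathbf{k}\{G\}$, and let $\mathcal{A}=\mathcal{F}/\mathcal{R}$ be the $\partial$-$\mathbf{k}$-algebra constructed from $\mathbf{Rep}_G$ as described in the context. Then: (1) $\mathcal{A}$ is a finitely generated $\partial$-$\mathbf{k}$-algebra; (2) there is a surjective $\partial$-$\mathbf{k}$-algebra homomorphism $\Phi:\mathcal{A}\to A$ such that $\Phi\circ a_V=\psi_V$ for all differential $G$-modules $V$; (3) the map $\Phi$ is a $\partial$-$\mathbf{k}$-algebra isomorphism $\mathcal{A}\to A$.
   Context: A $\partial$-$\mathbf{k}$-algebra is a commutative $\mathbf{k}$-algebra with $1$ with a derivation $\partial$ extending that of $\mathbf{k}$; homomorphisms commute with $\partial$; it is finitely generated (as a $\partial$-$\mathbf{k}$-algebra) if it is generated as a $\mathbf{k}$-algebra by finitely many elements and all their iterated derivatives. A linear differential algebraic group $G$ over $\mathbf{k}$ is a subgroup of $\mathbf{GL}_n(\mathcal{U})$ defined by differential polynomial equations over $\mathbf{k}$, where $\mathcal{U}\supset\mathbf{k}$ is a semi-universal differential field (every differentially finitely generated differential field extension of $\mathbf{k}$ embeds in $\mathcal{U}$ over $\mathbf{k}$). Its coordinate ring $A=\mathbf{k}\{G\}$ is the quotient of $\mathbf{k}\{X_{ij},1/\det\}$ (differential polynomial ring in $n^2$ differential indeterminates with $\det$ inverted) by the radical differential ideal of $G$; it is a differential Hopf algebra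 (comultiplication $\Delta$, counit $\varepsilon$, coinverse $S$ commute with $\partial$), and $G$ is viewed as the functor $B\mapsto G(B)=\mathrm{Hom}_{\mathbf{k}[\partial]}(A,B)$ from $\partial$-$\mathbf{k}$-algebras to groups. $\mathbf{Rep}_G$ is the category of differential representations (differential $G$-modules): finite dimensional $\mathbf{k}$-vector spaces $V$ with a morphism of group functors $r_V:G\to\mathbf{GL}(V)$, $\mathbf{GL}(V)(B)=\mathrm{Aut}_B(V\otimes B)$, equivalently an $A$-comodule structure $\rho_V:V\to V\otimes A$; morphisms are $\mathbf{k}$-linear maps commuting with $G$. Tensor products and duals carry the usual actions; $\underline{1}$ is the trivial representation. Prolongation: let $\mathbf{k}[\partial]$ be the ring of linear differential operators ($\partial a=a\partial+\partial(a)$). $V^{(1)}:=\mathbf{k}[\partial]_{\le1}\otimes_{\mathbf{k}}V$ (right $\mathbf{k}$-structure on $\mathbf{k}[\partial]_{\le 1}$ for the tensor product, left one for the vector space structure); write $v=1\otimes v$, $\partial v=\partial\otimes v$. If $V$ has basis $v_1,\dots,v_n$ and $\rho_V(v_j)=\sum_iv_i\otimes a_{ij}$, then $V^{(1)}$ is a $G$-module via $\rho(v_j)=\sum_iv_i\otimes a_{ij}$, $\rho(\partial v_j)=\sum_i(\partial v_i\otimes a_{ij}+v_i\otimes\partial a_{ij})$. For $u\in V^*$ define $F(u)\in(V^{(1)})^*$ by $F(u)(v)=u(v)$, $F(u)(\partial\otimes v)=\partial(u(v))$ for $v\in V$. The linear map $\psi_V:V\otimes V^*\to A$ is $\psi_V(v\otimes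 u)(g)=u(r_V(g)\cdot v)$, i.e. $\psi_V(v\otimes u)=(u\otimes\mathrm{id}_A)(\rho_V(v))$. Construction of $\mathcal{A}$: $\mathcal{F}=\bigoplus_{V\in\mathrm{Ob}(\mathbf{Rep}_G)}V\otimes V^*$ with canonical injections $i_V:V\otimes V^*\to\mathcal{F}$; $\mathcal{R}\subset\mathcal{F}$ is the subspace spanned by all $(i_V\circ(\mathrm{id}\otimes\phi^* )-i_W\circ(\phi\otimes\mathrm{id}))(z)$ with $V,W\in\mathrm{Ob}(\mathbf{Rep}_G)$, $\phi\in\mathrm{Hom}_G(V,W)$, $z\in V\otimes W^*$; $\mathcal{A}=\mathcal{F}/\mathcal{R}$, and $a_V:V\otimes V^*\to\mathcal{A}$ is $i_V$ followed by the quotient map. $\mathcal{A}$ is a $\partial$-$\mathbf{k}$-algebra with product $a_V(v\otimes u)\cdot a_W(w\otimes t)=a_{V\otimes W}((v\otimes w)\otimes(u\otimes t))$, unit $a_{\underline{1}}(e\otimes f)$ where $0\neq e\in\underline{1}$, $f\in\underline{1}^*$, $f(e)=1$, and derivation $\partial(a_V(v\otimes u))=a_{V^{(1)}}(\partial v\otimes F(u))$. *)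

theory Defs
  imports
    "HOL-Analysis.Determinants"
    "HOL-Algebra.Algebraic_Closure_Type"
    "HOL-Library.Poly_Mapping"
begin

section \<open>Linear algebra over a field given by a type\<close>

abbreviation kring :: "'k::field ring" where
  "kring \<equiv> ring_of_type_algebra"

text \<open>A vector space over \<^typ>\<open>'k::field\<close> is a record \<open>V\<close> with \<open>Module.module kring V\<close>.  The fields
  \<^const>\<open>mult\<close> and \<^const>\<open>one\<close>, which every module record has, play no role for vector spaces.\<close>

definition add_hom :: "('a, 'm) ring_scheme \<Rightarrow> ('b, 'n) ring_scheme \<Rightarrow> ('a \<Rightarrow> 'b) set" where
  "add_hom M N = hom (add_monoid M) (add_monoid N)"

definition lin :: "('k, 'a, 'm) module_scheme \<Rightarrow> ('k, 'b, 'n) module_scheme \<Rightarrow> ('a \<Rightarrow> 'b) set" where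
  "lin M N = {f \<in> add_hom M N. \<forall>c. \<forall>x \<in> carrier M. f (c \<odot>\<^bsub>M\<^esub> x) = c \<odot>\<^bsub>N\<^esub> f x}"

definition lspan :: "('k::field, 'a, 'm) module_scheme \<Rightarrow> 'a set \<Rightarrow> 'a set" where
  "lspan M S = \<Inter> {N. submodule N kring M \<and> S \<subseteq> N}"

definition fin_dim :: "('k::field, 'a, 'm) module_scheme \<Rightarrow> bool" where
  "fin_dim V \<longleftrightarrow> (\<exists>S. finite S \<and> S \<subseteq> carrier V \<and> lspan V S = carrier V)"

definition quot_mod :: "('k, 'a, 'm) module_scheme \<Rightarrow> 'a set \<Rightarrow> ('k, 'a set) module" where
  "quot_mod M N = \<lparr>carrier = carrier (M Quot N), mult = mult (M Quot N), one = one (M Quot N),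
     zero = zero (M Quot N), add = add (M Quot N),
     module.smult = (\<lambda>c C. \<Union>x\<in>C. N +>\<^bsub>M\<^esub> (c \<odot>\<^bsub>M\<^esub> x))\<rparr>"

definition kmod :: "('k::field, 'k) module" where
  "kmod = \<lparr>carrier = UNIV, mult = (*), one = 1, zero = 0, add = (+), module.smult = (*)\<rparr>"

definition dual :: "('k::field, 'a, 'm) module_scheme \<Rightarrow> ('k, 'a \<Rightarrow> 'k) module" where
  "dual V = \<lparr>carrier = lin V kmod \<inter> extensional (carrier V), mult = undefined, one = undefined,
     zero = (\<lambda>x\<in>carrier V. 0), add = (\<lambda>u u'. \<lambda>x\<in>carrier V. u x + u' x),
     module.smult = (\<lambda>c u. \<lambda>x\<in>carrier V. c * u x)\<rparr>"

text \<open>The transpose \<open>W\<^sup>* \<rightarrow> V\<^sup>*\<close> of \<open>\<phi> : V \<rightarrow> W\<close>.\<close>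

definition dual_map :: "('k, 'a, 'm) module_scheme \<Rightarrow> ('a \<Rightarrow> 'b) \<Rightarrow> ('b \<Rightarrow> 'k) \<Rightarrow> ('a \<Rightarrow> 'k)" where
  "dual_map V \<phi> u = (\<lambda>x\<in>carrier V. u (\<phi> x))"


subsection \<open>Tensor products\<close>

definition free_mod :: "'x set \<Rightarrow> ('k::field, 'x \<Rightarrow> 'k) module" where
  "free_mod B = \<lparr>carrier = {f. finite {x. f x \<noteq> 0} \<and> {x. f x \<noteq> 0} \<subseteq> B},
     mult = undefined, one = undefined,
     zero = (\<lambda>_. 0), add = (\<lambda>f g x. f x + g x), module.smult = (\<lambda>c f x. c * f x)\<rparr>"

definition unit_fun :: "'x \<Rightarrow> 'x \<Rightarrow> 'k::field" where
  "unit_fun x = (\<lambda>y. if y = x then 1 else 0)"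

definition tensor_rel ::
  "('k::field, 'a, 'm) module_scheme \<Rightarrow> ('k, 'b, 'n) module_scheme \<Rightarrow> ('a \<times> 'b \<Rightarrow> 'k) set" where
  "tensor_rel M N = lspan (free_mod (carrier M \<times> carrier N))
    ({\<lambda>p. unit_fun (x \<oplus>\<^bsub>M\<^esub> x', y) p - unit_fun (x, y) p - unit_fun (x', y) p | x x' y.
        x \<in> carrier M \<and> x' \<in> carrier M \<and> y \<in> carrier N} \<union>
     {\<lambda>p. unit_fun (x, y \<oplus>\<^bsub>N\<^esub> y') p - unit_fun (x, y) p - unit_fun (x, y') p | x y y'.
        x \<in> carrier M \<and> y \<in> carrier N \<and> y' \<in> carrier N} \<union>
     {\<lambda>p. unit_fun (c \<odot>\<^bsub>M\<^esub> x, y) p - c * unit_fun (x, y) p | c x y.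
        x \<in> carrier M \<and> y \<in> carrier N} \<union>
     {\<lambda>p. unit_fun (x, c \<odot>\<^bsub>N\<^esub> y) p - c * unit_fun (x, y) p | c x y.
        x \<in> carrier M \<and> y \<in> carrier N})"

definition tensor ::
  "('k::field, 'a, 'm) module_scheme \<Rightarrow> ('k, 'b, 'n) module_scheme \<Rightarrow> ('k, ('a \<times> 'b \<Rightarrow> 'k) set) module"
  where "tensor M N = quot_mod (free_mod (carrier M \<times> carrier N)) (tensor_rel M N)"

definition tmul ::
  "('k::field, 'a, 'm) module_scheme \<Rightarrow> ('k, 'b, 'n) module_scheme \<Rightarrow> 'a \<Rightarrow> 'b \<Rightarrow> ('a \<times> 'b \<Rightarrow> 'k) set"
  where "tmul M N x y =
    tensor_rel M N +>\<^bsub>free_mod (carrier M \<times> carrier N) :: ('k, 'a \<times> 'b \<Rightarrow> 'k) module\<^esub> unit_fun (x, y)"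

text \<open>The additive map \<open>f\<close> on \<open>M \<otimes> N\<close> with \<open>f (x \<otimes> y) = \<beta> x y\<close>.  On \<open>carrier (tensor M N)\<close> it is
  unique, since pure tensors generate \<open>M \<otimes> N\<close> additively, and it exists whenever \<open>\<beta>\<close> is biadditive
  with \<open>\<beta> (c x) y = \<beta> x (c y)\<close>.  It is \<open>k\<close>-linear if \<open>\<beta>\<close> is \<open>k\<close>-bilinear, but the derivations
  below need \<open>\<beta>\<close> that are only balanced in this sense.\<close>

definition tlift ::
  "('k::field, 'a, 'm) module_scheme \<Rightarrow> ('k, 'b, 'n) module_scheme \<Rightarrow> ('c, 'p) ring_scheme \<Rightarrow>
    ('a \<Rightarrow> 'b \<Rightarrow> 'c) \<Rightarrow> ('a \<times> 'b \<Rightarrow> 'k) set \<Rightarrow> 'c" where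
  "tlift M N P \<beta> = (SOME f. f \<in> add_hom (tensor M N) P \<and>
     (\<forall>x \<in> carrier M. \<forall>y \<in> carrier N. f (tmul M N x y) = \<beta> x y))"

text \<open>\<open>f \<otimes> g : M \<otimes> N \<rightarrow> M' \<otimes> N'\<close>\<close>

definition tmap ::
  "('k::field, 'a, 'm) module_scheme \<Rightarrow> ('k, 'b, 'n) module_scheme \<Rightarrow>
    ('k, 'c, 'p) module_scheme \<Rightarrow> ('k, 'd, 'q) module_scheme \<Rightarrow>
    ('a \<Rightarrow> 'c) \<Rightarrow> ('b \<Rightarrow> 'd) \<Rightarrow> ('a \<times> 'b \<Rightarrow> 'k) set \<Rightarrow> ('c \<times> 'd \<Rightarrow> 'k) set" where
  "tmap M N M' N' f g = tlift M N (tensor M' N') (\<lambda>x y. tmul M' N' (f x) (g y))"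


section \<open>Differential algebras\<close>

definition derivation :: "('k::field \<Rightarrow> 'k) \<Rightarrow> bool" where
  "derivation d \<longleftrightarrow> (\<forall>x y. d (x + y) = d x + d y) \<and> (\<forall>x y. d (x * y) = d x * y + x * d y)"

record ('k, 'a) dalg = "('k, 'a) module" +
  der :: "'a \<Rightarrow> 'a"

definition dk_algebra :: "('k::field \<Rightarrow> 'k) \<Rightarrow> ('k, 'a, 'm) dalg_scheme \<Rightarrow> bool" where
  "dk_algebra d A \<longleftrightarrow> Module.algebra kring A \<and> der A \<in> add_hom A A \<and>
     (\<forall>x \<in> carrier A. \<forall>y \<in> carrier A.
        der A (x \<otimes>\<^bsub>A\<^esub> y) = (der A x \<otimes>\<^bsub>A\<^esub> y) \<oplus>\<^bsub>A\<^esub> (x \<otimes>\<^bsub>A\<^esub> der A y)) \<and>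
     (\<forall>c. der A (c \<odot>\<^bsub>A\<^esub> \<one>\<^bsub>A\<^esub>) = d c \<odot>\<^bsub>A\<^esub> \<one>\<^bsub>A\<^esub>)"

definition dk_hom :: "('k, 'a, 'm) dalg_scheme \<Rightarrow> ('k, 'b, 'n) dalg_scheme \<Rightarrow> ('a \<Rightarrow> 'b) set" where
  "dk_hom A B = {f \<in> ring_hom A B. f \<in> lin A B \<and> (\<forall>x \<in> carrier A. f (der A x) = der B (f x))}"

definition dk_iso :: "('k, 'a, 'm) dalg_scheme \<Rightarrow> ('k, 'b, 'n) dalg_scheme \<Rightarrow> ('a \<Rightarrow> 'b) set" where
  "dk_iso A B = {f \<in> dk_hom A B. bij_betw f (carrier A) (carrier B)}"

definition finitely_generated_dk_algebra ::
  "('k::field \<Rightarrow> 'k) \<Rightarrow> ('k, 'a, 'm) dalg_scheme \<Rightarrow> bool" where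
  "finitely_generated_dk_algebra d A \<longleftrightarrow> dk_algebra d A \<and>
     (\<exists>S. finite S \<and> S \<subseteq> carrier A \<and>
        (\<forall>B. subring B A \<and> (\<forall>c. \<forall>x \<in> B. c \<odot>\<^bsub>A\<^esub> x \<in> B) \<and> (\<forall>s \<in> S. \<forall>m. (der A ^^ m) s \<in> B)
           \<longrightarrow> B = carrier A))"

definition quot_dalg :: "('k, 'a, 'm) dalg_scheme \<Rightarrow> 'a set \<Rightarrow> ('k, 'a set) dalg" where
  "quot_dalg A I = \<lparr>carrier = carrier (quot_mod A I), mult = mult (quot_mod A I),
     one = one (quot_mod A I), zero = zero (quot_mod A I), add = add (quot_mod A I),
     module.smult = module.smult (quot_mod A I), der = (\<lambda>C. \<Union>x\<in>C. I +>\<^bsub>A\<^esub> der A x)\<rparr>"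

text \<open>\<open>A \<otimes>\<^sub>k B\<close> as a differential algebra:
  \<open>(a \<otimes> b) (a' \<otimes> b') = a a' \<otimes> b b'\<close> and \<open>\<partial> (a \<otimes> b) = \<partial> a \<otimes> b + a \<otimes> \<partial> b\<close>.\<close>

definition tensor_dalg ::
  "('k::field, 'a, 'm) dalg_scheme \<Rightarrow> ('k, 'b, 'n) dalg_scheme \<Rightarrow> ('k, ('a \<times> 'b \<Rightarrow> 'k) set) dalg"
  where "tensor_dalg A B = \<lparr>carrier = carrier (tensor A B),
     mult = (\<lambda>x y. tlift A B (tensor A B) (\<lambda>a b.
       tlift A B (tensor A B) (\<lambda>a' b'. tmul A B (a \<otimes>\<^bsub>A\<^esub> a') (b \<otimes>\<^bsub>B\<^esub> b')) y) x),
     one = tmul A B \<one>\<^bsub>A\<^esub> \<one>\<^bsub>B\<^esub>,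
     zero = zero (tensor A B), add = add (tensor A B), module.smult = module.smult (tensor A B),
     der = tlift A B (tensor A B)
       (\<lambda>a b. tmul A B (der A a) b \<oplus>\<^bsub>tensor A B\<^esub> tmul A B a (der B b))\<rparr>"

text \<open>A differential ring \<open>(R, D)\<close> on a whole type, as an algebra through \<open>emb : k \<rightarrow> R\<close>.\<close>

definition ext_dalg :: "('k \<Rightarrow> 'r::comm_ring_1) \<Rightarrow> ('r \<Rightarrow> 'r) \<Rightarrow> ('k, 'r) dalg" where
  "ext_dalg emb D = \<lparr>carrier = UNIV, mult = (*), one = 1, zero = 0, add = (+),
     module.smult = (\<lambda>c x. emb c * x), der = D\<rparr>"


subsection \<open>Differential polynomials\<close>

text \<open>\<open>k{x\<^sub>i | i \<in> 'x}\<close>: polynomials in the variables \<open>(i, m)\<close>, which stand for the derivatives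
  \<open>\<partial>\<^sup>m x\<^sub>i\<close>.\<close>

type_synonym ('k, 'x) dpoly = "('x \<times> nat \<Rightarrow>\<^sub>0 nat) \<Rightarrow>\<^sub>0 'k"

definition dp_const :: "'k::field \<Rightarrow> ('k, 'x) dpoly" where
  "dp_const c = Poly_Mapping.single 0 c"

definition dp_var :: "'x \<Rightarrow> ('k::field, 'x) dpoly" where
  "dp_var i = Poly_Mapping.single (Poly_Mapping.single (i, 0) 1) 1"

definition dp_der :: "('k::field \<Rightarrow> 'k) \<Rightarrow> ('k, 'x) dpoly \<Rightarrow> ('k, 'x) dpoly" where
  "dp_der d p = (\<Sum>m\<in>Poly_Mapping.keys p.
     Poly_Mapping.single m (d (Poly_Mapping.lookup p m)) +
     (\<Sum>(i, r)\<in>Poly_Mapping.keys m. Poly_Mapping.single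
        (m - Poly_Mapping.single (i, r) 1 + Poly_Mapping.single (i, Suc r) 1)
        (of_nat (Poly_Mapping.lookup m (i, r)) * Poly_Mapping.lookup p m)))"

definition dp_eval ::
  "('k::field \<Rightarrow> 'r::comm_ring_1) \<Rightarrow> ('r \<Rightarrow> 'r) \<Rightarrow> ('x \<Rightarrow> 'r) \<Rightarrow> ('k, 'x) dpoly \<Rightarrow> 'r" where
  "dp_eval emb D a p = (\<Sum>m\<in>Poly_Mapping.keys p. emb (Poly_Mapping.lookup p m) *
     (\<Prod>(i, r)\<in>Poly_Mapping.keys m. ((D ^^ r) (a i)) ^ Poly_Mapping.lookup m (i, r)))"

definition dp_alg :: "('k::field \<Rightarrow> 'k) \<Rightarrow> ('k, ('k, 'x) dpoly) dalg" where
  "dp_alg d = ext_dalg dp_const (dp_der d)"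


subsection \<open>Semi-universal differential field extensions\<close>

text \<open>A differential field extension of \<open>k\<close> is a \<open>\<partial>\<close>-\<open>k\<close>-algebra that is a field.\<close>

definition fin_gen_field_ext ::
  "('k::field \<Rightarrow> 'k) \<Rightarrow> ('k, 'a, 'm) dalg_scheme \<Rightarrow> bool" where
  "fin_gen_field_ext d L \<longleftrightarrow> dk_algebra d L \<and> Ring.field L \<and>
     (\<exists>S. finite S \<and> S \<subseteq> carrier L \<and>
        (\<forall>F. subfield F L \<and> (\<forall>c. c \<odot>\<^bsub>L\<^esub> \<one>\<^bsub>L\<^esub> \<in> F) \<and> S \<subseteq> F \<and> der L ` F \<subseteq> F
           \<longrightarrow> F = carrier L))"

text \<open>Every differentially finitely generated extension of \<open>k\<close> is the fraction field of a quotient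
  of some \<open>k{y\<^sub>0, \<dots>, y\<^sub>m}\<close>, whose elements are classes of pairs of differential polynomials.  So
  each such extension has an isomorphic copy with carrier in the type used here for \<open>L\<close>.\<close>

definition semi_universal ::
  "('k::field \<Rightarrow> 'k) \<Rightarrow> ('u::field \<Rightarrow> 'u) \<Rightarrow> ('k \<Rightarrow> 'u) \<Rightarrow> bool" where
  "semi_universal d D emb \<longleftrightarrow> dk_algebra d (ext_dalg emb D) \<and>
     (\<forall>L :: ('k, (('k, nat) dpoly \<times> ('k, nat) dpoly) set) dalg.
        fin_gen_field_ext d L \<longrightarrow> (\<exists>\<sigma>. \<sigma> \<in> dk_hom L (ext_dalg emb D)))"


section \<open>Linear differential algebraic groups\<close>

definition linear_diff_alg_group ::
  "('u::field \<Rightarrow> 'u) \<Rightarrow> ('k::field \<Rightarrow> 'u) \<Rightarrow> ('u ^ 'n ^ 'n) set \<Rightarrow> bool" where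
  "linear_diff_alg_group D emb G \<longleftrightarrow>
     (\<exists>S :: ('k, 'n \<times> 'n) dpoly set.
        G = {g. invertible g \<and> (\<forall>p \<in> S. dp_eval emb D (\<lambda>(i, j). g $ i $ j) p = 0)}) \<and>
     mat 1 \<in> G \<and> (\<forall>g \<in> G. \<forall>h \<in> G. g ** h \<in> G) \<and> (\<forall>g \<in> G. matrix_inv g \<in> G)"

text \<open>\<open>k{X\<^sub>i\<^sub>j, 1/det}\<close> is obtained from \<open>k{X\<^sub>i\<^sub>j, Y}\<close> by dividing out the differential ideal generated
  by \<open>Y det - 1\<close>.  This ideal lies in the ideal of all differential polynomials that vanish at
  \<open>X = g\<close>, \<open>Y = 1 / det g\<close> for every \<open>g \<in> G\<close>, so \<open>k{G}\<close> is the quotient of \<open>k{X\<^sub>i\<^sub>j, Y}\<close> by the latter.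
  \<open>InvDet\<close> is the indeterminate \<open>Y\<close>.\<close>

datatype 'n gl_index = Entry 'n 'n | InvDet

definition gl_point :: "'u::field ^ 'n ^ 'n \<Rightarrow> 'n gl_index \<Rightarrow> 'u" where
  "gl_point g x = (case x of Entry i j \<Rightarrow> g $ i $ j | InvDet \<Rightarrow> inverse (det g))"

definition group_ideal ::
  "('u::field \<Rightarrow> 'u) \<Rightarrow> ('k::field \<Rightarrow> 'u) \<Rightarrow> ('u ^ 'n ^ 'n) set \<Rightarrow> ('k, 'n gl_index) dpoly set" where
  "group_ideal D emb G = {p. \<forall>g \<in> G. dp_eval emb D (gl_point g) p = 0}"

text \<open>Differential Hopf algebras.  The coinverse is determined by the rest and is not recorded.\<close>

record ('k, 'a) dhopf = "('k, 'a) dalg" +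
  comult :: "'a \<Rightarrow> ('a \<times> 'a \<Rightarrow> 'k) set"
  counit :: "'a \<Rightarrow> 'k"

definition coord_dalg ::
  "('k::field \<Rightarrow> 'k) \<Rightarrow> ('u::field \<Rightarrow> 'u) \<Rightarrow> ('k \<Rightarrow> 'u) \<Rightarrow> ('u ^ 'n ^ 'n) set \<Rightarrow>
    ('k, ('k, 'n gl_index) dpoly set) dalg" where
  "coord_dalg d D emb G = quot_dalg (dp_alg d) (group_ideal D emb G)"

definition coord_fun ::
  "('k::field \<Rightarrow> 'k) \<Rightarrow> ('u::field \<Rightarrow> 'u) \<Rightarrow> ('k \<Rightarrow> 'u) \<Rightarrow> ('u ^ 'n ^ 'n) set \<Rightarrow>
    'n \<Rightarrow> 'n \<Rightarrow> ('k, 'n gl_index) dpoly set" where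
  "coord_fun d D emb G i j =
     group_ideal D emb G +>\<^bsub>dp_alg d :: ('k, ('k, 'n gl_index) dpoly) dalg\<^esub> dp_var (Entry i j)"

text \<open>\<open>\<Delta>\<close> and \<open>\<epsilon>\<close> are the homomorphisms of \<open>\<partial>\<close>-\<open>k\<close>-algebras with \<open>\<Delta> x\<^sub>i\<^sub>j = \<Sum>\<^sub>l x\<^sub>i\<^sub>l \<otimes> x\<^sub>l\<^sub>j\<close> and
  \<open>\<epsilon> x\<^sub>i\<^sub>j = \<delta>\<^sub>i\<^sub>j\<close>; the \<open>x\<^sub>i\<^sub>j\<close> and \<open>1/det\<close> generate \<open>k{G}\<close>, so they are unique on its carrier.\<close>

definition coord_ring ::
  "('k::field \<Rightarrow> 'k) \<Rightarrow> ('u::field \<Rightarrow> 'u) \<Rightarrow> ('k \<Rightarrow> 'u) \<Rightarrow> ('u ^ 'n ^ 'n) set \<Rightarrow>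
    ('k, ('k, 'n gl_index) dpoly set) dhopf" where
  "coord_ring d D emb G = (let A = coord_dalg d D emb G; x = coord_fun d D emb G in
     \<lparr>carrier = carrier A, mult = mult A, one = one A, zero = zero A, add = add A,
      module.smult = module.smult A, der = der A,
      comult = (SOME \<Delta>. \<Delta> \<in> dk_hom A (tensor_dalg A A) \<and>
        (\<forall>i j. \<Delta> (x i j) = finsum (tensor A A) (\<lambda>l. tmul A A (x i l) (x l j)) UNIV)),
      counit = (SOME \<epsilon>. \<epsilon> \<in> dk_hom A (ext_dalg id d) \<and>
        (\<forall>i j. \<epsilon> (x i j) = (if i = j then 1 else 0)))\<rparr>)"


section \<open>Differential representations\<close>

record ('k, 'v, 'a) gmod = "('k, 'v) module" +
  coact :: "'v \<Rightarrow> ('v \<times> 'a \<Rightarrow> 'k) set"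

text \<open>\<open>(V \<otimes> A) \<otimes> A \<rightarrow> V \<otimes> (A \<otimes> A)\<close>\<close>

definition tensor_assoc ::
  "('k::field, 'v, 'm) module_scheme \<Rightarrow> ('k, 'a, 'n) module_scheme \<Rightarrow>
    (('v \<times> 'a \<Rightarrow> 'k) set \<times> 'a \<Rightarrow> 'k) set \<Rightarrow> ('v \<times> ('a \<times> 'a \<Rightarrow> 'k) set \<Rightarrow> 'k) set" where
  "tensor_assoc V A = tlift (tensor V A) A (tensor V (tensor A A)) (\<lambda>s a.
     tlift V A (tensor V (tensor A A)) (\<lambda>v b. tmul V (tensor A A) v (tmul A A b a)) s)"

definition gmodule :: "('k::field, 'a) dhopf \<Rightarrow> ('k, 'v, 'a) gmod \<Rightarrow> bool" where
  "gmodule A V \<longleftrightarrow> Module.module kring V \<and> fin_dim V \<and> coact V \<in> lin V (tensor V A) \<and>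
     (\<forall>v \<in> carrier V.
        tensor_assoc V A (tmap V A (tensor V A) A (coact V) id (coact V v)) =
        tmap V A V (tensor A A) id (comult A) (coact V v)) \<and>
     (\<forall>v \<in> carrier V. tlift V A V (\<lambda>w a. counit A a \<odot>\<^bsub>V\<^esub> w) (coact V v) = v)"

definition gmod_hom ::
  "('k::field, 'a) dhopf \<Rightarrow> ('k, 'v, 'a) gmod \<Rightarrow> ('k, 'w, 'a) gmod \<Rightarrow> ('v \<Rightarrow> 'w) set" where
  "gmod_hom A V W =
     {\<phi> \<in> lin V W. \<forall>v \<in> carrier V. coact W (\<phi> v) = tmap V A W A \<phi> id (coact V v)}"

definition gmod_iso ::
  "('k::field, 'a) dhopf \<Rightarrow> ('k, 'v, 'a) gmod \<Rightarrow> ('k, 'w, 'a) gmod \<Rightarrow> ('v \<Rightarrow> 'w) set" where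
  "gmod_iso A V W = {\<phi> \<in> gmod_hom A V W. bij_betw \<phi> (carrier V) (carrier W)}"

definition triv_gmod :: "('k::field, 'a) dhopf \<Rightarrow> ('k, 'k, 'a) gmod" where
  "triv_gmod A = \<lparr>carrier = carrier kmod, mult = mult kmod, one = one kmod, zero = zero kmod,
     add = add kmod, module.smult = module.smult kmod, coact = (\<lambda>c. tmul kmod A c \<one>\<^bsub>A\<^esub>)\<rparr>"

text \<open>If \<open>\<rho> v = \<Sum> v\<^sub>i \<otimes> a\<^sub>i\<close> and \<open>\<rho> w = \<Sum> w\<^sub>j \<otimes> b\<^sub>j\<close> then \<open>\<rho> (v \<otimes> w) = \<Sum> (v\<^sub>i \<otimes> w\<^sub>j) \<otimes> a\<^sub>i b\<^sub>j\<close>.\<close>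

definition tensor_gmod ::
  "('k::field, 'a) dhopf \<Rightarrow> ('k, 'v, 'a) gmod \<Rightarrow> ('k, 'w, 'a) gmod \<Rightarrow>
    ('k, ('v \<times> 'w \<Rightarrow> 'k) set, 'a) gmod" where
  "tensor_gmod A V W = (let T = tensor V W in
     \<lparr>carrier = carrier T, mult = mult T, one = one T, zero = zero T, add = add T,
      module.smult = module.smult T,
      coact = tlift V W (tensor T A) (\<lambda>v w.
        tlift V A (tensor T A) (\<lambda>v' a.
          tlift W A (tensor T A) (\<lambda>w' b. tmul T A (tmul V W v' w') (a \<otimes>\<^bsub>A\<^esub> b))
            (coact W w))
          (coact V v))\<rparr>)"

text \<open>\<open>V\<^sup>(\<^sup>1\<^sup>) = k[\<partial>]\<^sub>\<le>\<^sub>1 \<otimes>\<^sub>k V\<close>.  Each element is \<open>1 \<otimes> x + \<partial> \<otimes> y\<close> for unique \<open>x, y \<in> V\<close> and is represented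
  by \<open>(x, y)\<close>.  As \<open>c \<partial> = \<partial> c - \<partial>(c)\<close> in \<open>k[\<partial>]\<close>, one has
  \<open>c (1 \<otimes> x + \<partial> \<otimes> y) = 1 \<otimes> (c x - \<partial>(c) y) + \<partial> \<otimes> c y\<close>.\<close>

definition prolong_mod ::
  "('k::field \<Rightarrow> 'k) \<Rightarrow> ('k, 'v, 'm) module_scheme \<Rightarrow> ('k, 'v \<times> 'v) module" where
  "prolong_mod d V = \<lparr>carrier = carrier V \<times> carrier V, mult = undefined, one = undefined,
     zero = (\<zero>\<^bsub>V\<^esub>, \<zero>\<^bsub>V\<^esub>),
     add = (\<lambda>(x, y) (x', y'). (x \<oplus>\<^bsub>V\<^esub> x', y \<oplus>\<^bsub>V\<^esub> y')),
     module.smult = (\<lambda>c (x, y). ((c \<odot>\<^bsub>V\<^esub> x) \<ominus>\<^bsub>V\<^esub> (d c \<odot>\<^bsub>V\<^esub> y), c \<odot>\<^bsub>V\<^esub> y))\<rparr>"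

definition prolong_incl :: "('k, 'v, 'm) module_scheme \<Rightarrow> 'v \<Rightarrow> 'v \<times> 'v" where
  "prolong_incl V v = (v, \<zero>\<^bsub>V\<^esub>)"

definition prolong_der :: "('k, 'v, 'm) module_scheme \<Rightarrow> 'v \<Rightarrow> 'v \<times> 'v" where
  "prolong_der V v = (\<zero>\<^bsub>V\<^esub>, v)"

text \<open>If \<open>\<rho> v = \<Sum> v\<^sub>i \<otimes> a\<^sub>i\<close> then in \<open>V\<^sup>(\<^sup>1\<^sup>)\<close> again \<open>\<rho> v = \<Sum> v\<^sub>i \<otimes> a\<^sub>i\<close>, and
  \<open>\<rho> (\<partial>v) = \<Sum> \<partial>v\<^sub>i \<otimes> a\<^sub>i + v\<^sub>i \<otimes> \<partial>a\<^sub>i\<close>.\<close>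

definition prolong_gmod ::
  "('k::field \<Rightarrow> 'k) \<Rightarrow> ('k, 'a) dhopf \<Rightarrow> ('k, 'v, 'a) gmod \<Rightarrow> ('k, 'v \<times> 'v, 'a) gmod" where
  "prolong_gmod d A V = (let P = prolong_mod d V; T = tensor P A in
     \<lparr>carrier = carrier P, mult = mult P, one = one P, zero = zero P, add = add P,
      module.smult = module.smult P,
      coact = (\<lambda>(x, y).
        tmap V A P A (prolong_incl V) id (coact V x) \<oplus>\<^bsub>T\<^esub>
        tlift V A T (\<lambda>v a. tmul P A (prolong_der V v) a \<oplus>\<^bsub>T\<^esub> tmul P A (prolong_incl V v) (der A a))
          (coact V y))\<rparr>)"

text \<open>\<open>F(u)\<close>, given by \<open>F(u)(1 \<otimes> v) = u v\<close> and \<open>F(u)(\<partial> \<otimes> v) = \<partial>(u v)\<close>.\<close>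

definition prolong_functional ::
  "('k::field \<Rightarrow> 'k) \<Rightarrow> ('k, 'v, 'm) module_scheme \<Rightarrow> ('v \<Rightarrow> 'k) \<Rightarrow> ('v \<times> 'v \<Rightarrow> 'k)" where
  "prolong_functional d V u = (\<lambda>(x, y)\<in>carrier V \<times> carrier V. u x + d (u y))"

text \<open>\<open>u \<otimes> t\<close> as an element of \<open>(V \<otimes> W)\<^sup>*\<close>\<close>

definition tensor_functional ::
  "('k::field, 'v, 'm) module_scheme \<Rightarrow> ('k, 'w, 'n) module_scheme \<Rightarrow>
    ('v \<Rightarrow> 'k) \<Rightarrow> ('w \<Rightarrow> 'k) \<Rightarrow> ('v \<times> 'w \<Rightarrow> 'k) set \<Rightarrow> 'k" where
  "tensor_functional V W u t =
     (\<lambda>z\<in>carrier (tensor V W). tlift V W kmod (\<lambda>v w. u v * t w) z)"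

text \<open>\<open>\<psi>\<^sub>V : V \<otimes> V\<^sup>* \<rightarrow> A\<close>, \<open>\<psi>\<^sub>V (v \<otimes> u) = (u \<otimes> id) (\<rho> v)\<close>\<close>

definition mat_coeff ::
  "('k::field, 'a) dhopf \<Rightarrow> ('k, 'v, 'a) gmod \<Rightarrow> ('v \<times> ('v \<Rightarrow> 'k) \<Rightarrow> 'k) set \<Rightarrow> 'a" where
  "mat_coeff A V = tlift V (dual V) A (\<lambda>v u. tlift V A A (\<lambda>w a. u w \<odot>\<^bsub>A\<^esub> a) (coact V v))"


section \<open>The algebra \<open>\<F>/\<R>\<close>\<close>

text \<open>All differential \<open>G\<close>-modules form a proper class.  The direct sum \<open>\<F>\<close> is taken over those with
  carrier in a type \<^typ>\<open>'e\<close>, which has to be large enough for every finite-dimensional space to have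
  an isomorphic copy in it.\<close>

definition reps :: "('k::field, 'a) dhopf \<Rightarrow> ('k, 'e, 'a) gmod set" where
  "reps A = {V. gmodule A V}"

type_synonym ('k, 'e, 'a) fsum = "('k, 'e, 'a) gmod \<Rightarrow> ('e \<times> ('e \<Rightarrow> 'k) \<Rightarrow> 'k) set"

definition Fsum :: "('k::field, 'a) dhopf \<Rightarrow> ('k, ('k, 'e, 'a) fsum) module" where
  "Fsum A = \<lparr>carrier = {f \<in> (\<Pi>\<^sub>E V\<in>reps A. carrier (tensor V (dual V))).
       finite {V \<in> reps A. f V \<noteq> \<zero>\<^bsub>tensor V (dual V)\<^esub>}},
     mult = undefined, one = undefined,
     zero = (\<lambda>V\<in>reps A. \<zero>\<^bsub>tensor V (dual V)\<^esub>),
     add = (\<lambda>f g. \<lambda>V\<in>reps A. f V \<oplus>\<^bsub>tensor V (dual V)\<^esub> g V),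
     module.smult = (\<lambda>c f. \<lambda>V\<in>reps A. c \<odot>\<^bsub>tensor V (dual V)\<^esub> f V)\<rparr>"

definition Finj ::
  "('k::field, 'a) dhopf \<Rightarrow> ('k, 'e, 'a) gmod \<Rightarrow> ('e \<times> ('e \<Rightarrow> 'k) \<Rightarrow> 'k) set \<Rightarrow> ('k, 'e, 'a) fsum" where
  "Finj A V z = (\<lambda>W\<in>reps A. if W = V then z else \<zero>\<^bsub>tensor W (dual W)\<^esub>)"

definition Rrel :: "('k::field, 'a) dhopf \<Rightarrow> ('k, 'e, 'a) fsum set" where
  "Rrel A = lspan (Fsum A)
     {Finj A V (tmap V (dual W) V (dual V) id (dual_map V \<phi>) z) \<ominus>\<^bsub>Fsum A\<^esub>
      Finj A W (tmap V (dual W) W (dual W) \<phi> id z) | V W \<phi> z.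
        V \<in> reps A \<and> W \<in> reps A \<and> \<phi> \<in> gmod_hom A V W \<and> z \<in> carrier (tensor V (dual W))}"

definition FmodR :: "('k::field, 'a) dhopf \<Rightarrow> ('k, ('k, 'e, 'a) fsum set) module" where
  "FmodR A = quot_mod (Fsum A) (Rrel A)"

text \<open>The map \<open>a\<^sub>V\<close> for \<open>V \<in> reps A\<close>.\<close>

definition rep_coeff ::
  "('k::field, 'a) dhopf \<Rightarrow> ('k, 'e, 'a) gmod \<Rightarrow> ('e \<times> ('e \<Rightarrow> 'k) \<Rightarrow> 'k) set \<Rightarrow>
    ('k, 'e, 'a) fsum set" where
  "rep_coeff A V z = Rrel A +>\<^bsub>Fsum A\<^esub> Finj A V z"

text \<open>The map \<open>a\<^sub>V\<close> for a \<open>G\<close>-module \<open>V\<close> on any type, such as \<open>V \<otimes> W\<close> or \<open>V\<^sup>(\<^sup>1\<^sup>)\<close>: replace \<open>V\<close> by an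
  isomorphic copy \<open>V'\<close> in \<^const>\<open>reps\<close>, carrying \<open>z \<in> V \<otimes> V\<^sup>*\<close> along \<open>\<theta> \<otimes> (\<theta>\<^sup>-\<^sup>1)\<^sup>*\<close>.  By the definition of
  \<^const>\<open>Rrel\<close> the result does not depend on \<open>V'\<close> and \<open>\<theta>\<close>, and for \<open>V \<in> reps A\<close> it is \<open>rep_coeff A V z\<close>.\<close>

definition rep_coeff_any ::
  "('k::field, 'a) dhopf \<Rightarrow> ('k, 'v, 'a) gmod \<Rightarrow> ('v \<times> ('v \<Rightarrow> 'k) \<Rightarrow> 'k) set \<Rightarrow>
    ('k, 'e, 'a) fsum set" where
  "rep_coeff_any A V z = (SOME x. \<exists>V' \<in> reps A. \<exists>\<theta> \<in> gmod_iso A V V'.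
     x = rep_coeff A V' (tmap V (dual V) V' (dual V') \<theta> (dual_map V' (inv_into (carrier V) \<theta>)) z))"

text \<open>The \<open>\<partial>\<close>-\<open>k\<close>-algebra \<open>\<F>/\<R>\<close>.  Multiplication and derivation are determined on the carrier by the
  given formulas, as the \<open>a\<^sub>V (v \<otimes> u)\<close> generate \<open>\<F>/\<R>\<close> additively.\<close>

definition tannaka_mult ::
  "('k::field, 'a) dhopf \<Rightarrow>
    ('k, 'e, 'a) fsum set \<Rightarrow> ('k, 'e, 'a) fsum set \<Rightarrow> ('k, 'e, 'a) fsum set" where
  "tannaka_mult A = (SOME m.
     (\<forall>x \<in> carrier (FmodR A). m x \<in> add_hom (FmodR A) (FmodR A)) \<and>
     (\<forall>y \<in> carrier (FmodR A). (\<lambda>x. m x y) \<in> add_hom (FmodR A) (FmodR A)) \<and>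
     (\<forall>V \<in> reps A. \<forall>W \<in> reps A. \<forall>v \<in> carrier V. \<forall>u \<in> carrier (dual V).
        \<forall>w \<in> carrier W. \<forall>t \<in> carrier (dual W).
        m (rep_coeff A V (tmul V (dual V) v u)) (rep_coeff A W (tmul W (dual W) w t)) =
        (let T = tensor_gmod A V W in
          rep_coeff_any A T (tmul T (dual T) (tmul V W v w) (tensor_functional V W u t)))))"

definition tannaka_der ::
  "('k::field \<Rightarrow> 'k) \<Rightarrow> ('k, 'a) dhopf \<Rightarrow> ('k, 'e, 'a) fsum set \<Rightarrow> ('k, 'e, 'a) fsum set" where
  "tannaka_der d A = (SOME D. D \<in> add_hom (FmodR A) (FmodR A) \<and>
     (\<forall>V \<in> reps A. \<forall>v \<in> carrier V. \<forall>u \<in> carrier (dual V).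
        D (rep_coeff A V (tmul V (dual V) v u)) =
        (let P = prolong_gmod d A V in
          rep_coeff_any A P (tmul P (dual P) (prolong_der V v) (prolong_functional d V u)))))"

definition tannaka_algebra ::
  "('k::field \<Rightarrow> 'k) \<Rightarrow> ('k, 'a) dhopf \<Rightarrow> ('k, ('k, 'e, 'a) fsum set) dalg" where
  "tannaka_algebra d A = \<lparr>carrier = carrier (FmodR A), mult = tannaka_mult A,
     one = (let E = triv_gmod A in rep_coeff_any A E (tmul E (dual E) 1 (\<lambda>c. c))),
     zero = zero (FmodR A), add = add (FmodR A), module.smult = module.smult (FmodR A),
     der = tannaka_der d A\<rparr>"

end

(*
  The matrix coefficients psi_V are compatible with morphisms, so they induce a linear map
  Phi : F/R -> A.  A finite-dimensional subcomodule N of A gives a section of Phi over N, namely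
  w |-> a_N (w (x) eps|N).  For a G-module V and u in V^* the map f_u v = (u (x) id) (rho v) is a
  comodule map V -> A with eps o f_u = u, so a_V (v (x) u) = a_N (f_u v (x) eps) with N = f_u V.
  Hence every element x of F/R is the section of Phi x over some N, and Phi is injective; it is
  surjective since every element of A lies in a finite-dimensional subcomodule.  The bialgebra axioms
  for A are checked at points of G.  That the points separate A (x) A and A (x) A (x) A follows from
  Artin's lemma on automorphisms over an algebraically closed field, Taylor series, which turn
  non-differential points into differential ones, and semi-universality.
*)
theory Submission
  imports Defs
begin

section \<open>Vector spaces and additive maps\<close>

text \<open>\<open>comult\<close> and \<open>counit\<close> are chosen by \<open>SOME\<close>, so
  nothing is known about them until homomorphisms with the prescribed values on the x_ij are
  exhibited; this already needs points that separate A \<otimes> A. Artin's argument does not apply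
  directly to the points of G over \<open>'u\<close>: it needs a set of points stable under
  automorphisms whose fixed field is k, and automorphisms of \<open>'u\<close> over k need not
  commute with \<open>D\<close>. The k-algebra homomorphisms from A to the algebraic closure of
  \<open>'u\<close>, with the derivation forgotten, form such a set; Taylor series restore the
  derivation afterwards. Characteristic 0 gives separability and division by n!. The product and the
  derivation of F/R are chosen by \<open>SOME\<close> as well. Hence \<Phi> is first shown to be
  bijective as a linear map; transporting the operations of A back along it proves that operations
  as required exist, and their values on generators then show that \<Phi> respects whichever were
  chosen. Tensor products are quotients of free spaces without bases, so computations with
  coefficients of \<rho> are replaced by slices: functionals applied to one factor.\<close>

abbreviation kvs :: "('k::field, 'a, 'm) module_scheme \<Rightarrow> bool" where
  "kvs M \<equiv> Module.module kring M"

lemma kring_simps [simp]: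
  "carrier kring = UNIV" "monoid.mult kring = (*)" "monoid.one kring = 1"
  "ring.zero kring = 0" "ring.add kring = (+)"
  by (simp_all add: ring_of_type_algebra_def fun_eq_iff)

lemma kring_minus [simp]: "\<ominus>\<^bsub>kring\<^esub> (c :: 'k::field) = - c"
proof -
  interpret cring "kring :: 'k ring" by (rule cring_from_type_algebra)
  show ?thesis using minus_equality[of "- c" c] by simp
qed

lemma kvs_abelian [simp]: "kvs M \<Longrightarrow> abelian_group M"
  by (rule module.axioms(2))

lemma kvsI:
  fixes M :: "('k::field, 'a, 'm) module_scheme" (structure)
  assumes "abelian_group M"
    and "\<And>c x. x \<in> carrier M \<Longrightarrow> c \<odot> x \<in> carrier M"
    and "\<And>a b x. x \<in> carrier M \<Longrightarrow> (a + b) \<odot> x = a \<odot> x \<oplus> b \<odot> x"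
    and "\<And>a x y. x \<in> carrier M \<Longrightarrow> y \<in> carrier M \<Longrightarrow> a \<odot> (x \<oplus> y) = a \<odot> x \<oplus> a \<odot> y"
    and "\<And>a b x. x \<in> carrier M \<Longrightarrow> (a * b) \<odot> x = a \<odot> (b \<odot> x)"
    and "\<And>x. x \<in> carrier M \<Longrightarrow> 1 \<odot> x = x"
  shows "kvs M"
  by (rule moduleI) (use assms in \<open>auto intro: cring_from_type_algebra\<close>)

lemma ag_closed [simp]:
  fixes P (structure)
  assumes "abelian_group P"
  shows "\<zero> \<in> carrier P"
    and "x \<in> carrier P \<Longrightarrow> y \<in> carrier P \<Longrightarrow> x \<oplus> y \<in> carrier P"
    and "x \<in> carrier P \<Longrightarrow> \<ominus> x \<in> carrier P"
    and "x \<in> carrier P \<Longrightarrow> y \<in> carrier P \<Longrightarrow> x \<ominus> y \<in> carrier P"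
  using assms abelian_group.axioms(1)[OF assms]
  by (simp_all add: abelian_monoid.zero_closed abelian_monoid.a_closed abelian_group.a_inv_closed abelian_group.minus_closed)

lemma ag_simps [simp]:
  fixes P (structure)
  assumes "abelian_group P" "x \<in> carrier P"
  shows "\<zero> \<oplus> x = x" and "x \<oplus> \<zero> = x"
    and "\<ominus> x \<oplus> x = \<zero>" and "x \<oplus> \<ominus> x = \<zero>"
    and "x \<ominus> x = \<zero>"
    and "\<ominus> (\<ominus> x) = x"
proof -
  interpret abelian_group P by fact
  show "\<zero> \<oplus> x = x" and "x \<oplus> \<zero> = x"
    and "\<ominus> x \<oplus> x = \<zero>" and "x \<oplus> \<ominus> x = \<zero>"
    and "x \<ominus> x = \<zero>" and "\<ominus> (\<ominus> x) = x"
    using assms(2) by (auto simp: l_neg r_neg minus_eq)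
qed

lemma ag_ac:
  fixes P (structure)
  assumes "abelian_group P"
  shows "x \<in> carrier P \<Longrightarrow> y \<in> carrier P \<Longrightarrow> x \<oplus> y = y \<oplus> x"
    and "x \<in> carrier P \<Longrightarrow> y \<in> carrier P \<Longrightarrow> z \<in> carrier P \<Longrightarrow>
      (x \<oplus> y) \<oplus> z = x \<oplus> (y \<oplus> z)"
    and "x \<in> carrier P \<Longrightarrow> y \<in> carrier P \<Longrightarrow> z \<in> carrier P \<Longrightarrow>
      x \<oplus> (y \<oplus> z) = y \<oplus> (x \<oplus> z)"
  using abelian_monoid.a_comm abelian_monoid.a_assoc abelian_monoid.a_lcomm abelian_group.axioms(1)[OF assms] by metis+

lemma ag_diff_eq_zero:
  assumes "abelian_group P" "x \<in> carrier P" "y \<in> carrier P"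
  shows "x \<ominus>\<^bsub>P\<^esub> y = \<zero>\<^bsub>P\<^esub> \<longleftrightarrow> x = y"
proof -
  interpret abelian_group P by fact
  show ?thesis by (metis assms(2,3) minus_eq minus_equality r_neg a_inv_closed minus_minus)
qed

lemma ag_cancel:
  fixes P (structure)
  assumes "abelian_group P" "x \<in> carrier P" "y \<in> carrier P" "z \<in> carrier P"
  shows "x \<oplus> y = x \<oplus> z \<longleftrightarrow> y = z" and "y \<oplus> x = z \<oplus> x \<longleftrightarrow> y = z"
proof -
  interpret abelian_group P by fact
  show "x \<oplus> y = x \<oplus> z \<longleftrightarrow> y = z" and "y \<oplus> x = z \<oplus> x \<longleftrightarrow> y = z"
    using assms(2-) by auto
qed

lemma ag_diff_add:
  fixes P (structure)
  assumes "abelian_group P" "x \<in> carrier P" "y \<in> carrier P"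
  shows "(x \<ominus> y) \<oplus> y = x" "(x \<oplus> y) \<ominus> y = x"
proof -
  interpret abelian_group P by fact
  show "(x \<ominus> y) \<oplus> y = x" "(x \<oplus> y) \<ominus> y = x"
    using assms(2,3) by (simp_all add: minus_eq a_assoc l_neg r_neg)
qed

lemma kvs_smult [simp]:
  fixes M (structure)
  assumes "kvs M"
  shows "x \<in> carrier M \<Longrightarrow> c \<odot> x \<in> carrier M"
    and "c \<odot> \<zero> = \<zero>"
    and "x \<in> carrier M \<Longrightarrow> 0 \<odot> x = \<zero>"
    and "x \<in> carrier M \<Longrightarrow> 1 \<odot> x = x"
  using module.smult_closed[OF assms] module.smult_r_null[OF assms] module.smult_l_null[OF assms]
    module.smult_one[OF assms] by auto

lemma kvs_smult_distrib:
  fixes M (structure)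
  assumes "kvs M"
  shows "x \<in> carrier M \<Longrightarrow> (a + b) \<odot> x = a \<odot> x \<oplus> b \<odot> x"
    and "x \<in> carrier M \<Longrightarrow> y \<in> carrier M \<Longrightarrow> a \<odot> (x \<oplus> y) = a \<odot> x \<oplus> a \<odot> y"
    and "x \<in> carrier M \<Longrightarrow> a \<odot> (b \<odot> x) = (a * b) \<odot> x"
    and "x \<in> carrier M \<Longrightarrow> \<ominus> x = (- 1) \<odot> x"
    and "x \<in> carrier M \<Longrightarrow> y \<in> carrier M \<Longrightarrow> a \<odot> (x \<ominus> y) = a \<odot> x \<ominus> a \<odot> y"
proof -
  interpret module kring M by fact
  show "x \<in> carrier M \<Longrightarrow> (a + b) \<odot> x = a \<odot> x \<oplus> b \<odot> x"
    and "x \<in> carrier M \<Longrightarrow> y \<in> carrier M \<Longrightarrow> a \<odot> (x \<oplus> y) = a \<odot> x \<oplus> a \<odot> y"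
    and "x \<in> carrier M \<Longrightarrow> a \<odot> (b \<odot> x) = (a * b) \<odot> x"
    and "x \<in> carrier M \<Longrightarrow> \<ominus> x = (- 1) \<odot> x"
    and "x \<in> carrier M \<Longrightarrow> y \<in> carrier M \<Longrightarrow> a \<odot> (x \<ominus> y) = a \<odot> x \<ominus> a \<odot> y"
    using smult_l_distr[of a b x] smult_r_distr[of a x y] smult_assoc1[of a b x]
      smult_l_minus[of 1 x] smult_r_minus[of a y] smult_r_distr[of a x "\<ominus> y"]
    by (auto simp: M.minus_eq smult_one[simplified])
qed

lemma add_hom_iff:
  "f \<in> add_hom M N \<longleftrightarrow> (\<forall>x\<in>carrier M. f x \<in> carrier N) \<and>
    (\<forall>x\<in>carrier M. \<forall>y\<in>carrier M. f (x \<oplus>\<^bsub>M\<^esub> y) = f x \<oplus>\<^bsub>N\<^esub> f y)"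
  by (auto simp: add_hom_def hom_def Pi_def)

lemma add_homI:
  "(\<And>x. x \<in> carrier M \<Longrightarrow> f x \<in> carrier N) \<Longrightarrow>
    (\<And>x y. x \<in> carrier M \<Longrightarrow> y \<in> carrier M \<Longrightarrow> f (x \<oplus>\<^bsub>M\<^esub> y) = f x \<oplus>\<^bsub>N\<^esub> f y) \<Longrightarrow> f \<in> add_hom M N"
  by (simp add: add_hom_iff)

lemma add_hom_closed: "f \<in> add_hom M N \<Longrightarrow> x \<in> carrier M \<Longrightarrow> f x \<in> carrier N"
  and add_hom_add: "f \<in> add_hom M N \<Longrightarrow> x \<in> carrier M \<Longrightarrow> y \<in> carrier M \<Longrightarrow>
    f (x \<oplus>\<^bsub>M\<^esub> y) = f x \<oplus>\<^bsub>N\<^esub> f y"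
  by (simp_all add: add_hom_iff)

lemma add_hom_zero:
  fixes M (structure)
  assumes "f \<in> add_hom M N" "abelian_group M" "abelian_group N"
  shows "f \<zero> = \<zero>\<^bsub>N\<^esub>"
proof -
  have "f \<zero> \<oplus>\<^bsub>N\<^esub> f \<zero> = f \<zero> \<oplus>\<^bsub>N\<^esub> \<zero>\<^bsub>N\<^esub>"
    using add_hom_add[OF assms(1), of "\<zero>" "\<zero>"] assms by (simp add: add_hom_closed)
  then show ?thesis using assms ag_cancel(1)[of N] by (metis add_hom_closed ag_closed(1))
qed

lemma add_hom_minus:
  fixes M (structure)
  assumes "f \<in> add_hom M N" "abelian_group M" "abelian_group N" "x \<in> carrier M"
  shows "f (\<ominus> x) = \<ominus>\<^bsub>N\<^esub> f x"
proof -
  have "f x \<oplus>\<^bsub>N\<^esub> f (\<ominus> x) = f x \<oplus>\<^bsub>N\<^esub> \<ominus>\<^bsub>N\<^esub> f x"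
    using add_hom_add[OF assms(1), of x "\<ominus> x"] assms by (simp add: add_hom_closed add_hom_zero)
  then show ?thesis using assms ag_cancel(1)[of N] by (metis add_hom_closed ag_closed(3))
qed

lemma add_hom_diff:
  assumes "f \<in> add_hom M N" "abelian_group M" "abelian_group N" "x \<in> carrier M" "y \<in> carrier M"
  shows "f (x \<ominus>\<^bsub>M\<^esub> y) = f x \<ominus>\<^bsub>N\<^esub> f y"
  using assms by (simp add: a_minus_def add_hom_add add_hom_minus)

lemma lin_add_hom: "f \<in> lin M N \<Longrightarrow> f \<in> add_hom M N"
  and lin_smult: "f \<in> lin M N \<Longrightarrow> x \<in> carrier M \<Longrightarrow> f (c \<odot>\<^bsub>M\<^esub> x) = c \<odot>\<^bsub>N\<^esub> f x"
  by (simp_all add: lin_def)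

lemma lin_closed: "f \<in> lin M N \<Longrightarrow> x \<in> carrier M \<Longrightarrow> f x \<in> carrier N"
  and lin_add: "f \<in> lin M N \<Longrightarrow> x \<in> carrier M \<Longrightarrow> y \<in> carrier M \<Longrightarrow> f (x \<oplus>\<^bsub>M\<^esub> y) = f x \<oplus>\<^bsub>N\<^esub> f y"
  by (simp_all add: lin_def add_hom_iff)

lemma linI:
  "(\<And>x. x \<in> carrier M \<Longrightarrow> f x \<in> carrier N) \<Longrightarrow>
    (\<And>x y. x \<in> carrier M \<Longrightarrow> y \<in> carrier M \<Longrightarrow> f (x \<oplus>\<^bsub>M\<^esub> y) = f x \<oplus>\<^bsub>N\<^esub> f y) \<Longrightarrow>
    (\<And>c x. x \<in> carrier M \<Longrightarrow> f (c \<odot>\<^bsub>M\<^esub> x) = c \<odot>\<^bsub>N\<^esub> f x) \<Longrightarrow> f \<in> lin M N"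
  by (simp add: lin_def add_hom_iff)

lemma add_hom_comp: "f \<in> add_hom M N \<Longrightarrow> g \<in> add_hom N P \<Longrightarrow> (\<lambda>x. g (f x)) \<in> add_hom M P"
  and lin_comp: "f \<in> lin M N \<Longrightarrow> g \<in> lin N P \<Longrightarrow> (\<lambda>x. g (f x)) \<in> lin M P"
  by (auto simp: lin_def add_hom_iff)

lemma add_hom_plus:
  assumes "f \<in> add_hom M P" "g \<in> add_hom M P" "abelian_group P"
  shows "(\<lambda>x. f x \<oplus>\<^bsub>P\<^esub> g x) \<in> add_hom M P"
  using assms by (simp add: add_hom_iff ag_ac)

lemma lin_id: "id \<in> lin M M" "(\<lambda>x. x) \<in> lin M M"
  by (simp_all add: lin_def add_hom_iff)

subsection \<open>Submodules and spans\<close>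

lemma submodule_iff:
  fixes M (structure)
  assumes "kvs M"
  shows "submodule N kring M \<longleftrightarrow> N \<subseteq> carrier M \<and> \<zero> \<in> N \<and>
    (\<forall>x\<in>N. \<forall>y\<in>N. x \<oplus> y \<in> N) \<and> (\<forall>c. \<forall>x\<in>N. c \<odot> x \<in> N)" (is "?L \<longleftrightarrow> ?R")
proof
  interpret module kring M by fact
  assume L: ?L
  obtain x where x: "x \<in> N" using submoduleE(2)[OF L] by blast
  then have "0 \<odot> x \<in> N" using submoduleE(4)[OF L, of 0 x] by simp
  moreover have "x \<in> carrier M" using submoduleE(1)[OF L] x by blast
  ultimately have "\<zero> \<in> N" using assms by simp
  then show ?R using submoduleE[OF L] by auto
next
  interpret module kring M by fact
  assume R: ?R
  show ?L
  proof (rule submoduleI)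
    fix a assume a: "a \<in> N"
    then have "(-1) \<odot> a \<in> N" using R by blast
    then show "\<ominus> a \<in> N" using a R assms by (auto simp: kvs_smult_distrib(4) subset_iff)
  qed (use R in auto)
qed

lemma submodule_carrier: "kvs M \<Longrightarrow> submodule (carrier M) kring M"
  by (simp add: submodule_iff)

lemma submodule_lspan:
  assumes "kvs M" "S \<subseteq> carrier M"
  shows "submodule (lspan M S) kring M"
  using assms submodule_carrier[OF assms(1)]
  unfolding lspan_def submodule_iff[OF assms(1)] by blast

lemma lspan_superset: "S \<subseteq> lspan M S"
  by (auto simp: lspan_def)

lemma lspan_minimal: "submodule N kring M \<Longrightarrow> S \<subseteq> N \<Longrightarrow> lspan M S \<subseteq> N"
  by (auto simp: lspan_def)

lemma lspan_mono: "S \<subseteq> T \<Longrightarrow> lspan M S \<subseteq> lspan M T"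
  by (auto simp: lspan_def)

lemma lspan_subset_carrier: "kvs M \<Longrightarrow> S \<subseteq> carrier M \<Longrightarrow> lspan M S \<subseteq> carrier M"
  by (rule lspan_minimal) (rule submodule_carrier)

text \<open>Minimality of the span, applied to the subspace of all x with \<open>P x\<close>. The
  two side conditions are separate cases so that \<open>induction\<close> can start from a bare
  membership fact.\<close>

lemma lspan_induct [consumes 1, case_names kvs subset base zero add smult]:
  fixes M (structure)
  assumes "x \<in> lspan M S" "kvs M" "S \<subseteq> carrier M"
    and "\<And>s. s \<in> S \<Longrightarrow> P s" and "P \<zero>"
    and "\<And>x y. x \<in> carrier M \<Longrightarrow> y \<in> carrier M \<Longrightarrow> P x \<Longrightarrow> P y \<Longrightarrow> P (x \<oplus> y)"
    and "\<And>c x. x \<in> carrier M \<Longrightarrow> P x \<Longrightarrow> P (c \<odot> x)"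
  shows "P x"
proof -
  have "submodule {x \<in> carrier M. P x} kring M"
    unfolding submodule_iff[OF assms(2)] using assms by auto
  then have "lspan M S \<subseteq> {x \<in> carrier M. P x}"
    by (rule lspan_minimal) (use assms in auto)
  with assms(1) show ?thesis by blast
qed

lemma lspan_insert:
  fixes M (structure)
  assumes "kvs M" "s \<in> carrier M" "S \<subseteq> carrier M"
  shows "x \<in> lspan M (insert s S) \<longleftrightarrow> (\<exists>c. \<exists>y\<in>lspan M S. x = c \<odot> s \<oplus> y)" (is "_ \<longleftrightarrow> ?R")
proof
  note sub = submodule_lspan[OF assms(1,3), unfolded submodule_iff[OF assms(1)]]
  assume "x \<in> lspan M (insert s S)"
  then show ?R
  proof (induction rule: lspan_induct)
    case (base t)
    show ?case
    proof (cases "t = s")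
      case True
      then have "t = 1 \<odot> s \<oplus> \<zero>" using assms by simp
      then show ?thesis using sub by blast
    next
      case False
      then have t: "t \<in> S" using base by blast
      then have "t = 0 \<odot> s \<oplus> t" using assms by (simp add: subset_iff)
      then show ?thesis using lspan_superset[of S M] t by blast
    qed
  next
    case zero
    have "\<zero> = 0 \<odot> s \<oplus> \<zero>" using assms by simp
    then show ?case using sub by blast
  next
    case (add x y)
    then obtain a x' b y' where *: "x' \<in> lspan M S" "x = a \<odot> s \<oplus> x'"
      "y' \<in> lspan M S" "y = b \<odot> s \<oplus> y'" by blast
    then have "x \<oplus> y = (a + b) \<odot> s \<oplus> (x' \<oplus> y')"
      using assms sub by (simp add: kvs_smult_distrib ag_ac subset_iff)
    moreover have "x' \<oplus> y' \<in> lspan M S" using * sub by blast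
    ultimately show ?case by blast
  next
    case (smult c x)
    then obtain a x' where *: "x' \<in> lspan M S" "x = a \<odot> s \<oplus> x'" by blast
    then have "c \<odot> x = (c * a) \<odot> s \<oplus> (c \<odot> x')"
      using assms sub by (simp add: kvs_smult_distrib subset_iff)
    moreover have "c \<odot> x' \<in> lspan M S" using * sub by blast
    ultimately show ?case by blast
  qed (use assms in auto)
next
  note sub = submodule_lspan[OF assms(1), of "insert s S", unfolded submodule_iff[OF assms(1)]]
  assume ?R
  then obtain c y where y: "y \<in> lspan M S" "x = c \<odot> s \<oplus> y" by blast
  have "y \<in> lspan M (insert s S)" using y(1) lspan_mono[of S "insert s S" M] by blast
  moreover have "s \<in> lspan M (insert s S)" using lspan_superset[of "insert s S" M] by blast
  ultimately show "x \<in> lspan M (insert s S)" using sub assms y(2) by simp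
qed

subsection \<open>Quotient spaces\<close>

lemma submodule_abelian_subgroup:
  assumes "kvs M" "submodule N kring M"
  shows "abelian_subgroup N M"
  using assms by (intro abelian_subgroupI3 additive_subgroup.intro submodule.axioms(1)) auto

lemma quot_mod_simps:
  fixes M (structure)
  assumes "kvs M" "submodule N kring M"
  shows "carrier (quot_mod M N) = (\<lambda>x. N +> x) ` carrier M"
    and "\<zero>\<^bsub>quot_mod M N\<^esub> = N +> \<zero>"
    and "x \<in> carrier M \<Longrightarrow> y \<in> carrier M \<Longrightarrow>
      (N +> x) \<oplus>\<^bsub>quot_mod M N\<^esub> (N +> y) = N +> (x \<oplus> y)"
    and "x \<in> carrier M \<Longrightarrow> c \<odot>\<^bsub>quot_mod M N\<^esub> (N +> x) = N +> (c \<odot> x)"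
    and "x \<in> carrier M \<Longrightarrow> y \<in> carrier M \<Longrightarrow> N +> x = N +> y \<longleftrightarrow> x \<ominus> y \<in> N"
proof -
  interpret S: abelian_subgroup N M by (rule submodule_abelian_subgroup[OF assms])
  interpret M: abelian_group M using assms by simp
  show "carrier (quot_mod M N) = (\<lambda>x. N +> x) ` carrier M"
    by (auto simp: quot_mod_def FactRing_def A_RCOSETS_def')
  have "N +> \<zero> = N"
    by (rule S.a_coset_join2) (use assms S.a_subgroup in \<open>auto simp: submodule_iff\<close>)
  then show "\<zero>\<^bsub>quot_mod M N\<^esub> = N +> \<zero>"
    by (simp add: quot_mod_def FactRing_def)
  show "x \<in> carrier M \<Longrightarrow> y \<in> carrier M \<Longrightarrow>
      (N +> x) \<oplus>\<^bsub>quot_mod M N\<^esub> (N +> y) = N +> (x \<oplus> y)"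
    by (simp add: quot_mod_def FactRing_def S.a_rcos_sum)
  have eq: "N +> x = N +> y \<longleftrightarrow> x \<ominus> y \<in> N" if "x \<in> carrier M" "y \<in> carrier M" for x y
  proof -
    have "x \<ominus> y \<in> N \<longleftrightarrow> x \<in> N +> y"
      using S.a_rcos_module[OF that(2,1)] by (simp add: a_minus_def)
    then show ?thesis using S.a_rcos_self[OF that(1)] S.a_repr_independence'[of x y] that by auto
  qed
  then show "x \<in> carrier M \<Longrightarrow> y \<in> carrier M \<Longrightarrow> N +> x = N +> y \<longleftrightarrow> x \<ominus> y \<in> N" .
  assume x: "x \<in> carrier M"
  \<comment> \<open>\<open>quot_mod\<close> defines the scalar multiple of a class as a union over
    all its representatives; the union collapses because each of them contributes the same
    coset.\<close>
  have rcos: "N +> (c \<odot> y) = N +> (c \<odot> x)" if "y \<in> N +> x" for y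
  proof -
    have y: "y \<in> carrier M" using that x S.a_subset S.a_r_coset_subset_G by blast
    then have "y \<ominus> x \<in> N" using S.a_rcos_module[OF x y] that by (simp add: a_minus_def)
    then have "c \<odot> (y \<ominus> x) \<in> N" using assms by (auto simp: submodule_iff)
    then show ?thesis using eq x y assms by (simp add: kvs_smult_distrib(5))
  qed
  have "(\<Union>y\<in>N +> x. N +> (c \<odot> y)) = N +> (c \<odot> x)"
    by (rule SUP_eq_const) (use S.a_rcos_self[OF x] in blast, rule rcos)
  then show "c \<odot>\<^bsub>quot_mod M N\<^esub> (N +> x) = N +> (c \<odot> x)"
    by (simp add: quot_mod_def)
qed

lemma kvs_quot_mod:
  fixes M (structure)
  assumes "kvs M" "submodule N kring M"
  shows "kvs (quot_mod M N)"
proof (rule kvsI)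
  note q = quot_mod_simps[OF assms]
  show "abelian_group (quot_mod M N)"
  proof (rule abelian_groupI)
    fix C assume "C \<in> carrier (quot_mod M N)"
    then obtain x where x: "x \<in> carrier M" "C = N +> x" by (auto simp: q)
    then have "(N +> (\<ominus> x)) \<oplus>\<^bsub>quot_mod M N\<^esub> C = \<zero>\<^bsub>quot_mod M N\<^esub>"
      using assms by (simp add: q(2,3))
    moreover have "N +> (\<ominus> x) \<in> carrier (quot_mod M N)" using x assms by (auto simp: q(1))
    ultimately show "\<exists>Y\<in>carrier (quot_mod M N). Y \<oplus>\<^bsub>quot_mod M N\<^esub> C = \<zero>\<^bsub>quot_mod M N\<^esub>" by blast
  qed (use assms in \<open>auto simp: q(1,2,3) ag_ac\<close>)
qed (use assms in \<open>auto simp: quot_mod_simps(1,3,4) kvs_smult_distrib\<close>)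

lemma quot_mod_proj: "kvs M \<Longrightarrow> submodule N kring M \<Longrightarrow> (\<lambda>x. N +>\<^bsub>M\<^esub> x) \<in> lin M (quot_mod M N)"
  by (rule linI) (simp_all add: quot_mod_simps)

text \<open>Factorisation is wanted for additive maps into an arbitrary abelian group: the
  derivations and the evaluations in a larger field that are later lifted through tensor products
  are not linear maps of spaces over \<open>'k\<close>.\<close>

lemma quot_mod_lift:
  fixes M (structure)
  assumes "kvs M" "submodule N kring M" "f \<in> add_hom M P" "abelian_group P"
    and "\<And>x. x \<in> N \<Longrightarrow> f x = \<zero>\<^bsub>P\<^esub>"
  obtains h where "h \<in> add_hom (quot_mod M N) P" "\<And>x. x \<in> carrier M \<Longrightarrow> h (N +> x) = f x"
proof
  note q = quot_mod_simps[OF assms(1,2)]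
  define h where "h C = f (SOME x. x \<in> carrier M \<and> C = N +> x)" for C
  show h: "h (N +> x) = f x" if x: "x \<in> carrier M" for x
  proof -
    define y where "y = (SOME y. y \<in> carrier M \<and> N +> x = N +> y)"
    have y: "y \<in> carrier M" "N +> x = N +> y"
      unfolding y_def by (rule someI2[of _ x]; use x in blast)+
    then have "f (x \<ominus> y) = \<zero>\<^bsub>P\<^esub>" using assms(5) x q(5) by blast
    then have "f x = f y" using assms x y(1) by (simp add: add_hom_diff ag_diff_eq_zero add_hom_closed)
    then show ?thesis by (simp add: h_def y_def)
  qed
  show "h \<in> add_hom (quot_mod M N) P"
    by (rule add_homI) (use assms in \<open>auto simp: q(1,3) h add_hom_closed add_hom_add\<close>)
qed

lemma ag_add_diff:
  fixes P (structure)
  assumes "abelian_group P" "x \<in> carrier P" "y \<in> carrier P"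
  shows "(x \<oplus> y) \<ominus> x \<ominus> y = \<zero>"
  using assms ag_diff_add(2)[of P y x] by (simp add: ag_ac)

subsection \<open>Free vector spaces\<close>

lemma free_mod_simps [simp]:
  "\<zero>\<^bsub>free_mod B\<^esub> = (\<lambda>_. 0)" "f \<oplus>\<^bsub>free_mod B\<^esub> g = (\<lambda>x. f x + g x)"
  "c \<odot>\<^bsub>free_mod B\<^esub> f = (\<lambda>x. c * f x)"
  by (simp_all add: free_mod_def)

lemma free_mod_carrier:
  "f \<in> carrier (free_mod B) \<longleftrightarrow> finite {x. f x \<noteq> 0} \<and> (\<forall>x. f x \<noteq> 0 \<longrightarrow> x \<in> B)"
  by (auto simp: free_mod_def)

lemma free_mod_closed:
  assumes "f \<in> carrier (free_mod B)" "g \<in> carrier (free_mod B)"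
  shows "(\<lambda>x. f x + g x) \<in> carrier (free_mod B)" "(\<lambda>x. f x - g x) \<in> carrier (free_mod B)"
proof -
  have fin: "finite ({x. f x \<noteq> 0} \<union> {x. g x \<noteq> 0})" using assms by (simp add: free_mod_carrier)
  have "finite {x. f x + g x \<noteq> 0}" "finite {x. f x - g x \<noteq> 0}"
    by (rule finite_subset[OF _ fin]; auto)+
  moreover have "x \<in> B" if "f x \<noteq> 0 \<or> g x \<noteq> 0" for x using assms that by (auto simp: free_mod_carrier)
  then have "\<forall>x. f x + g x \<noteq> 0 \<longrightarrow> x \<in> B" "\<forall>x. f x - g x \<noteq> 0 \<longrightarrow> x \<in> B" by (metis add_0, metis diff_self)
  ultimately show "(\<lambda>x. f x + g x) \<in> carrier (free_mod B)" "(\<lambda>x. f x - g x) \<in> carrier (free_mod B)"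
    unfolding free_mod_carrier by simp_all
qed

lemma free_mod_smult_closed:
  "f \<in> carrier (free_mod B) \<Longrightarrow> (\<lambda>x. c * f x) \<in> carrier (free_mod B)"
  by (auto simp: free_mod_carrier)

lemma unit_fun_carrier [simp]: "x \<in> B \<Longrightarrow> unit_fun x \<in> carrier (free_mod B)"
  by (simp add: free_mod_carrier unit_fun_def)

lemma kvs_free_mod [simp]: "kvs (free_mod B)"
proof (rule kvsI)
  show "abelian_group (free_mod B)"
  proof (rule abelian_groupI)
    fix f assume f: "f \<in> carrier (free_mod B)"
    then have "(\<lambda>x. (-1) * f x) \<in> carrier (free_mod B)" by (rule free_mod_smult_closed)
    then show "\<exists>g\<in>carrier (free_mod B). g \<oplus>\<^bsub>free_mod B\<^esub> f = \<zero>\<^bsub>free_mod B\<^esub>"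
      by (intro bexI[of _ "\<lambda>x. (-1) * f x"]) auto
  qed (simp_all add: free_mod_closed free_mod_smult_closed algebra_simps, simp add: free_mod_carrier)
qed (simp_all add: free_mod_closed free_mod_smult_closed algebra_simps)

lemma free_mod_minus:
  assumes "f \<in> carrier (free_mod B)" "g \<in> carrier (free_mod B)"
  shows "f \<ominus>\<^bsub>free_mod B\<^esub> g = (\<lambda>x. f x - g x)"
  using assms by (simp add: a_minus_def kvs_smult_distrib(4))

lemma free_mod_induct [consumes 1, case_names zero add]:
  assumes "f \<in> carrier (free_mod B)" and "P (\<lambda>_. 0)"
    and "\<And>f c x. f \<in> carrier (free_mod B) \<Longrightarrow> P f \<Longrightarrow> x \<in> B \<Longrightarrow> P (\<lambda>p. f p + c * unit_fun x p)"
  shows "P f"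
proof -
  have "P f" if "finite S" "{x. f x \<noteq> 0} \<subseteq> S" "S \<subseteq> B" for S f
    using that
  proof (induction S arbitrary: f rule: finite_induct)
    case empty
    then have "f = (\<lambda>_. 0)" by auto
    then show ?case using assms(2) by simp
  next
    case (insert s S)
    define g where "g = f(s := 0)"
    have "{x. g x \<noteq> 0} \<subseteq> S" using insert by (auto simp: g_def)
    moreover from this have "finite {x. g x \<noteq> 0}" using insert(1) finite_subset by blast
    ultimately have "P g" "g \<in> carrier (free_mod B)" using insert by (auto simp: free_mod_carrier)
    then have "P (\<lambda>p. g p + f s * unit_fun s p)" using assms(3) insert by blast
    also have "(\<lambda>p. g p + f s * unit_fun s p) = f" by (auto simp: g_def unit_fun_def)
    finally show ?case .
  qed
  from this[of "{x. f x \<noteq> 0}" f] assms(1) show ?thesis by (auto simp: free_mod_carrier)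
qed

text \<open>The target has no scalars, so the map cannot be prescribed on basis elements alone:
  \<open>g c x\<close> is the value on the multiple by \<open>c\<close> of the basis element
  \<open>x\<close>, and it has to be additive in \<open>c\<close>.\<close>

lemma free_mod_lift:
  fixes g :: "'k::field \<Rightarrow> 'x \<Rightarrow> 'c" and P :: "('c, 'p) ring_scheme" (structure)
  assumes "abelian_group P"
    and cl: "\<And>c x. x \<in> B \<Longrightarrow> g c x \<in> carrier P"
    and add: "\<And>c c' x. x \<in> B \<Longrightarrow> g (c + c') x = g c x \<oplus> g c' x"
  obtains F where "F \<in> add_hom (free_mod B) P"
    and "\<And>c x. x \<in> B \<Longrightarrow> F (\<lambda>p. c * unit_fun x p) = g c x"
proof
  interpret P: abelian_group P by fact
  define F where "F f = finsum P (\<lambda>x. g (f x) x) {x. f x \<noteq> 0}" for f :: "'x \<Rightarrow> 'k"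
  have g0: "g 0 x = \<zero>" if "x \<in> B" for x
    using add[of x 0 0] cl[of x 0] that by (metis P.add.r_cancel_one' add.right_neutral)
  have F: "F f = finsum P (\<lambda>x. g (f x) x) S" if "finite S" "{x. f x \<noteq> 0} \<subseteq> S" "S \<subseteq> B" for f :: "'x \<Rightarrow> 'k" and S
    unfolding F_def
    by (rule P.add.finprod_mono_neutral_cong_left) (use that g0 cl in auto)
  show "F \<in> add_hom (free_mod B) P"
  proof (rule add_homI)
    fix f :: "'x \<Rightarrow> 'k" assume f: "f \<in> carrier (free_mod B)"
    show "F f \<in> carrier P" unfolding F_def
      by (rule P.finsum_closed, rule Pi_I, rule cl) (use f in \<open>simp add: free_mod_carrier\<close>)
    fix h :: "'x \<Rightarrow> 'k" assume h: "h \<in> carrier (free_mod B)"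
    let ?S = "{x. f x \<noteq> 0} \<union> {x. h x \<noteq> 0}"
    have S: "finite ?S" "?S \<subseteq> B" using f h by (auto simp: free_mod_carrier)
    have "F (\<lambda>x. f x + h x) = finsum P (\<lambda>x. g (f x + h x) x) ?S" by (rule F) (use S in auto)
    also have "\<dots> = finsum P (\<lambda>x. g (f x) x \<oplus> g (h x) x) ?S"
      by (rule P.finsum_cong') (use S add cl in auto)
    also have "\<dots> = F f \<oplus> F h"
      using F[OF S(1) _ S(2), of f] F[OF S(1) _ S(2), of h] S cl
      by (subst P.finsum_addf) auto
    finally show "F (f \<oplus>\<^bsub>free_mod B\<^esub> h) = F f \<oplus> F h" by simp
  qed
  fix c x assume x: "x \<in> B"
  then have "F (\<lambda>p. c * unit_fun x p) = finsum P (\<lambda>y. g (c * unit_fun x y) y) {x}"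
    by (intro F) (auto simp: unit_fun_def split: if_splits)
  then show "F (\<lambda>p. c * unit_fun x p) = g c x" using x cl by (simp add: unit_fun_def)
qed

section \<open>Tensor products\<close>

lemma tensor_rel_submodule:
  assumes "kvs M" "kvs N"
  shows "submodule (tensor_rel M N) kring (free_mod (carrier M \<times> carrier N))"
  unfolding tensor_rel_def
  by (rule submodule_lspan) (use assms in \<open>auto intro!: free_mod_closed(2) free_mod_smult_closed unit_fun_carrier\<close>)

lemma kvs_tensor [simp]: "kvs M \<Longrightarrow> kvs N \<Longrightarrow> kvs (tensor M N)"
  unfolding tensor_def by (intro kvs_quot_mod tensor_rel_submodule) auto

context
  fixes M :: "('k::field, 'a, 'm) module_scheme" (structure) and N :: "('k, 'b, 'n) module_scheme"
  assumes M: "kvs M" and N: "kvs N"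
begin

private abbreviation (input) "Fr \<equiv> (free_mod (carrier M \<times> carrier N) :: ('k, 'a \<times> 'b \<Rightarrow> 'k) module)"
private lemmas q = quot_mod_simps[OF kvs_free_mod tensor_rel_submodule[OF M N]]

lemma tmul_closed [simp]: "x \<in> carrier M \<Longrightarrow> y \<in> carrier N \<Longrightarrow> tmul M N x y \<in> carrier (tensor M N)"
  unfolding tensor_def tmul_def q(1) by (intro imageI) simp

private lemma rel_eq:
  assumes "f \<in> carrier Fr" "g \<in> carrier Fr" "(\<lambda>x. f x - g x) \<in> tensor_rel M N"
  shows "tensor_rel M N +>\<^bsub>Fr\<^esub> f = tensor_rel M N +>\<^bsub>Fr\<^esub> g"
  using q(5)[OF assms(1,2)] assms by (simp add: free_mod_minus)

private lemma mem_rel: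
  "x \<in> carrier M \<Longrightarrow> x' \<in> carrier M \<Longrightarrow> y \<in> carrier N \<Longrightarrow>
    (\<lambda>p. unit_fun (x \<oplus> x', y) p - unit_fun (x, y) p - unit_fun (x', y) p) \<in> tensor_rel M N"
  "x \<in> carrier M \<Longrightarrow> y \<in> carrier N \<Longrightarrow> y' \<in> carrier N \<Longrightarrow>
    (\<lambda>p. unit_fun (x, y \<oplus>\<^bsub>N\<^esub> y') p - unit_fun (x, y) p - unit_fun (x, y') p) \<in> tensor_rel M N"
  "x \<in> carrier M \<Longrightarrow> y \<in> carrier N \<Longrightarrow>
    (\<lambda>p. unit_fun (c \<odot> x, y) p - c * unit_fun (x, y) p) \<in> tensor_rel M N"
  "x \<in> carrier M \<Longrightarrow> y \<in> carrier N \<Longrightarrow>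
    (\<lambda>p. unit_fun (x, c \<odot>\<^bsub>N\<^esub> y) p - c * unit_fun (x, y) p) \<in> tensor_rel M N"
  unfolding tensor_rel_def by (rule subsetD[OF lspan_superset]; blast)+

lemma tmul_add_left:
  assumes "x \<in> carrier M" "x' \<in> carrier M" "y \<in> carrier N"
  shows "tmul M N (x \<oplus> x') y = tmul M N x y \<oplus>\<^bsub>tensor M N\<^esub> tmul M N x' y"
  unfolding tmul_def tensor_def
  using assms M N by (subst q(3), simp, simp, intro rel_eq) (use mem_rel(1)[OF assms] in \<open>auto simp: free_mod_smult_closed free_mod_closed diff_diff_add\<close>)

lemma tmul_add_right:
  assumes "x \<in> carrier M" "y \<in> carrier N" "y' \<in> carrier N"
  shows "tmul M N x (y \<oplus>\<^bsub>N\<^esub> y') = tmul M N x y \<oplus>\<^bsub>tensor M N\<^esub> tmul M N x y'"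
  unfolding tmul_def tensor_def
  using assms M N by (subst q(3), simp, simp, intro rel_eq) (use mem_rel(2)[OF assms] in \<open>auto simp: free_mod_smult_closed free_mod_closed diff_diff_add\<close>)

lemma tmul_smult_left:
  assumes "x \<in> carrier M" "y \<in> carrier N"
  shows "tmul M N (c \<odot> x) y = c \<odot>\<^bsub>tensor M N\<^esub> tmul M N x y"
  unfolding tmul_def tensor_def
  using assms M N by (subst q(4), simp, intro rel_eq) (use mem_rel(3)[OF assms] in \<open>auto simp: free_mod_smult_closed free_mod_closed\<close>)

lemma tmul_smult_right:
  assumes "x \<in> carrier M" "y \<in> carrier N"
  shows "tmul M N x (c \<odot>\<^bsub>N\<^esub> y) = c \<odot>\<^bsub>tensor M N\<^esub> tmul M N x y"
  unfolding tmul_def tensor_def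
  using assms M N by (subst q(4), simp, intro rel_eq) (use mem_rel(4)[OF assms] in \<open>auto simp: free_mod_smult_closed free_mod_closed\<close>)

lemma tmul_zero_left [simp]: "y \<in> carrier N \<Longrightarrow> tmul M N \<zero> y = \<zero>\<^bsub>tensor M N\<^esub>"
  using tmul_smult_left[of "\<zero>" y 0] M N by simp

lemma tmul_zero_right [simp]: "x \<in> carrier M \<Longrightarrow> tmul M N x \<zero>\<^bsub>N\<^esub> = \<zero>\<^bsub>tensor M N\<^esub>"
  using tmul_smult_right[of x "\<zero>\<^bsub>N\<^esub>" 0] M N by simp

text \<open>There is no zero case and no scalar case: zero is a pure tensor of zeros, and a scalar
  is absorbed into the left factor of a pure tensor.\<close>

lemma tensor_induct [consumes 1, case_names tmul add]:
  assumes "z \<in> carrier (tensor M N)"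
    and tm: "\<And>x y. x \<in> carrier M \<Longrightarrow> y \<in> carrier N \<Longrightarrow> P (tmul M N x y)"
    and ad: "\<And>z z'. z \<in> carrier (tensor M N) \<Longrightarrow> z' \<in> carrier (tensor M N) \<Longrightarrow> P z \<Longrightarrow> P z' \<Longrightarrow>
      P (z \<oplus>\<^bsub>tensor M N\<^esub> z')"
  shows "P z"
proof -
  obtain f where f: "f \<in> carrier Fr" "z = tensor_rel M N +>\<^bsub>Fr\<^esub> f"
    using assms(1) by (auto simp: tensor_def q(1))
  from f(1) have "P (tensor_rel M N +>\<^bsub>Fr\<^esub> f)"
  proof (induction f rule: free_mod_induct)
    case zero
    have "tensor_rel M N +>\<^bsub>Fr\<^esub> (\<lambda>_. 0) = \<zero>\<^bsub>tensor M N\<^esub>"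
      by (simp add: tensor_def q(2))
    also have "\<dots> = tmul M N \<zero> \<zero>\<^bsub>N\<^esub>" using M N by simp
    finally show ?case using tm[of "\<zero>" "\<zero>\<^bsub>N\<^esub>"] M N by simp
  next
    case (add f c p)
    obtain x y where p: "p = (x, y)" "x \<in> carrier M" "y \<in> carrier N" using add.hyps(2) by auto
    have "tensor_rel M N +>\<^bsub>Fr\<^esub> (\<lambda>q. c * unit_fun p q) = tmul M N (c \<odot> x) y"
      using q(4)[of "unit_fun p" c] p by (simp add: tmul_smult_left) (simp add: tmul_def tensor_def)
    moreover have "tensor_rel M N +>\<^bsub>Fr\<^esub> (\<lambda>q. f q + c * unit_fun p q) =
      (tensor_rel M N +>\<^bsub>Fr\<^esub> f) \<oplus>\<^bsub>tensor M N\<^esub> (tensor_rel M N +>\<^bsub>Fr\<^esub> (\<lambda>q. c * unit_fun p q))"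
      using q(3)[of f "\<lambda>q. c * unit_fun p q"] add.hyps free_mod_smult_closed[OF unit_fun_carrier[OF add.hyps(2)], of c]
      by (simp add: tensor_def)
    moreover have "tensor_rel M N +>\<^bsub>Fr\<^esub> f \<in> carrier (tensor M N)"
      using add.hyps(1) by (simp add: tensor_def q(1))
    ultimately show ?case using ad[OF _ _ add.IH tm] p M by auto
  qed
  then show ?thesis using f by simp
qed

lemma tensor_ext:
  assumes "f \<in> add_hom (tensor M N) P" "g \<in> add_hom (tensor M N) P"
    and "\<And>x y. x \<in> carrier M \<Longrightarrow> y \<in> carrier N \<Longrightarrow> f (tmul M N x y) = g (tmul M N x y)"
    and "z \<in> carrier (tensor M N)"
  shows "f z = g z"
  using assms(4) by (induction z rule: tensor_induct) (use assms in \<open>auto simp: add_hom_add\<close>)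

end

text \<open>This is what factoring additively through M \<otimes> N requires; as the target carries
  no scalars, bilinearity over \<open>'k\<close> could not even be stated.\<close>

definition balanced ::
  "('k::field, 'a, 'm) module_scheme \<Rightarrow> ('k, 'b, 'n) module_scheme \<Rightarrow> ('c, 'p) ring_scheme \<Rightarrow>
    ('a \<Rightarrow> 'b \<Rightarrow> 'c) \<Rightarrow> bool" where
  "balanced M N P \<beta> \<longleftrightarrow> (\<forall>x\<in>carrier M. \<beta> x \<in> add_hom N P) \<and>
     (\<forall>y\<in>carrier N. (\<lambda>x. \<beta> x y) \<in> add_hom M P) \<and>
     (\<forall>c. \<forall>x\<in>carrier M. \<forall>y\<in>carrier N. \<beta> (c \<odot>\<^bsub>M\<^esub> x) y = \<beta> x (c \<odot>\<^bsub>N\<^esub> y))"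

lemma balancedI:
  assumes "\<And>x y. x \<in> carrier M \<Longrightarrow> y \<in> carrier N \<Longrightarrow> \<beta> x y \<in> carrier P"
    and "\<And>x x' y. x \<in> carrier M \<Longrightarrow> x' \<in> carrier M \<Longrightarrow> y \<in> carrier N \<Longrightarrow>
      \<beta> (x \<oplus>\<^bsub>M\<^esub> x') y = \<beta> x y \<oplus>\<^bsub>P\<^esub> \<beta> x' y"
    and "\<And>x y y'. x \<in> carrier M \<Longrightarrow> y \<in> carrier N \<Longrightarrow> y' \<in> carrier N \<Longrightarrow>
      \<beta> x (y \<oplus>\<^bsub>N\<^esub> y') = \<beta> x y \<oplus>\<^bsub>P\<^esub> \<beta> x y'"
    and "\<And>c x y. x \<in> carrier M \<Longrightarrow> y \<in> carrier N \<Longrightarrow> \<beta> (c \<odot>\<^bsub>M\<^esub> x) y = \<beta> x (c \<odot>\<^bsub>N\<^esub> y)"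
  shows "balanced M N P \<beta>"
  using assms by (simp add: balanced_def add_hom_iff)

text \<open>The map is built on the free space by sending c (x, y) to \<beta>(c x, y), and it must
  kill \<open>tensor_rel\<close>. The obstacle is that this relation space is a span over
  \<open>'k\<close>, whereas the kernel of an additive map need not be a subspace.\<close>

lemma tlift_exists:
  fixes M :: "('k::field, 'a, 'm) module_scheme" and N :: "('k, 'b, 'n) module_scheme"
    and P :: "('c, 'p) ring_scheme" (structure)
  assumes M: "kvs M" and N: "kvs N" and P: "abelian_group P" and \<beta>: "balanced M N P \<beta>"
  shows "\<exists>f. f \<in> add_hom (tensor M N) P \<and>
    (\<forall>x\<in>carrier M. \<forall>y\<in>carrier N. f (tmul M N x y) = \<beta> x y)"
proof -
  let ?B = "carrier M \<times> carrier N"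
  let ?Fr = "free_mod ?B :: ('k, 'a \<times> 'b \<Rightarrow> 'k) module"
  have \<beta>1: "\<beta> x y \<in> carrier P" "\<beta> (x \<oplus>\<^bsub>M\<^esub> x') y = \<beta> x y \<oplus> \<beta> x' y"
    "\<beta> x (y \<oplus>\<^bsub>N\<^esub> y') = \<beta> x y \<oplus> \<beta> x y'" "\<beta> (c \<odot>\<^bsub>M\<^esub> x) y = \<beta> x (c \<odot>\<^bsub>N\<^esub> y)"
    if "x \<in> carrier M" "x' \<in> carrier M" "y \<in> carrier N" "y' \<in> carrier N" for x x' y y' c
    using \<beta> that by (auto simp: balanced_def add_hom_iff)
  have zM: "\<zero>\<^bsub>M\<^esub> \<in> carrier M" and zN: "\<zero>\<^bsub>N\<^esub> \<in> carrier N" using M N by simp_all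
  obtain F where F: "F \<in> add_hom ?Fr P"
    "\<And>c p. p \<in> ?B \<Longrightarrow> F (\<lambda>q. c * unit_fun p q) = (case p of (x, y) \<Rightarrow> \<beta> (c \<odot>\<^bsub>M\<^esub> x) y)"
    by (rule free_mod_lift[OF P, of ?B "\<lambda>c (x, y). \<beta> (c \<odot>\<^bsub>M\<^esub> x) y"])
      (use M N \<beta>1 in \<open>auto simp: kvs_smult_distrib\<close>)
  have Fd: "F (\<lambda>q. f q - g q) = F f \<ominus> F g" if "f \<in> carrier ?Fr" "g \<in> carrier ?Fr" for f g
    using add_hom_diff[OF F(1) kvs_abelian[OF kvs_free_mod] P that] that by (simp add: free_mod_minus)
  have cl: "(\<lambda>q. c * unit_fun p q) \<in> carrier ?Fr" if "p \<in> ?B" for c p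
    by (rule free_mod_smult_closed[OF unit_fun_carrier[OF that]])
  have F2: "F (\<lambda>q. c * unit_fun r q - c' * unit_fun s q) =
      F (\<lambda>q. c * unit_fun r q) \<ominus> F (\<lambda>q. c' * unit_fun s q)"
    if "r \<in> ?B" "s \<in> ?B" for c c' r s
    by (rule Fd[OF cl[OF that(1)] cl[OF that(2)]])
  have F3: "F (\<lambda>q. c * unit_fun r q - c * unit_fun s q - c * unit_fun t q) =
      F (\<lambda>q. c * unit_fun r q) \<ominus> F (\<lambda>q. c * unit_fun s q) \<ominus> F (\<lambda>q. c * unit_fun t q)"
    if "r \<in> ?B" "s \<in> ?B" "t \<in> ?B" for c r s t
    using Fd[OF free_mod_closed(2)[OF cl[OF that(1)] cl[OF that(2)]] cl[OF that(3)]] F2[OF that(1,2)] by simp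
  \<comment> \<open>The largest subspace inside the kernel of \<open>F\<close>: all multiples of its
    elements are killed. Hence it is enough to put the four kinds of generators of
    \<open>tensor_rel\<close> into \<open>K\<close>.\<close>
  define K where "K = {f \<in> carrier ?Fr. \<forall>c. F (\<lambda>q. c * f q) = \<zero>}"
  have subK: "submodule K kring ?Fr"
  proof (subst submodule_iff[OF kvs_free_mod], intro conjI ballI allI)
    have "F (\<lambda>_. 0) = \<zero>" using add_hom_zero[OF F(1)] P by simp
    then show "\<zero>\<^bsub>?Fr\<^esub> \<in> K" by (simp add: K_def free_mod_carrier)
    show "f \<oplus>\<^bsub>?Fr\<^esub> g \<in> K" if "f \<in> K" "g \<in> K" for f g
    proof -
      have fg: "f \<in> carrier ?Fr" "g \<in> carrier ?Fr" using that by (simp_all add: K_def)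
      have "F (\<lambda>q. c * (f q + g q)) = \<zero>" for c
        using that P add_hom_add[OF F(1) free_mod_smult_closed[OF fg(1)] free_mod_smult_closed[OF fg(2)], of c c]
        by (simp add: K_def distrib_left)
      then show ?thesis using fg by (simp add: K_def free_mod_closed)
    qed
    show "c \<odot>\<^bsub>?Fr\<^esub> f \<in> K" if "f \<in> K" for c f
      using that by (simp add: K_def free_mod_smult_closed mult.assoc[symmetric])
  qed (simp add: K_def Collect_conj_eq)
  have K1: "f \<in> K" if "f \<in> {\<lambda>p. unit_fun (x \<oplus>\<^bsub>M\<^esub> x', y) p - unit_fun (x, y) p - unit_fun (x', y) p | x x' y.
        x \<in> carrier M \<and> x' \<in> carrier M \<and> y \<in> carrier N} \<union>
     {\<lambda>p. unit_fun (x, y \<oplus>\<^bsub>N\<^esub> y') p - unit_fun (x, y) p - unit_fun (x, y') p | x y y'.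
        x \<in> carrier M \<and> y \<in> carrier N \<and> y' \<in> carrier N}" for f
    using that
  proof (elim UnE CollectE exE conjE)
    fix x x' y assume *: "f = (\<lambda>p. unit_fun (x \<oplus>\<^bsub>M\<^esub> x', y) p - unit_fun (x, y) p - unit_fun (x', y) p)"
      "x \<in> carrier M" "x' \<in> carrier M" "y \<in> carrier N"
    have "f \<in> carrier ?Fr" unfolding *(1) by (intro free_mod_closed(2) unit_fun_carrier) (use * M N in auto)
    moreover have "F (\<lambda>q. c * f q) = \<zero>" for c
    proof -
      have "F (\<lambda>q. c * f q) = F (\<lambda>q. c * unit_fun (x \<oplus>\<^bsub>M\<^esub> x', y) q) \<ominus> F (\<lambda>q. c * unit_fun (x, y) q)
        \<ominus> F (\<lambda>q. c * unit_fun (x', y) q)"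
        unfolding *(1) right_diff_distrib by (rule F3) (use * M N in auto)
      also have "\<dots> = \<zero>" using * M N P by (simp add: F(2) kvs_smult_distrib(2) \<beta>1(1)[OF _ zM _ zN] \<beta>1(2)[OF _ _ _ zN] \<beta>1(3)[OF _ zM] ag_add_diff)
      finally show ?thesis .
    qed
    ultimately show "f \<in> K" by (simp add: K_def)
  next
    fix x y y' assume *: "f = (\<lambda>p. unit_fun (x, y \<oplus>\<^bsub>N\<^esub> y') p - unit_fun (x, y) p - unit_fun (x, y') p)"
      "x \<in> carrier M" "y' \<in> carrier N" "y \<in> carrier N"
    have "f \<in> carrier ?Fr" unfolding *(1) by (intro free_mod_closed(2) unit_fun_carrier) (use * M N in auto)
    moreover have "F (\<lambda>q. c * f q) = \<zero>" for c
    proof -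
      have "F (\<lambda>q. c * f q) = F (\<lambda>q. c * unit_fun (x, y \<oplus>\<^bsub>N\<^esub> y') q) \<ominus> F (\<lambda>q. c * unit_fun (x, y) q)
        \<ominus> F (\<lambda>q. c * unit_fun (x, y') q)"
        unfolding *(1) right_diff_distrib by (rule F3) (use * M N in auto)
      also have "\<dots> = \<zero>" using * M N P by (simp add: F(2) kvs_smult_distrib(2) \<beta>1(1)[OF _ zM _ zN] \<beta>1(2)[OF _ _ _ zN] \<beta>1(3)[OF _ zM] ag_add_diff)
      finally show ?thesis .
    qed
    ultimately show "f \<in> K" by (simp add: K_def)
  qed
  have K2: "f \<in> K" if "f \<in> {\<lambda>p. unit_fun (a \<odot>\<^bsub>M\<^esub> x, y) p - a * unit_fun (x, y) p | a x y.
        x \<in> carrier M \<and> y \<in> carrier N} \<union>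
     {\<lambda>p. unit_fun (x, a \<odot>\<^bsub>N\<^esub> y) p - a * unit_fun (x, y) p | a x y.
        x \<in> carrier M \<and> y \<in> carrier N}" for f
    using that
  proof (elim UnE CollectE exE conjE)
    fix a x y assume *: "f = (\<lambda>p. unit_fun (a \<odot>\<^bsub>M\<^esub> x, y) p - a * unit_fun (x, y) p)"
      "x \<in> carrier M" "y \<in> carrier N"
    have "f \<in> carrier ?Fr" unfolding *(1) by (intro free_mod_closed(2) cl unit_fun_carrier) (use * M N in auto)
    moreover have "F (\<lambda>q. c * f q) = \<zero>" for c
    proof -
      have "F (\<lambda>q. c * f q) = F (\<lambda>q. c * unit_fun (a \<odot>\<^bsub>M\<^esub> x, y) q) \<ominus> F (\<lambda>q. (c * a) * unit_fun (x, y) q)"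
        unfolding *(1) right_diff_distrib mult.assoc[symmetric] by (rule F2) (use * M N in auto)
      also have "\<dots> = \<zero>" using * M N P by (simp add: F(2) kvs_smult_distrib(3) \<beta>1(1)[OF _ zM _ zN])
      finally show ?thesis .
    qed
    ultimately show "f \<in> K" by (simp add: K_def)
  next
    fix a x y assume *: "f = (\<lambda>p. unit_fun (x, a \<odot>\<^bsub>N\<^esub> y) p - a * unit_fun (x, y) p)"
      "x \<in> carrier M" "y \<in> carrier N"
    have "f \<in> carrier ?Fr" unfolding *(1) by (intro free_mod_closed(2) cl unit_fun_carrier) (use * M N in auto)
    moreover have "F (\<lambda>q. c * f q) = \<zero>" for c
    proof -
      have "F (\<lambda>q. c * f q) = F (\<lambda>q. c * unit_fun (x, a \<odot>\<^bsub>N\<^esub> y) q) \<ominus> F (\<lambda>q. (c * a) * unit_fun (x, y) q)"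
        unfolding *(1) right_diff_distrib mult.assoc[symmetric] by (rule F2) (use * M N in auto)
      also have "\<dots> = \<zero>" using * M N P \<beta>1(4)[OF *(2) zM _ zN, of "a \<odot>\<^bsub>N\<^esub> y" c]
          \<beta>1(4)[OF *(2) zM *(3) zN, of "c * a"] \<beta>1(1)[OF *(2) zM _ zN]
        by (simp add: F(2) kvs_smult_distrib(3))
      finally show ?thesis .
    qed
    ultimately show "f \<in> K" by (simp add: K_def)
  qed
  have relK: "tensor_rel M N \<subseteq> K"
    unfolding tensor_rel_def
    by (rule lspan_minimal[OF subK], intro Un_least subsetI)
      (erule K1[OF UnI1], erule K1[OF UnI2], erule K2[OF UnI1], erule K2[OF UnI2])
  have "F f = \<zero>" if "f \<in> tensor_rel M N" for f
  proof -
    have "F (\<lambda>q. 1 * f q) = \<zero>" using subsetD[OF relK that] unfolding K_def by blast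
    then show ?thesis by simp
  qed
  then obtain h where h: "h \<in> add_hom (quot_mod ?Fr (tensor_rel M N)) P"
    "\<And>f. f \<in> carrier ?Fr \<Longrightarrow> h (tensor_rel M N +>\<^bsub>?Fr\<^esub> f) = F f"
    using quot_mod_lift[OF kvs_free_mod tensor_rel_submodule[OF M N] F(1) P] by metis
  have "h (tmul M N x y) = \<beta> x y" if "x \<in> carrier M" "y \<in> carrier N" for x y
    using h(2)[of "unit_fun (x, y)"] F(2)[of "(x, y)" 1] that M by (simp add: tmul_def)
  then show ?thesis using h(1) by (auto simp: tensor_def)
qed

lemma
  assumes "kvs M" "kvs N" "abelian_group P" "balanced M N P \<beta>"
  shows tlift_add_hom: "tlift M N P \<beta> \<in> add_hom (tensor M N) P"
    and tlift_tmul: "x \<in> carrier M \<Longrightarrow> y \<in> carrier N \<Longrightarrow> tlift M N P \<beta> (tmul M N x y) = \<beta> x y"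
  using someI_ex[OF tlift_exists[OF assms], folded tlift_def] by auto

lemma tlift_lin:
  assumes "kvs M" "kvs N" "kvs P" "balanced M N P \<beta>"
    and "\<And>c x y. x \<in> carrier M \<Longrightarrow> y \<in> carrier N \<Longrightarrow> \<beta> (c \<odot>\<^bsub>M\<^esub> x) y = c \<odot>\<^bsub>P\<^esub> \<beta> x y"
  shows "tlift M N P \<beta> \<in> lin (tensor M N) P"
proof -
  have P: "abelian_group P" using assms by simp
  note l = tlift_add_hom[OF assms(1,2) P assms(4)] and t = tlift_tmul[OF assms(1,2) P assms(4)]
  have "tlift M N P \<beta> (c \<odot>\<^bsub>tensor M N\<^esub> z) = c \<odot>\<^bsub>P\<^esub> tlift M N P \<beta> z" if "z \<in> carrier (tensor M N)" for c z
    using that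
  proof (induction z rule: tensor_induct[OF assms(1,2), consumes 1, case_names tmul add])
    case (tmul x y)
    then show ?case using assms by (simp add: tmul_smult_left[symmetric] t)
  next
    case (add z z')
    then show ?case using assms l by (simp add: kvs_smult_distrib add_hom_add add_hom_closed)
  qed
  then show ?thesis using l by (simp add: lin_def)
qed

lemma tmap_balanced:
  assumes "kvs M" "kvs N" "kvs M'" "kvs N'" "f \<in> lin M M'" "g \<in> lin N N'"
  shows "balanced M N (tensor M' N') (\<lambda>x y. tmul M' N' (f x) (g y))"
  by (rule balancedI) (use assms in \<open>simp_all add: lin_closed lin_add lin_smult
      tmul_add_left tmul_add_right tmul_smult_left tmul_smult_right\<close>)

lemma
  assumes "kvs M" "kvs N" "kvs M'" "kvs N'" "f \<in> lin M M'" "g \<in> lin N N'"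
  shows tmap_lin: "tmap M N M' N' f g \<in> lin (tensor M N) (tensor M' N')"
    and tmap_tmul: "x \<in> carrier M \<Longrightarrow> y \<in> carrier N \<Longrightarrow>
      tmap M N M' N' f g (tmul M N x y) = tmul M' N' (f x) (g y)"
proof -
  note b = tmap_balanced[OF assms]
  show "tmap M N M' N' f g \<in> lin (tensor M N) (tensor M' N')"
    unfolding tmap_def by (rule tlift_lin[OF assms(1,2) _ b])
      (use assms in \<open>simp_all add: lin_closed lin_smult tmul_smult_left\<close>)
  show "x \<in> carrier M \<Longrightarrow> y \<in> carrier N \<Longrightarrow>
      tmap M N M' N' f g (tmul M N x y) = tmul M' N' (f x) (g y)"
    unfolding tmap_def by (rule tlift_tmul[OF assms(1,2) _ b]) (use assms in simp_all)
qed

lemma tmap_id: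
  assumes "kvs M" "kvs N" "z \<in> carrier (tensor M N)"
    and "\<And>x. x \<in> carrier M \<Longrightarrow> f x = x" "\<And>y. y \<in> carrier N \<Longrightarrow> g y = y"
  shows "tmap M N M N f g z = z"
proof -
  have fg: "f \<in> lin M M" "g \<in> lin N N" using assms by (auto intro!: linI)
  show ?thesis
    by (rule tensor_ext[OF assms(1,2) lin_add_hom[OF tmap_lin[OF assms(1,2,1,2) fg]] lin_add_hom[OF lin_id(2)] _ assms(3)])
      (simp add: tmap_tmul[OF assms(1,2,1,2) fg] assms(4,5))
qed

section \<open>Linear functionals separate points\<close>

lemma submoduleD:
  fixes M (structure)
  assumes "kvs M" "submodule N kring M"
  shows "N \<subseteq> carrier M" "\<zero> \<in> N" "x \<in> N \<Longrightarrow> y \<in> N \<Longrightarrow> x \<oplus> y \<in> N"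
    "x \<in> N \<Longrightarrow> c \<odot> x \<in> N"
  using assms(2) unfolding submodule_iff[OF assms(1)] by simp_all

lemma kmod_simps [simp]:
  "carrier kmod = UNIV" "\<zero>\<^bsub>kmod\<^esub> = 0" "a \<oplus>\<^bsub>kmod\<^esub> b = a + b" "c \<odot>\<^bsub>kmod\<^esub> a = c * a"
  by (simp_all add: kmod_def)

lemma kvs_kmod [simp]: "kvs kmod"
proof (rule kvsI)
  show "abelian_group kmod"
    by (rule abelian_groupI) (auto simp: algebra_simps intro: exI[of _ "- x" for x])
qed (simp_all add: algebra_simps)

text \<open>A subspace maximal among those containing \<open>N\<close> and missing \<open>x\<close>
  is a complement of the line through \<open>x\<close>; the functional is the coordinate along
  \<open>x\<close> modulo this complement. Zorn's lemma is used because coordinate rings may have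
  infinite dimension.\<close>

lemma functional_exists:
  fixes M (structure)
  assumes M: "kvs M" and N: "submodule N kring M" and x: "x \<in> carrier M" "x \<notin> N"
  obtains u where "u \<in> lin M kmod" "\<And>y. y \<in> N \<Longrightarrow> u y = 0" "u x = 1"
proof -
  let ?\<S> = "{K. submodule K kring M \<and> N \<subseteq> K \<and> x \<notin> K}"
  have "\<exists>K\<in>?\<S>. \<forall>K'\<in>?\<S>. K \<subseteq> K' \<longrightarrow> K' = K"
  proof (rule subset_Zorn_nonempty)
    show "?\<S> \<noteq> {}" using N x by blast
    fix \<C> assume \<C>: "\<C> \<noteq> {}" "subset.chain ?\<S> \<C>"
    have sub: "K \<subseteq> carrier M" "\<zero> \<in> K" "\<And>y z. y \<in> K \<Longrightarrow> z \<in> K \<Longrightarrow> y \<oplus> z \<in> K"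
      "\<And>c y. y \<in> K \<Longrightarrow> c \<odot> y \<in> K" "N \<subseteq> K" "x \<notin> K" if "K \<in> \<C>" for K
      using \<C>(2) that unfolding subset.chain_def by (auto simp: submodule_iff[OF M] subset_iff)
    have two: "\<exists>K\<in>\<C>. y \<in> K \<and> z \<in> K" if "y \<in> \<Union>\<C>" "z \<in> \<Union>\<C>" for y z
    proof -
      obtain K L where KL: "K \<in> \<C>" "y \<in> K" "L \<in> \<C>" "z \<in> L" using \<open>y \<in> \<Union>\<C>\<close> \<open>z \<in> \<Union>\<C>\<close> by blast
      then have "K \<subseteq> L \<or> L \<subseteq> K" using \<C>(2) unfolding subset.chain_def by blast
      then show ?thesis using KL by blast
    qed
    have "submodule (\<Union>\<C>) kring M"
      unfolding submodule_iff[OF M]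
    proof (intro conjI ballI allI)
      show "\<Union>\<C> \<subseteq> carrier M" using sub(1) by blast
      show "\<zero> \<in> \<Union>\<C>" using \<C>(1) sub(2) by blast
      show "y \<oplus> z \<in> \<Union>\<C>" if "y \<in> \<Union>\<C>" "z \<in> \<Union>\<C>" for y z
        using two[OF that] sub(3) by blast
      show "c \<odot> y \<in> \<Union>\<C>" if "y \<in> \<Union>\<C>" for c y using that sub(4) by blast
    qed
    moreover have "N \<subseteq> \<Union>\<C>" "x \<notin> \<Union>\<C>" using \<C>(1) sub(5,6) by blast+
    ultimately show "\<Union>\<C> \<in> ?\<S>" by blast
  qed
  then obtain K where K': "K \<in> ?\<S>" "\<forall>K'\<in>?\<S>. K \<subseteq> K' \<longrightarrow> K' = K" by (rule bexE)
  then have K: "submodule K kring M" "N \<subseteq> K" "x \<notin> K" by simp_all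
  have max: "K' = K" if "submodule K' kring M" "N \<subseteq> K'" "x \<notin> K'" "K \<subseteq> K'" for K'
    using K'(2) that by simp
  note Kc = submoduleD(1)[OF M K(1)] and Ka = submoduleD(3)[OF M K(1)]
    and Ks = submoduleD(4)[OF M K(1)]
  have lspanK: "lspan M K = K"
    by (rule equalityI[OF lspan_minimal[OF K(1) subset_refl] lspan_superset])
  \<comment> \<open>By maximality, adjoining a \<open>y\<close> outside \<open>K\<close> brings
    \<open>x\<close> into the span, so \<open>y\<close> is congruent to a multiple of
    \<open>x\<close> modulo \<open>K\<close>.\<close>
  have ex: "\<exists>c. y \<ominus> c \<odot> x \<in> K" if y: "y \<in> carrier M" for y
  proof (cases "y \<in> K")
    case True
    have "y \<ominus> 0 \<odot> x = y" using M x y by (simp add: a_minus_def kvs_smult_distrib(4))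
    then show ?thesis using True by metis
  next
    case False
    let ?L = "lspan M (insert y K)"
    have L: "submodule ?L kring M" "K \<subseteq> ?L" "y \<in> ?L"
      using submodule_lspan[OF M, of "insert y K"] Kc y lspan_superset[of "insert y K" M] by auto
    then have "x \<in> ?L" using max[OF L(1)] K(2) False by blast
    then obtain c k where ck: "k \<in> K" "x = c \<odot> y \<oplus> k"
      using lspan_insert[OF M y Kc] lspanK by auto
    have k: "k \<in> carrier M" using ck Kc by blast
    have "c \<noteq> 0" using ck K(3) M y k by auto
    have "y \<ominus> inverse c \<odot> x = (- inverse c) \<odot> k"
    proof -
      have "inverse c \<odot> x = y \<oplus> inverse c \<odot> k"
        using ck(2) M y k \<open>c \<noteq> 0\<close> by (simp add: kvs_smult_distrib)
      then have "y \<ominus> inverse c \<odot> x = (y \<oplus> (-1) \<odot> y) \<oplus> (- inverse c) \<odot> k"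
        using M y k x by (simp add: a_minus_def kvs_smult_distrib ag_ac)
      also have "y \<oplus> (-1) \<odot> y = \<zero>" using M y by (metis kvs_smult_distrib(4) ag_simps(4) kvs_abelian)
      finally show ?thesis using M k by simp
    qed
    then show ?thesis using Ks[OF ck(1)] by metis
  qed
  have uniq: "c = c'" if "y \<in> carrier M" "y \<ominus> c \<odot> x \<in> K" "y \<ominus> c' \<odot> x \<in> K" for y c c'
  proof (rule ccontr)
    assume "c \<noteq> c'"
    have "(y \<ominus> c \<odot> x) \<oplus> (-1) \<odot> (y \<ominus> c' \<odot> x) = (y \<oplus> (-1) \<odot> y) \<oplus> ((-c) \<odot> x \<oplus> c' \<odot> x)"
      using M x that(1) by (simp add: a_minus_def kvs_smult_distrib(2-4) ag_ac)
    also have "\<dots> = (c' - c) \<odot> x"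
      using M x that(1) kvs_smult_distrib(1)[OF M x(1), of "-c" c'] ag_simps(4)[of M y]
      by (simp add: kvs_smult_distrib(4))
    finally have "(c' - c) \<odot> x \<in> K" using that Ka Ks by metis
    then have "inverse (c' - c) \<odot> ((c' - c) \<odot> x) \<in> K" by (rule Ks)
    then show False using \<open>c \<noteq> c'\<close> K(3) M x by (simp add: kvs_smult_distrib(3))
  qed
  define u where "u y = (THE c. y \<ominus> c \<odot> x \<in> K)" for y
  have u: "u y = c" if "y \<in> carrier M" "y \<ominus> c \<odot> x \<in> K" for y c
    unfolding u_def using uniq[OF that(1)] that(2) by blast
  have uK: "y \<ominus> u y \<odot> x \<in> K" if "y \<in> carrier M" for y
    using ex[OF that] u[OF that] by metis
  have "u \<in> lin M kmod"
  proof (rule linI)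
    fix y z assume y: "y \<in> carrier M" and z: "z \<in> carrier M"
    have "(y \<oplus> z) \<ominus> (u y + u z) \<odot> x = (y \<ominus> u y \<odot> x) \<oplus> (z \<ominus> u z \<odot> x)"
      using M x y z by (simp add: a_minus_def kvs_smult_distrib(1-4) ag_ac)
    then show "u (y \<oplus> z) = u y \<oplus>\<^bsub>kmod\<^esub> u z" using u M y z uK Ka by simp
  next
    fix c y assume y: "y \<in> carrier M"
    have "c \<odot> y \<ominus> (c * u y) \<odot> x = c \<odot> (y \<ominus> u y \<odot> x)"
      using M x y by (simp add: a_minus_def kvs_smult_distrib(2-4))
    then show "u (c \<odot> y) = c \<odot>\<^bsub>kmod\<^esub> u y" using u M y uK Ks by simp
  qed simp
  moreover have "u y = 0" if "y \<in> N" for y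
  proof (rule u)
    show y: "y \<in> carrier M" using that K(2) Kc by blast
    have "y \<ominus> 0 \<odot> x = y" using M x y by (simp add: a_minus_def kvs_smult_distrib(4))
    then show "y \<ominus> 0 \<odot> x \<in> K" using that K(2) by auto
  qed
  moreover have "u x = 1" by (rule u) (use M x submoduleD(2)[OF M K(1)] in auto)
  ultimately show thesis by (rule that)
qed

section \<open>Rank of tensors\<close>

definition right_span ::
  "('k::field, 'a, 'm) module_scheme \<Rightarrow> ('k, 'b, 'n) module_scheme \<Rightarrow> 'b set \<Rightarrow> ('a \<times> 'b \<Rightarrow> 'k) set set"
  where "right_span M N R = lspan (tensor M N) {tmul M N x r | x r. x \<in> carrier M \<and> r \<in> R}"

definition left_span ::
  "('k::field, 'a, 'm) module_scheme \<Rightarrow> ('k, 'b, 'n) module_scheme \<Rightarrow> 'a set \<Rightarrow> ('a \<times> 'b \<Rightarrow> 'k) set set"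
  where "left_span M N S = lspan (tensor M N) {tmul M N s y | s y. s \<in> S \<and> y \<in> carrier N}"

text \<open>\<open>id \<otimes> u : M \<otimes> N \<rightarrow> M\<close> for \<open>u \<in> N\<^sup>*\<close>.\<close>

definition slice ::
  "('k::field, 'a, 'm) module_scheme \<Rightarrow> ('k, 'b, 'n) module_scheme \<Rightarrow> ('b \<Rightarrow> 'k) \<Rightarrow> ('a \<times> 'b \<Rightarrow> 'k) set \<Rightarrow> 'a"
  where "slice M N u = tlift M N M (\<lambda>x y. u y \<odot>\<^bsub>M\<^esub> x)"

lemma slice_balanced:
  assumes "kvs M" "kvs N" "u \<in> lin N kmod"
  shows "balanced M N M (\<lambda>x y. u y \<odot>\<^bsub>M\<^esub> x)"
  by (rule balancedI) (use assms in \<open>simp_all add: lin_add lin_smult kvs_smult_distrib mult.commute\<close>)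

lemma
  assumes "kvs M" "kvs N" "u \<in> lin N kmod"
  shows slice_lin: "slice M N u \<in> lin (tensor M N) M"
    and slice_tmul: "x \<in> carrier M \<Longrightarrow> y \<in> carrier N \<Longrightarrow> slice M N u (tmul M N x y) = u y \<odot>\<^bsub>M\<^esub> x"
  unfolding slice_def
  using assms by (auto intro!: tlift_lin tlift_tmul slice_balanced simp: kvs_smult_distrib mult.commute)

context
  fixes M :: "('k::field, 'a, 'm) module_scheme" (structure) and N :: "('k, 'b, 'n) module_scheme"
  assumes M: "kvs M" and N: "kvs N"
begin

private abbreviation (input) "T \<equiv> tensor M N"

lemma right_span_submodule:
  assumes "R \<subseteq> carrier N" shows "submodule (right_span M N R) kring T"
  unfolding right_span_def using assms M N by (intro submodule_lspan) auto

lemma left_span_submodule: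
  assumes "S \<subseteq> carrier M" shows "submodule (left_span M N S) kring T"
  unfolding left_span_def using assms M N by (intro submodule_lspan) auto

lemma left_spanI: "s \<in> S \<Longrightarrow> y \<in> carrier N \<Longrightarrow> tmul M N s y \<in> left_span M N S"
  unfolding left_span_def by (rule subsetD[OF lspan_superset]) blast

lemma right_span_mono: "R \<subseteq> R' \<Longrightarrow> right_span M N R \<subseteq> right_span M N R'"
  unfolding right_span_def by (rule lspan_mono) blast

lemma left_span_mono: "S \<subseteq> S' \<Longrightarrow> left_span M N S \<subseteq> left_span M N S'"
  unfolding left_span_def by (rule lspan_mono) blast

lemma right_span_lspan:
  assumes "R \<subseteq> carrier N" "r \<in> lspan N R" "x \<in> carrier M"
  shows "tmul M N x r \<in> right_span M N R"
proof -
  note sub = submoduleD[OF kvs_tensor[OF M N] right_span_submodule[OF assms(1)]]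
  show ?thesis using assms(2)
  proof (induction rule: lspan_induct)
    case (base s)
    then show ?case unfolding right_span_def using assms(3) by (intro subsetD[OF lspan_superset]) blast
  qed (use sub assms M N in \<open>auto simp: tmul_add_right tmul_smult_right\<close>)
qed

lemma tensor_finite_right:
  assumes "z \<in> carrier T"
  obtains R where "finite R" "R \<subseteq> carrier N" "z \<in> right_span M N R"
proof -
  from assms have "\<exists>R. finite R \<and> R \<subseteq> carrier N \<and> z \<in> right_span M N R"
  proof (induction rule: tensor_induct[OF M N, consumes 1, case_names tmul add])
    case (tmul x y)
    have "tmul M N x y \<in> right_span M N {y}"
      unfolding right_span_def using tmul by (intro subsetD[OF lspan_superset]) blast
    then show ?case using tmul by (intro exI[of _ "{y}"]) auto
  next
    case (add z z')
    then obtain R R' where R: "finite R" "R \<subseteq> carrier N" "z \<in> right_span M N R"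
      "finite R'" "R' \<subseteq> carrier N" "z' \<in> right_span M N R'" by blast
    have "z \<in> right_span M N (R \<union> R')" "z' \<in> right_span M N (R \<union> R')"
      using R right_span_mono[of R "R \<union> R'"] right_span_mono[of R' "R \<union> R'"] by blast+
    then have "z \<oplus>\<^bsub>T\<^esub> z' \<in> right_span M N (R \<union> R')"
      using submoduleD(3)[OF kvs_tensor[OF M N] right_span_submodule[of "R \<union> R'"]] R by simp
    then show ?case using R by (intro exI[of _ "R \<union> R'"]) auto
  qed
  then show thesis using that by blast
qed

lemma right_span_insert:
  assumes "R \<subseteq> carrier N" "r \<in> carrier N" "z \<in> right_span M N (insert r R)"
  obtains x z' where "x \<in> carrier M" "z' \<in> right_span M N R" "z = tmul M N x r \<oplus>\<^bsub>T\<^esub> z'"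
proof -
  note sub = submoduleD[OF kvs_tensor[OF M N] right_span_submodule[OF assms(1)]]
  have rc: "\<And>z. z \<in> right_span M N R \<Longrightarrow> z \<in> carrier T" using sub(1) by blast
  have "\<exists>x z'. x \<in> carrier M \<and> z' \<in> right_span M N R \<and> z = tmul M N x r \<oplus>\<^bsub>T\<^esub> z'"
    using assms(3)[unfolded right_span_def]
  proof (induction rule: lspan_induct)
    case kvs show ?case using M N by simp
  next
    case subset show ?case using assms M N by auto
  next
    case (base s)
    then obtain x q where s: "s = tmul M N x q" "x \<in> carrier M" "q \<in> insert r R" by blast
    show ?case
    proof (cases "q = r")
      case True
      then have "s = tmul M N x r \<oplus>\<^bsub>T\<^esub> \<zero>\<^bsub>T\<^esub>" using s assms M N by simp
      then show ?thesis using s(2) sub(2) by blast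
    next
      case False
      then have "s \<in> right_span M N R"
        unfolding right_span_def using s by (intro subsetD[OF lspan_superset]) blast
      moreover from this have "s = tmul M N \<zero> r \<oplus>\<^bsub>T\<^esub> s" using assms M N rc by simp
      ultimately show ?thesis using M by (metis ag_closed(1) kvs_abelian)
    qed
  next
    case zero
    have "\<zero>\<^bsub>T\<^esub> = tmul M N \<zero> r \<oplus>\<^bsub>T\<^esub> \<zero>\<^bsub>T\<^esub>" using assms M N by simp
    then show ?case using ag_closed(1)[OF kvs_abelian[OF M]] sub(2) by blast
  next
    case (add y z)
    then obtain x1 y' x2 z' where *: "x1 \<in> carrier M" "y' \<in> right_span M N R" "y = tmul M N x1 r \<oplus>\<^bsub>T\<^esub> y'"
      "x2 \<in> carrier M" "z' \<in> right_span M N R" "z = tmul M N x2 r \<oplus>\<^bsub>T\<^esub> z'" by blast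
    then have "y \<oplus>\<^bsub>T\<^esub> z = tmul M N (x1 \<oplus> x2) r \<oplus>\<^bsub>T\<^esub> (y' \<oplus>\<^bsub>T\<^esub> z')"
      using assms M N rc by (simp add: tmul_add_left ag_ac)
    moreover have "x1 \<oplus> x2 \<in> carrier M" "y' \<oplus>\<^bsub>T\<^esub> z' \<in> right_span M N R" using * M sub by auto
    ultimately show ?case by blast
  next
    case (smult c y)
    then obtain x1 y' where *: "x1 \<in> carrier M" "y' \<in> right_span M N R" "y = tmul M N x1 r \<oplus>\<^bsub>T\<^esub> y'" by blast
    then have "c \<odot>\<^bsub>T\<^esub> y = tmul M N (c \<odot> x1) r \<oplus>\<^bsub>T\<^esub> (c \<odot>\<^bsub>T\<^esub> y')"
      using assms M N rc by (simp add: tmul_smult_left kvs_smult_distrib(2))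
    moreover have "c \<odot> x1 \<in> carrier M" "c \<odot>\<^bsub>T\<^esub> y' \<in> right_span M N R" using * M sub by auto
    ultimately show ?case by blast
  qed
  then show thesis using that by blast
qed

lemma slice_vanish:
  assumes "R \<subseteq> carrier N" "u \<in> lin N kmod" "\<And>r. r \<in> R \<Longrightarrow> u r = 0" "z \<in> right_span M N R"
  shows "slice M N u z = \<zero>"
proof -
  note l = slice_lin[OF M N assms(2)]
  show ?thesis using assms(4)[unfolded right_span_def]
  proof (induction rule: lspan_induct)
    case (base s)
    then show ?case using slice_tmul[OF M N assms(2)] assms(1,3) M by (auto simp: subset_iff)
  next
    case zero
    then show ?case using add_hom_zero[OF lin_add_hom[OF l]] M N by simp
  qed (use assms M N in \<open>auto simp: lin_add[OF l] lin_smult[OF l]\<close>)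
qed

text \<open>In an expression of \<open>z\<close> with linearly independent right factors the left factors are slices.\<close>

lemma tensor_left_slices:
  assumes "z \<in> carrier T"
  obtains S where "finite S" "S \<subseteq> carrier M" "z \<in> left_span M N S"
    "\<And>s. s \<in> S \<Longrightarrow> \<exists>u\<in>lin N kmod. s = slice M N u z"
proof -
  obtain R where R: "finite R" "R \<subseteq> carrier N" "z \<in> right_span M N R"
    using tensor_finite_right[OF assms] by blast
  then have "\<exists>S. finite S \<and> S \<subseteq> carrier M \<and> z \<in> left_span M N S \<and>
    (\<forall>s\<in>S. \<exists>u\<in>lin N kmod. s = slice M N u z)"
  proof (induction R arbitrary: z rule: finite_induct)
    case empty
    then have "z \<in> lspan T {}" by (simp add: right_span_def)
    then have "z \<in> left_span M N {}" by (simp add: left_span_def)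
    then show ?case by blast
  next
    case (insert r R)
    then have R: "R \<subseteq> carrier N" "r \<in> carrier N" by auto
    note sub = submoduleD[OF kvs_tensor[OF M N] right_span_submodule[OF R(1)]]
    obtain x z' where z: "x \<in> carrier M" "z' \<in> right_span M N R" "z = tmul M N x r \<oplus>\<^bsub>T\<^esub> z'"
      using right_span_insert[OF R insert.prems(2)] by metis
    have z': "z' \<in> carrier T" using z(2) sub(1) by blast
    have zc: "z \<in> carrier T" using z z' R M N by simp
    show ?case
    proof (cases "r \<in> lspan N R")
      case True
      then have "z \<in> right_span M N R" using z(3) sub(3)[OF right_span_lspan[OF R(1) True z(1)] z(2)] by simp
      then show ?thesis using insert.IH R by blast
    next
      case False
      \<comment> \<open>As \<open>r\<close> is independent of \<open>R\<close>, some functional is 1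
        at \<open>r\<close> and 0 on \<open>R\<close>; slicing with it isolates the left factor
        \<open>x\<close>.\<close>
      then obtain u where u: "u \<in> lin N kmod" "\<And>y. y \<in> lspan N R \<Longrightarrow> u y = 0" "u r = 1"
        using functional_exists[OF N submodule_lspan[OF N R(1)] R(2)] by metis
      have "u q = 0" if "q \<in> R" for q using that u(2) lspan_superset[of R N] by blast
      then have u0: "slice M N u z' = \<zero>" using slice_vanish[OF R(1) u(1) _ z(2)] by blast
      then have x: "x = slice M N u z"
        using z R M N z' u(3) lin_add[OF slice_lin[OF M N u(1)]] slice_tmul[OF M N u(1)] by simp
      obtain S where S: "finite S" "S \<subseteq> carrier M" "z' \<in> left_span M N S"
        "\<And>s. s \<in> S \<Longrightarrow> \<exists>u\<in>lin N kmod. s = slice M N u z'" using insert.IH[OF R(1) z(2)] by blast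
      have slices: "\<exists>v\<in>lin N kmod. s = slice M N v z" if sS: "s \<in> S" for s
      proof -
        obtain v where v: "v \<in> lin N kmod" "s = slice M N v z'" using S(4)[OF sS] by blast
        \<comment> \<open>A slice of \<open>z'\<close> by \<open>v\<close> has to be rewritten as a
          slice of \<open>z\<close>. Subtracting \<open>v r\<close> times \<open>u\<close> makes the
          functional vanish at \<open>r\<close> and changes nothing on \<open>z'\<close>, whose
          slice by \<open>u\<close> is zero.\<close>
        define w where "w y = v y - v r * u y" for y
        have w: "w \<in> lin N kmod"
          by (rule linI) (simp_all add: w_def lin_add[OF u(1)] lin_add[OF v(1)] lin_smult[OF u(1)]
              lin_smult[OF v(1)] algebra_simps)
        have sw: "slice M N w y = slice M N v y \<oplus> (- v r) \<odot> slice M N u y" if "y \<in> carrier T" for y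
        proof -
          have "(\<lambda>y. (- v r) \<odot> slice M N u y) \<in> add_hom T M"
            by (rule add_homI) (use M in \<open>simp_all add: kvs_smult_distrib(2) lin_closed[OF slice_lin[OF M N u(1)]]
                lin_add[OF slice_lin[OF M N u(1)]]\<close>)
          then have h: "(\<lambda>y. slice M N v y \<oplus> (- v r) \<odot> slice M N u y) \<in> add_hom T M"
            by (rule add_hom_plus[OF lin_add_hom[OF slice_lin[OF M N v(1)]]]) (use M in simp)
          have "slice M N w (tmul M N p q) = slice M N v (tmul M N p q) \<oplus> (- v r) \<odot> slice M N u (tmul M N p q)"
            if "p \<in> carrier M" "q \<in> carrier N" for p q
            using that M kvs_smult_distrib(1)[OF M that(1), of "v q" "- v r * u q", symmetric]
            by (simp add: slice_tmul[OF M N] w u(1) v(1) kvs_smult_distrib(3) w_def)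
          then show ?thesis
            by (rule tensor_ext[OF M N lin_add_hom[OF slice_lin[OF M N w]] h _ that])
        qed
        have "slice M N w z = slice M N w (tmul M N x r) \<oplus> slice M N w z'"
          using z R z' M N lin_add[OF slice_lin[OF M N w]] by simp
        also have "slice M N w (tmul M N x r) = \<zero>"
          using z R M by (simp add: slice_tmul[OF M N w] w_def u(3))
        also have "slice M N w z' = slice M N v z'" using sw[OF z'] u0 M v(2) S(2) sS by (simp add: subset_iff)
        finally have "slice M N w z = s" using v(2) S(2) sS M by (simp add: subset_iff)
        then show ?thesis using w by blast
      qed
      have sub': "insert x S \<subseteq> carrier M" using S z by blast
      note lsub = submoduleD[OF kvs_tensor[OF M N] left_span_submodule[OF sub']]
      have "z' \<in> left_span M N (insert x S)" using S(3) left_span_mono[of S "insert x S"] by blast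
      moreover have "tmul M N x r \<in> left_span M N (insert x S)" by (rule left_spanI) (use R in auto)
      ultimately have "z \<in> left_span M N (insert x S)" using lsub(3) z(3) by simp
      then show ?thesis using S(1) sub' slices x u(1) by (intro exI[of _ "insert x S"]) blast
    qed
  qed
  then show thesis using that by blast
qed

text \<open>By \<open>tensor_left_slices\<close> the left factors of \<open>z\<close> can be taken
  to be slices of \<open>z\<close>; if these vanish, \<open>z\<close> lies in the span of tensors
  with left factor zero.\<close>

lemma slices_separate:
  assumes "z \<in> carrier T" "\<And>u. u \<in> lin N kmod \<Longrightarrow> slice M N u z = \<zero>"
  shows "z = \<zero>\<^bsub>T\<^esub>"
proof -
  obtain S where S: "S \<subseteq> carrier M" "z \<in> left_span M N S" "\<And>s. s \<in> S \<Longrightarrow> \<exists>u\<in>lin N kmod. s = slice M N u z"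
    using tensor_left_slices[OF assms(1)] by metis
  have "S \<subseteq> {\<zero>}" using S(3) assms(2) by blast
  from S(2)[unfolded left_span_def] show ?thesis
  proof (induction rule: lspan_induct)
    case (base s)
    then show ?case using \<open>S \<subseteq> {\<zero>}\<close> M N by auto
  qed (use S M N in auto)
qed

end

lemma slice_tmap:
  assumes "kvs M" "kvs M'" "kvs N" "f \<in> lin M M'" "u \<in> lin N kmod" "z \<in> carrier (tensor M N)"
  shows "slice M' N u (tmap M N M' N f id z) = f (slice M N u z)"
proof -
  note tl = tmap_lin[OF assms(1,3,2,3,4) lin_id(1)] and tt = tmap_tmul[OF assms(1,3,2,3,4) lin_id(1)]
  note s' = slice_lin[OF assms(2,3,5)] and s = slice_lin[OF assms(1,3,5)]
  show ?thesis
    by (rule tensor_ext[OF assms(1,3) add_hom_comp[OF lin_add_hom[OF tl] lin_add_hom[OF s']]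
        add_hom_comp[OF lin_add_hom[OF s] lin_add_hom[OF assms(4)]] _ assms(6)])
      (simp add: tt slice_tmul assms lin_closed[OF assms(4)] lin_smult[OF assms(4)])
qed

text \<open>Flatness over a field without a choice of bases: slices commute with \<open>f\<close> on
  the left factor and together detect zero.\<close>

lemma tmap_inj:
  assumes "kvs M" "kvs M'" "kvs N" "f \<in> lin M M'" "inj_on f (carrier M)"
  shows "inj_on (tmap M N M' N f id) (carrier (tensor M N))"
proof (rule inj_onI)
  fix y z assume y: "y \<in> carrier (tensor M N)" and z: "z \<in> carrier (tensor M N)"
    and eq: "tmap M N M' N f id y = tmap M N M' N f id z"
  have "slice M N u (y \<ominus>\<^bsub>tensor M N\<^esub> z) = \<zero>\<^bsub>M\<^esub>" if u: "u \<in> lin N kmod" for u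
  proof -
    note s = slice_lin[OF assms(1,3) u]
    have "f (slice M N u y) = f (slice M N u z)"
      using slice_tmap[OF assms(1-4) u y] slice_tmap[OF assms(1-4) u z] eq by simp
    then have "slice M N u y = slice M N u z"
      using assms(5) lin_closed[OF s y] lin_closed[OF s z] by (simp add: inj_on_eq_iff)
    then show ?thesis using add_hom_diff[OF lin_add_hom[OF s] _ _ y z] assms lin_closed[OF s z] by simp
  qed
  then have "y \<ominus>\<^bsub>tensor M N\<^esub> z = \<zero>\<^bsub>tensor M N\<^esub>"
    using slices_separate[OF assms(1,3)] y z assms by simp
  then show "y = z" using ag_diff_eq_zero[OF _ y z] assms by simp
qed

section \<open>Automorphisms of algebraically closed fields\<close>

definition is_subfield :: "'w::field set \<Rightarrow> bool" where
  "is_subfield K \<longleftrightarrow> 0 \<in> K \<and> 1 \<in> K \<and> (\<forall>x\<in>K. \<forall>y\<in>K. x + y \<in> K \<and> x * y \<in> K) \<and>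
     (\<forall>x\<in>K. - x \<in> K \<and> inverse x \<in> K)"

definition polys_over :: "'w::field set \<Rightarrow> 'w poly set" where
  "polys_over K = {p. \<forall>i. coeff p i \<in> K}"

lemma is_subfieldD:
  assumes "is_subfield K"
  shows "0 \<in> K" "1 \<in> K" "x \<in> K \<Longrightarrow> y \<in> K \<Longrightarrow> x + y \<in> K" "x \<in> K \<Longrightarrow> y \<in> K \<Longrightarrow> x * y \<in> K"
    "x \<in> K \<Longrightarrow> - x \<in> K" "x \<in> K \<Longrightarrow> y \<in> K \<Longrightarrow> x - y \<in> K" "x \<in> K \<Longrightarrow> inverse x \<in> K"
    "x \<in> K \<Longrightarrow> y \<in> K \<Longrightarrow> x / y \<in> K"
proof -
  show *: "0 \<in> K" "1 \<in> K" "x \<in> K \<Longrightarrow> y \<in> K \<Longrightarrow> x + y \<in> K" "x \<in> K \<Longrightarrow> y \<in> K \<Longrightarrow> x * y \<in> K"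
    "x \<in> K \<Longrightarrow> - x \<in> K" "x \<in> K \<Longrightarrow> inverse x \<in> K" for x y
    using assms by (auto simp: is_subfield_def)
  show "x \<in> K \<Longrightarrow> y \<in> K \<Longrightarrow> x - y \<in> K" "x \<in> K \<Longrightarrow> y \<in> K \<Longrightarrow> x / y \<in> K"
    using *(3)[of x "- y"] *(4)[of x "inverse y"] *(5)[of y] *(6)[of y] by (auto simp: field_simps)
qed

section \<open>Polynomials over a subfield and simple field extensions\<close>

context
  fixes K :: "'w::field set"
  assumes K: "is_subfield K"
begin

lemma sum_in_subfield: "(\<And>i. i \<in> I \<Longrightarrow> f i \<in> K) \<Longrightarrow> sum f I \<in> K"
  by (induction I rule: infinite_finite_induct) (auto intro: is_subfieldD[OF K])

lemma polys_over_intros: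
  shows "0 \<in> polys_over K" "1 \<in> polys_over K" "c \<in> K \<Longrightarrow> [:c:] \<in> polys_over K"
    and "p \<in> polys_over K \<Longrightarrow> q \<in> polys_over K \<Longrightarrow> p + q \<in> polys_over K"
    and "p \<in> polys_over K \<Longrightarrow> q \<in> polys_over K \<Longrightarrow> p - q \<in> polys_over K"
    and "p \<in> polys_over K \<Longrightarrow> - p \<in> polys_over K"
    and "p \<in> polys_over K \<Longrightarrow> q \<in> polys_over K \<Longrightarrow> p * q \<in> polys_over K"
    and "c \<in> K \<Longrightarrow> p \<in> polys_over K \<Longrightarrow> smult c p \<in> polys_over K"
    and "c \<in> K \<Longrightarrow> monom c n \<in> polys_over K"
    and "c \<in> K \<Longrightarrow> p \<in> polys_over K \<Longrightarrow> pCons c p \<in> polys_over K"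
    and "p \<in> polys_over K \<Longrightarrow> pderiv p \<in> polys_over K"
proof -
  have "of_nat n \<in> K" for n by (induction n) (auto intro: is_subfieldD[OF K])
  then show "p \<in> polys_over K \<Longrightarrow> pderiv p \<in> polys_over K"
    by (simp add: polys_over_def coeff_pderiv is_subfieldD[OF K] del: of_nat_Suc)
  show "p \<in> polys_over K \<Longrightarrow> q \<in> polys_over K \<Longrightarrow> p * q \<in> polys_over K"
    by (auto simp: polys_over_def coeff_mult intro!: sum_in_subfield is_subfieldD[OF K])
qed (auto simp: polys_over_def coeff_pCons is_subfieldD[OF K] split: nat.split)

lemma polys_over_power: "p \<in> polys_over K \<Longrightarrow> p ^ n \<in> polys_over K"
  by (induction n) (auto intro: polys_over_intros)

lemma polys_over_sum: "(\<And>i. i \<in> I \<Longrightarrow> f i \<in> polys_over K) \<Longrightarrow> sum f I \<in> polys_over K"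
  by (induction I rule: infinite_finite_induct) (auto intro: polys_over_intros)

lemma polys_over_pcompose:
  assumes "q \<in> polys_over K"
  shows "p \<in> polys_over K \<Longrightarrow> pcompose p q \<in> polys_over K"
proof (induction p)
  case (pCons a p)
  have "a \<in> K" "p \<in> polys_over K" using pCons(3)
    by (auto simp: polys_over_def coeff_pCons split: nat.splits dest: spec[of _ 0] spec[of _ "Suc _"])
  then show ?case using pCons assms by (auto simp: pcompose_pCons intro!: polys_over_intros)
qed (simp add: polys_over_intros)

text \<open>Long division with the coefficients kept in \<open>K\<close>. The induction runs over a
  bound for the support of the dividend, which treats the zero polynomial uniformly.\<close>

lemma polys_over_division:
  assumes m: "m \<in> polys_over K" "m \<noteq> 0" and p: "p \<in> polys_over K"
  obtains q r where "q \<in> polys_over K" "r \<in> polys_over K" "p = q * m + r" "r = 0 \<or> degree r < degree m"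
proof -
  have "\<exists>q r. q \<in> polys_over K \<and> r \<in> polys_over K \<and> p = q * m + r \<and> (r = 0 \<or> degree r < degree m)"
    if "p \<in> polys_over K" "\<forall>i\<ge>n. coeff p i = 0" for p n
    using that
  proof (induction n arbitrary: p)
    case 0
    then have "p = 0" by (intro poly_eqI) simp
    then show ?case by (intro exI[of _ 0]) (simp add: polys_over_intros)
  next
    case (Suc n)
    show ?case
    proof (cases "n < degree m")
      case True
      have "degree p \<le> n" by (rule degree_le) (use Suc.prems in auto)
      then show ?thesis using True Suc.prems by (intro exI[of _ 0] exI[of _ p]) (simp add: polys_over_intros)
    next
      case False
      define c where "c = coeff p n / lead_coeff m"
      have c: "c \<in> K" using Suc.prems m by (auto simp: c_def polys_over_def intro: is_subfieldD[OF K])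
      define p' where "p' = p - monom c (n - degree m) * m"
      have "p' \<in> polys_over K" unfolding p'_def using c Suc.prems m by (intro polys_over_intros)
      moreover have "coeff p' i = 0" if "i \<ge> n" for i
      proof (cases "i = n")
        case True
        then show ?thesis using False m by (simp add: p'_def coeff_monom_mult c_def)
      next
        case ni: False
        then have "coeff m (i - (n - degree m)) = 0" using that False by (intro coeff_eq_0) linarith
        then show ?thesis using ni that Suc.prems by (simp add: p'_def coeff_monom_mult)
      qed
      ultimately obtain q r where "q \<in> polys_over K" "r \<in> polys_over K" "p' = q * m + r"
        "r = 0 \<or> degree r < degree m" using Suc.IH[of p'] by blast
      moreover from this have "p = (q + monom c (n - degree m)) * m + r"
        unfolding p'_def by (simp add: algebra_simps)
      ultimately show ?thesis using c by (intro exI[of _ "q + monom c (n - degree m)"] exI[of _ r])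
        (auto intro: polys_over_intros)
    qed
  qed
  from this[OF p, of "Suc (degree p)"] show thesis using that by (auto simp: coeff_eq_0)
qed

text \<open>Both properties are recorded because they serve different ends: minimality of the degree
  yields a simple root in \<open>exists_conjugate\<close>, divisibility yields well-definedness in
  \<open>partial_hom_extend\<close>.\<close>

lemma minimal_poly:
  assumes "p \<in> polys_over K" "p \<noteq> 0" "poly p x = 0"
  obtains m where "m \<in> polys_over K" "m \<noteq> 0" "poly m x = 0"
    "\<And>q. q \<in> polys_over K \<Longrightarrow> q \<noteq> 0 \<Longrightarrow> poly q x = 0 \<Longrightarrow> degree m \<le> degree q"
    "\<And>q. q \<in> polys_over K \<Longrightarrow> poly q x = 0 \<Longrightarrow> \<exists>s\<in>polys_over K. q = s * m"
proof -
  let ?P = "\<lambda>q. q \<in> polys_over K \<and> q \<noteq> 0 \<and> poly q x = 0"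
  obtain m where m: "?P m" "\<And>q. ?P q \<Longrightarrow> degree m \<le> degree q"
    using ex_has_least_nat[of ?P p degree] assms by blast
  have "\<exists>s\<in>polys_over K. q = s * m" if "q \<in> polys_over K" "poly q x = 0" for q
  proof -
    obtain s r where s: "s \<in> polys_over K" "r \<in> polys_over K" "q = s * m + r" "r = 0 \<or> degree r < degree m"
      using polys_over_division[of m q] m(1) \<open>q \<in> polys_over K\<close> by blast
    then have "poly r x = 0" using that m(1) by simp
    then have "r = 0" using m(2)[of r] s by force
    then show ?thesis using s by auto
  qed
  then show thesis using m that by blast
qed

text \<open>The field K(x) inside \<open>'w\<close>, for algebraic and transcendental
  \<open>x\<close> alike.\<close>

definition fractions :: "'w \<Rightarrow> 'w set" where
  "fractions x = {poly p x / poly q x | p q. p \<in> polys_over K \<and> q \<in> polys_over K \<and> poly q x \<noteq> 0}"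

lemma fractionsI:
  "p \<in> polys_over K \<Longrightarrow> q \<in> polys_over K \<Longrightarrow> poly q x \<noteq> 0 \<Longrightarrow> poly p x / poly q x \<in> fractions x"
  unfolding fractions_def by blast

lemma is_subfield_fractions: "is_subfield (fractions x)"
proof -
  note I = fractionsI[of _ _ x]
  show ?thesis unfolding is_subfield_def
  proof (intro conjI ballI)
    show "0 \<in> fractions x" "1 \<in> fractions x" using I[of 0 1] I[of 1 1] by (simp_all add: polys_over_intros)
    fix a assume "a \<in> fractions x"
    then obtain p q where a: "a = poly p x / poly q x" "p \<in> polys_over K" "q \<in> polys_over K" "poly q x \<noteq> 0"
      by (auto simp: fractions_def)
    show "- a \<in> fractions x" using I[of "- p" q] a by (simp add: polys_over_intros)
    show "inverse a \<in> fractions x" using I[of q p] I[of 0 1] a by (cases "poly p x = 0") (auto simp: polys_over_intros)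
    fix b assume "b \<in> fractions x"
    then obtain p' q' where b: "b = poly p' x / poly q' x" "p' \<in> polys_over K" "q' \<in> polys_over K" "poly q' x \<noteq> 0"
      by (auto simp: fractions_def)
    show "a * b \<in> fractions x" using I[of "p * p'" "q * q'"] a b by (simp add: polys_over_intros)
    show "a + b \<in> fractions x" using I[of "p * q' + p' * q" "q * q'"] a b
      by (simp add: polys_over_intros add_frac_eq)
  qed
qed

lemma subset_fractions: "K \<subseteq> fractions x" and in_fractions: "x \<in> fractions x"
proof -
  show "K \<subseteq> fractions x"
  proof
    fix c assume "c \<in> K"
    then show "c \<in> fractions x" using fractionsI[of "[:c:]" 1 x] by (simp add: polys_over_intros)
  qed
  have "[:0, 1:] \<in> polys_over K" by (intro polys_over_intros is_subfieldD[OF K])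
  then show "x \<in> fractions x" using fractionsI[of "[:0, 1:]" 1 x] by (simp add: polys_over_intros)
qed

end

lemma infinite_of_char_0:
  assumes "CHAR('w::field) = 0" shows "infinite (UNIV :: 'w set)"
proof -
  have "inj (of_nat :: nat \<Rightarrow> 'w)"
  proof (rule linorder_injI)
    fix m n :: nat assume "m < n"
    then have "\<not> 0 dvd n - m" by simp
    then have "of_nat (n - m) \<noteq> (0 :: 'w)" using assms by (simp add: of_nat_eq_0_iff_char_dvd del: dvd_0_left_iff)
    moreover have "of_nat (n - m) = (of_nat n - of_nat m :: 'w)" using \<open>m < n\<close> by (simp add: of_nat_diff)
    ultimately show "of_nat m \<noteq> (of_nat n :: 'w)" by auto
  qed
  then show ?thesis using infinite_UNIV_nat infinite_UNIV_char_0 range_inj_infinite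
    by (metis infinite_super subset_UNIV)
qed

lemma poly_zero_of_char_0:
  fixes p :: "'w::field poly"
  assumes "CHAR('w) = 0" "infinite {x. poly p x = 0}" shows "p = 0"
  using assms poly_roots_finite by blast

lemma degree_pos_of_root:
  fixes p :: "'w::field poly"
  assumes "p \<noteq> 0" "poly p x = 0" shows "degree p > 0"
proof (rule ccontr)
  assume "\<not> degree p > 0"
  then obtain a where "p = [:a:]" by (metis degree_eq_zeroE neq0_conv)
  then show False using assms by simp
qed

text \<open>For every \<open>y\<close> outside \<open>K\<close>, maximality puts \<open>c\<close>
  into K(y). Applied to y = c^2, unless that already lies in \<open>K\<close>, this shows that
  \<open>c\<close> is algebraic over \<open>K\<close>. For any \<open>x\<close> outside
  \<open>K\<close>, \<open>c\<close> is a rational function of \<open>x\<close>, so an equation for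
  \<open>c\<close> turns into one for \<open>x\<close>.\<close>

lemma algebraic_of_maximal:
  fixes K :: "'w::alg_closed_field set"
  assumes char: "CHAR('w) = 0" and K: "is_subfield K" "c \<notin> K"
    and max: "\<And>K'. is_subfield K' \<Longrightarrow> K \<subseteq> K' \<Longrightarrow> c \<notin> K' \<Longrightarrow> K' = K"
  shows "\<exists>p. p \<in> polys_over K \<and> p \<noteq> 0 \<and> poly p x = 0"
proof -
  note inf = infinite_of_char_0[OF char]
  note pin = polys_over_intros[OF K(1)]
  have cfrac: "c \<in> fractions K y" if "y \<notin> K" for y
    using max[OF is_subfield_fractions[OF K(1), of y] subset_fractions[OF K(1)]] in_fractions[OF K(1), of y] that by blast
  have "\<exists>p. p \<in> polys_over K \<and> p \<noteq> 0 \<and> poly p c = 0"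
  proof (cases "c\<^sup>2 \<in> K")
    case True
    have "[:- (c\<^sup>2), 0, 1:] \<in> polys_over K" by (intro pin is_subfieldD[OF K(1)] True)
    then show ?thesis by (intro exI[of _ "[:- (c\<^sup>2), 0, 1:]"]) (simp add: power2_eq_square)
  next
    case False
    obtain P Q where PQ: "P \<in> polys_over K" "Q \<in> polys_over K" "poly Q (c\<^sup>2) \<noteq> 0" "c = poly P (c\<^sup>2) / poly Q (c\<^sup>2)"
      using cfrac[OF False] by (auto simp: fractions_def[OF K(1)])
    have sq: "[:0, 0, 1:] \<in> polys_over K" by (intro pin is_subfieldD[OF K(1)])
    \<comment> \<open>The relation c Q(c^2) = P(c^2) as a polynomial in c. It splits into an odd and
      an even part, so it can vanish identically only if \<open>Q\<close> does, as 2 is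
      invertible.\<close>
    define p where "p = [:0, 1:] * pcompose Q [:0, 0, 1:] - pcompose P [:0, 0, 1:]"
    have "p \<in> polys_over K" unfolding p_def
      by (intro pin polys_over_pcompose[OF K(1) sq] PQ is_subfieldD[OF K(1)])
    moreover have pe: "poly p y = y * poly Q (y\<^sup>2) - poly P (y\<^sup>2)" for y
      by (simp add: p_def poly_pcompose power2_eq_square)
    moreover have "p \<noteq> 0"
    proof
      assume "p = 0"
      then have "y * poly Q (y\<^sup>2) = poly P (y\<^sup>2)" "- y * poly Q (y\<^sup>2) = poly P (y\<^sup>2)" for y
        using pe[of y] pe[of "- y"] by auto
      then have two: "of_nat 2 * (y * poly Q (y\<^sup>2)) = 0" for y
        by (metis add.inverse_inverse add_eq_0_iff mult_2 mult_minus_left of_nat_numeral)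
      have "of_nat 2 \<noteq> (0::'w)" using char by (simp add: of_nat_eq_0_iff_char_dvd del: of_nat_numeral)
      then have "y * poly Q (y\<^sup>2) = 0" for y using two[of y] by (metis mult_eq_0_iff)
      then have allz: "poly ([:0, 1:] * pcompose Q [:0, 0, 1:]) y = 0" for y
        by (simp add: poly_pcompose power2_eq_square)
      have "[:0, 1:] * pcompose Q [:0, 0, 1:] = 0"
        by (rule poly_zero_of_char_0[OF char]) (use allz inf in simp)
      then have "pcompose Q [:0, 0, 1:] = 0" by simp
      moreover have "poly (pcompose Q [:0, 0, 1:]) c = poly Q (c\<^sup>2)" by (simp add: poly_pcompose power2_eq_square)
      ultimately have "poly Q (c\<^sup>2) = 0" by simp
      with PQ show False by simp
    qed
    moreover have "poly p c = 0" using pe[of c] PQ(3,4) by (simp add: field_simps)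
    ultimately show ?thesis by blast
  qed
  then obtain m where m: "m \<in> polys_over K" "m \<noteq> 0" "poly m c = 0" by blast
  show ?thesis
  proof (cases "x \<in> K")
    case True
    then have "[:- x, 1:] \<in> polys_over K" by (intro pin is_subfieldD[OF K(1)])
    then show ?thesis by (intro exI[of _ "[:- x, 1:]"]) simp
  next
    case False
    obtain P Q where PQ: "P \<in> polys_over K" "Q \<in> polys_over K" "poly Q x \<noteq> 0" "c = poly P x / poly Q x"
      using cfrac[OF False] by (auto simp: fractions_def[OF K(1)])
    \<comment> \<open>\<open>m\<close> evaluated at P/Q and multiplied by the power of Q that clears
      the denominators.\<close>
    define M where "M = (\<Sum>j\<le>degree m. smult (coeff m j) (P ^ j * Q ^ (degree m - j)))"
    have "M \<in> polys_over K" unfolding M_def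
      by (intro polys_over_sum[OF K(1)] pin polys_over_power[OF K(1)] PQ) (use m in \<open>simp add: polys_over_def\<close>)
    moreover have Me: "poly M y = poly Q y ^ degree m * poly m (poly P y / poly Q y)" if "poly Q y \<noteq> 0" for y
      unfolding M_def poly_altdef[of m] poly_sum sum_distrib_left
    proof (rule sum.cong)
      fix j assume "j \<in> {..degree m}"
      then have "poly Q y ^ degree m = poly Q y ^ (degree m - j) * poly Q y ^ j" by (simp flip: power_add)
      then show "poly (smult (coeff m j) (P ^ j * Q ^ (degree m - j))) y =
          poly Q y ^ degree m * (coeff m j * (poly P y / poly Q y) ^ j)"
        using that by (simp add: power_divide)
    qed simp
    moreover have "poly M x = 0" using Me[OF PQ(3)] PQ(4) m(3) by simp
    moreover have "M \<noteq> 0"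
    proof
      \<comment> \<open>Then P/Q takes only roots of \<open>m\<close> as values, hence one value
        \<open>r\<close> infinitely often. So P = r Q with \<open>r\<close> in \<open>K\<close>, and
        c = r contradicts the choice of \<open>c\<close>.\<close>
      assume M: "M = 0"
      let ?A = "{y. poly Q y \<noteq> 0}"
      have Q0: "Q \<noteq> 0" using PQ(3) by auto
      have "?A = UNIV - {y. poly Q y = 0}" by auto
      then have infA: "infinite ?A" using Diff_infinite_finite[OF poly_roots_finite[OF Q0] inf] by simp
      have "(\<lambda>y. poly P y / poly Q y) ` ?A \<subseteq> {r. poly m r = 0}" using Me M by auto
      then have "finite ((\<lambda>y. poly P y / poly Q y) ` ?A)" using poly_roots_finite[OF m(2)] by (rule finite_subset)
      from pigeonhole_infinite[OF infA this]
      obtain a0 where a0: "infinite {y\<in>?A. poly P y / poly Q y = poly P a0 / poly Q a0}" by (rule bexE)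
      define r where "r = poly P a0 / poly Q a0"
      have "infinite {y. poly (P - smult r Q) y = 0}"
        by (rule infinite_super[OF _ a0]) (auto simp: r_def[symmetric] field_simps)
      then have P: "P = smult r Q" using poly_zero_of_char_0[OF char] by (metis eq_iff_diff_eq_0)
      obtain i where i: "coeff Q i \<noteq> 0" using Q0 leading_coeff_0_iff by blast
      have "r = coeff P i / coeff Q i" using i by (simp add: P)
      then have "r \<in> K" using PQ(1,2) by (auto simp: polys_over_def intro!: is_subfieldD[OF K(1)])
      moreover have "c = r" using PQ(3,4) by (simp add: P)
      ultimately show False using K(2) by simp
    qed
    ultimately show ?thesis by blast
  qed
qed

subsection \<open>Extension of homomorphisms\<close>

text \<open>Homomorphisms from a subring of \<open>'w\<close> to \<open>'w\<close> that fix \<open>K\<close>, given by their graphs.\<close>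

definition partial_hom :: "'w::field set \<Rightarrow> ('w \<times> 'w) set \<Rightarrow> bool" where
  "partial_hom K H \<longleftrightarrow> single_valued H \<and> (\<forall>a\<in>K. (a, a) \<in> H) \<and>
     (\<forall>(a, b)\<in>H. \<forall>(a', b')\<in>H. (a + a', b + b') \<in> H \<and> (a * a', b * b') \<in> H)"

lemma partial_homD:
  assumes "partial_hom K H"
  shows "(a, b) \<in> H \<Longrightarrow> (a, b') \<in> H \<Longrightarrow> b = b'" "a \<in> K \<Longrightarrow> (a, a) \<in> H"
    "(a, b) \<in> H \<Longrightarrow> (a', b') \<in> H \<Longrightarrow> (a + a', b + b') \<in> H"
    "(a, b) \<in> H \<Longrightarrow> (a', b') \<in> H \<Longrightarrow> (a * a', b * b') \<in> H"
  using assms unfolding partial_hom_def single_valued_def by fast+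

text \<open>Factors X are stripped from an equation of \<open>y\<close> until its constant term
  \<open>a\<close> is nonzero; solving a + y p(y) = 0 then gives the inverse.\<close>

lemma inverse_in_algebraic_ring:
  fixes K R :: "'w::field set"
  assumes K: "is_subfield K" "K \<subseteq> R" and R: "\<And>a b. a \<in> R \<Longrightarrow> b \<in> R \<Longrightarrow> a + b \<in> R \<and> a * b \<in> R"
    and y: "y \<in> R" "y \<noteq> 0" and p: "p \<in> polys_over K" "p \<noteq> 0" "poly p y = 0"
  shows "inverse y \<in> R"
proof -
  have polyR: "poly p y \<in> R" if "p \<in> polys_over K" for p
    using that
  proof (induction p)
    case (pCons a p)
    have "a \<in> K" "p \<in> polys_over K" using pCons(3)
      by (auto simp: polys_over_def coeff_pCons split: nat.splits dest: spec[of _ 0] spec[of _ "Suc _"])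
    then show ?case using pCons(2) R y K by auto
  qed (use K is_subfieldD(1) in auto)
  from p show ?thesis
  proof (induction p)
    case (pCons a p)
    have a: "a \<in> K" "p \<in> polys_over K" using pCons(3)
      by (auto simp: polys_over_def coeff_pCons split: nat.splits dest: spec[of _ 0] spec[of _ "Suc _"])
    show ?case
    proof (cases "a = 0")
      case True
      then show ?thesis using pCons a y by auto
    next
      case False
      then have "inverse y = - inverse a * poly p y" using pCons(5) y by (simp add: field_simps add_eq_0_iff)
      moreover have "- inverse a \<in> R"
        by (rule subsetD[OF K(2)]) (intro is_subfieldD(5)[OF K(1)] is_subfieldD(7)[OF K(1)] a(1))
      ultimately show ?thesis using R[of "- inverse a" "poly p y"] polyR[OF a(2)] by simp
    qed
  qed simp
qed

text \<open>\<open>partial_hom\<close> asks only for closure under sums and products, which passes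
  easily to unions of chains; inverses in the domain come from algebraicity over
  \<open>K\<close>.\<close>

lemma is_subfield_Domain:
  assumes K: "is_subfield K" and alg: "\<And>x. \<exists>p. p \<in> polys_over K \<and> p \<noteq> 0 \<and> poly p x = 0"
    and H: "partial_hom K H"
  shows "is_subfield (Domain H)" (is "is_subfield ?R")
  unfolding is_subfield_def
proof (intro conjI ballI)
  note h = partial_homD[OF H]
  show "0 \<in> ?R" "1 \<in> ?R" using h(2) is_subfieldD(1,2)[OF K] by blast+
  show "a + b \<in> ?R" "a * b \<in> ?R" if "a \<in> ?R" "b \<in> ?R" for a b using that h(3,4) by blast+
  have m1: "(- 1, - 1) \<in> H" using h(2) is_subfieldD(2,5)[OF K] by blast
  show "- a \<in> ?R" if "a \<in> ?R" for a using that h(4)[OF m1] by fastforce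
  show "inverse a \<in> ?R" if "a \<in> ?R" for a
  proof (cases "a = 0")
    case True then show ?thesis using h(2) is_subfieldD(1)[OF K] by auto
  next
    case False
    obtain p where p: "p \<in> polys_over K" "p \<noteq> 0" "poly p a = 0" using alg by blast
    show ?thesis
      by (rule inverse_in_algebraic_ring[OF K _ _ that False p]) (use h in blast)+
  qed
qed

text \<open>If \<open>m\<close> generates the polynomials over the domain that vanish at
  \<open>x\<close>, then adjoining \<open>x\<close> amounts to dividing by \<open>m\<close>, and
  \<open>x\<close> may be sent to any root of the image of \<open>m\<close>. The map with graph
  \<open>H\<close> has no name in the statement, so the condition on \<open>x'\<close> ranges over
  all functions \<open>g\<close> that agree with \<open>H\<close>.\<close>

lemma partial_hom_extend:
  fixes K :: "'w::alg_closed_field set"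
  assumes K: "is_subfield K" and alg: "\<And>x. \<exists>p. p \<in> polys_over K \<and> p \<noteq> 0 \<and> poly p x = 0"
    and H: "partial_hom K H"
    and m: "m \<in> polys_over (Domain H)" "\<And>q. q \<in> polys_over (Domain H) \<Longrightarrow> poly q x = 0 \<Longrightarrow>
      \<exists>s\<in>polys_over (Domain H). q = s * m"
    and x': "\<And>g. (\<And>a. a \<in> Domain H \<Longrightarrow> (a, g a) \<in> H) \<Longrightarrow> poly (map_poly g m) x' = 0"
  obtains H' where "partial_hom K H'" "H \<subseteq> H'" "(x, x') \<in> H'"
proof -
  let ?R = "Domain H"
  note h = partial_homD[OF H]
  define g where "g a = (THE b. (a, b) \<in> H)" for a
  have g: "(a, g a) \<in> H" if "a \<in> ?R" for a
    unfolding g_def using that h(1) by (metis DomainE theI)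
  have gI: "g a = b" if "(a, b) \<in> H" for a b using g[of a] h(1) that by blast
  have "is_subfield ?R" by (rule is_subfield_Domain[OF K alg H])
  note pin = polys_over_intros[OF this] and R = is_subfieldD[OF this]
  have s0: "g 0 = 0" and s1: "g 1 = 1" using gI h(2) is_subfieldD(1,2)[OF K] by blast+
  have sa: "g (a + b) = g a + g b" and sm: "g (a * b) = g a * g b" if "a \<in> ?R" "b \<in> ?R" for a b
    using gI[OF h(3)[OF g[OF that(1)] g[OF that(2)]]] gI[OF h(4)[OF g[OF that(1)] g[OF that(2)]]] by auto
  have ss: "g (sum f I) = (\<Sum>i\<in>I. g (f i))" if "\<And>i. i \<in> I \<Longrightarrow> f i \<in> ?R" for f and I :: "nat set"
    using that
    by (induction I rule: infinite_finite_induct) (auto simp: s0 sa sum_in_subfield[OF \<open>is_subfield ?R\<close>])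
  have ma: "map_poly g (p + q) = map_poly g p + map_poly g q" and mm: "map_poly g (p * q) = map_poly g p * map_poly g q"
    if "p \<in> polys_over ?R" "q \<in> polys_over ?R" for p q
    using that by (intro poly_eqI; simp add: coeff_map_poly s0 polys_over_def sa coeff_mult ss R sm)+
  define H' where "H' = {(poly p x, poly (map_poly g p) x') | p. p \<in> polys_over ?R}"
  have H'I: "(poly p x, poly (map_poly g p) x') \<in> H'" if "p \<in> polys_over ?R" for p
    using that by (auto simp: H'_def)
  have const: "map_poly g [:a:] = [:g a:]" for a by (simp add: map_poly_pCons s0)
  have sub: "H \<subseteq> H'"
  proof
    fix z assume z: "z \<in> H"
    obtain a b where ab: "z = (a, b)" by (cases z)
    have "[:a:] \<in> polys_over ?R" using z ab by (intro pin) auto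
    from H'I[OF this] show "z \<in> H'" using gI z ab by (simp add: const)
  qed
  have mx': "poly (map_poly g m) x' = 0" by (rule x') (rule g)
  have "partial_hom K H'"
    unfolding partial_hom_def
  proof (intro conjI ballI)
    show "single_valued H'"
    proof (rule single_valuedI)
      fix a b c assume "(a, b) \<in> H'" "(a, c) \<in> H'"
      then obtain p q where pq: "p \<in> polys_over ?R" "q \<in> polys_over ?R" "a = poly p x" "a = poly q x"
        "b = poly (map_poly g p) x'" "c = poly (map_poly g q) x'" unfolding H'_def by blast
      then obtain s where s: "s \<in> polys_over ?R" "p - q = s * m" using m(2)[of "p - q"] pin by auto
      then have "p = q + s * m" by (simp add: algebra_simps)
      then have "map_poly g p = map_poly g q + map_poly g s * map_poly g m"
        using s(1) m(1) pq(2) by (simp add: ma mm pin)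
      then show "b = c" using pq mx' by simp
    qed
    show "(a, a) \<in> H'" if "a \<in> K" for a using h(2)[OF that] sub by blast
    fix u assume u: "u \<in> H'"
    obtain p where p: "u = (poly p x, poly (map_poly g p) x')" "p \<in> polys_over ?R" using u unfolding H'_def by blast
    have "case v of (a', b') \<Rightarrow> (poly p x + a', poly (map_poly g p) x' + b') \<in> H' \<and>
        (poly p x * a', poly (map_poly g p) x' * b') \<in> H'" if v: "v \<in> H'" for v
    proof -
      obtain q where q: "v = (poly q x, poly (map_poly g q) x')" "q \<in> polys_over ?R" using v unfolding H'_def by blast
      show ?thesis using H'I[OF pin(4)[OF p(2) q(2)]] H'I[OF pin(7)[OF p(2) q(2)]] p q by (simp add: ma mm)
    qed
    then show "case u of (a, b) \<Rightarrow> \<forall>(a', b')\<in>H'. (a + a', b + b') \<in> H' \<and> (a * a', b * b') \<in> H'"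
      using p(1) by simp
  qed
  moreover have "(x, x') \<in> H'"
  proof -
    have "[:0, 1:] \<in> polys_over ?R" by (intro pin R)
    from H'I[OF this] show ?thesis by (simp add: map_poly_pCons s0 s1)
  qed
  ultimately show thesis using sub that by blast
qed

text \<open>Characteristic 0 makes the derivative of \<open>m\<close> nonzero and of smaller degree,
  hence nonzero at \<open>c\<close>: the root \<open>c\<close> is simple. Dividing by X - c leaves a
  polynomial that does not vanish at \<open>c\<close> and is not constant, as \<open>c\<close> lies
  outside \<open>K\<close>; any root of it will do.\<close>

lemma exists_conjugate:
  fixes c :: "'w::alg_closed_field"
  assumes char: "CHAR('w) = 0" and K: "is_subfield K" "c \<notin> K"
    and m: "m \<in> polys_over K" "m \<noteq> 0" "poly m c = 0"
      "\<And>q. q \<in> polys_over K \<Longrightarrow> q \<noteq> 0 \<Longrightarrow> poly q c = 0 \<Longrightarrow> degree m \<le> degree q"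
  obtains c' where "poly m c' = 0" "c' \<noteq> c"
proof -
  define n where "n = degree m"
  have n: "n > 0" unfolding n_def by (rule degree_pos_of_root[OF m(2,3)])
  have "coeff (pderiv m) (n - 1) = of_nat n * lead_coeff m"
    using n by (simp add: coeff_pderiv n_def del: of_nat_Suc)
  moreover have "of_nat n \<noteq> (0 :: 'w)" using n char by (simp add: of_nat_eq_0_iff_char_dvd)
  ultimately have d0: "pderiv m \<noteq> 0" using m(2) by fastforce
  have "degree (pderiv m) \<le> n - 1"
    by (rule degree_le) (use n in \<open>auto simp: coeff_pderiv n_def intro!: coeff_eq_0\<close>)
  then have pd: "poly (pderiv m) c \<noteq> 0"
    using m(4)[OF polys_over_intros(11)[OF K(1) m(1)] d0] n unfolding n_def by linarith
  obtain q where q: "m = [:- c, 1:] * q" using m(3) by (metis poly_eq_0_iff_dvd dvdE)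
  have "poly (pderiv m) c = poly q c" unfolding q pderiv_mult by (simp add: pderiv_pCons)
  then have qc: "poly q c \<noteq> 0" using pd by simp
  have "degree q > 0"
  proof (rule ccontr)
    assume "\<not> degree q > 0"
    then obtain a where a: "q = [:a:]" by (metis degree_eq_zeroE neq0_conv)
    then have "coeff m 0 = - c * a" "coeff m 1 = a" by (simp_all add: q)
    then have "a \<in> K" "- c * a \<in> K" using m(1) unfolding polys_over_def by (metis mem_Collect_eq)+
    moreover have "a \<noteq> 0" using a qc by auto
    then have "c = - ((- c * a) / a)" by simp
    ultimately have "c \<in> K" using is_subfieldD(5,8)[OF K(1)] by metis
    with K(2) show False by simp
  qed
  then obtain c' where c': "poly q c' = 0" using alg_closed_imp_poly_has_root by blast
  show thesis by (rule that[of c']) (use c' qc in \<open>auto simp: q\<close>)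
qed

text \<open>Enlarging \<open>K0\<close> to a subfield \<open>K\<close> maximal without
  \<open>c\<close> makes \<open>'w\<close> algebraic over \<open>K\<close>, so that transcendental
  elements never have to be treated. The embedding of K(c) that moves \<open>c\<close> to another
  conjugate then extends to all of \<open>'w\<close>.\<close>

theorem exists_automorphism:
  fixes c :: "'w::alg_closed_field"
  assumes char: "CHAR('w) = 0" and K0: "is_subfield K0" "c \<notin> K0"
  obtains g where "bij g" "\<And>x y. g (x + y) = g x + g y" "\<And>x y. g (x * y) = g x * g y"
    "\<And>a. a \<in> K0 \<Longrightarrow> g a = a" "g c \<noteq> c"
proof -
  let ?\<S> = "{K. is_subfield K \<and> K0 \<subseteq> K \<and> c \<notin> K}"
  have "\<exists>K\<in>?\<S>. \<forall>K'\<in>?\<S>. K \<subseteq> K' \<longrightarrow> K' = K"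
  proof (rule subset_Zorn_nonempty)
    show "?\<S> \<noteq> {}" using K0 by blast
    fix \<C> assume \<C>: "\<C> \<noteq> {}" "subset.chain ?\<S> \<C>"
    have sub: "is_subfield K" "K0 \<subseteq> K" "c \<notin> K" if "K \<in> \<C>" for K
      using \<C>(2) that unfolding subset.chain_def by auto
    have two: "\<exists>K\<in>\<C>. y \<in> K \<and> z \<in> K" if yz: "y \<in> \<Union>\<C>" "z \<in> \<Union>\<C>" for y z
    proof -
      obtain K L where KL: "K \<in> \<C>" "y \<in> K" "L \<in> \<C>" "z \<in> L" using yz by blast
      then have "K \<subseteq> L \<or> L \<subseteq> K" using \<C>(2) unfolding subset.chain_def by blast
      then show ?thesis using KL by blast
    qed
    obtain K1 where K1: "K1 \<in> \<C>" using \<C>(1) by blast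
    have "is_subfield (\<Union>\<C>)"
      unfolding is_subfield_def
    proof (intro conjI ballI)
      show "0 \<in> \<Union>\<C>" "1 \<in> \<Union>\<C>" using K1 is_subfieldD(1,2)[OF sub(1)[OF K1]] by blast+
      show "y + z \<in> \<Union>\<C>" "y * z \<in> \<Union>\<C>" if "y \<in> \<Union>\<C>" "z \<in> \<Union>\<C>" for y z
        using two[OF that] is_subfieldD(3,4)[OF sub(1)] by blast+
      show "- y \<in> \<Union>\<C>" "inverse y \<in> \<Union>\<C>" if "y \<in> \<Union>\<C>" for y
        using that is_subfieldD(5,7)[OF sub(1)] by blast+
    qed
    moreover have "K0 \<subseteq> \<Union>\<C>" "c \<notin> \<Union>\<C>" using K1 sub(2,3) by blast+
    ultimately show "\<Union>\<C> \<in> ?\<S>" by blast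
  qed
  then obtain K where K': "K \<in> ?\<S>" "\<forall>K'\<in>?\<S>. K \<subseteq> K' \<longrightarrow> K' = K" by (rule bexE)
  then have K: "is_subfield K" "K0 \<subseteq> K" "c \<notin> K" by simp_all
  have alg: "\<exists>p. p \<in> polys_over K \<and> p \<noteq> 0 \<and> poly p x = 0" for x
  proof (rule algebraic_of_maximal[OF char K(1,3)])
    show "K' = K" if "is_subfield K'" "K \<subseteq> K'" "c \<notin> K'" for K'
      using K'(2) K(2) that by blast
  qed
  obtain m where m: "m \<in> polys_over K" "m \<noteq> 0" "poly m c = 0"
    "\<And>q. q \<in> polys_over K \<Longrightarrow> q \<noteq> 0 \<Longrightarrow> poly q c = 0 \<Longrightarrow> degree m \<le> degree q"
    "\<And>q. q \<in> polys_over K \<Longrightarrow> poly q c = 0 \<Longrightarrow> \<exists>s\<in>polys_over K. q = s * m"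
    using minimal_poly[OF K(1)] alg[of c] by metis
  obtain c' where c': "poly m c' = 0" "c' \<noteq> c" by (rule exists_conjugate[OF char K(1,3) m(1-4)])
  have ph0: "partial_hom K (Id_on K)"
    unfolding partial_hom_def single_valued_def using is_subfieldD(3,4)[OF K(1)] by auto
  have "map_poly g m = m" if "\<And>a. a \<in> Domain (Id_on K) \<Longrightarrow> (a, g a) \<in> Id_on K" for g
  proof -
    have "g a = a" if "a \<in> K" for a using \<open>\<And>a. a \<in> Domain (Id_on K) \<Longrightarrow> (a, g a) \<in> Id_on K\<close>[of a] that by auto
    then show ?thesis
      using m(1) is_subfieldD(1)[OF K(1)] by (intro poly_eqI) (simp add: coeff_map_poly polys_over_def)
  qed
  then obtain H1 where H1: "partial_hom K H1" "(c, c') \<in> H1"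
    using partial_hom_extend[OF K(1) alg ph0, of m c c'] m(1,5) c'(1) by (metis Domain_Id_on)
  \<comment> \<open>A maximal extension of \<open>H1\<close> has full domain, since any further
    element could be adjoined by \<open>partial_hom_extend\<close>.\<close>
  let ?\<P> = "{H. partial_hom K H \<and> H1 \<subseteq> H}"
  have "\<exists>H\<in>?\<P>. \<forall>H'\<in>?\<P>. H \<subseteq> H' \<longrightarrow> H' = H"
  proof (rule subset_Zorn_nonempty)
    show "?\<P> \<noteq> {}" using H1 by blast
    fix \<C> assume \<C>: "\<C> \<noteq> {}" "subset.chain ?\<P> \<C>"
    have sub: "partial_hom K H" "H1 \<subseteq> H" if "H \<in> \<C>" for H
      using \<C>(2) that unfolding subset.chain_def by auto
    have two: "\<exists>H\<in>\<C>. y \<in> H \<and> z \<in> H" if yz: "y \<in> \<Union>\<C>" "z \<in> \<Union>\<C>" for y z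
    proof -
      obtain H L where KL: "H \<in> \<C>" "y \<in> H" "L \<in> \<C>" "z \<in> L" using yz by blast
      then have "H \<subseteq> L \<or> L \<subseteq> H" using \<C>(2) unfolding subset.chain_def by blast
      then show ?thesis using KL by blast
    qed
    have "partial_hom K (\<Union>\<C>)"
      unfolding partial_hom_def
    proof (intro conjI ballI)
      show "single_valued (\<Union>\<C>)"
      proof (rule single_valuedI)
        fix a b b' assume "(a, b) \<in> \<Union>\<C>" "(a, b') \<in> \<Union>\<C>"
        from two[OF this] show "b = b'" using partial_homD(1)[OF sub(1)] by blast
      qed
      show "(a, a) \<in> \<Union>\<C>" if "a \<in> K" for a using \<C>(1) partial_homD(2)[OF sub(1) that] by blast
      have "(a + a', b + b') \<in> \<Union>\<C> \<and> (a * a', b * b') \<in> \<Union>\<C>"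
        if "(a, b) \<in> \<Union>\<C>" "(a', b') \<in> \<Union>\<C>" for a b a' b'
        using two[OF that] partial_homD(3,4)[OF sub(1)] by blast
      then show "case u of (a, b) \<Rightarrow> \<forall>(a', b')\<in>\<Union>\<C>. (a + a', b + b') \<in> \<Union>\<C> \<and> (a * a', b * b') \<in> \<Union>\<C>"
        if "u \<in> \<Union>\<C>" for u using that by (cases u) blast
    qed
    then show "\<Union>\<C> \<in> ?\<P>" using \<C>(1) sub(2) by blast
  qed
  then obtain H where H': "H \<in> ?\<P>" "\<forall>H'\<in>?\<P>. H \<subseteq> H' \<longrightarrow> H' = H" by (rule bexE)
  then have H: "partial_hom K H" "H1 \<subseteq> H" by simp_all
  note h = partial_homD[OF H(1)]
  define g where "g a = (THE b. (a, b) \<in> H)" for a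
  have gI: "g a = b" if "(a, b) \<in> H" for a b unfolding g_def using that h(1) by blast
  have g: "(a, g a) \<in> H" if "a \<in> Domain H" for a using that gI by blast
  note D = is_subfield_Domain[OF K(1) alg H(1)]
  have s1: "g 1 = 1" and s0: "g 0 = 0" using gI h(2) is_subfieldD(1,2)[OF K(1)] by blast+
  have "x \<in> Domain H" for x
  proof -
    obtain p where p: "p \<in> polys_over K" "p \<noteq> 0" "poly p x = 0" using alg by blast
    have "p \<in> polys_over (Domain H)" using p(1) h(2) unfolding polys_over_def by blast
    then obtain m where m: "m \<in> polys_over (Domain H)" "m \<noteq> 0" "poly m x = 0"
      "\<And>q. q \<in> polys_over (Domain H) \<Longrightarrow> poly q x = 0 \<Longrightarrow> \<exists>s\<in>polys_over (Domain H). q = s * m"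
      using minimal_poly[OF D _ p(2,3)] by metis
    \<comment> \<open>The transported polynomial keeps its degree because \<open>g\<close> maps the
      leading coefficient, a unit, to a unit; so it has a root.\<close>
    have lc: "lead_coeff m \<in> Domain H" "inverse (lead_coeff m) \<in> Domain H"
      using m(1) is_subfieldD(7)[OF D] by (auto simp: polys_over_def)
    have "g (lead_coeff m) * g (inverse (lead_coeff m)) = 1"
      using gI[OF h(4)[OF g[OF lc(1)] g[OF lc(2)]]] m(2) s1 by simp
    then have "coeff (map_poly g m) (degree m) \<noteq> 0" by (auto simp: coeff_map_poly s0)
    moreover have "degree m > 0" by (rule degree_pos_of_root[OF m(2,3)])
    ultimately have "degree (map_poly g m) > 0" by (meson le_degree less_le_trans)
    then obtain x' where x': "poly (map_poly g m) x' = 0" using alg_closed_imp_poly_has_root by blast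
    have "map_poly \<tau> m = map_poly g m" if "\<And>a. a \<in> Domain H \<Longrightarrow> (a, \<tau> a) \<in> H" for \<tau>
    proof -
      have t: "\<tau> a = g a" if "a \<in> Domain H" for a using gI \<open>\<And>a. a \<in> Domain H \<Longrightarrow> (a, \<tau> a) \<in> H\<close>[OF that] by simp
      then have "\<tau> 0 = 0" using s0 is_subfieldD(1)[OF D] by simp
      then show ?thesis using m(1) t by (intro poly_eqI) (simp add: coeff_map_poly s0 polys_over_def)
    qed
    then have "poly (map_poly \<tau> m) x' = 0" if "\<And>a. a \<in> Domain H \<Longrightarrow> (a, \<tau> a) \<in> H" for \<tau>
      using that x' by simp
    with m(4) obtain H2 where "partial_hom K H2" "H \<subseteq> H2" "(x, x') \<in> H2"
      using partial_hom_extend[OF K(1) alg H(1) m(1), of x x'] by blast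
    moreover from this have "H2 = H" using H'(2) H(2) by blast
    ultimately show ?thesis by blast
  qed
  then have g: "(a, g a) \<in> H" for a using g by blast
  have sa: "g (x + y) = g x + g y" and sm: "g (x * y) = g x * g y" for x y
    using gI[OF h(3)[OF g g]] gI[OF h(4)[OF g g]] by auto
  have sK: "g a = a" if "a \<in> K" for a using gI[OF h(2)[OF that]] .
  have s_eq_0: "x = 0" if "g x = 0" for x
  proof (rule ccontr)
    assume "x \<noteq> 0"
    then have "g x * g (inverse x) = 1" using sm[of x "inverse x"] s1 by simp
    then show False using that by simp
  qed
  have inj: "inj g"
  proof (rule injI)
    fix x y assume "g x = g y"
    then have "g (x - y) = 0" using sa[of "x - y" y] by simp
    then show "x = y" using s_eq_0 by fastforce
  qed
  \<comment> \<open>\<open>g\<close> maps the finite set of roots of a polynomial over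
    \<open>K\<close> injectively into itself, hence onto itself; so the algebraic element
    \<open>y\<close> is hit.\<close>
  have "y \<in> range g" for y
  proof -
    obtain p where p: "p \<in> polys_over K" "p \<noteq> 0" "poly p y = 0" using alg by blast
    have hom: "g (poly q x) = poly q (g x)" if "q \<in> polys_over K" for q x
      using that
    proof (induction q)
      case (pCons a q)
      have "a \<in> K" "q \<in> polys_over K" using pCons(3)
        by (auto simp: polys_over_def coeff_pCons split: nat.splits dest: spec[of _ 0] spec[of _ "Suc _"])
      then show ?case using pCons(2) by (simp add: sa sm sK)
    qed (simp add: s0)
    let ?Z = "{x. poly p x = 0}"
    have "g ` ?Z \<subseteq> ?Z" using hom[OF p(1), symmetric] s0 by auto
    moreover have "finite ?Z" using poly_roots_finite[OF p(2)] .
    ultimately have "g ` ?Z = ?Z" using inj by (intro endo_inj_surj) (auto intro: inj_on_subset)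
    then show ?thesis using p(3) by blast
  qed
  then have "bij g" using inj by (auto simp: bij_def)
  moreover have "g c \<noteq> c" using gI[of c c'] H1(2) H(2) c'(2) by blast
  ultimately show thesis using that sa sm sK K(2) by blast
qed

section \<open>Points with values in an algebraically closed field\<close>

definition field_embedding :: "('k::field \<Rightarrow> 'w::field) \<Rightarrow> bool" where
  "field_embedding \<iota> \<longleftrightarrow> (\<forall>x y. \<iota> (x + y) = \<iota> x + \<iota> y \<and> \<iota> (x * y) = \<iota> x * \<iota> y) \<and> \<iota> 1 = 1"

lemma field_embeddingD:
  assumes "field_embedding \<iota>"
  shows "\<iota> (x + y) = \<iota> x + \<iota> y" "\<iota> (x * y) = \<iota> x * \<iota> y" "\<iota> 1 = 1" "\<iota> 0 = 0" "\<iota> (- x) = - \<iota> x"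
    "\<iota> (inverse x) = inverse (\<iota> x)" "\<iota> x = 0 \<longleftrightarrow> x = 0"
proof -
  show *: "\<iota> (x + y) = \<iota> x + \<iota> y" "\<iota> (x * y) = \<iota> x * \<iota> y" "\<iota> 1 = 1" for x y
    using assms by (auto simp: field_embedding_def)
  have "\<iota> (0 + 0) = \<iota> 0 + \<iota> 0" by (rule *(1))
  then show z: "\<iota> 0 = 0" by (metis add.right_neutral add_left_cancel)
  have "\<iota> x + \<iota> (- x) = 0" using *(1)[of x "- x"] z by simp
  then show "\<iota> (- x) = - \<iota> x" by (simp add: add_eq_0_iff)
  have inv: "\<iota> x * \<iota> (inverse x) = 1" if "x \<noteq> 0" for x using *(2)[of x "inverse x"] *(3) that by simp
  show "\<iota> x = 0 \<longleftrightarrow> x = 0" using inv[of x] z by (cases "x = 0") auto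
  show "\<iota> (inverse x) = inverse (\<iota> x)"
    using inv[of x] z by (cases "x = 0") (auto simp: inverse_unique)
qed

lemma is_subfield_range: "field_embedding \<iota> \<Longrightarrow> is_subfield (range \<iota>)"
  unfolding is_subfield_def
  using field_embeddingD(1,2)[of \<iota>, symmetric] field_embeddingD(3,4)[of \<iota>, symmetric] field_embeddingD(5,6)[of \<iota>, symmetric]
  by auto

definition lin_to :: "('k::field \<Rightarrow> 'w::field) \<Rightarrow> ('k, 'a, 'm) module_scheme \<Rightarrow> ('a \<Rightarrow> 'w) set" where
  "lin_to \<iota> M = {h. (\<forall>x\<in>carrier M. \<forall>y\<in>carrier M. h (x \<oplus>\<^bsub>M\<^esub> y) = h x + h y) \<and>
     (\<forall>c. \<forall>x\<in>carrier M. h (c \<odot>\<^bsub>M\<^esub> x) = \<iota> c * h x)}"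

definition separating :: "('a, 'm) ring_scheme \<Rightarrow> ('a \<Rightarrow> 'w::zero) set \<Rightarrow> bool" where
  "separating M Y \<longleftrightarrow> (\<forall>x\<in>carrier M. x \<noteq> \<zero>\<^bsub>M\<^esub> \<longrightarrow> (\<exists>h\<in>Y. h x \<noteq> 0))"

definition field_auts :: "('k \<Rightarrow> 'w::field) \<Rightarrow> ('w \<Rightarrow> 'w) set" where
  "field_auts \<iota> = {q. bij q \<and> (\<forall>x y. q (x + y) = q x + q y \<and> q (x * y) = q x * q y) \<and> (\<forall>c. q (\<iota> c) = \<iota> c)}"

lemma field_auts_inv:
  assumes "q \<in> field_auts \<iota>" shows "inv_into UNIV q \<in> field_auts \<iota>"
proof -
  have b: "bij q" and h: "\<And>x y. q (x + y) = q x + q y" "\<And>x y. q (x * y) = q x * q y" "\<And>c. q (\<iota> c) = \<iota> c"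
    using assms by (auto simp: field_auts_def)
  have *: "inv_into UNIV q (q x) = x" "q (inv_into UNIV q x) = x" for x
    using b by (simp_all add: bij_is_inj bij_is_surj surj_f_inv_f)
  have "inv_into UNIV q (x + y) = inv_into UNIV q x + inv_into UNIV q y" "inv_into UNIV q (x * y) = inv_into UNIV q x * inv_into UNIV q y" "inv_into UNIV q (\<iota> c) = \<iota> c" for x y c
    using *(1)[of "inv_into UNIV q x + inv_into UNIV q y"] *(1)[of "inv_into UNIV q x * inv_into UNIV q y"] *(1)[of "\<iota> c"] by (simp_all add: h *)
  then show ?thesis using bij_imp_bij_inv[OF b] by (auto simp: field_auts_def)
qed

text \<open>Applies \<open>exists_automorphism\<close> to the image of k. Algebraicity over k is not
  assumed, so this goes beyond the Galois correspondence of an algebraic extension.\<close>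

lemma fixed_by_auts:
  fixes \<iota> :: "'k::field \<Rightarrow> 'w::alg_closed_field"
  assumes "CHAR('w) = 0" "field_embedding \<iota>" "\<And>q. q \<in> field_auts \<iota> \<Longrightarrow> q w = w"
  shows "w \<in> range \<iota>"
proof (rule ccontr)
  assume "w \<notin> range \<iota>"
  then obtain q where "bij q" "\<And>x y. q (x + y) = q x + q y" "\<And>x y. q (x * y) = q x * q y"
    "\<And>a. a \<in> range \<iota> \<Longrightarrow> q a = a" "q w \<noteq> w"
    by (rule exists_automorphism[OF assms(1) is_subfield_range[OF assms(2)]]) blast
  moreover from this have "q \<in> field_auts \<iota>" by (simp add: field_auts_def)
  ultimately show False using assms(3) by blast
qed

lemma lin_to_finsum:
  assumes "h \<in> lin_to \<iota> M" "kvs M" "field_embedding \<iota>" "finite I" "\<And>i. i \<in> I \<Longrightarrow> x i \<in> carrier M"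
  shows "finsum M x I \<in> carrier M" "h (finsum M x I) = (\<Sum>i\<in>I. h (x i))"
proof -
  interpret abelian_group M using assms(2) by simp
  show "finsum M x I \<in> carrier M" using assms(5) by (intro finsum_closed) auto
  have h0: "h \<zero>\<^bsub>M\<^esub> = 0"
    using assms(1) zero_closed kvs_smult(3)[OF assms(2) zero_closed] field_embeddingD(4)[OF assms(3)]
    unfolding lin_to_def by (metis (mono_tags, lifting) mem_Collect_eq mult_zero_left)
  from assms(4,5) show "h (finsum M x I) = (\<Sum>i\<in>I. h (x i))"
  proof (induction I rule: finite_induct)
    case (insert i I)
    have "finsum M x I \<in> carrier M" using insert.prems by (intro finsum_closed) auto
    then show ?case using insert assms(1) by (simp add: Pi_def lin_to_def)
  qed (simp add: h0)
qed

section \<open>Artin's lemma: independence over k tested at points\<close>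

definition independent_set :: "('k::field, 'a, 'm) module_scheme \<Rightarrow> 'a set \<Rightarrow> bool" where
  "independent_set M R \<longleftrightarrow> (\<forall>c. finsum M (\<lambda>r. c r \<odot>\<^bsub>M\<^esub> r) R = \<zero>\<^bsub>M\<^esub> \<longrightarrow> (\<forall>r\<in>R. c r = 0))"

text \<open>Artin's argument: in a shortest relation over \<open>'w\<close>, normalised to have a coefficient \<open>1\<close>,
  all coefficients are fixed by the automorphisms of \<open>'w\<close> over \<open>k\<close>.\<close>

lemma independent_over_field:
  fixes \<iota> :: "'k::field \<Rightarrow> 'w::alg_closed_field" and M :: "('k, 'a, 'm) module_scheme" (structure)
  assumes char: "CHAR('w) = 0" and \<iota>: "field_embedding \<iota>" and M: "kvs M"
    and Y: "Y \<subseteq> lin_to \<iota> M" "separating M Y" "\<And>q h. q \<in> field_auts \<iota> \<Longrightarrow> h \<in> Y \<Longrightarrow> (\<lambda>x. q (h x)) \<in> Y"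
    and R: "finite R" "R \<subseteq> carrier M" "independent_set M R"
    and zero: "\<And>h. h \<in> Y \<Longrightarrow> (\<Sum>r\<in>R. \<omega> r * h r) = 0"
  shows "\<forall>r\<in>R. \<omega> r = 0"
  using zero
proof (induction "card {r \<in> R. \<omega> r \<noteq> 0}" arbitrary: \<omega> rule: less_induct)
  case less
  show ?case
  proof (rule ccontr)
    assume "\<not> (\<forall>r\<in>R. \<omega> r = 0)"
    then obtain r0 where r0: "r0 \<in> R" "\<omega> r0 \<noteq> 0" by blast
    define \<eta> where "\<eta> r = \<omega> r / \<omega> r0" for r
    have \<eta>: "(\<Sum>r\<in>R. \<eta> r * h r) = 0" if "h \<in> Y" for h
      using less.prems[OF that] by (simp add: \<eta>_def flip: sum_divide_distrib)
    have fixed: "q (\<eta> r) = \<eta> r" if q: "q \<in> field_auts \<iota>" and r: "r \<in> R" for q r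
    proof -
      have hom: "q (x + y) = q x + q y" "q (x * y) = q x * q y" "q (\<iota> c) = \<iota> c" for x y c
        using q by (auto simp: field_auts_def)
      have s01: "q 0 = 0" "q 1 = 1" using hom(3)[of 0] hom(3)[of 1] field_embeddingD(3,4)[OF \<iota>] by auto
      have ssum: "q (sum f I) = (\<Sum>i\<in>I. q (f i))" for f and I :: "'a set"
        by (induction I rule: infinite_finite_induct) (auto simp: hom s01)
      \<comment> \<open>Again a relation, and a shorter one: it vanishes wherever
        \<open>\<omega>\<close> does and also at \<open>r0\<close>, where \<open>\<eta>\<close> is
        1. So the induction hypothesis makes it zero, that is, \<open>q\<close> fixes every
        coefficient.\<close>
      define \<xi> where "\<xi> r = q (\<eta> r) - \<eta> r" for r
      have \<xi>0: "(\<Sum>r\<in>R. \<xi> r * h r) = 0" if h: "h \<in> Y" for h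
      proof -
        \<comment> \<open>Stability of \<open>Y\<close> is used for the inverse of \<open>q\<close>:
          the relation at \<open>h\<close> followed by this inverse, moved by \<open>q\<close>,
          becomes the relation at \<open>h\<close> with coefficients
          \<open>q (\<eta> r)\<close>.\<close>
        have h': "(\<lambda>x. inv_into UNIV q (h x)) \<in> Y" by (rule Y(3)[OF field_auts_inv[OF q] h])
        have "q (inv_into UNIV q x) = x" for x using q by (simp add: field_auts_def bij_is_surj surj_f_inv_f)
        then have "(\<Sum>r\<in>R. q (\<eta> r) * h r) = q (\<Sum>r\<in>R. \<eta> r * inv_into UNIV q (h r))" by (simp add: ssum hom)
        also have "\<dots> = 0" using \<eta>[OF h'] s01 by simp
        finally show ?thesis using \<eta>[OF h] by (simp add: \<xi>_def left_diff_distrib sum_subtractf)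
      qed
      have "card {r \<in> R. \<xi> r \<noteq> 0} < card {r \<in> R. \<omega> r \<noteq> 0}"
      proof (rule psubset_card_mono)
        have "\<xi> r0 = 0" using r0 s01 by (simp add: \<xi>_def \<eta>_def)
        moreover have "\<xi> r = 0" if "\<omega> r = 0" for r using that s01 by (simp add: \<xi>_def \<eta>_def)
        ultimately show "{r \<in> R. \<xi> r \<noteq> 0} \<subset> {r \<in> R. \<omega> r \<noteq> 0}" using r0 by blast
      qed (use R(1) in simp)
      from less.hyps[OF this \<xi>0] have "\<xi> r = 0" using r by (rule bspec)
      then show ?thesis by (simp add: \<xi>_def)
    qed
    have "\<eta> r \<in> range \<iota>" if "r \<in> R" for r
      by (rule fixed_by_auts[OF char \<iota>]) (rule fixed[OF _ that])
    then have "\<forall>r\<in>R. \<exists>c. \<eta> r = \<iota> c" by (simp add: image_iff)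
    from bchoice[OF this] obtain c where "\<forall>r\<in>R. \<eta> r = \<iota> (c r)" by (rule exE)
    then have c: "\<And>r. r \<in> R \<Longrightarrow> \<eta> r = \<iota> (c r)" by simp
    \<comment> \<open>The relation now has coefficients in k, so it comes from an actual combination
      of \<open>R\<close> in M, and all points of \<open>Y\<close> kill that combination.\<close>
    let ?y = "finsum M (\<lambda>r. c r \<odot> r) R"
    have cr: "c r \<odot> r \<in> carrier M" if "r \<in> R" for r using R(2) M that by (simp add: subset_iff)
    have "h ?y = 0" if h: "h \<in> Y" for h
    proof -
      have hl: "h \<in> lin_to \<iota> M" using h Y(1) by blast
      have "h ?y = (\<Sum>r\<in>R. h (c r \<odot> r))" by (rule lin_to_finsum(2)[OF hl M \<iota> R(1) cr])
      also have "\<dots> = (\<Sum>r\<in>R. \<eta> r * h r)"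
        by (rule sum.cong) (use hl R(2) c in \<open>auto simp: lin_to_def\<close>)
      finally show ?thesis using \<eta>[OF h] by simp
    qed
    moreover have "?y \<in> carrier M"
    proof -
      interpret abelian_group M using M by simp
      show ?thesis using cr by (intro finsum_closed) auto
    qed
    ultimately have "?y = \<zero>" using Y(2) unfolding separating_def by blast
    then have "c r0 = 0" using R(3) r0(1) unfolding independent_set_def by blast
    moreover have "\<eta> r0 = 1" using r0 by (simp add: \<eta>_def)
    ultimately show False using c[OF r0(1)] field_embeddingD(4)[OF \<iota>] by simp
  qed
qed

text \<open>The target is the additive group of \<open>'w\<close>: \<open>g\<close> and
  \<open>h\<close> are linear only along an embedding of k, so an additive lift is the natural
  one.\<close>

definition tensor_eval ::
  "('k::field, 'a, 'm) module_scheme \<Rightarrow> ('k, 'b, 'n) module_scheme \<Rightarrow> ('a \<Rightarrow> 'w::field) \<Rightarrow> ('b \<Rightarrow> 'w) \<Rightarrow>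
    ('a \<times> 'b \<Rightarrow> 'k) set \<Rightarrow> 'w" where
  "tensor_eval M N g h = tlift M N (kring :: 'w ring) (\<lambda>x y. g x * h y)"

lemma abelian_group_kring [simp]: "abelian_group (kring :: 'w::field ring)"
  using cring.axioms(1)[OF cring_from_type_algebra] ring.is_abelian_group by blast

context
  fixes M :: "('k::field, 'a, 'm) module_scheme" (structure) and N :: "('k, 'b, 'n) module_scheme"
    and \<iota> :: "'k \<Rightarrow> 'w::field" and g h
  assumes M: "kvs M" and N: "kvs N" and g: "g \<in> lin_to \<iota> M" and h: "h \<in> lin_to \<iota> N"
begin

private lemma bal: "balanced M N (kring :: 'w ring) (\<lambda>x y. g x * h y)"
  by (rule balancedI) (use g h in \<open>simp_all add: lin_to_def algebra_simps\<close>)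

lemma tensor_eval_tmul: "x \<in> carrier M \<Longrightarrow> y \<in> carrier N \<Longrightarrow> tensor_eval M N g h (tmul M N x y) = g x * h y"
  unfolding tensor_eval_def by (rule tlift_tmul[OF M N abelian_group_kring bal])

lemma tensor_eval_add_hom: "tensor_eval M N g h \<in> add_hom (tensor M N) (kring :: 'w ring)"
  unfolding tensor_eval_def by (rule tlift_add_hom[OF M N abelian_group_kring bal])

lemma tensor_eval_add:
  "z \<in> carrier (tensor M N) \<Longrightarrow> z' \<in> carrier (tensor M N) \<Longrightarrow>
    tensor_eval M N g h (z \<oplus>\<^bsub>tensor M N\<^esub> z') = tensor_eval M N g h z + tensor_eval M N g h z'"
  using add_hom_add[OF tensor_eval_add_hom] by simp

lemma tensor_eval_lin_to: "tensor_eval M N g h \<in> lin_to \<iota> (tensor M N)"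
proof -
  have "tensor_eval M N g h (c \<odot>\<^bsub>tensor M N\<^esub> z) = \<iota> c * tensor_eval M N g h z" if "z \<in> carrier (tensor M N)" for c z
    using that
  proof (induction z rule: tensor_induct[OF M N, consumes 1, case_names tmul add])
    case (tmul x y)
    then show ?case using g M N by (simp add: tmul_smult_left[OF M N, symmetric] tensor_eval_tmul) (simp add: lin_to_def)
  next
    case (add z z')
    then show ?case using M N by (simp add: kvs_smult_distrib(2) tensor_eval_add distrib_left)
  qed
  then show ?thesis using tensor_eval_add by (simp add: lin_to_def)
qed

end

lemma finsum_in_submodule:
  assumes "kvs M" "submodule N kring M" "\<And>i. i \<in> I \<Longrightarrow> f i \<in> N"
  shows "finsum M f I \<in> N"
proof -
  interpret abelian_group M using assms(1) by simp
  have fc: "f i \<in> carrier M" if "i \<in> I" for i using submoduleD(1)[OF assms(1,2)] assms(3)[OF that] by blast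
  show ?thesis using assms(3) fc
  proof (induction I rule: infinite_finite_induct)
    case (insert i I)
    then show ?case using submoduleD(3)[OF assms(1,2)] by (simp add: Pi_def)
  qed (use submoduleD(2)[OF assms(1,2)] in \<open>simp_all add: finsum_infinite\<close>)
qed

lemma dependent_in_lspan:
  fixes M (structure)
  assumes "kvs M" "finite R" "R \<subseteq> carrier M" "\<not> independent_set M R"
  obtains r where "r \<in> R" "r \<in> lspan M (R - {r})"
proof -
  interpret abelian_group M using assms(1) by simp
  obtain c r where c: "finsum M (\<lambda>r. c r \<odot> r) R = \<zero>" "r \<in> R" "c r \<noteq> 0"
    using assms(4) unfolding independent_set_def by blast
  have R': "R - {r} \<subseteq> carrier M" using assms(3) by blast
  have cl: "c s \<odot> s \<in> carrier M" if "s \<in> R" for s using assms(1,3) that by (simp add: subset_iff)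
  let ?s = "finsum M (\<lambda>r. c r \<odot> r) (R - {r})"
  have "insert r (R - {r}) = R" using c(2) by blast
  then have "finsum M (\<lambda>r. c r \<odot> r) R = c r \<odot> r \<oplus> ?s"
    using finsum_insert[of "R - {r}" r "\<lambda>r. c r \<odot> r"] assms(2) cl c(2) by (simp add: Pi_def)
  then have eq: "c r \<odot> r \<oplus> ?s = \<zero>" using c(1) by simp
  note sub = submodule_lspan[OF assms(1) R']
  have s: "?s \<in> lspan M (R - {r})"
    by (rule finsum_in_submodule[OF assms(1) sub])
      (use submoduleD(4)[OF assms(1) sub] lspan_superset[of "R - {r}" M] in blast)
  then have sc: "?s \<in> carrier M" using submoduleD(1)[OF assms(1) sub] by blast
  have rc: "r \<in> carrier M" using c(2) assms(3) by blast
  have "c r \<odot> r = \<ominus> ?s" using eq cl[OF c(2)] sc by (metis minus_equality)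
  then have "inverse (c r) \<odot> (c r \<odot> r) = inverse (c r) \<odot> ((-1) \<odot> ?s)"
    using sc assms(1) by (simp add: kvs_smult_distrib(4))
  then have "r = inverse (c r) \<odot> ((-1) \<odot> ?s)"
    using c(3) rc assms(1) by (simp add: kvs_smult_distrib(3))
  moreover have "inverse (c r) \<odot> ((-1) \<odot> ?s) \<in> lspan M (R - {r})"
    using submoduleD(4)[OF assms(1) sub] s by blast
  ultimately show thesis using that c(2) by metis
qed

text \<open>A set of right factors of least cardinality is independent, since a dependent one could
  be dropped by distributing it over the others.\<close>

lemma tensor_independent_right:
  assumes M: "kvs M" and N: "kvs N" and z: "z \<in> carrier (tensor M N)"
  obtains R where "finite R" "R \<subseteq> carrier N" "independent_set N R" "z \<in> right_span M N R"
proof -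
  let ?P = "\<lambda>R. finite R \<and> R \<subseteq> carrier N \<and> z \<in> right_span M N R"
  obtain R0 where "?P R0" using tensor_finite_right[OF M N z] by metis
  then obtain R where R: "?P R" "\<And>R'. ?P R' \<Longrightarrow> card R \<le> card R'"
    using ex_has_least_nat[of ?P R0 card] by blast
  have "independent_set N R"
  proof (rule ccontr)
    assume "\<not> independent_set N R"
    then obtain r where r: "r \<in> R" "r \<in> lspan N (R - {r})"
      using dependent_in_lspan[OF N, of R] R(1) by blast
    have R': "R - {r} \<subseteq> carrier N" using R(1) by blast
    have "right_span M N R \<subseteq> right_span M N (R - {r})"
      unfolding right_span_def[of _ _ R]
    proof (rule lspan_minimal[OF right_span_submodule[OF M N R']], rule subsetI)
      fix t assume "t \<in> {tmul M N x s | x s. x \<in> carrier M \<and> s \<in> R}"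
      then obtain x s where t: "t = tmul M N x s" "x \<in> carrier M" "s \<in> R" by blast
      have "s \<in> lspan N (R - {r})" using t(3) r(2) lspan_superset[of "R - {r}" N] by blast
      then show "t \<in> right_span M N (R - {r})" using right_span_lspan[OF M N R' _ t(2)] t(1) by simp
    qed
    then have "?P (R - {r})" using R(1) by blast
    then have "card R \<le> card (R - {r})" by (rule R(2))
    then show False using R(1) r(1) by (metis card_Diff1_less not_le)
  qed
  then show thesis using that R(1) by blast
qed

lemma right_span_finsum:
  assumes M: "kvs M" and N: "kvs N" and "finite R" "R \<subseteq> carrier N" "z \<in> right_span M N R"
  obtains x where "\<And>r. r \<in> R \<Longrightarrow> x r \<in> carrier M" "z = finsum (tensor M N) (\<lambda>r. tmul M N (x r) r) R"
proof -
  interpret T: abelian_group "tensor M N" using M N by simp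
  from assms(3-5) have "\<exists>x. (\<forall>r\<in>R. x r \<in> carrier M) \<and> z = finsum (tensor M N) (\<lambda>r. tmul M N (x r) r) R"
  proof (induction R arbitrary: z rule: finite_induct)
    case empty
    have "submodule {\<zero>\<^bsub>tensor M N\<^esub>} kring (tensor M N)" using M N by (simp add: submodule_iff)
    then have "right_span M N {} \<subseteq> {\<zero>\<^bsub>tensor M N\<^esub>}" unfolding right_span_def by (rule lspan_minimal) simp
    then show ?case using empty by auto
  next
    case (insert r R)
    have R: "R \<subseteq> carrier N" "r \<in> carrier N" using insert.prems by auto
    obtain y z' where y: "y \<in> carrier M" "z' \<in> right_span M N R" "z = tmul M N y r \<oplus>\<^bsub>tensor M N\<^esub> z'"
      using right_span_insert[OF M N R insert.prems(2)] by metis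
    obtain x where x: "\<And>r. r \<in> R \<Longrightarrow> x r \<in> carrier M" "z' = finsum (tensor M N) (\<lambda>r. tmul M N (x r) r) R"
      using insert.IH[OF R(1) y(2)] by blast
    define x' where "x' = x(r := y)"
    have x': "x' s \<in> carrier M" if "s \<in> insert r R" for s using that x(1) y(1) by (auto simp: x'_def)
    have "finsum (tensor M N) (\<lambda>r. tmul M N (x' r) r) R = finsum (tensor M N) (\<lambda>r. tmul M N (x r) r) R"
      by (rule T.finsum_cong') (use insert.hyps x(1) R M N in \<open>auto simp: x'_def\<close>)
    moreover have "finsum (tensor M N) (\<lambda>r. tmul M N (x' r) r) (insert r R) =
        tmul M N (x' r) r \<oplus>\<^bsub>tensor M N\<^esub> finsum (tensor M N) (\<lambda>r. tmul M N (x' r) r) R"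
      by (rule T.finsum_insert) (use insert.hyps x' R M N in auto)
    ultimately have "z = finsum (tensor M N) (\<lambda>r. tmul M N (x' r) r) (insert r R)"
      using y(3) x(2) by (simp add: x'_def)
    then show ?case using x' by blast
  qed
  then show thesis using that by blast
qed

text \<open>With independent right factors r, a fixed \<open>g\<close> turns vanishing at all pairs
  into a relation with coefficients g(x_r) among the values h(r).
  \<open>independent_over_field\<close> makes these coefficients zero, and as \<open>g\<close>
  varies in \<open>Z\<close> all left factors are zero. Stability under automorphisms is therefore
  asked of the second set of points.\<close>

theorem tensor_eval_separates:
  fixes \<iota> :: "'k::field \<Rightarrow> 'w::alg_closed_field"
  assumes char: "CHAR('w) = 0" and \<iota>: "field_embedding \<iota>" and M: "kvs M" and N: "kvs N"
    and Z: "Z \<subseteq> lin_to \<iota> M" "separating M Z"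
    and Y: "Y \<subseteq> lin_to \<iota> N" "separating N Y" "\<And>q h. q \<in> field_auts \<iota> \<Longrightarrow> h \<in> Y \<Longrightarrow> (\<lambda>x. q (h x)) \<in> Y"
    and z: "z \<in> carrier (tensor M N)" "z \<noteq> \<zero>\<^bsub>tensor M N\<^esub>"
  shows "\<exists>g\<in>Z. \<exists>h\<in>Y. tensor_eval M N g h z \<noteq> 0"
proof (rule ccontr)
  assume neg: "\<not> ?thesis"
  interpret T: abelian_group "tensor M N" using M N by simp
  obtain R where R: "finite R" "R \<subseteq> carrier N" "independent_set N R" "z \<in> right_span M N R"
    using tensor_independent_right[OF M N z(1)] by metis
  obtain x where x: "\<And>r. r \<in> R \<Longrightarrow> x r \<in> carrier M" "z = finsum (tensor M N) (\<lambda>r. tmul M N (x r) r) R"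
    using right_span_finsum[OF M N R(1,2,4)] by metis
  have "x r = \<zero>\<^bsub>M\<^esub>" if r: "r \<in> R" for r
  proof (rule ccontr)
    assume "x r \<noteq> \<zero>\<^bsub>M\<^esub>"
    then obtain g where g: "g \<in> Z" "g (x r) \<noteq> 0" using Z(2) x(1)[OF r] unfolding separating_def by blast
    have "(\<Sum>r\<in>R. g (x r) * h r) = 0" if h: "h \<in> Y" for h
    proof -
      have gl: "g \<in> lin_to \<iota> M" and hl: "h \<in> lin_to \<iota> N" using g(1) h Z(1) Y(1) by auto
      have tc: "tmul M N (x r) r \<in> carrier (tensor M N)" if "r \<in> R" for r
        using x(1)[OF that] R(2) that M N by (simp add: subset_iff)
      have "tensor_eval M N g h z = (\<Sum>r\<in>R. tensor_eval M N g h (tmul M N (x r) r))"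
        unfolding x(2)
        by (rule lin_to_finsum(2)[OF tensor_eval_lin_to[OF M N gl hl] kvs_tensor[OF M N] \<iota> R(1) tc])
      also have "\<dots> = (\<Sum>r\<in>R. g (x r) * h r)"
        by (rule sum.cong) (use x(1) R(2) in \<open>auto simp: tensor_eval_tmul[OF M N gl hl] subset_iff\<close>)
      finally show ?thesis using neg g(1) h by auto
    qed
    then have "\<forall>r\<in>R. g (x r) = 0" using independent_over_field[of \<iota> N Y R "\<lambda>r. g (x r)"] char \<iota> N Y R(1-3) by blast
    then show False using g(2) r by blast
  qed
  then have "z = finsum (tensor M N) (\<lambda>r. \<zero>\<^bsub>tensor M N\<^esub>) R"
    unfolding x(2) by (intro T.finsum_cong') (use R(2) M N in \<open>auto simp: subset_iff\<close>)
  then show False using z(2) by simp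
qed

section \<open>Evaluation of differential polynomials\<close>

locale diff_embedding =
  fixes d :: "'k::field \<Rightarrow> 'k" and emb :: "'k \<Rightarrow> 'r::comm_ring_1" and D :: "'r \<Rightarrow> 'r"
  assumes emb_add: "emb (x + y) = emb x + emb y" and emb_mult: "emb (x * y) = emb x * emb y"
    and emb_one [simp]: "emb 1 = 1"
    and D_add: "D (a + b) = D a + D b" and D_mult: "D (a * b) = D a * b + a * D b"
    and D_emb: "D (emb c) = emb (d c)"
begin

lemma emb_zero [simp]: "emb 0 = 0"
proof -
  have "emb (0 + 0) = emb 0 + emb 0" by (rule emb_add)
  then show ?thesis by (metis add.right_neutral add_left_cancel)
qed

lemma D_zero [simp]: "D 0 = 0"
proof -
  have "D (0 + 0) = D 0 + D 0" by (rule D_add)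
  then show ?thesis by (metis add.right_neutral add_left_cancel)
qed

lemma D_one [simp]: "D 1 = 0"
proof -
  have "D (1 * 1) = D 1 * 1 + 1 * D 1" by (rule D_mult)
  then show ?thesis by (metis add.right_neutral add_left_cancel mult.right_neutral mult_1)
qed

lemma emb_minus: "emb (- x) = - emb x"
proof -
  have "emb (x + - x) = emb x + emb (- x)" by (rule emb_add)
  then show ?thesis by (simp add: eq_neg_iff_add_eq_0 add.commute)
qed

lemma D_sum: "D (sum f S) = (\<Sum>i\<in>S. D (f i))"
  by (induction S rule: infinite_finite_induct) (auto simp: D_add)

lemma D_prod: "finite S \<Longrightarrow> D (prod f S) = (\<Sum>v\<in>S. D (f v) * prod f (S - {v}))"
proof (induction S rule: finite_induct)
  case (insert s S)
  have "(\<Sum>v\<in>S. D (f v) * prod f (insert s S - {v})) = (\<Sum>v\<in>S. f s * (D (f v) * prod f (S - {v})))"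
  proof (rule sum.cong)
    fix v assume v: "v \<in> S"
    then have "insert s S - {v} = insert s (S - {v})" using insert.hyps by auto
    then show "D (f v) * prod f (insert s S - {v}) = f s * (D (f v) * prod f (S - {v}))"
      using insert.hyps v by (simp add: mult.left_commute)
  qed simp
  moreover have "insert s S - {s} = S" using insert.hyps by auto
  ultimately show ?case using insert by (simp add: D_mult sum_distrib_left)
qed simp

lemma D_power: "D (x ^ n) = of_nat n * x ^ (n - 1) * D x"
proof (induction n)
  case (Suc n)
  show ?case by (cases n) (use Suc in \<open>simp_all add: D_mult algebra_simps\<close>)
qed simp

lemma emb_of_nat: "emb (of_nat n) = of_nat n"
  by (induction n) (auto simp: emb_add)

definition dp_monom :: "('x \<Rightarrow> 'r) \<Rightarrow> ('x \<times> nat \<Rightarrow>\<^sub>0 nat) \<Rightarrow> 'r" where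
  "dp_monom a m = (\<Prod>(i, r)\<in>Poly_Mapping.keys m. ((D ^^ r) (a i)) ^ Poly_Mapping.lookup m (i, r))"

lemma dp_monom_superset:
  assumes "finite S" "Poly_Mapping.keys m \<subseteq> S"
  shows "dp_monom a m = (\<Prod>v\<in>S. ((D ^^ snd v) (a (fst v))) ^ Poly_Mapping.lookup m v)"
  unfolding dp_monom_def case_prod_beta prod.collapse
  by (rule prod.mono_neutral_left) (use assms in \<open>auto simp: in_keys_iff\<close>)

lemma dp_monom_zero [simp]: "dp_monom a 0 = 1"
  by (simp add: dp_monom_def)

lemma dp_monom_single [simp]: "dp_monom a (Poly_Mapping.single (i, r) n) = ((D ^^ r) (a i)) ^ n"
  by (subst dp_monom_superset[of "{(i, r)}"]) (auto split: if_splits)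

lemma dp_monom_add: "dp_monom a (m + m') = dp_monom a m * dp_monom a m'"
proof -
  let ?S = "Poly_Mapping.keys m \<union> Poly_Mapping.keys m'"
  have "finite ?S" "Poly_Mapping.keys (m + m') \<subseteq> ?S" using keys_add[of m m'] by auto
  then show ?thesis
    by (simp add: dp_monom_superset[of ?S] lookup_add power_add prod.distrib)
qed

lemma dp_eval_altdef: "dp_eval emb D a p = (\<Sum>m\<in>Poly_Mapping.keys p. emb (Poly_Mapping.lookup p m) * dp_monom a m)"
  by (simp add: dp_eval_def dp_monom_def)

lemma dp_eval_zero [simp]: "dp_eval emb D a 0 = 0"
  by (simp add: dp_eval_def)

lemma dp_eval_add: "dp_eval emb D a (p + q) = dp_eval emb D a p + dp_eval emb D a q"
  unfolding dp_eval_altdef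
  by (rule setsum_keys_plus_distrib[where f = "\<lambda>m c. emb c * dp_monom a m"]) (simp_all add: emb_add distrib_right)

lemma dp_eval_single [simp]: "dp_eval emb D a (Poly_Mapping.single m c) = emb c * dp_monom a m"
  by (cases "c = 0") (simp_all add: dp_eval_altdef)

lemma dp_eval_sum: "dp_eval emb D a (sum f S) = (\<Sum>i\<in>S. dp_eval emb D a (f i))"
  by (induction S rule: infinite_finite_induct) (auto simp: dp_eval_add)

lemma dp_eval_minus: "dp_eval emb D a (- p) = - dp_eval emb D a p"
  using dp_eval_add[of a p "- p"] by (simp add: eq_neg_iff_add_eq_0 add.commute)

lemma dp_eval_diff: "dp_eval emb D a (p - q) = dp_eval emb D a p - dp_eval emb D a q"
  using dp_eval_add[of a p "- q"] by (simp add: dp_eval_minus)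

end

lemma poly_mapping_sum_single: "p = (\<Sum>m\<in>Poly_Mapping.keys p. Poly_Mapping.single m (Poly_Mapping.lookup p m))"
  by (rule poly_mapping_eqI) (simp add: lookup_sum lookup_single when_def sum.delta in_keys_iff)

lemma dpoly_induct [case_names zero single add]:
  fixes p :: "('k::field, 'x) dpoly"
  assumes "P 0" "\<And>m c. P (Poly_Mapping.single m c)" "\<And>p q. P p \<Longrightarrow> P q \<Longrightarrow> P (p + q)"
  shows "P p"
proof -
  have "P (\<Sum>m\<in>S. Poly_Mapping.single m (f m))" for S and f :: "_ \<Rightarrow> 'k"
    by (induction S rule: infinite_finite_induct) (use assms in auto)
  then show ?thesis by (subst poly_mapping_sum_single)
qed

context diff_embedding begin

lemma dp_eval_mult: "dp_eval emb D a (p * q) = dp_eval emb D a p * dp_eval emb D a q"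
proof (induction p rule: dpoly_induct)
  case (single m c)
  show ?case
    by (induction q rule: dpoly_induct)
      (simp_all add: mult_single emb_mult dp_monom_add dp_eval_add distrib_left distrib_right mult_ac)
qed (simp_all add: dp_eval_add distrib_right)

lemma dp_eval_one [simp]: "dp_eval emb D a 1 = 1"
  using dp_eval_single[of a 0 1] by simp

lemma dp_eval_const [simp]: "dp_eval emb D a (dp_const c) = emb c"
  by (simp add: dp_const_def)

lemma dp_eval_var [simp]: "dp_eval emb D a (dp_var i) = a i"
  by (simp add: dp_var_def)

text \<open>The product rule with its terms written as monomials again, in the shape of the inner
  sum of \<open>dp_der\<close>.\<close>

lemma D_dp_monom:
  "D (dp_monom a m) = (\<Sum>(i, r)\<in>Poly_Mapping.keys m. of_nat (Poly_Mapping.lookup m (i, r)) *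
    dp_monom a (m - Poly_Mapping.single (i, r) 1 + Poly_Mapping.single (i, Suc r) 1))"
proof -
  let ?K = "Poly_Mapping.keys m"
  let ?f = "\<lambda>v. ((D ^^ snd v) (a (fst v))) ^ Poly_Mapping.lookup m v"
  have "D (dp_monom a m) = (\<Sum>v\<in>?K. D (?f v) * prod ?f (?K - {v}))"
    by (simp add: dp_monom_superset[of ?K] D_prod)
  also have "\<dots> = (\<Sum>v\<in>?K. of_nat (Poly_Mapping.lookup m v) *
      dp_monom a (m - Poly_Mapping.single v 1 + Poly_Mapping.single (fst v, Suc (snd v)) 1))"
  proof (rule sum.cong)
    fix v assume v: "v \<in> ?K"
    obtain i r where ir: "v = (i, r)" by (cases v)
    let ?m = "m - Poly_Mapping.single v 1"
    have "Poly_Mapping.keys ?m \<subseteq> ?K" by (auto simp: in_keys_iff lookup_minus)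
    then have "dp_monom a ?m = (\<Prod>w\<in>?K. ((D ^^ snd w) (a (fst w))) ^ Poly_Mapping.lookup ?m w)"
      by (intro dp_monom_superset) auto
    also have "\<dots> = (D ^^ r) (a i) ^ (Poly_Mapping.lookup m v - 1) *
        (\<Prod>w\<in>?K - {v}. ((D ^^ snd w) (a (fst w))) ^ Poly_Mapping.lookup ?m w)"
      using v by (subst prod.remove[of _ v]) (auto simp: ir lookup_minus)
    also have "(\<Prod>w\<in>?K - {v}. ((D ^^ snd w) (a (fst w))) ^ Poly_Mapping.lookup ?m w) = prod ?f (?K - {v})"
      by (rule prod.cong) (auto simp: lookup_minus lookup_single when_def)
    finally show "D (?f v) * prod ?f (?K - {v}) = of_nat (Poly_Mapping.lookup m v) *
        dp_monom a (?m + Poly_Mapping.single (fst v, Suc (snd v)) 1)"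
      by (simp add: dp_monom_add D_power ir mult_ac)
  qed simp
  finally show ?thesis by (simp add: case_prod_beta)
qed

lemma dp_eval_der: "dp_eval emb D a (dp_der d p) = D (dp_eval emb D a p)"
proof -
  have "dp_eval emb D a (dp_der d p) = (\<Sum>m\<in>Poly_Mapping.keys p. emb (d (Poly_Mapping.lookup p m)) * dp_monom a m +
     emb (Poly_Mapping.lookup p m) * D (dp_monom a m))"
    unfolding dp_der_def dp_eval_sum dp_eval_add D_dp_monom sum_distrib_left
    by (auto intro!: sum.cong simp: dp_eval_sum emb_mult emb_of_nat mult_ac case_prod_beta)
  also have "\<dots> = D (dp_eval emb D a p)"
    by (simp add: dp_eval_altdef D_sum D_mult D_emb)
  finally show ?thesis .
qed

end

lemma dp_eval_hom:
  fixes \<psi> :: "'r::comm_ring_1 \<Rightarrow> 's::comm_ring_1"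
  assumes "\<And>x y. \<psi> (x + y) = \<psi> x + \<psi> y" "\<And>x y. \<psi> (x * y) = \<psi> x * \<psi> y" "\<psi> 1 = 1" "\<psi> 0 = 0"
    and "\<And>x. \<psi> (D x) = D' (\<psi> x)" "\<And>c. \<psi> (emb c) = emb' c"
  shows "\<psi> (dp_eval emb D a p) = dp_eval emb' D' (\<lambda>i. \<psi> (a i)) p"
proof -
  have s: "\<psi> (sum f S) = (\<Sum>i\<in>S. \<psi> (f i))" for f and S :: "('c \<times> nat \<Rightarrow>\<^sub>0 nat) set"
    by (induction S rule: infinite_finite_induct) (auto simp: assms)
  have p: "\<psi> (prod f S) = (\<Prod>i\<in>S. \<psi> (f i))" for f and S :: "('c \<times> nat) set"
    by (induction S rule: infinite_finite_induct) (auto simp: assms)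
  have pw: "\<psi> (x ^ n) = \<psi> x ^ n" for x n by (induction n) (auto simp: assms)
  have fp: "\<psi> ((D ^^ n) x) = (D' ^^ n) (\<psi> x)" for x n by (induction n) (auto simp: assms)
  show ?thesis by (simp add: dp_eval_def s p pw fp assms case_prod_beta)
qed

lemma dp_der_single:
  "dp_der d (Poly_Mapping.single m c) = Poly_Mapping.single m (d c) +
     (\<Sum>(i, r)\<in>Poly_Mapping.keys m. Poly_Mapping.single
        (m - Poly_Mapping.single (i, r) 1 + Poly_Mapping.single (i, Suc r) 1)
        (of_nat (Poly_Mapping.lookup m (i, r)) * c))" if "d 0 = 0"
proof (cases "c = 0")
  case True
  then show ?thesis using that by (auto simp: dp_der_def intro!: sum.neutral[symmetric])
next
  case False
  then show ?thesis by (simp add: dp_der_def)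
qed

lemma dp_der_funpow_var:
  fixes d :: "'k::field \<Rightarrow> 'k"
  assumes "d 0 = 0" "d 1 = 0"
  shows "(dp_der d ^^ r) (dp_var i) = Poly_Mapping.single (Poly_Mapping.single (i, r) 1) 1"
proof (induction r)
  case (Suc r)
  have "Poly_Mapping.single (i, r) (1::nat) - Poly_Mapping.single (i, r) 1 = 0" by simp
  then show ?case using Suc assms by (simp add: dp_der_single)
qed (simp add: dp_var_def)

text \<open>A differential polynomial is its own value at the generic point. Combined with
  \<open>dp_eval_hom\<close> this turns every homomorphism out of the differential polynomial ring
  into an evaluation, and it yields the induction rule \<open>dpoly_generate_jets\<close>.\<close>

lemma dp_eval_generic:
  fixes d :: "'k::field \<Rightarrow> 'k"
  assumes "d 0 = 0" "d 1 = 0"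
  shows "dp_eval dp_const (dp_der d) dp_var p = p"
proof -
  have pw: "Poly_Mapping.single m (1::'k) ^ n = Poly_Mapping.single (\<Sum>j<n. m) 1"
    for m :: "'x \<times> nat \<Rightarrow>\<^sub>0 nat" and n
    by (induction n) (simp_all add: mult_single lessThan_Suc)
  have pr: "(\<Prod>v\<in>S. Poly_Mapping.single (f v) (1::'k)) = Poly_Mapping.single (sum f S) 1"
    for f :: "'x \<times> nat \<Rightarrow> 'x \<times> nat \<Rightarrow>\<^sub>0 nat" and S
    by (induction S rule: infinite_finite_induct) (auto simp: mult_single)
  have sc: "(\<Sum>j<n. Poly_Mapping.single v (1::nat)) = Poly_Mapping.single v n" for v :: "'x \<times> nat" and n
    by (induction n) (simp_all add: lessThan_Suc flip: single_add)
  have mon: "(\<Prod>(i, r)\<in>Poly_Mapping.keys m. ((dp_der d ^^ r) (dp_var i)) ^ Poly_Mapping.lookup m (i, r)) =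
      Poly_Mapping.single m (1::'k)" for m :: "'x \<times> nat \<Rightarrow>\<^sub>0 nat"
  proof -
    have "(\<Prod>(i, r)\<in>Poly_Mapping.keys m. ((dp_der d ^^ r) (dp_var i)) ^ Poly_Mapping.lookup m (i, r)) =
      Poly_Mapping.single (\<Sum>v\<in>Poly_Mapping.keys m. Poly_Mapping.single v (Poly_Mapping.lookup m v)) (1::'k)"
      unfolding pr[symmetric] by (rule prod.cong) (auto simp: dp_der_funpow_var[of d, OF assms] pw sc[unfolded One_nat_def])
    then show ?thesis using poly_mapping_sum_single[of m] by simp
  qed
  show ?thesis
    unfolding dp_eval_def mon by (simp add: dp_const_def mult_single flip: poly_mapping_sum_single)
qed

section \<open>Differential algebras and their homomorphisms\<close>

lemma dk_algebraD:
  fixes A (structure)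
  assumes "dk_algebra d A"
  shows "kvs A" "cring A" "der A \<in> add_hom A A"
    "x \<in> carrier A \<Longrightarrow> y \<in> carrier A \<Longrightarrow> (c \<odot> x) \<otimes> y = c \<odot> (x \<otimes> y)"
    "x \<in> carrier A \<Longrightarrow> y \<in> carrier A \<Longrightarrow> der A (x \<otimes> y) = (der A x \<otimes> y) \<oplus> (x \<otimes> der A y)"
    "der A (c \<odot> \<one>) = d c \<odot> \<one>"
    "x \<in> carrier A \<Longrightarrow> der A x \<in> carrier A"
    "x \<in> carrier A \<Longrightarrow> der A (c \<odot> x) = d c \<odot> x \<oplus> c \<odot> der A x"
    "x \<in> carrier A \<Longrightarrow> y \<in> carrier A \<Longrightarrow> x \<otimes> (c \<odot> y) = c \<odot> (x \<otimes> y)"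
proof -
  have alg: "Module.algebra kring A" using assms by (simp add: dk_algebra_def)
  interpret Module.algebra kring A by (rule alg)
  show k: "kvs A" and cr: "cring A" by (rule module, rule M_cring)
  show da: "der A \<in> add_hom A A"
    and dm: "\<And>x y. x \<in> carrier A \<Longrightarrow> y \<in> carrier A \<Longrightarrow> der A (x \<otimes> y) = (der A x \<otimes> y) \<oplus> (x \<otimes> der A y)"
    and dc: "\<And>c. der A (c \<odot> \<one>) = d c \<odot> \<one>"
    using assms by (auto simp: dk_algebra_def)
  show sm: "\<And>c x y. x \<in> carrier A \<Longrightarrow> y \<in> carrier A \<Longrightarrow> (c \<odot> x) \<otimes> y = c \<odot> (x \<otimes> y)"
    using smult_assoc2 by simp
  show dcl: "\<And>x. x \<in> carrier A \<Longrightarrow> der A x \<in> carrier A" using add_hom_closed[OF da] .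
  show "der A (c \<odot> x) = d c \<odot> x \<oplus> c \<odot> der A x" if x: "x \<in> carrier A"
  proof -
    have "c \<odot> x = (c \<odot> \<one>) \<otimes> x" using sm[of "\<one>" x c] x by simp
    then have "der A (c \<odot> x) = (d c \<odot> \<one>) \<otimes> x \<oplus> (c \<odot> \<one>) \<otimes> der A x"
      using dm[of "c \<odot> \<one>" x] dc x k by simp
    then show ?thesis using sm[of "\<one>"] x dcl[OF x] by simp
  qed
  show "x \<otimes> (c \<odot> y) = c \<odot> (x \<otimes> y)" if "x \<in> carrier A" "y \<in> carrier A"
    using sm[of y x c] that k by (simp add: m_comm)
qed

lemma ext_dalg_simps [simp]:
  "carrier (ext_dalg e E) = UNIV" "x \<otimes>\<^bsub>ext_dalg e E\<^esub> y = x * y" "\<one>\<^bsub>ext_dalg e E\<^esub> = 1"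
  "\<zero>\<^bsub>ext_dalg e E\<^esub> = 0" "x \<oplus>\<^bsub>ext_dalg e E\<^esub> y = x + y" "c \<odot>\<^bsub>ext_dalg e E\<^esub> x = e c * x" "der (ext_dalg e E) = E"
  by (simp_all add: ext_dalg_def)

lemma dk_algebra_ext:
  assumes "diff_embedding d e E" shows "dk_algebra d (ext_dalg e E)"
proof -
  interpret diff_embedding d e E by fact
  have ab: "abelian_group (ext_dalg e E)"
    by (rule abelian_groupI) (auto intro: exI[of _ "- x" for x])
  have "cring (ext_dalg e E)"
    by (rule cringI[OF ab comm_monoidI]) (auto simp: algebra_simps)
  then have "Module.algebra kring (ext_dalg e E)"
    by (intro algebraI cring_from_type_algebra) (auto simp: algebra_simps emb_add emb_mult)
  then show ?thesis by (simp add: dk_algebra_def add_hom_iff D_add D_mult D_emb)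
qed

lemma dk_algebra_extD:
  assumes "dk_algebra d (ext_dalg e E)" shows "diff_embedding d e E"
proof
  note A = dk_algebraD[OF assms]
  show "e (x + y) = e x + e y" for x y using kvs_smult_distrib(1)[OF A(1), of 1 x y] by simp
  show one: "e 1 = 1" using kvs_smult(4)[OF A(1), of 1] by simp
  show "e (x * y) = e x * e y" for x y using kvs_smult_distrib(3)[OF A(1), of 1 x y] by simp
  show "E (a + b) = E a + E b" for a b using add_hom_add[OF A(3), of a b] by simp
  show "E (a * b) = E a * b + a * E b" for a b using A(5)[of a b] by simp
  show "E (e c) = e (d c)" for c using A(6)[of c] by simp
qed

lemma dk_hom_iff:
  "\<phi> \<in> dk_hom A B \<longleftrightarrow> (\<forall>x\<in>carrier A. \<phi> x \<in> carrier B) \<and> \<phi> \<one>\<^bsub>A\<^esub> = \<one>\<^bsub>B\<^esub> \<and>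
     (\<forall>x\<in>carrier A. \<forall>y\<in>carrier A. \<phi> (x \<otimes>\<^bsub>A\<^esub> y) = \<phi> x \<otimes>\<^bsub>B\<^esub> \<phi> y \<and> \<phi> (x \<oplus>\<^bsub>A\<^esub> y) = \<phi> x \<oplus>\<^bsub>B\<^esub> \<phi> y) \<and>
     (\<forall>c. \<forall>x\<in>carrier A. \<phi> (c \<odot>\<^bsub>A\<^esub> x) = c \<odot>\<^bsub>B\<^esub> \<phi> x) \<and> (\<forall>x\<in>carrier A. \<phi> (der A x) = der B (\<phi> x))"
  by (auto simp: dk_hom_def ring_hom_def lin_def add_hom_iff)

text \<open>Equational axioms can be tested after a jointly injective family of structure-preserving
  maps into a known algebra. The family consists of evaluations at points for A, of a single
  bijection for the copy of a field inside the type required by \<open>semi_universal\<close>, and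
  of \<Phi> for F/R.\<close>

lemma dk_algebra_embedded:
  fixes B (structure)
  assumes A: "dk_algebra d A"
    and inj: "\<And>x y. x \<in> carrier B \<Longrightarrow> y \<in> carrier B \<Longrightarrow> (\<And>i. i \<in> I \<Longrightarrow> \<Phi> i x = \<Phi> i y) \<Longrightarrow> x = y"
    and \<Phi>: "\<And>i x. i \<in> I \<Longrightarrow> x \<in> carrier B \<Longrightarrow> \<Phi> i x \<in> carrier A"
    and closed: "\<zero> \<in> carrier B" "\<one> \<in> carrier B"
      "\<And>x y. x \<in> carrier B \<Longrightarrow> y \<in> carrier B \<Longrightarrow> x \<oplus> y \<in> carrier B"
      "\<And>x y. x \<in> carrier B \<Longrightarrow> y \<in> carrier B \<Longrightarrow> x \<otimes> y \<in> carrier B"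
      "\<And>c x. x \<in> carrier B \<Longrightarrow> c \<odot> x \<in> carrier B"
      "\<And>x. x \<in> carrier B \<Longrightarrow> der B x \<in> carrier B"
    and hom: "\<And>i. i \<in> I \<Longrightarrow> \<Phi> i \<zero> = \<zero>\<^bsub>A\<^esub>" "\<And>i. i \<in> I \<Longrightarrow> \<Phi> i \<one> = \<one>\<^bsub>A\<^esub>"
      "\<And>i x y. i \<in> I \<Longrightarrow> x \<in> carrier B \<Longrightarrow> y \<in> carrier B \<Longrightarrow> \<Phi> i (x \<oplus> y) = \<Phi> i x \<oplus>\<^bsub>A\<^esub> \<Phi> i y"
      "\<And>i x y. i \<in> I \<Longrightarrow> x \<in> carrier B \<Longrightarrow> y \<in> carrier B \<Longrightarrow> \<Phi> i (x \<otimes> y) = \<Phi> i x \<otimes>\<^bsub>A\<^esub> \<Phi> i y"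
      "\<And>i c x. i \<in> I \<Longrightarrow> x \<in> carrier B \<Longrightarrow> \<Phi> i (c \<odot> x) = c \<odot>\<^bsub>A\<^esub> \<Phi> i x"
      "\<And>i x. i \<in> I \<Longrightarrow> x \<in> carrier B \<Longrightarrow> \<Phi> i (der B x) = der A (\<Phi> i x)"
  shows "dk_algebra d B"
proof -
  note a = dk_algebraD[OF A]
  interpret A: cring A by (rule a(2))
  have ab: "abelian_group B"
  proof (rule abelian_groupI)
    fix x assume x: "x \<in> carrier B"
    have "(-1) \<odot> x \<oplus> x = \<zero>"
    proof (rule inj)
      fix i assume i: "i \<in> I"
      have "(-1) \<odot>\<^bsub>A\<^esub> \<Phi> i x = \<ominus>\<^bsub>A\<^esub> \<Phi> i x" using kvs_smult_distrib(4)[OF a(1) \<Phi>[OF i x]] by simp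
      then show "\<Phi> i ((-1) \<odot> x \<oplus> x) = \<Phi> i \<zero>" using x i closed \<Phi>[OF i x] by (simp add: hom A.l_neg)
    qed (use x closed in simp_all)
    then show "\<exists>y\<in>carrier B. y \<oplus> x = \<zero>" using closed(5)[OF x] by blast
  qed (rule closed; assumption | rule inj; simp add: closed hom \<Phi> A.a_ac)+
  have cm: "comm_monoid B"
    by (rule comm_monoidI) (rule closed; assumption | rule inj; simp add: closed hom \<Phi> A.m_ac)+
  have cr: "cring B"
    by (rule cringI[OF ab cm], rule inj) (simp_all add: closed hom \<Phi> A.l_distr)
  have "Module.algebra kring B"
  proof (rule algebraI[OF cring_from_type_algebra cr])
    show "(a \<oplus>\<^bsub>kring\<^esub> b) \<odot> x = a \<odot> x \<oplus> b \<odot> x" if "x \<in> carrier B" for a b x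
      by (rule inj) (simp_all add: that closed hom \<Phi> kvs_smult_distrib(1)[OF a(1)])
    show "a \<odot> (x \<oplus> y) = a \<odot> x \<oplus> a \<odot> y" if "x \<in> carrier B" "y \<in> carrier B" for a x y
      by (rule inj) (simp_all add: that closed hom \<Phi> kvs_smult_distrib(2)[OF a(1)])
    show "(a \<otimes>\<^bsub>kring\<^esub> b) \<odot> x = a \<odot> (b \<odot> x)" if "x \<in> carrier B" for a b x
      by (rule inj) (simp_all add: that closed hom \<Phi> kvs_smult_distrib(3)[OF a(1)])
    show "\<one>\<^bsub>kring\<^esub> \<odot> x = x" if "x \<in> carrier B" for x
      by (rule inj) (simp_all add: that closed hom \<Phi> kvs_smult(4)[OF a(1)])
    show "a \<odot> x \<otimes> y = a \<odot> (x \<otimes> y)" if "x \<in> carrier B" "y \<in> carrier B" for a x y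
      by (rule inj) (simp_all add: that closed hom \<Phi> a(4))
  qed (simp add: closed)
  moreover have "der B \<in> add_hom B B"
    by (rule add_homI, simp add: closed, rule inj) (simp_all add: closed hom \<Phi> add_hom_add[OF a(3)])
  moreover have "der B (x \<otimes> y) = (der B x \<otimes> y) \<oplus> (x \<otimes> der B y)" if "x \<in> carrier B" "y \<in> carrier B" for x y
    by (rule inj) (simp_all add: that closed hom \<Phi> a(5))
  moreover have "der B (c \<odot> \<one>) = d c \<odot> \<one>" for c
    by (rule inj) (simp_all add: closed hom \<Phi> a(6))
  ultimately show ?thesis by (simp add: dk_algebra_def)
qed

section \<open>Taylor morphisms\<close>

text \<open>Homomorphisms of k-algebras without any compatibility with the derivation of A; the
  field \<open>'w\<close> carries no derivation.\<close>

definition alg_points :: "('k::field \<Rightarrow> 'w::field) \<Rightarrow> ('k, 'a, 'm) module_scheme \<Rightarrow> ('a \<Rightarrow> 'w) set" where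
  "alg_points \<iota> A = {g \<in> lin_to \<iota> A. g \<one>\<^bsub>A\<^esub> = 1 \<and>
     (\<forall>x\<in>carrier A. \<forall>y\<in>carrier A. g (x \<otimes>\<^bsub>A\<^esub> y) = g x * g y)}"

text \<open>The exponential of t\<partial>, followed by \<open>g\<close> on coefficients. It turns
  an algebra homomorphism into one that takes \<partial> to d/dt, and the constant term returns
  \<open>g\<close>.\<close>

definition taylor :: "('k, 'a, 'm) dalg_scheme \<Rightarrow> ('a \<Rightarrow> 'w::field) \<Rightarrow> 'a \<Rightarrow> 'w fps" where
  "taylor A g x = Abs_fps (\<lambda>n. g ((der A ^^ n) x) / of_nat (fact n))"

context
  fixes d :: "'k::field \<Rightarrow> 'k" and A :: "('k, 'a, 'm) dalg_scheme" (structure) and \<iota> :: "'k \<Rightarrow> 'w::field" and g :: "'a \<Rightarrow> 'w"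
  assumes char: "CHAR('w) = 0" and A: "dk_algebra d A" and \<iota>: "field_embedding \<iota>" and g: "g \<in> alg_points \<iota> A"
begin

private lemma nz: "n > 0 \<Longrightarrow> of_nat n \<noteq> (0 :: 'w)"
  using char by (simp add: of_nat_eq_0_iff_char_dvd)

lemma taylor_nth_0 [simp]: "fps_nth (taylor A g x) 0 = g x"
  by (simp add: taylor_def)

lemma fps_deriv_taylor: "fps_deriv (taylor A g x) = taylor A g (der A x)"
proof (rule fps_ext)
  fix n
  have "of_nat (Suc n) * y / of_nat (fact (Suc n)) = (y / of_nat (fact n) :: 'w)" for y
    unfolding fact_Suc of_nat_mult using nz[of "Suc n"] by (simp del: of_nat_Suc)
  then show "fps_nth (fps_deriv (taylor A g x)) n = fps_nth (taylor A g (der A x)) n"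
    by (simp add: taylor_def funpow_swap1 del: of_nat_Suc fact_Suc)
qed

lemma taylor_add:
  assumes "x \<in> carrier A" "y \<in> carrier A"
  shows "taylor A g (x \<oplus> y) = taylor A g x + taylor A g y"
proof -
  note a = dk_algebraD[OF A]
  have "(der A ^^ n) (x \<oplus> y) = (der A ^^ n) x \<oplus> (der A ^^ n) y \<and> (der A ^^ n) x \<in> carrier A \<and> (der A ^^ n) y \<in> carrier A" for n
    by (induction n) (use assms a(3,7) in \<open>auto simp: add_hom_add\<close>)
  then show ?thesis using g by (intro fps_ext) (simp add: taylor_def alg_points_def lin_to_def add_divide_distrib)
qed

text \<open>In place of binomial sums: both sides have the same constant term, and by the product
  rule the coefficients of their derivatives agree one degree lower. Recovering a coefficient from
  that of the derivative divides by a positive integer, which is nonzero in characteristic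
  0.\<close>

lemma taylor_mult:
  assumes "x \<in> carrier A" "y \<in> carrier A"
  shows "taylor A g (x \<otimes> y) = taylor A g x * taylor A g y"
proof (rule fps_ext)
  note a = dk_algebraD[OF A]
  interpret A: cring A by (rule a(2))
  have g0: "g (x \<otimes> y) = g x * g y" if "x \<in> carrier A" "y \<in> carrier A" for x y
    using g that by (simp add: alg_points_def)
  fix n show "fps_nth (taylor A g (x \<otimes> y)) n = fps_nth (taylor A g x * taylor A g y) n"
    using assms
  proof (induction n arbitrary: x y)
    case 0 then show ?case by (simp add: g0)
  next
    case (Suc n)
    have "taylor A g (der A (x \<otimes> y)) = taylor A g (der A x \<otimes> y) + taylor A g (x \<otimes> der A y)"
      using Suc.prems a(5,7) by (simp add: taylor_add)
    then have "fps_nth (fps_deriv (taylor A g (x \<otimes> y))) n = fps_nth (taylor A g (der A x) * taylor A g y + taylor A g x * taylor A g (der A y)) n"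
      using Suc.IH[of "der A x" y] Suc.IH[of x "der A y"] Suc.prems a(7) by (simp add: fps_deriv_taylor)
    also have "\<dots> = fps_nth (fps_deriv (taylor A g x * taylor A g y)) n"
      by (simp add: fps_deriv_taylor algebra_simps)
    finally have "of_nat (Suc n) * fps_nth (taylor A g (x \<otimes> y)) (Suc n) =
        of_nat (Suc n) * fps_nth (taylor A g x * taylor A g y) (Suc n)"
      by (simp only: fps_deriv_nth Suc_eq_plus1)
    then show ?case using nz[of "Suc n"] by (simp only: mult_cancel_left zero_less_Suc simp_thms)
  qed
qed

lemma taylor_const: "taylor A g (c \<odot> \<one>) = Abs_fps (\<lambda>n. \<iota> ((d ^^ n) c) / of_nat (fact n))"
proof -
  note a = dk_algebraD[OF A]
  interpret A: cring A by (rule a(2))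
  have "(der A ^^ n) (c \<odot> \<one>) = (d ^^ n) c \<odot> \<one>" for n
    by (induction n) (auto simp: a(6))
  moreover have "g (c \<odot> \<one>) = \<iota> c" for c using g by (simp add: alg_points_def lin_to_def)
  ultimately show ?thesis by (simp add: taylor_def)
qed

end

text \<open>The Taylor series of an element of k: as \<open>d\<close> may be nonzero, k does not
  simply land in the constant series. Laurent series are used because
  \<open>semi_universal_embedding\<close> works inside a field.\<close>

definition const_taylor :: "('k \<Rightarrow> 'k) \<Rightarrow> ('k \<Rightarrow> 'w::field) \<Rightarrow> 'k \<Rightarrow> 'w fls" where
  "const_taylor d \<iota> c = fps_to_fls (Abs_fps (\<lambda>n. \<iota> ((d ^^ n) c) / of_nat (fact n)))"

lemma taylor_dk_hom:
  fixes d :: "'k::field \<Rightarrow> 'k" and A :: "('k, 'a, 'm) dalg_scheme" (structure) and \<iota> :: "'k \<Rightarrow> 'w::field"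
  assumes char: "CHAR('w) = 0" and A: "dk_algebra d A" and \<iota>: "field_embedding \<iota>" and g: "g \<in> alg_points \<iota> A"
  shows "(\<lambda>x. fps_to_fls (taylor A g x)) \<in> dk_hom A (ext_dalg (const_taylor d \<iota>) fls_deriv)"
proof -
  note a = dk_algebraD[OF A]
  interpret A: cring A by (rule a(2))
  note t = taylor_add[OF assms] taylor_mult[OF assms] taylor_const[OF assms] fps_deriv_taylor[OF assms]
  have "taylor A g \<one> = 1"
  proof -
    have "taylor A g \<one> * taylor A g \<one> = taylor A g \<one> * 1"
      using t(2)[of "\<one>" "\<one>"] by simp
    moreover have "fps_nth (taylor A g \<one>) 0 \<noteq> 0" using g by (simp add: taylor_def alg_points_def)
    then have "taylor A g \<one> \<noteq> 0" by auto
    ultimately show ?thesis by (metis mult_cancel_left)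
  qed
  moreover have "fps_to_fls (taylor A g (c \<odot> x)) = const_taylor d \<iota> c * fps_to_fls (taylor A g x)" if "x \<in> carrier A" for c x
  proof -
    have "c \<odot> x = (c \<odot> \<one>) \<otimes> x" using a(4)[of "\<one>" x c] that by simp
    then show ?thesis using t(2)[of "c \<odot> \<one>" x] that a(1)
      by (simp add: t(3) const_taylor_def fls_times_fps_to_fls)
  qed
  ultimately show ?thesis
    by (auto simp: dk_hom_iff t fls_times_fps_to_fls fls_deriv_fps_to_fls)
qed

lemma diff_embedding_self:
  assumes "derivation d" shows "diff_embedding d (\<lambda>c. c) d"
  by standard (use assms in \<open>auto simp: derivation_def\<close>)

text \<open>\<open>\<iota>\<close> is itself an algebra point of the differential field k, so this
  is the Taylor morphism of k.\<close>

lemma diff_embedding_taylor: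
  fixes d :: "'k::field \<Rightarrow> 'k" and \<iota> :: "'k \<Rightarrow> 'w::field"
  assumes char: "CHAR('w) = 0" and d: "derivation d" and \<iota>: "field_embedding \<iota>"
  shows "diff_embedding d (const_taylor d \<iota>) fls_deriv"
proof -
  note K = dk_algebra_ext[OF diff_embedding_self[OF d]]
  have "\<iota> \<in> alg_points \<iota> (ext_dalg (\<lambda>c. c) d)"
    using \<iota> by (simp add: alg_points_def lin_to_def field_embedding_def)
  from taylor_dk_hom[OF char K \<iota> this]
  have "const_taylor d \<iota> \<in> dk_hom (ext_dalg (\<lambda>c. c) d) (ext_dalg (const_taylor d \<iota>) fls_deriv)"
    by (simp add: const_taylor_def[abs_def] taylor_def)
  then show ?thesis by unfold_locales (auto simp: dk_hom_iff fls_deriv_mult)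
qed

section \<open>Embeddings into semi-universal extensions\<close>

lemma (in diff_embedding) dp_eval_in:
  fixes a :: "'x \<Rightarrow> 'r"
  assumes "\<And>x y. x \<in> Q \<Longrightarrow> y \<in> Q \<Longrightarrow> x + y \<in> Q" "\<And>x y. x \<in> Q \<Longrightarrow> y \<in> Q \<Longrightarrow> x * y \<in> Q"
    and "\<And>c. emb c \<in> Q" "\<And>x. x \<in> Q \<Longrightarrow> D x \<in> Q" "\<And>i. a i \<in> Q"
  shows "dp_eval emb D a p \<in> Q"
proof (induction p rule: dpoly_induct)
  case zero
  then show ?case using assms(3)[of 0] by simp
next
  case (single m c)
  have one: "1 \<in> Q" using assms(3)[of 1] by simp
  have "(D ^^ r) (a i) \<in> Q" for r i by (induction r) (use assms in auto)
  moreover have "x ^ n \<in> Q" if "x \<in> Q" for x n by (induction n) (use assms one that in auto)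
  moreover have "prod f S \<in> Q" if "\<And>v. v \<in> S \<Longrightarrow> f v \<in> Q" for f and S :: "('x \<times> nat) set"
    using that by (induction S rule: infinite_finite_induct) (use assms one in auto)
  ultimately have "dp_monom a m \<in> Q" by (auto simp: dp_monom_def)
  then show ?case using assms by simp
qed (use assms in \<open>auto simp: dp_eval_add\<close>)

lemma D_inverse:
  fixes e :: "'k::field \<Rightarrow> 'l::field"
  assumes "diff_embedding d e E" "x \<noteq> 0"
  shows "E (inverse x) = - E x / x\<^sup>2" "E (y / x) = (E y * x - y * E x) / x\<^sup>2"
proof -
  interpret diff_embedding d e E by fact
  have "E x * inverse x + x * E (inverse x) = 0" using D_mult[of x "inverse x"] assms(2) by simp
  then have "x * E (inverse x) = - (E x * inverse x)" by (simp add: eq_neg_iff_add_eq_0 add.commute)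
  then have "inverse x * (x * E (inverse x)) = inverse x * - (E x * inverse x)" by simp
  then show i: "E (inverse x) = - E x / x\<^sup>2"
    using assms(2) by (simp add: power2_eq_square field_simps)
  show "E (y / x) = (E y * x - y * E x) / x\<^sup>2"
    using assms(2) by (simp add: divide_inverse[of y] D_mult i) (simp add: field_simps power2_eq_square)
qed

text \<open>\<open>semi_universal\<close> speaks only of extensions whose elements are sets of pairs
  of differential polynomials. The differential field generated by \<open>B\<close> is therefore
  copied into that type, each element being represented by all the fractions equal to it, and the
  resulting homomorphism is read back on \<open>F\<close>.\<close>

theorem semi_universal_embedding:
  fixes d :: "'k::field \<Rightarrow> 'k" and e :: "'k \<Rightarrow> 'l::field" and D :: "'u::field \<Rightarrow> 'u"
  assumes su: "semi_universal d D emb" and e: "diff_embedding d e E" and B: "finite B"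
  obtains F s where "is_subfield F" "\<And>c. e c \<in> F" "B \<subseteq> F" "\<And>x. x \<in> F \<Longrightarrow> E x \<in> F"
    "\<And>x y. x \<in> F \<Longrightarrow> y \<in> F \<Longrightarrow> s (x + y) = s x + s y"
    "\<And>x y. x \<in> F \<Longrightarrow> y \<in> F \<Longrightarrow> s (x * y) = s x * s y"
    "s 1 = 1" "\<And>c. s (e c) = emb c" "\<And>x. x \<in> F \<Longrightarrow> s (E x) = D (s x)"
proof -
  interpret diff_embedding d e E by fact
  obtain xs where xs: "set xs = B" using B finite_list by blast
  \<comment> \<open>The differential indeterminates are indexed by \<open>nat\<close>; those beyond
    the list \<open>xs\<close> are sent to 0, so that \<open>b\<close> has finite range.\<close>
  define b :: "nat \<Rightarrow> 'l" where "b i = (if i < length xs then xs ! i else 0)" for i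
  have Bb: "B \<subseteq> range b"
  proof
    fix x assume "x \<in> B"
    then obtain i where "i < length xs" "xs ! i = x" unfolding xs[symmetric] in_set_conv_nth by blast
    then have "b i = x" by (simp add: b_def)
    then show "x \<in> range b" by blast
  qed
  have "range b \<subseteq> insert 0 B" unfolding xs[symmetric] b_def by auto
  then have finb: "finite (range b)" using B finite_subset by blast
  define ev where "ev = dp_eval e E b"
  have ev: "ev (p + q) = ev p + ev q" "ev (p * q) = ev p * ev q" "ev 1 = 1" "ev 0 = 0" "ev (- p) = - ev p" "ev (p - q) = ev p - ev q"
    "ev (dp_const c) = e c" "ev (dp_var i) = b i" "ev (dp_der d p) = E (ev p)" for p q c i
    by (simp_all add: ev_def dp_eval_add dp_eval_mult dp_eval_minus dp_eval_diff dp_eval_der)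
  define F where "F = {ev p / ev q | p q. ev q \<noteq> 0}"
  have FI: "ev p / ev q \<in> F" if "ev q \<noteq> 0" for p q using that by (auto simp: F_def)
  have evF: "ev p \<in> F" for p using FI[of 1 p] by (simp add: ev)
  have F: "is_subfield F"
    unfolding is_subfield_def
  proof (intro conjI ballI)
    show "0 \<in> F" "1 \<in> F" using evF[of 0] evF[of 1] by (simp_all add: ev)
    fix x assume "x \<in> F"
    then obtain p q where x: "x = ev p / ev q" "ev q \<noteq> 0" by (auto simp: F_def)
    show "- x \<in> F" using FI[OF x(2), of "- p"] x by (simp add: ev)
    show "inverse x \<in> F" using FI[of p q] evF[of 0] x by (cases "ev p = 0") (auto simp: ev)
    fix y assume "y \<in> F"
    then obtain p' q' where y: "y = ev p' / ev q'" "ev q' \<noteq> 0" by (auto simp: F_def)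
    show "x * y \<in> F" using FI[of "q * q'" "p * p'"] x y by (simp add: ev)
    show "x + y \<in> F" using FI[of "q * q'" "p * q' + p' * q"] x y by (simp add: ev add_frac_eq)
  qed
  note Fi = is_subfieldD[OF F]
  have EF: "E x \<in> F" if xF: "x \<in> F" for x
  proof -
    obtain p q where x: "x = ev p / ev q" "ev q \<noteq> 0" using xF by (auto simp: F_def)
    have "E x = ev (dp_der d p * q - p * dp_der d q) / ev (q * q)"
      using D_inverse(2)[OF e x(2), of "ev p"] x(1) by (simp add: ev power2_eq_square)
    then show ?thesis using FI[of "q * q" "dp_der d p * q - p * dp_der d q"] x(2) by (simp add: ev)
  qed
  have eF: "e c \<in> F" for c using evF[of "dp_const c"] by (simp add: ev)
  \<comment> \<open>All pairs that represent the fraction \<open>\<xi>\<close>, written without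
    division.\<close>
  define cls where "cls \<xi> = {(p, q). ev q \<noteq> 0 \<and> ev p = \<xi> * ev q}" for \<xi>
  have inj: "inj_on cls F"
  proof (rule inj_onI)
    fix x y assume xF: "x \<in> F" and eq: "cls x = cls y"
    obtain p q where x: "x = ev p / ev q" "ev q \<noteq> 0" using xF by (auto simp: F_def)
    then have "(p, q) \<in> cls x" by (simp add: cls_def)
    then have "(p, q) \<in> cls y" by (simp only: eq)
    then show "x = y" using x by (simp add: cls_def)
  qed
  define val where "val = inv_into F cls"
  have val: "val (cls x) = x" if "x \<in> F" for x using that inj by (simp add: val_def)
  define L :: "('k, (('k, nat) dpoly \<times> ('k, nat) dpoly) set) dalg" where
    "L = \<lparr>carrier = cls ` F, mult = (\<lambda>x y. cls (val x * val y)), one = cls 1, zero = cls 0,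
       add = (\<lambda>x y. cls (val x + val y)), module.smult = (\<lambda>c x. cls (e c * val x)), der = (\<lambda>x. cls (E (val x)))\<rparr>"
  have L: "carrier L = cls ` F" "x \<otimes>\<^bsub>L\<^esub> y = cls (val x * val y)" "\<one>\<^bsub>L\<^esub> = cls 1" "\<zero>\<^bsub>L\<^esub> = cls 0"
    "x \<oplus>\<^bsub>L\<^esub> y = cls (val x + val y)" "c \<odot>\<^bsub>L\<^esub> x = cls (e c * val x)" "der L x = cls (E (val x))" for x y c
    by (simp_all add: L_def)
  have dkL: "dk_algebra d L"
    by (rule dk_algebra_embedded[OF dk_algebra_ext[OF e], of _ "{()}" "\<lambda>_. val"])
      (auto simp: L val Fi EF eF)
  interpret L: cring L by (rule dk_algebraD(2)[OF dkL])
  have fieldL: "Ring.field L"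
  proof (rule L.cring_fieldI2)
    show "\<zero>\<^bsub>L\<^esub> \<noteq> \<one>\<^bsub>L\<^esub>" using inj Fi(1,2) by (auto simp: L inj_on_eq_iff)
    fix x assume x: "x \<in> carrier L" "x \<noteq> \<zero>\<^bsub>L\<^esub>"
    then obtain \<xi> where \<xi>: "\<xi> \<in> F" "x = cls \<xi>" "\<xi> \<noteq> 0" by (auto simp: L)
    then show "\<exists>y\<in>carrier L. x \<otimes>\<^bsub>L\<^esub> y = \<one>\<^bsub>L\<^esub>"
      by (intro bexI[of _ "cls (inverse \<xi>)"]) (auto simp: L val Fi)
  qed
  have "fin_gen_field_ext d L"
    unfolding fin_gen_field_ext_def
  proof (intro conjI dkL fieldL exI[of _ "cls ` range b"] allI impI)
    show "finite (cls ` range b)" using finb by simp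
    show "cls ` range b \<subseteq> carrier L" using evF[of "dp_var _"] by (auto simp: L ev)
    fix K assume K: "subfield K L \<and> (\<forall>c. c \<odot>\<^bsub>L\<^esub> \<one>\<^bsub>L\<^esub> \<in> K) \<and> cls ` range b \<subseteq> K \<and> der L ` K \<subseteq> K"
    then have sf: "subfield K L" by blast
    note sr = subringE[OF subcring.axioms(1)[OF subdomain.axioms(1)[OF subfield.axioms(1)[OF sf]]]]
    \<comment> \<open>The part of \<open>F\<close> whose copy lies in the given subfield. It is
      closed under the operations and contains the values of \<open>b\<close>, hence all numerators,
      denominators and quotients.\<close>
    define Q where "Q = {\<xi> \<in> F. cls \<xi> \<in> K}"
    have "ev p \<in> Q" for p
      unfolding ev_def
    proof (rule dp_eval_in)
      show "x + y \<in> Q" if "x \<in> Q" "y \<in> Q" for x y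
        using sr(7)[of "cls x" "cls y"] that by (auto simp: Q_def L val Fi)
      show "x * y \<in> Q" if "x \<in> Q" "y \<in> Q" for x y
        using sr(6)[of "cls x" "cls y"] that by (auto simp: Q_def L val Fi)
      show "e c \<in> Q" for c
      proof -
        have "c \<odot>\<^bsub>L\<^esub> \<one>\<^bsub>L\<^esub> \<in> K" using K by blast
        then show ?thesis by (simp add: Q_def L val Fi eF)
      qed
      show "E x \<in> Q" if "x \<in> Q" for x
      proof -
        have "der L (cls x) \<in> K" using K that unfolding Q_def by blast
        then show ?thesis using that by (simp add: Q_def L val EF)
      qed
      show "b i \<in> Q" for i
      proof -
        have "cls (b i) \<in> K" using K by blast
        then show ?thesis using evF[of "dp_var i"] by (simp add: Q_def ev)
      qed
    qed
    moreover have "inverse x \<in> Q" if "x \<in> Q" for x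
    proof (cases "x = 0")
      case False
      then have nz: "cls x \<in> K - {\<zero>\<^bsub>L\<^esub>}" using that inj Fi(1) by (auto simp: Q_def L inj_on_eq_iff)
      have "inv\<^bsub>L\<^esub> (cls x) \<in> K" using L.subfield_m_inv(1)[OF sf nz] by blast
      moreover have "inv\<^bsub>L\<^esub> (cls x) = cls (inverse x)"
        by (rule L.comm_inv_char) (use that False in \<open>auto simp: Q_def L val Fi\<close>)
      ultimately show ?thesis using that Fi by (simp add: Q_def)
    qed (use that in simp)
    moreover have "x * y \<in> Q" if "x \<in> Q" "y \<in> Q" for x y
      using sr(6)[of "cls x" "cls y"] that by (auto simp: Q_def L val Fi)
    ultimately have "ev p / ev q \<in> Q" for p q by (simp add: divide_inverse)
    then have "F \<subseteq> Q" by (auto simp: F_def)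
    then show "K = carrier L" using sr(1) by (auto simp: Q_def L)
  qed
  then obtain s where s: "s \<in> dk_hom L (ext_dalg emb D)" using su by (auto simp: semi_universal_def)
  show thesis
  proof (rule that[of F "\<lambda>x. s (cls x)"])
    note h = s[unfolded dk_hom_iff]
    show "s (cls (x + y)) = s (cls x) + s (cls y)" "s (cls (x * y)) = s (cls x) * s (cls y)" if "x \<in> F" "y \<in> F" for x y
    proof -
      have "s (cls x \<oplus>\<^bsub>L\<^esub> cls y) = s (cls x) + s (cls y)" "s (cls x \<otimes>\<^bsub>L\<^esub> cls y) = s (cls x) * s (cls y)"
        using h that by (auto simp: L(1))
      then show "s (cls (x + y)) = s (cls x) + s (cls y)" "s (cls (x * y)) = s (cls x) * s (cls y)"
        using that by (auto simp: L val)
    qed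
    show one: "s (cls 1) = 1" using h by (simp add: L)
    show "s (cls (e c)) = emb c" for c
    proof -
      have "s (c \<odot>\<^bsub>L\<^esub> \<one>\<^bsub>L\<^esub>) = emb c * s \<one>\<^bsub>L\<^esub>" using h L.one_closed by auto
      then show ?thesis using one by (simp add: L val Fi)
    qed
    show "s (cls (E x)) = D (s (cls x))" if "x \<in> F" for x
    proof -
      have "s (der L (cls x)) = D (s (cls x))" using h that by (auto simp: L(1))
      then show ?thesis using that by (simp add: L val)
    qed
  qed (use F eF EF Bb evF[of "dp_var _"] in \<open>auto simp: ev\<close>)
qed

section \<open>Tensor products of differential algebras\<close>

lemma tensor_dalg_simps [simp]:
  "carrier (tensor_dalg A B) = carrier (tensor A B)" "\<zero>\<^bsub>tensor_dalg A B\<^esub> = \<zero>\<^bsub>tensor A B\<^esub>"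
  "x \<oplus>\<^bsub>tensor_dalg A B\<^esub> y = x \<oplus>\<^bsub>tensor A B\<^esub> y" "c \<odot>\<^bsub>tensor_dalg A B\<^esub> x = c \<odot>\<^bsub>tensor A B\<^esub> x"
  "\<one>\<^bsub>tensor_dalg A B\<^esub> = tmul A B \<one>\<^bsub>A\<^esub> \<one>\<^bsub>B\<^esub>"
  by (simp_all add: tensor_dalg_def)

lemma cring_facts:
  fixes A (structure)
  assumes "cring A"
  shows "x \<in> carrier A \<Longrightarrow> y \<in> carrier A \<Longrightarrow> x \<otimes> y \<in> carrier A" "\<one> \<in> carrier A"
    "x \<in> carrier A \<Longrightarrow> y \<in> carrier A \<Longrightarrow> z \<in> carrier A \<Longrightarrow> (x \<oplus> y) \<otimes> z = x \<otimes> z \<oplus> y \<otimes> z"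
    "x \<in> carrier A \<Longrightarrow> y \<in> carrier A \<Longrightarrow> z \<in> carrier A \<Longrightarrow> z \<otimes> (x \<oplus> y) = z \<otimes> x \<oplus> z \<otimes> y"
  by (simp_all add: cring.cring_simprules[OF assms])

text \<open>Lifts a map of four variables to a pair of tensor products, one after the other. The
  point is that the inner lift, at a fixed \<open>z'\<close>, is balanced in the outer variables;
  this is proved by induction on \<open>z'\<close>.\<close>

lemma tlift_tlift:
  fixes M :: "('k::field, 'a, 'm) module_scheme" and N :: "('k, 'b, 'n) module_scheme"
    and M' :: "('k, 'c, 'p) module_scheme" and N' :: "('k, 'd, 'q) module_scheme"
    and P :: "('e, 'r) ring_scheme" (structure)
  assumes kvs: "kvs M" "kvs N" "kvs M'" "kvs N'" and P: "abelian_group P"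
    and b1: "\<And>x y. x \<in> carrier M \<Longrightarrow> y \<in> carrier N \<Longrightarrow> balanced M' N' P (\<beta> x y)"
    and b2: "\<And>x' y'. x' \<in> carrier M' \<Longrightarrow> y' \<in> carrier N' \<Longrightarrow> balanced M N P (\<lambda>x y. \<beta> x y x' y')"
  defines "F \<equiv> \<lambda>z z'. tlift M N P (\<lambda>x y. tlift M' N' P (\<beta> x y) z') z"
  shows "z' \<in> carrier (tensor M' N') \<Longrightarrow> (\<lambda>z. F z z') \<in> add_hom (tensor M N) P"
    and "z \<in> carrier (tensor M N) \<Longrightarrow> F z \<in> add_hom (tensor M' N') P"
    and "x \<in> carrier M \<Longrightarrow> y \<in> carrier N \<Longrightarrow> x' \<in> carrier M' \<Longrightarrow> y' \<in> carrier N' \<Longrightarrow>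
      F (tmul M N x y) (tmul M' N' x' y') = \<beta> x y x' y'"
proof -
  have b2c: "\<beta> x y x' y' \<in> carrier P" "\<beta> (x1 \<oplus>\<^bsub>M\<^esub> x2) y x' y' = \<beta> x1 y x' y' \<oplus> \<beta> x2 y x' y'"
    "\<beta> x (y1 \<oplus>\<^bsub>N\<^esub> y2) x' y' = \<beta> x y1 x' y' \<oplus> \<beta> x y2 x' y'" "\<beta> (c \<odot>\<^bsub>M\<^esub> x) y x' y' = \<beta> x (c \<odot>\<^bsub>N\<^esub> y) x' y'"
    if "x \<in> carrier M" "x1 \<in> carrier M" "x2 \<in> carrier M" "y \<in> carrier N" "y1 \<in> carrier N" "y2 \<in> carrier N"
      "x' \<in> carrier M'" "y' \<in> carrier N'" for x x1 x2 y y1 y2 x' y' c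
    using b2[OF that(7,8)] that by (auto simp: balanced_def add_hom_iff)
  note tl = tlift_add_hom[OF kvs(3,4) P b1] and tt = tlift_tmul[OF kvs(3,4) P b1]
  have bal: "balanced M N P (\<lambda>x y. tlift M' N' P (\<beta> x y) z')" if z': "z' \<in> carrier (tensor M' N')" for z'
    using z'
  proof (induction z' rule: tensor_induct[OF kvs(3,4), consumes 1, case_names tmul add])
    case (tmul x' y')
    show ?case by (rule balancedI) (use tmul kvs b2c in \<open>simp_all add: tt\<close>)
  next
    case (add z1 z2)
    have h1: "\<And>x y. x \<in> carrier M \<Longrightarrow> y \<in> carrier N \<Longrightarrow> tlift M' N' P (\<beta> x y) z1 \<in> carrier P"
      "\<And>x y. x \<in> carrier M \<Longrightarrow> y \<in> carrier N \<Longrightarrow> tlift M' N' P (\<beta> x y) z2 \<in> carrier P"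
      using add_hom_closed[OF tl] add.hyps by auto
    show ?case
    proof (rule balancedI)
      fix x1 x2 y assume "x1 \<in> carrier M" "x2 \<in> carrier M" "y \<in> carrier N"
      then show "tlift M' N' P (\<beta> (x1 \<oplus>\<^bsub>M\<^esub> x2) y) (z1 \<oplus>\<^bsub>tensor M' N'\<^esub> z2) =
          tlift M' N' P (\<beta> x1 y) (z1 \<oplus>\<^bsub>tensor M' N'\<^esub> z2) \<oplus> tlift M' N' P (\<beta> x2 y) (z1 \<oplus>\<^bsub>tensor M' N'\<^esub> z2)"
        using add.IH kvs h1 P by (simp add: add_hom_add[OF tl add.hyps] balanced_def add_hom_add[where f="\<lambda>x. tlift M' N' P (\<beta> x y) z1" and M=M and N=P]
            add_hom_add[where f="\<lambda>x. tlift M' N' P (\<beta> x y) z2" and M=M and N=P] ag_ac)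
    next
      fix x y1 y2 assume "x \<in> carrier M" "y1 \<in> carrier N" "y2 \<in> carrier N"
      then show "tlift M' N' P (\<beta> x (y1 \<oplus>\<^bsub>N\<^esub> y2)) (z1 \<oplus>\<^bsub>tensor M' N'\<^esub> z2) =
          tlift M' N' P (\<beta> x y1) (z1 \<oplus>\<^bsub>tensor M' N'\<^esub> z2) \<oplus> tlift M' N' P (\<beta> x y2) (z1 \<oplus>\<^bsub>tensor M' N'\<^esub> z2)"
        using add.IH kvs h1 P by (simp add: add_hom_add[OF tl add.hyps] balanced_def add_hom_add[where f="\<lambda>y. tlift M' N' P (\<beta> x y) z1" and M=N and N=P]
            add_hom_add[where f="\<lambda>y. tlift M' N' P (\<beta> x y) z2" and M=N and N=P] ag_ac)
    next
      fix c x y assume "x \<in> carrier M" "y \<in> carrier N"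
      then show "tlift M' N' P (\<beta> (c \<odot>\<^bsub>M\<^esub> x) y) (z1 \<oplus>\<^bsub>tensor M' N'\<^esub> z2) = tlift M' N' P (\<beta> x (c \<odot>\<^bsub>N\<^esub> y)) (z1 \<oplus>\<^bsub>tensor M' N'\<^esub> z2)"
        using add.IH kvs by (simp add: add_hom_add[OF tl add.hyps] balanced_def)
    next
      fix x y assume "x \<in> carrier M" "y \<in> carrier N"
      then show "tlift M' N' P (\<beta> x y) (z1 \<oplus>\<^bsub>tensor M' N'\<^esub> z2) \<in> carrier P"
        using h1 P by (simp add: add_hom_add[OF tl add.hyps])
    qed
  qed
  note F1 = tlift_add_hom[OF kvs(1,2) P bal] and F2 = tlift_tmul[OF kvs(1,2) P bal]
  show "z' \<in> carrier (tensor M' N') \<Longrightarrow> (\<lambda>z. F z z') \<in> add_hom (tensor M N) P"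
    unfolding F_def by (rule F1)
  show "x \<in> carrier M \<Longrightarrow> y \<in> carrier N \<Longrightarrow> x' \<in> carrier M' \<Longrightarrow> y' \<in> carrier N' \<Longrightarrow>
      F (tmul M N x y) (tmul M' N' x' y') = \<beta> x y x' y'"
    unfolding F_def using F2[of "tmul M' N' x' y'" x y] tt[of x y x' y'] kvs by simp
  show "F z \<in> add_hom (tensor M' N') P" if "z \<in> carrier (tensor M N)"
    using that
  proof (induction z rule: tensor_induct[OF kvs(1,2), consumes 1, case_names tmul add])
    case (tmul x y)
    show ?case
      by (rule add_homI) (use tmul kvs tl[OF tmul] in \<open>simp_all add: F_def F2 add_hom_closed[OF tl[OF tmul]] add_hom_add[OF tl[OF tmul]]\<close>)
  next
    case (add z1 z2)
    have Fz: "F (z1 \<oplus>\<^bsub>tensor M N\<^esub> z2) z' = F z1 z' \<oplus> F z2 z'" if "z' \<in> carrier (tensor M' N')" for z'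
      unfolding F_def by (rule add_hom_add[OF F1[OF that] add.hyps])
    show ?case
      by (rule add_homI) (use add.IH P kvs in \<open>simp_all add: Fz add_hom_closed[OF add.IH(1)] add_hom_closed[OF add.IH(2)]
          add_hom_add[OF add.IH(1)] add_hom_add[OF add.IH(2)] ag_ac\<close>)
  qed
qed

context
  fixes d :: "'k::field \<Rightarrow> 'k" and A :: "('k, 'a, 'm) dalg_scheme" (structure) and B :: "('k, 'b, 'n) dalg_scheme"
  assumes A: "dk_algebra d A" and B: "dk_algebra d B"
begin

private lemmas a = dk_algebraD[OF A]
private lemmas b = dk_algebraD[OF B]
private lemmas ca = cring_facts[OF a(2)]
private lemmas cb = cring_facts[OF b(2)]
private lemma T: "abelian_group (tensor A B)" using a b by simp

private lemma bal_mult: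
  assumes "x \<in> carrier A" "y \<in> carrier B"
  shows "balanced A B (tensor A B) (\<lambda>x' y'. tmul A B (x \<otimes> x') (y \<otimes>\<^bsub>B\<^esub> y'))"
    and "balanced A B (tensor A B) (\<lambda>x' y'. tmul A B (x' \<otimes> x) (y' \<otimes>\<^bsub>B\<^esub> y))"
  by (rule balancedI; use assms a b in \<open>simp_all add: ca cb tmul_add_left tmul_add_right
      tmul_smult_left tmul_smult_right a(4,9) b(4,9)\<close>)+

lemma tensor_mult_hom:
  "w \<in> carrier (tensor A B) \<Longrightarrow> (\<lambda>z. z \<otimes>\<^bsub>tensor_dalg A B\<^esub> w) \<in> add_hom (tensor A B) (tensor A B)"
  "z \<in> carrier (tensor A B) \<Longrightarrow> (\<lambda>w. z \<otimes>\<^bsub>tensor_dalg A B\<^esub> w) \<in> add_hom (tensor A B) (tensor A B)"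
  "x \<in> carrier A \<Longrightarrow> y \<in> carrier B \<Longrightarrow> x' \<in> carrier A \<Longrightarrow> y' \<in> carrier B \<Longrightarrow>
    tmul A B x y \<otimes>\<^bsub>tensor_dalg A B\<^esub> tmul A B x' y' = tmul A B (x \<otimes> x') (y \<otimes>\<^bsub>B\<^esub> y')"
  using tlift_tlift[OF a(1) b(1) a(1) b(1) T bal_mult]
  by (simp_all add: tensor_dalg_def)

lemma tensor_mult_closed [simp]:
  "z \<in> carrier (tensor A B) \<Longrightarrow> w \<in> carrier (tensor A B) \<Longrightarrow> z \<otimes>\<^bsub>tensor_dalg A B\<^esub> w \<in> carrier (tensor A B)"
  using add_hom_closed[OF tensor_mult_hom(1)] by blast

text \<open>Only the sum is balanced: when \<open>c\<close> moves across the tensor sign, the first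
  summand contributes an extra d(c) x \<otimes> y on one side and the second summand the same term
  on the other side.\<close>

private lemma bal_der: "balanced A B (tensor A B) (\<lambda>x y. tmul A B (der A x) y \<oplus>\<^bsub>tensor A B\<^esub> tmul A B x (der B y))"
proof (rule balancedI)
  fix c x y assume xy: "x \<in> carrier A" "y \<in> carrier B"
  then show "tmul A B (der A (c \<odot> x)) y \<oplus>\<^bsub>tensor A B\<^esub> tmul A B (c \<odot> x) (der B y) =
      tmul A B (der A x) (c \<odot>\<^bsub>B\<^esub> y) \<oplus>\<^bsub>tensor A B\<^esub> tmul A B x (der B (c \<odot>\<^bsub>B\<^esub> y))"
    using a b T by (simp add: tmul_add_left tmul_add_right tmul_smult_left tmul_smult_right ag_ac)
qed (use a b T in \<open>simp_all add: add_hom_add[OF a(3)] add_hom_add[OF b(3)] tmul_add_left tmul_add_right ag_ac\<close>)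

lemma tensor_der_hom: "der (tensor_dalg A B) \<in> add_hom (tensor A B) (tensor A B)"
  and tensor_der_tmul: "x \<in> carrier A \<Longrightarrow> y \<in> carrier B \<Longrightarrow> der (tensor_dalg A B) (tmul A B x y) =
    tmul A B (der A x) y \<oplus>\<^bsub>tensor A B\<^esub> tmul A B x (der B y)"
  using tlift_add_hom[OF a(1) b(1) T bal_der] tlift_tmul[OF a(1) b(1) T bal_der]
  by (simp_all add: tensor_dalg_def)

lemma tensor_eval_dk:
  fixes e :: "'k \<Rightarrow> 'u::field"
  assumes e: "diff_embedding d e D" and g: "g \<in> dk_hom A (ext_dalg e D)" and h: "h \<in> dk_hom B (ext_dalg e D)"
    and z: "z \<in> carrier (tensor A B)" and w: "w \<in> carrier (tensor A B)"
  shows "tensor_eval A B g h (z \<otimes>\<^bsub>tensor_dalg A B\<^esub> w) = tensor_eval A B g h z * tensor_eval A B g h w"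
    and "tensor_eval A B g h (der (tensor_dalg A B) z) = D (tensor_eval A B g h z)"
proof -
  interpret diff_embedding d e D by fact
  note gi = g[unfolded dk_hom_iff] and hi = h[unfolded dk_hom_iff]
  have gl: "g \<in> lin_to e A" "h \<in> lin_to e B" using gi hi by (auto simp: lin_to_def)
  note te = tensor_eval_tmul[OF a(1) b(1) gl] and ta = tensor_eval_add[OF a(1) b(1) gl]
  show "tensor_eval A B g h (der (tensor_dalg A B) z) = D (tensor_eval A B g h z)"
    using z
  proof (induction z rule: tensor_induct[OF a(1) b(1), consumes 1, case_names tmul add])
    case (tmul x y)
    then show ?case using gi hi a(1,7) b(1,7) by (simp add: tensor_der_tmul ta te D_mult)
  next
    case (add z z')
    then show ?case using add_hom_closed[OF tensor_der_hom] by (simp add: add_hom_add[OF tensor_der_hom] ta D_add)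
  qed
  show "tensor_eval A B g h (z \<otimes>\<^bsub>tensor_dalg A B\<^esub> w) = tensor_eval A B g h z * tensor_eval A B g h w"
    using z
  proof (induction z rule: tensor_induct[OF a(1) b(1), consumes 1, case_names tmul add])
    case (tmul x y)
    note xy = this
    show ?case using w
    proof (induction w rule: tensor_induct[OF a(1) b(1), consumes 1, case_names tmul add])
      case (tmul x' y')
      then show ?case using xy gi hi by (simp add: tensor_mult_hom(3) te ca cb)
    next
      case (add w w')
      have "tmul A B x y \<in> carrier (tensor A B)" using xy a b by simp
      then show ?case using add by (simp add: add_hom_add[OF tensor_mult_hom(2)] ta distrib_left)
    qed
  next
    case (add z z')
    then show ?case using w by (simp add: add_hom_add[OF tensor_mult_hom(1)] ta distrib_right)
  qed
qed

end

text \<open>Used to compare points over the algebraic closure with points over \<open>'u\<close>: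
  there is no given map from the closure to \<open>'u\<close>, only a relation that respects sums
  and products, and such a relation passes from the factors to tensors.\<close>

lemma tensor_eval_rel:
  fixes \<iota> :: "'k::field \<Rightarrow> 'w::field" and e :: "'k \<Rightarrow> 'u::field"
  assumes M: "kvs M" and N: "kvs N" and l: "g \<in> lin_to \<iota> M" "h \<in> lin_to \<iota> N" "g' \<in> lin_to e M" "h' \<in> lin_to e N"
    and add: "\<And>w v w' v'. R w v \<Longrightarrow> R w' v' \<Longrightarrow> R (w + w') (v + v')"
    and mult: "\<And>w v w' v'. R w v \<Longrightarrow> R w' v' \<Longrightarrow> R (w * w') (v * v')"
    and gg: "\<And>x. x \<in> carrier M \<Longrightarrow> R (g x) (g' x)" and hh: "\<And>x. x \<in> carrier N \<Longrightarrow> R (h x) (h' x)"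
    and z: "z \<in> carrier (tensor M N)"
  shows "R (tensor_eval M N g h z) (tensor_eval M N g' h' z)"
  using z
  by (induction z rule: tensor_induct[OF M N, consumes 1, case_names tmul add])
    (simp_all add: tensor_eval_tmul[OF M N l(1,2)] tensor_eval_tmul[OF M N l(3,4)]
      tensor_eval_add[OF M N l(1,2)] tensor_eval_add[OF M N l(3,4)] add mult gg hh)

lemma tensor_assoc_balanced:
  fixes A (structure)
  assumes V: "kvs V" and A: "kvs A"
  shows "a \<in> carrier A \<Longrightarrow> balanced V A (tensor V (tensor A A)) (\<lambda>v b. tmul V (tensor A A) v (tmul A A b a))"
    and "balanced (tensor V A) A (tensor V (tensor A A)) (\<lambda>s a.
     tlift V A (tensor V (tensor A A)) (\<lambda>v b. tmul V (tensor A A) v (tmul A A b a)) s)"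
proof -
  have P: "abelian_group (tensor V (tensor A A))" using V A by simp
  show b: "balanced V A (tensor V (tensor A A)) (\<lambda>v b. tmul V (tensor A A) v (tmul A A b a))" if "a \<in> carrier A" for a
    by (rule balancedI) (use that V A in \<open>simp_all add: tmul_add_left tmul_add_right tmul_smult_left tmul_smult_right\<close>)
  note l = tlift_add_hom[OF V A P b] and t = tlift_tmul[OF V A P b]
  show "balanced (tensor V A) A (tensor V (tensor A A)) (\<lambda>s a.
     tlift V A (tensor V (tensor A A)) (\<lambda>v b. tmul V (tensor A A) v (tmul A A b a)) s)"
  proof (rule balancedI)
    fix s a a' assume s: "s \<in> carrier (tensor V A)" and aa: "a \<in> carrier A" "a' \<in> carrier A"
    have aac: "a \<oplus> a' \<in> carrier A" using aa A by simp
    show "tlift V A (tensor V (tensor A A)) (\<lambda>v b. tmul V (tensor A A) v (tmul A A b (a \<oplus> a'))) s =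
      tlift V A (tensor V (tensor A A)) (\<lambda>v b. tmul V (tensor A A) v (tmul A A b a)) s \<oplus>\<^bsub>tensor V (tensor A A)\<^esub>
      tlift V A (tensor V (tensor A A)) (\<lambda>v b. tmul V (tensor A A) v (tmul A A b a')) s"
      by (rule tensor_ext[OF V A l[OF aac] add_hom_plus[OF l[OF aa(1)] l[OF aa(2)] P] _ s])
        (use V A aa aac in \<open>simp add: t tmul_add_right\<close>)
  next
    fix c s a assume s: "s \<in> carrier (tensor V A)" and aa: "a \<in> carrier A"
    have ca: "c \<odot> a \<in> carrier A" using aa A by simp
    show "tlift V A (tensor V (tensor A A)) (\<lambda>v b. tmul V (tensor A A) v (tmul A A b a)) (c \<odot>\<^bsub>tensor V A\<^esub> s) =
      tlift V A (tensor V (tensor A A)) (\<lambda>v b. tmul V (tensor A A) v (tmul A A b (c \<odot> a))) s"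
      using s
    proof (induction s rule: tensor_induct[OF V A, consumes 1, case_names tmul add])
      case (tmul v b)
      then show ?case using V A aa ca by (simp add: tmul_smult_left[OF V A, symmetric] t)
        (simp add: tmul_smult_left tmul_smult_right)
    next
      case (add s s')
      then show ?case using V A aa ca by (simp add: kvs_smult_distrib(2) add_hom_add[OF l])
    qed
  qed (use V A in \<open>simp_all add: add_hom_closed[OF l] add_hom_add[OF l]\<close>)
qed

lemma
  assumes V: "kvs V" and A: "kvs A"
  shows tensor_assoc_hom: "tensor_assoc V A \<in> add_hom (tensor (tensor V A) A) (tensor V (tensor A A))"
    and tensor_assoc_tmul: "v \<in> carrier V \<Longrightarrow> b \<in> carrier A \<Longrightarrow> a \<in> carrier A \<Longrightarrow>
      tensor_assoc V A (tmul (tensor V A) A (tmul V A v b) a) = tmul V (tensor A A) v (tmul A A b a)"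
proof -
  have P: "abelian_group (tensor V (tensor A A))" and VA: "kvs (tensor V A)" using V A by simp_all
  note b = tensor_assoc_balanced[OF V A]
  show "tensor_assoc V A \<in> add_hom (tensor (tensor V A) A) (tensor V (tensor A A))"
    unfolding tensor_assoc_def by (rule tlift_add_hom[OF VA A P b(2)])
  show "v \<in> carrier V \<Longrightarrow> b \<in> carrier A \<Longrightarrow> a \<in> carrier A \<Longrightarrow>
      tensor_assoc V A (tmul (tensor V A) A (tmul V A v b) a) = tmul V (tensor A A) v (tmul A A b a)"
    unfolding tensor_assoc_def
    using tlift_tmul[OF VA A P b(2), of "tmul V A v b" a] tlift_tmul[OF V A P b(1), of a v b] V A by simp
qed

text \<open>Follows from \<open>dp_eval_generic\<close>, which writes \<open>p\<close> as a
  polynomial expression in constants and derivatives of indeterminates.\<close>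

lemma dpoly_generate_jets:
  fixes d :: "'k::field \<Rightarrow> 'k" and p :: "('k, 'x) dpoly"
  assumes "d 0 = 0" "d 1 = 0" and "\<And>p q. P p \<Longrightarrow> P q \<Longrightarrow> P (p + q)" "\<And>p q. P p \<Longrightarrow> P q \<Longrightarrow> P (p * q)"
    and "\<And>c. P (dp_const c)" "\<And>r i. P ((dp_der d ^^ r) (dp_var i))"
  shows "P p"
proof -
  have z: "P 0" and o: "P 1" using assms(5)[of 0] assms(5)[of 1] by (simp_all add: dp_const_def)
  have "P (x ^ n)" if "P x" for x n by (induction n) (use assms(4) o that in auto)
  moreover have "P (prod f S)" if "\<And>v. v \<in> S \<Longrightarrow> P (f v)" for f and S :: "('x \<times> nat) set"
    using that by (induction S rule: infinite_finite_induct) (use assms(4) o in auto)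
  moreover have "P (sum f S)" if "\<And>v. v \<in> S \<Longrightarrow> P (f v)" for f and S :: "('x \<times> nat \<Rightarrow>\<^sub>0 nat) set"
    using that by (induction S rule: infinite_finite_induct) (use assms(3) z in auto)
  ultimately have "P (dp_eval dp_const (dp_der d) dp_var p)"
    unfolding dp_eval_def using assms(4-6) by (auto simp: case_prod_beta)
  then show ?thesis by (simp only: dp_eval_generic[of d, OF assms(1,2)])
qed

lemma dpoly_generate:
  fixes d :: "'k::field \<Rightarrow> 'k" and p :: "('k, 'x) dpoly"
  assumes "d 0 = 0" "d 1 = 0" and "\<And>p q. P p \<Longrightarrow> P q \<Longrightarrow> P (p + q)" "\<And>p q. P p \<Longrightarrow> P q \<Longrightarrow> P (p * q)"
    and "\<And>c. P (dp_const c)" "\<And>p. P p \<Longrightarrow> P (dp_der d p)" "\<And>i. P (dp_var i)"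
  shows "P p"
proof (rule dpoly_generate_jets[where P = P and d = d])
  show "P ((dp_der d ^^ r) (dp_var i))" for r i by (induction r) (use assms(6,7) in auto)
qed (rule assms; assumption)+

section \<open>The coordinate ring\<close>

text \<open>\<open>det\<close> makes sense over any commutative ring, so the generic matrix has a
  determinant among the differential polynomials; homomorphisms specialise it.\<close>

lemma hom_det:
  fixes \<psi> :: "'r::comm_ring_1 \<Rightarrow> 's::comm_ring_1" and M :: "'r ^ 'n ^ 'n"
  assumes "\<And>x y. \<psi> (x + y) = \<psi> x + \<psi> y" "\<And>x y. \<psi> (x * y) = \<psi> x * \<psi> y" "\<psi> 1 = 1" "\<psi> 0 = 0"
  shows "\<psi> (det M) = det (\<chi> i j. \<psi> (M $ i $ j))"
proof -
  have s: "\<psi> (sum f S) = (\<Sum>i\<in>S. \<psi> (f i))" for f and S :: "('n \<Rightarrow> 'n) set"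
    by (induction S rule: infinite_finite_induct) (auto simp: assms)
  have p: "\<psi> (prod f S) = (\<Prod>i\<in>S. \<psi> (f i))" for f and S :: "'n set"
    by (induction S rule: infinite_finite_induct) (auto simp: assms)
  have m: "\<psi> (- x) = - \<psi> x" for x
    using assms(1)[of x "- x"] assms(4) by (simp add: eq_neg_iff_add_eq_0 add.commute)
  have n: "\<psi> (of_nat n) = of_nat n" for n by (induction n) (auto simp: assms)
  have i: "\<psi> (of_int z) = of_int z" for z by (cases z rule: int_diff_cases) (simp add: assms n m diff_conv_add_uminus del: add_uminus_conv_diff)
  show ?thesis by (simp add: det_def s p i assms)
qed

lemma finite_gl_index: "finite (UNIV :: 'n::finite gl_index set)"
proof -
  have "x \<in> range (\<lambda>(i, j). Entry i j) \<union> {InvDet}" for x :: "'n gl_index"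
    by (cases x) (auto simp: image_iff)
  then have "(UNIV :: 'n gl_index set) \<subseteq> range (\<lambda>(i, j). Entry i j) \<union> {InvDet}" by blast
  then show ?thesis by (rule finite_subset) simp
qed

locale diff_group =
  fixes d :: "'k::field_char_0 \<Rightarrow> 'k" and D :: "'u::field \<Rightarrow> 'u" and emb :: "'k \<Rightarrow> 'u"
    and G :: "('u ^ 'n ^ 'n) set"
  assumes deriv: "derivation d" and su: "semi_universal d D emb"
    and grp: "linear_diff_alg_group D emb G"
begin

sublocale diff_embedding d emb D
  using su by (intro dk_algebra_extD) (simp add: semi_universal_def)

abbreviation "ev g p \<equiv> dp_eval emb D (gl_point g) p"
abbreviation "I \<equiv> group_ideal D emb G"
abbreviation Pd :: "('k, ('k, 'n gl_index) dpoly) dalg" where "Pd \<equiv> dp_alg d"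
abbreviation A :: "('k, ('k, 'n gl_index) dpoly set) dhopf" where "A \<equiv> coord_ring d D emb G"

definition cl :: "('k, 'n gl_index) dpoly \<Rightarrow> ('k, 'n gl_index) dpoly set" where
  "cl p = I +>\<^bsub>Pd\<^esub> p"

lemma d_const [simp]: "d 0 = 0" "d 1 = 0"
proof -
  note K = diff_embedding_self[OF deriv]
  show "d 0 = 0" "d 1 = 0" by (rule diff_embedding.D_zero[OF K], rule diff_embedding.D_one[OF K])
qed

lemma dp_const_hom:
  "dp_const (x + y) = dp_const x + (dp_const y :: ('k, 'x) dpoly)"
  "dp_const (x * y) = dp_const x * (dp_const y :: ('k, 'x) dpoly)" "dp_const 1 = (1 :: ('k, 'x) dpoly)"
  by (simp_all add: dp_const_def single_add mult_single)

lemma Pd_simps [simp]: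
  "carrier Pd = UNIV" "x \<otimes>\<^bsub>Pd\<^esub> y = x * y" "\<one>\<^bsub>Pd\<^esub> = 1" "\<zero>\<^bsub>Pd\<^esub> = 0" "x \<oplus>\<^bsub>Pd\<^esub> y = x + y"
  "c \<odot>\<^bsub>Pd\<^esub> x = dp_const c * x" "der Pd = dp_der d"
  by (simp_all add: dp_alg_def)

lemma cring_Pd: "cring Pd" and kvs_Pd: "kvs Pd"
proof -
  have ab: "abelian_group Pd"
    by (rule abelian_groupI) (auto intro: exI[of _ "- x" for x])
  show "cring Pd" by (rule cringI[OF ab comm_monoidI]) (auto simp: algebra_simps)
  show "kvs Pd" by (rule kvsI[OF ab]) (auto simp: algebra_simps dp_const_hom)
qed

lemma Pd_minus [simp]: "x \<ominus>\<^bsub>Pd\<^esub> y = x - y"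
proof -
  interpret cring Pd by (rule cring_Pd)
  have "\<ominus>\<^bsub>Pd\<^esub> y = - y" by (rule minus_equality) simp_all
  then show ?thesis by (simp add: a_minus_def)
qed

lemma I_iff: "p \<in> I \<longleftrightarrow> (\<forall>g\<in>G. ev g p = 0)"
  by (simp add: group_ideal_def)

lemma I_submodule: "submodule I kring Pd"
  unfolding submodule_iff[OF kvs_Pd] by (simp add: I_iff dp_eval_add dp_eval_mult)

lemma I_ideal: "ideal I Pd"
proof -
  interpret cring Pd by (rule cring_Pd)
  show ?thesis
    by (rule idealI[OF cring.axioms(1)[OF cring_Pd] submodule.axioms(1)[OF I_submodule]]) (simp_all add: I_iff dp_eval_mult)
qed

lemma mem_cl: "x \<in> cl p \<longleftrightarrow> (\<forall>g\<in>G. ev g x = ev g p)"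
proof -
  have "x \<in> cl p \<longleftrightarrow> (\<exists>h\<in>I. x = h + p)" by (simp add: cl_def a_r_coset_def')
  also have "\<dots> \<longleftrightarrow> x - p \<in> I" by (metis add_diff_cancel_right' diff_add_cancel)
  also have "\<dots> \<longleftrightarrow> (\<forall>g\<in>G. ev g x = ev g p)" by (simp add: I_iff dp_eval_diff)
  finally show ?thesis .
qed

lemma cl_eq_iff: "cl p = cl q \<longleftrightarrow> (\<forall>g\<in>G. ev g p = ev g q)"
  by (auto simp: set_eq_iff mem_cl)

lemma A_fields:
  "carrier A = carrier (quot_mod Pd I)" "mult A = mult (quot_mod Pd I)" "\<one>\<^bsub>A\<^esub> = \<one>\<^bsub>quot_mod Pd I\<^esub>"
  "\<zero>\<^bsub>A\<^esub> = \<zero>\<^bsub>quot_mod Pd I\<^esub>" "add A = add (quot_mod Pd I)" "module.smult A = module.smult (quot_mod Pd I)"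
  "der A = (\<lambda>C. \<Union>x\<in>C. I +>\<^bsub>Pd\<^esub> der Pd x)"
  by (simp_all add: coord_ring_def coord_dalg_def quot_dalg_def Let_def)

lemma A_simps [simp]:
  "carrier A = range cl" "cl p \<otimes>\<^bsub>A\<^esub> cl q = cl (p * q)" "\<one>\<^bsub>A\<^esub> = cl 1" "\<zero>\<^bsub>A\<^esub> = cl 0"
  "cl p \<oplus>\<^bsub>A\<^esub> cl q = cl (p + q)" "c \<odot>\<^bsub>A\<^esub> cl p = cl (dp_const c * p)" "der A (cl p) = cl (dp_der d p)"
proof -
  note q = quot_mod_simps[OF kvs_Pd I_submodule]
  show "carrier A = range cl" by (simp add: A_fields q(1) cl_def[abs_def])
  show "\<zero>\<^bsub>A\<^esub> = cl 0" by (simp add: A_fields q(2) cl_def)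
  show "\<one>\<^bsub>A\<^esub> = cl 1" by (simp add: A_fields quot_mod_def FactRing_def cl_def)
  show "cl p \<oplus>\<^bsub>A\<^esub> cl q = cl (p + q)" using q(3)[of p q] by (simp add: A_fields cl_def)
  show "c \<odot>\<^bsub>A\<^esub> cl p = cl (dp_const c * p)" using q(4)[of p c] by (simp add: A_fields cl_def)
  show "cl p \<otimes>\<^bsub>A\<^esub> cl q = cl (p * q)"
    using ideal.rcoset_mult_add[OF I_ideal, of p q] by (simp add: A_fields quot_mod_def FactRing_def cl_def)
  have "(\<Union>x\<in>cl p. I +>\<^bsub>Pd\<^esub> der Pd x) = cl (dp_der d p)"
  proof (rule SUP_eq_const)
    have "p \<in> cl p" by (simp add: mem_cl)
    then show "cl p \<noteq> {}" by blast
    fix x assume "x \<in> cl p"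
    then have "cl (dp_der d x) = cl (dp_der d p)" by (simp add: mem_cl cl_eq_iff dp_eval_der)
    then show "I +>\<^bsub>Pd\<^esub> der Pd x = cl (dp_der d p)" by (simp add: cl_def)
  qed
  then show "der A (cl p) = cl (dp_der d p)" by (simp add: A_fields)
qed

definition eval_at :: "'u ^ 'n ^ 'n \<Rightarrow> ('k, 'n gl_index) dpoly set \<Rightarrow> 'u" where
  "eval_at g a = ev g (SOME p. a = cl p)"

lemma eval_at_cl [simp]: "g \<in> G \<Longrightarrow> eval_at g (cl p) = ev g p"
  unfolding eval_at_def by (rule someI2[of _ p]) (auto simp: cl_eq_iff)

text \<open>A is by construction a ring of functions on G: its ideal consists of all differential
  polynomials that vanish there.\<close>

lemma A_eqI: "a \<in> carrier A \<Longrightarrow> b \<in> carrier A \<Longrightarrow> (\<And>g. g \<in> G \<Longrightarrow> eval_at g a = eval_at g b) \<Longrightarrow> a = b"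
  unfolding A_simps(1) by (elim rangeE) (simp add: cl_eq_iff)

lemma dk_algebra_A: "dk_algebra d A"
proof (rule dk_algebra_embedded[OF dk_algebra_ext[OF diff_embedding_axioms], of A G eval_at])
  show "a = b" if "a \<in> carrier A" "b \<in> carrier A" "\<And>g. g \<in> G \<Longrightarrow> eval_at g a = eval_at g b" for a b
    using that by (rule A_eqI)
qed (auto simp: dp_eval_add dp_eval_mult dp_eval_der)

lemma kvs_A [simp]: "kvs A"
  by (rule dk_algebraD(1)[OF dk_algebra_A])

lemma eval_at_hom: "g \<in> G \<Longrightarrow> eval_at g \<in> dk_hom A (ext_dalg emb D)"
  by (auto simp: dk_hom_iff dp_eval_add dp_eval_mult dp_eval_der)

lemma group_closed: "mat 1 \<in> G" "g \<in> G \<Longrightarrow> h \<in> G \<Longrightarrow> g ** h \<in> G" "g \<in> G \<Longrightarrow> det g \<noteq> 0"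
  using grp by (auto simp: linear_diff_alg_group_def invertible_det_nz)

abbreviation coord :: "'n \<Rightarrow> 'n \<Rightarrow> ('k, 'n gl_index) dpoly set" where
  "coord i j \<equiv> cl (dp_var (Entry i j))"

lemma eval_at_coord: "g \<in> G \<Longrightarrow> eval_at g (coord i j) = g $ i $ j"
  by (simp add: gl_point_def)

text \<open>A is a quotient of a differential polynomial ring, so \<open>dp_eval_generic\<close> and
  \<open>dp_eval_hom\<close> turn \<phi> into evaluation at the images of the
  indeterminates.\<close>

lemma hom_cl:
  assumes e: "diff_embedding d e E" and \<phi>: "\<phi> \<in> dk_hom A (ext_dalg e E)"
  shows "\<phi> (cl p) = dp_eval e E (\<lambda>i. \<phi> (cl (dp_var i))) p"
    and "\<phi> (cl (p + q)) = \<phi> (cl p) + \<phi> (cl q)" "\<phi> (cl (p * q)) = \<phi> (cl p) * \<phi> (cl q)" "\<phi> (cl 1) = 1"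
    "\<phi> (cl 0) = 0" "\<phi> (cl (dp_const c)) = e c"
proof -
  interpret E: diff_embedding d e E by fact
  note h = \<phi>[unfolded dk_hom_iff]
  show add: "\<phi> (cl (p + q)) = \<phi> (cl p) + \<phi> (cl q)" and mult: "\<phi> (cl (p * q)) = \<phi> (cl p) * \<phi> (cl q)"
    and one: "\<phi> (cl 1) = 1" for p q
    using h by (simp_all flip: A_simps(2,5))
  show zero: "\<phi> (cl 0) = 0" using add[of 0 0] by simp
  show const: "\<phi> (cl (dp_const c)) = e c" for c
  proof -
    have "\<phi> (c \<odot>\<^bsub>A\<^esub> cl 1) = e c * \<phi> (cl 1)" using h by (simp del: A_simps(6))
    then show ?thesis using one by simp
  qed
  have der: "\<phi> (cl (dp_der d p)) = E (\<phi> (cl p))" for p using h by (simp flip: A_simps(7))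
  have "\<phi> (cl (dp_eval dp_const (dp_der d) dp_var p)) = dp_eval e E (\<lambda>i. \<phi> (cl (dp_var i))) p"
    by (rule dp_eval_hom[where \<psi> = "\<lambda>p. \<phi> (cl p)"]) (simp_all add: add mult one zero const der)
  then show "\<phi> (cl p) = dp_eval e E (\<lambda>i. \<phi> (cl (dp_var i))) p"
    by (simp add: dp_eval_generic)
qed

text \<open>The point has the images of the x_ij as entries. The class of \<open>InvDet\<close> is
  an inverse of the determinant in A, which makes the matrix invertible; the defining equations of G
  hold as identities in A, so \<phi> carries them to equations for the matrix.\<close>

lemma point_of_hom:
  assumes \<phi>: "\<phi> \<in> dk_hom A (ext_dalg emb D)"
  shows "\<exists>g. g \<in> G \<and> (\<forall>a\<in>carrier A. \<phi> a = eval_at g a)"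
proof -
  note h = hom_cl[OF diff_embedding_axioms \<phi>]
  define g where "g = (\<chi> i j. \<phi> (coord i j))"
  define \<Delta> where "\<Delta> = (det (\<chi> i j. dp_var (Entry i j)) :: ('k, 'n gl_index) dpoly)"
  have det_ev: "ev k \<Delta> = det k" for k
    unfolding \<Delta>_def by (subst hom_det[of "ev k"]) (simp_all add: dp_eval_add dp_eval_mult gl_point_def)
  have "\<phi> (cl \<Delta>) = det g"
    unfolding \<Delta>_def g_def by (subst hom_det[of "\<lambda>p. \<phi> (cl p)"]) (simp_all add: h(2-5))
  moreover have "cl (dp_var InvDet * \<Delta>) = cl 1"
    unfolding cl_eq_iff by (simp add: dp_eval_mult det_ev gl_point_def group_closed(3))
  then have "\<phi> (cl (dp_var InvDet)) * \<phi> (cl \<Delta>) = 1" by (metis h(3,4))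
  ultimately have y: "\<phi> (cl (dp_var InvDet)) * det g = 1" by simp
  then have "det g \<noteq> 0" by auto
  then have inv: "invertible g" by (simp add: invertible_det_nz)
  have "\<phi> (cl (dp_var InvDet)) = inverse (det g)" using y \<open>det g \<noteq> 0\<close> by (simp add: field_simps)
  then have gp: "(\<lambda>i. \<phi> (cl (dp_var i))) = gl_point g"
    by (auto simp: gl_point_def g_def fun_eq_iff split: gl_index.split)
  obtain S :: "('k, 'n \<times> 'n) dpoly set" where
    S: "G = {g. invertible g \<and> (\<forall>p \<in> S. dp_eval emb D (\<lambda>(i, j). g $ i $ j) p = 0)}"
    using grp by (auto simp: linear_diff_alg_group_def)
  have gS: "dp_eval emb D (\<lambda>(i, j). g $ i $ j) p = 0" if p: "p \<in> S" for p
  proof -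
    \<comment> \<open>The equations of G are written in variables indexed by pairs;
      \<open>p'\<close> is the same equation in the variables \<open>Entry i j\<close>.\<close>
    define p' :: "('k, 'n gl_index) dpoly" where
      "p' = dp_eval dp_const (dp_der d) (\<lambda>(i, j). dp_var (Entry i j)) p"
    have ev': "ev k p' = dp_eval emb D (\<lambda>(i, j). k $ i $ j) p" for k
      unfolding p'_def
      by (subst dp_eval_hom[where \<psi> = "ev k" and D' = D and emb' = emb])
        (simp_all add: dp_eval_add dp_eval_mult dp_eval_der gl_point_def case_prod_unfold)
    have "cl p' = cl 0" unfolding cl_eq_iff ev' using p S by auto
    then have "\<phi> (cl p') = 0" using h(5) by simp
    moreover have "\<phi> (cl p') = ev g p'" using h(1)[of p'] unfolding gp .
    ultimately show ?thesis using ev'[of g] by simp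
  qed
  have gi: "invertible g \<and> (\<forall>p \<in> S. dp_eval emb D (\<lambda>(i, j). g $ i $ j) p = 0)"
    by (rule conjI[OF inv], rule ballI, rule gS)
  have gG: "g \<in> G" unfolding S by (rule CollectI, rule gi)
  have "\<phi> a = eval_at g a" if "a \<in> carrier A" for a
  proof -
    obtain p where p: "a = cl p" using \<open>a \<in> carrier A\<close> unfolding A_simps(1) by (rule rangeE)
    show ?thesis unfolding p eval_at_cl[OF gG] h(1)[of p] gp ..
  qed
  then show ?thesis using gG by (intro exI[of _ g]) simp
qed

subsection \<open>Points separate tensor products\<close>

text \<open>The abstract properties of a specialisation from the algebraic closure to
  \<open>'u\<close>. It is a relation rather than a map, since it relates the constant term of a
  series to the image of the whole series.\<close>

definition lifts :: "('u alg_closure \<Rightarrow> 'u \<Rightarrow> bool) \<Rightarrow> bool" where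
  "lifts R \<longleftrightarrow> (\<forall>w v w' v'. R w v \<longrightarrow> R w' v' \<longrightarrow> R (w + w') (v + v') \<and> R (w * w') (v * v')) \<and>
     (\<forall>w v. R w v \<longrightarrow> w \<noteq> 0 \<longrightarrow> v \<noteq> 0)"

lemma liftsD:
  assumes "lifts R"
  shows "R w v \<Longrightarrow> R w' v' \<Longrightarrow> R (w + w') (v + v')" "R w v \<Longrightarrow> R w' v' \<Longrightarrow> R (w * w') (v * v')"
    "R w v \<Longrightarrow> w \<noteq> 0 \<Longrightarrow> v \<noteq> 0"
  using assms unfolding lifts_def by simp_all

lemma embedding_to_ac: "field_embedding (\<lambda>c. to_ac (emb c))"
  by (simp add: field_embedding_def emb_add emb_mult)

lemma CHAR_0: "CHAR('u) = 0" "CHAR('u alg_closure) = 0"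
proof -
  have "of_nat n \<noteq> (0 :: 'u)" if "n > 0" for n
  proof
    assume "of_nat n = (0 :: 'u)"
    then have 0: "emb (of_nat n) = 0" by (simp add: emb_of_nat)
    have "emb (of_nat n * inverse (of_nat n)) = 1" using that by simp
    then show False unfolding emb_mult 0 by simp
  qed
  then show "CHAR('u) = 0" by (simp add: CHAR_eq0_iff)
  then show "CHAR('u alg_closure) = 0" by simp
qed

text \<open>Finitely many points over the algebraic closure, with no compatibility with the derivations,
  specialise to points of \<open>G\<close>: pass to Taylor series, which are differential points over a field of
  Laurent series, and embed the differential field generated by their coordinates into \<open>'u\<close>.\<close>

lemma lift_points:
  fixes \<gamma> :: "nat \<Rightarrow> ('k, 'n gl_index) dpoly set \<Rightarrow> 'u alg_closure"
  assumes "\<And>i. i < n \<Longrightarrow> \<gamma> i \<in> alg_points (\<lambda>c. to_ac (emb c)) A"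
  shows "\<exists>R g. lifts R \<and> (\<forall>i<n. g i \<in> G) \<and> (\<forall>i<n. \<forall>a\<in>carrier A. R (\<gamma> i a) (eval_at (g i) a))"
proof -
  let ?\<iota> = "\<lambda>c. to_ac (emb c)"
  let ?e = "const_taylor d ?\<iota>"
  have e: "diff_embedding d ?e fls_deriv"
    by (rule diff_embedding_taylor[OF CHAR_0(2) deriv embedding_to_ac])
  interpret E: diff_embedding d ?e fls_deriv by (rule e)
  define \<tau> where "\<tau> i a = fps_to_fls (taylor A (\<gamma> i) a)" for i a
  have \<tau>: "\<tau> i \<in> dk_hom A (ext_dalg ?e fls_deriv)" if "i < n" for i
    unfolding \<tau>_def[abs_def] by (rule taylor_dk_hom[OF CHAR_0(2) dk_algebra_A embedding_to_ac assms[OF that]])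
  \<comment> \<open>Finitely many generators: the Taylor series of the coordinates, 1/det included,
    of all the given points. One embedding has to serve all points at once, since tensors mix their
    values.\<close>
  define B where "B = (\<lambda>(i, x). \<tau> i (cl (dp_var x))) ` ({..<n} \<times> UNIV)"
  have finB: "finite B" unfolding B_def by (intro finite_imageI finite_cartesian_product finite_gl_index) simp
  obtain F t where
    F: "is_subfield F" "\<And>c. ?e c \<in> F" "B \<subseteq> F" "\<And>x. x \<in> F \<Longrightarrow> fls_deriv x \<in> F"
    and t: "\<And>x y. x \<in> F \<Longrightarrow> y \<in> F \<Longrightarrow> t (x + y) = t x + t y"
    "\<And>x y. x \<in> F \<Longrightarrow> y \<in> F \<Longrightarrow> t (x * y) = t x * t y"
    "t 1 = 1" "\<And>c. t (?e c) = emb c" "\<And>x. x \<in> F \<Longrightarrow> t (fls_deriv x) = D (t x)"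
  proof (rule semi_universal_embedding[OF su e finB], goal_cases)
    case prems: (1 F t)
    show ?case by (rule prems(1)[of F t]) (fact prems)+
  qed
  have \<tau>F: "\<tau> i a \<in> F" if i: "i < n" and a: "a \<in> carrier A" for i a
  proof -
    obtain p where p: "a = cl p" using a by auto
    have "dp_eval ?e fls_deriv (\<lambda>x. \<tau> i (cl (dp_var x))) p \<in> F"
    proof (rule E.dp_eval_in)
      show "\<tau> i (cl (dp_var x)) \<in> F" for x using F(3) i by (auto simp: B_def)
    qed (use F is_subfieldD[OF F(1)] in auto)
    then show ?thesis using hom_cl(1)[OF e \<tau>[OF i], of p] p by simp
  qed
  have ex: "\<exists>g. g \<in> G \<and> (\<forall>a\<in>carrier A. t (\<tau> i a) = eval_at g a)" if i: "i < n" for i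
  proof -
    have hom: "(\<lambda>a. t (\<tau> i a)) \<in> dk_hom A (ext_dalg emb D)"
      using \<tau>[OF i] \<tau>F[OF i] t F(2) hom_cl(6)[OF e \<tau>[OF i]] unfolding dk_hom_iff by simp
    show ?thesis by (rule point_of_hom[OF hom])
  qed
  define g where "g i = (SOME g. g \<in> G \<and> (\<forall>a\<in>carrier A. t (\<tau> i a) = eval_at g a))" for i
  have g: "g i \<in> G" "a \<in> carrier A \<Longrightarrow> t (\<tau> i a) = eval_at (g i) a" if "i < n" for i a
    using someI_ex[OF ex[OF that], folded g_def] by auto
  \<comment> \<open>A power series links its constant term, which is the value at the original
    point, to its image in \<open>'u\<close>, which is the value at the differential point. If the
    constant term is nonzero, so is the series, and a homomorphism of fields preserves this.\<close>
  define R where "R w v \<longleftrightarrow> (\<exists>f. fps_to_fls f \<in> F \<and> fps_nth f 0 = w \<and> t (fps_to_fls f) = v)" for w v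
  have "lifts R"
    unfolding lifts_def
  proof (intro conjI allI impI)
    fix w v w' v' assume "R w v" "R w' v'"
    then obtain f f' where f: "fps_to_fls f \<in> F" "fps_nth f 0 = w" "t (fps_to_fls f) = v"
      "fps_to_fls f' \<in> F" "fps_nth f' 0 = w'" "t (fps_to_fls f') = v'" by (auto simp: R_def)
    show "R (w + w') (v + v')" unfolding R_def
      by (rule exI[of _ "f + f'"]) (use f t(1) is_subfieldD(3)[OF F(1)] in simp)
    show "R (w * w') (v * v')" unfolding R_def
      by (rule exI[of _ "f * f'"]) (use f t(2) is_subfieldD(4)[OF F(1)] in \<open>simp add: fls_times_fps_to_fls\<close>)
  next
    fix w v assume "R w v" "w \<noteq> 0"
    then obtain f where f: "fps_to_fls f \<in> F" "fps_nth f 0 \<noteq> 0" "t (fps_to_fls f) = v" by (auto simp: R_def)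
    then have "fps_to_fls f \<noteq> 0" by auto
    then have "t (fps_to_fls f) * t (inverse (fps_to_fls f)) = 1"
      using t(2)[OF f(1) is_subfieldD(7)[OF F(1) f(1)]] t(3) by simp
    then show "v \<noteq> 0" using f(3) by auto
  qed
  moreover have "R (\<gamma> i a) (eval_at (g i) a)" if "i < n" "a \<in> carrier A" for i a
    unfolding R_def
    by (rule exI[of _ "taylor A (\<gamma> i) a"])
      (use g(2)[OF that] \<tau>F[OF that] in \<open>simp add: \<tau>_def taylor_nth_0[OF CHAR_0(2) dk_algebra_A embedding_to_ac assms[OF that(1)]]\<close>)
  ultimately show ?thesis using g(1) by (intro exI[of _ R] exI[of _ g] conjI allI ballI impI)
qed

abbreviation "ac_points \<equiv> alg_points (\<lambda>c. to_ac (emb c)) A"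

text \<open>Separation comes from the points of G over \<open>'u\<close>; admitting all other
  algebra points makes the set stable under automorphisms of the closure.\<close>

lemma ac_points:
  "ac_points \<subseteq> lin_to (\<lambda>c. to_ac (emb c)) A" "separating A ac_points"
  "t \<in> field_auts (\<lambda>c. to_ac (emb c)) \<Longrightarrow> h \<in> ac_points \<Longrightarrow> (\<lambda>x. t (h x)) \<in> ac_points"
proof -
  show "ac_points \<subseteq> lin_to (\<lambda>c. to_ac (emb c)) A" by (auto simp: alg_points_def)
  show "separating A ac_points"
    unfolding separating_def
  proof (intro ballI impI)
    fix a assume a: "a \<in> carrier A" "a \<noteq> \<zero>\<^bsub>A\<^esub>"
    then obtain p where p: "a = cl p" "cl p \<noteq> cl 0" unfolding A_simps(1,4) by (elim rangeE) simp
    then obtain g where "g \<in> G" "ev g p \<noteq> 0" unfolding cl_eq_iff by auto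
    then have g: "g \<in> G" "eval_at g a \<noteq> 0" using p by simp_all
    have "(\<lambda>a. to_ac (eval_at g a)) \<in> ac_points"
      using g(1) by (auto simp: alg_points_def lin_to_def dp_eval_add dp_eval_mult)
    then show "\<exists>h\<in>ac_points. h a \<noteq> 0" using g(2) by (intro bexI[of _ "\<lambda>a. to_ac (eval_at g a)"]) simp
  qed
  assume s: "t \<in> field_auts (\<lambda>c. to_ac (emb c))" and h: "h \<in> ac_points"
  have "t 1 = 1" using s field_embeddingD(3)[OF embedding_to_ac] unfolding field_auts_def by (metis (mono_tags, lifting) mem_Collect_eq)
  moreover have "h (cl (dp_const c)) = to_ac (emb c)" for c
  proof -
    have "h (c \<odot>\<^bsub>A\<^esub> cl 1) = to_ac (emb c) * h (cl 1)" "h (cl 1) = 1"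
      using h by (simp_all add: alg_points_def lin_to_def del: A_simps(6))
    then show ?thesis by simp
  qed
  ultimately show "(\<lambda>x. t (h x)) \<in> ac_points"
    using s h unfolding field_auts_def alg_points_def lin_to_def by simp
qed

lemma ac_points_separate:
  assumes "z \<in> carrier (tensor A A)" "z \<noteq> \<zero>\<^bsub>tensor A A\<^esub>"
  shows "\<exists>g\<in>ac_points. \<exists>h\<in>ac_points. tensor_eval A A g h z \<noteq> 0"
proof (rule tensor_eval_separates[OF CHAR_0(2) embedding_to_ac kvs_A kvs_A ac_points(1,2) ac_points(1,2)])
  fix t h assume "t \<in> field_auts (\<lambda>c. to_ac (emb c))" "h \<in> ac_points"
  then show "(\<lambda>x. t (h x)) \<in> ac_points" by (rule ac_points(3))
qed (rule assms)+

lemma eval_at_lin_to: "g \<in> G \<Longrightarrow> eval_at g \<in> lin_to emb A"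
  by (auto simp: lin_to_def dp_eval_add dp_eval_mult)

abbreviation "eval2 g h \<equiv> tensor_eval A A (eval_at g) (eval_at h)"
abbreviation "eval3 g h l \<equiv> tensor_eval A (tensor A A) (eval_at g) (eval2 h l)"

lemma eval2_lin_to: "g \<in> G \<Longrightarrow> h \<in> G \<Longrightarrow> eval2 g h \<in> lin_to emb (tensor A A)"
  by (rule tensor_eval_lin_to[OF kvs_A kvs_A eval_at_lin_to eval_at_lin_to])

text \<open>Some pair over the closure detects \<open>z\<close> by
  \<open>ac_points_separate\<close>; both members are lifted by one relation \<open>R\<close>, which
  carries the nonzero value to a nonzero value at two points of G.\<close>

lemma eval2_separates:
  assumes z: "z \<in> carrier (tensor A A)" "\<And>g h. g \<in> G \<Longrightarrow> h \<in> G \<Longrightarrow> eval2 g h z = 0"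
  shows "z = \<zero>\<^bsub>tensor A A\<^esub>"
proof (rule ccontr)
  assume "z \<noteq> \<zero>\<^bsub>tensor A A\<^esub>"
  then obtain g' h' where gh: "g' \<in> ac_points" "h' \<in> ac_points" "tensor_eval A A g' h' z \<noteq> 0"
    using ac_points_separate[OF z(1)] by blast
  have "(\<lambda>i. if i = 0 then g' else h') i \<in> ac_points" for i :: nat using gh by simp
  from lift_points[of 2 "\<lambda>i. if i = 0 then g' else h'", OF this] obtain R g where R': "lifts R \<and> (\<forall>i<2::nat. g i \<in> G) \<and>
    (\<forall>i<2::nat. \<forall>a\<in>carrier A. R ((if i = 0 then g' else h') a) (eval_at (g i) a))" by (elim exE)
  have R: "lifts R" "\<And>i. i < 2 \<Longrightarrow> g i \<in> G"
    "\<And>i a. i < 2 \<Longrightarrow> a \<in> carrier A \<Longrightarrow> R ((if i = 0 then g' else h') a) (eval_at (g i) a)"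
    by (rule R'[THEN conjunct1], rule R'[THEN conjunct2, THEN conjunct1, THEN spec, THEN mp], assumption,
        rule R'[THEN conjunct2, THEN conjunct2, THEN spec, THEN mp, THEN bspec], assumption+)
  have "R (tensor_eval A A g' h' z) (eval2 (g 0) (g 1) z)"
    by (rule tensor_eval_rel[OF kvs_A kvs_A subsetD[OF ac_points(1) gh(1)] subsetD[OF ac_points(1) gh(2)]
          eval_at_lin_to[OF R(2)[of 0]] eval_at_lin_to[OF R(2)[of 1]] liftsD(1)[OF R(1)] liftsD(2)[OF R(1)] _ _ z(1)])
      (use R(3)[of 0] R(3)[of 1] in simp_all)
  then have "eval2 (g 0) (g 1) z \<noteq> 0" using liftsD(3)[OF R(1)] gh(3) by blast
  then show False using z(2) R(2) by simp
qed

lemma eval3_separates: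
  assumes z: "z \<in> carrier (tensor A (tensor A A))"
    "\<And>g h l. g \<in> G \<Longrightarrow> h \<in> G \<Longrightarrow> l \<in> G \<Longrightarrow> eval3 g h l z = 0"
  shows "z = \<zero>\<^bsub>tensor A (tensor A A)\<^esub>"
proof (rule ccontr)
  let ?\<iota> = "\<lambda>c. to_ac (emb c)"
  assume "z \<noteq> \<zero>\<^bsub>tensor A (tensor A A)\<^esub>"
  \<comment> \<open>\<open>tensor_eval\<close> is unspecified outside the carrier, so
    \<open>Y\<close> is taken closed under agreement on the carrier; this is what makes its
    stability under automorphisms provable.\<close>
  define Y where "Y = {f \<in> lin_to ?\<iota> (tensor A A). \<exists>h\<in>ac_points. \<exists>l\<in>ac_points. \<forall>z\<in>carrier (tensor A A).
    f z = tensor_eval A A h l z}"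
  have YI: "tensor_eval A A h l \<in> Y" if "h \<in> ac_points" "l \<in> ac_points" for h l
    using that tensor_eval_lin_to[OF kvs_A kvs_A subsetD[OF ac_points(1)] subsetD[OF ac_points(1)]]
    unfolding Y_def by blast
  have Y1: "Y \<subseteq> lin_to ?\<iota> (tensor A A)" by (auto simp: Y_def)
  have Y2: "separating (tensor A A) Y"
    unfolding separating_def
  proof (intro ballI impI)
    fix y assume "y \<in> carrier (tensor A A)" "y \<noteq> \<zero>\<^bsub>tensor A A\<^esub>"
    then obtain g' h' where "g' \<in> ac_points" "h' \<in> ac_points" "tensor_eval A A g' h' y \<noteq> 0"
      using ac_points_separate by blast
    then show "\<exists>f\<in>Y. f y \<noteq> 0" using YI by blast
  qed
  have Y3: "(\<lambda>x. t (f x)) \<in> Y" if t: "t \<in> field_auts ?\<iota>" and f: "f \<in> Y" for t f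
  proof -
    obtain h l where hl: "h \<in> ac_points" "l \<in> ac_points" "\<And>z. z \<in> carrier (tensor A A) \<Longrightarrow> f z = tensor_eval A A h l z"
      using f unfolding Y_def by blast
    note thl = ac_points(3)[OF t hl(1)] ac_points(3)[OF t hl(2)]
    note l1 = subsetD[OF ac_points(1) hl(1)] subsetD[OF ac_points(1) hl(2)]
    note l2 = subsetD[OF ac_points(1) thl(1)] subsetD[OF ac_points(1) thl(2)]
    have "t (f z) = tensor_eval A A (\<lambda>x. t (h x)) (\<lambda>x. t (l x)) z" if z: "z \<in> carrier (tensor A A)" for z
      unfolding hl(3)[OF z]
      using z
    proof (induction z rule: tensor_induct[OF kvs_A kvs_A, consumes 1, case_names tmul add])
      case (tmul x y)
      then show ?case using t unfolding tensor_eval_tmul[OF kvs_A kvs_A l1 tmul] tensor_eval_tmul[OF kvs_A kvs_A l2 tmul]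
        by (simp add: field_auts_def)
    next
      case (add z z')
      then show ?case using t unfolding tensor_eval_add[OF kvs_A kvs_A l1 add.hyps] tensor_eval_add[OF kvs_A kvs_A l2 add.hyps]
        by (simp add: field_auts_def)
    qed
    moreover have "(\<lambda>x. t (f x)) \<in> lin_to ?\<iota> (tensor A A)"
      using f t unfolding Y_def lin_to_def field_auts_def by simp
    ultimately show ?thesis using thl unfolding Y_def by blast
  qed
  \<comment> \<open>Separation once more, now with evaluations at pairs as the points of the second
    factor A \<otimes> A.\<close>
  have "\<exists>g\<in>ac_points. \<exists>f\<in>Y. tensor_eval A (tensor A A) g f z \<noteq> 0"
  proof (rule tensor_eval_separates[OF CHAR_0(2) embedding_to_ac kvs_A kvs_tensor[OF kvs_A kvs_A] ac_points(1,2) Y1 Y2])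
    fix t f assume "t \<in> field_auts ?\<iota>" "f \<in> Y"
    then show "(\<lambda>x. t (f x)) \<in> Y" by (rule Y3)
  qed (rule z(1), rule \<open>z \<noteq> _\<close>)
  then obtain g' f where gf: "g' \<in> ac_points" "f \<in> Y" "tensor_eval A (tensor A A) g' f z \<noteq> 0" by blast
  obtain h' l' where hl: "h' \<in> ac_points" "l' \<in> ac_points" "\<And>z. z \<in> carrier (tensor A A) \<Longrightarrow> f z = tensor_eval A A h' l' z"
    using gf(2) unfolding Y_def by blast
  have "(\<lambda>i. if i = 0 then g' else if i = 1 then h' else l') i \<in> ac_points" for i :: nat using gf hl by simp
  from lift_points[of 3 "\<lambda>i. if i = 0 then g' else if i = 1 then h' else l'", OF this] obtain R g where R': "lifts R \<and> (\<forall>i<3::nat. g i \<in> G) \<and>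
    (\<forall>i<3::nat. \<forall>a\<in>carrier A. R ((if i = 0 then g' else if i = 1 then h' else l') a) (eval_at (g i) a))" by (elim exE)
  have R: "lifts R" "\<And>i. i < 3 \<Longrightarrow> g i \<in> G"
    "\<And>i a. i < 3 \<Longrightarrow> a \<in> carrier A \<Longrightarrow> R ((if i = 0 then g' else if i = 1 then h' else l') a) (eval_at (g i) a)"
    by (rule R'[THEN conjunct1], rule R'[THEN conjunct2, THEN conjunct1, THEN spec, THEN mp], assumption,
        rule R'[THEN conjunct2, THEN conjunct2, THEN spec, THEN mp, THEN bspec], assumption+)
  have R2: "R (f y) (eval2 (g 1) (g 2) y)" if y: "y \<in> carrier (tensor A A)" for y
    unfolding hl(3)[OF y]
    by (rule tensor_eval_rel[OF kvs_A kvs_A subsetD[OF ac_points(1) hl(1)] subsetD[OF ac_points(1) hl(2)]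
          eval_at_lin_to[OF R(2)[of 1]] eval_at_lin_to[OF R(2)[of 2]] liftsD(1)[OF R(1)] liftsD(2)[OF R(1)] _ _ y])
      (use R(3)[of 1] R(3)[of 2] in simp_all)
  have G0: "R (g' a) (eval_at (g 0) a)" if "a \<in> carrier A" for a
    using R(3)[of 0 a, OF _ that] by simp
  have "R (tensor_eval A (tensor A A) g' f z) (eval3 (g 0) (g 1) (g 2) z)"
    by (rule tensor_eval_rel[where R = R and g = g' and h = f and g' = "eval_at (g 0)" and h' = "eval2 (g 1) (g 2)",
          OF kvs_A kvs_tensor[OF kvs_A kvs_A] subsetD[OF ac_points(1) gf(1)] subsetD[OF Y1 gf(2)]
          eval_at_lin_to[OF R(2)[of 0]] eval2_lin_to[OF R(2)[of 1] R(2)[of 2]] liftsD(1)[OF R(1)] liftsD(2)[OF R(1)]])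
      (simp, simp, simp, assumption, assumption, assumption, assumption, erule G0, erule R2, rule z(1))
  then have "eval3 (g 0) (g 1) (g 2) z \<noteq> 0" using liftsD(3)[OF R(1)] gf(3) by blast
  then show False using z(2) R(2) by simp
qed

end

subsection \<open>The bialgebra structure\<close>

definition left_slice ::
  "('k::field, 'a, 'm) module_scheme \<Rightarrow> ('k, 'b, 'n) module_scheme \<Rightarrow> ('a \<Rightarrow> 'k) \<Rightarrow> ('a \<times> 'b \<Rightarrow> 'k) set \<Rightarrow> 'b"
  where "left_slice M N u = tlift M N N (\<lambda>x y. u x \<odot>\<^bsub>N\<^esub> y)"

lemma left_slice_balanced:
  assumes "kvs M" "kvs N" "u \<in> lin M kmod"
  shows "balanced M N N (\<lambda>x y. u x \<odot>\<^bsub>N\<^esub> y)"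
  by (rule balancedI) (use assms in \<open>simp_all add: lin_add lin_smult kvs_smult_distrib mult.commute\<close>)

lemma
  assumes "kvs M" "kvs N" "u \<in> lin M kmod"
  shows left_slice_lin: "left_slice M N u \<in> lin (tensor M N) N"
    and left_slice_tmul: "x \<in> carrier M \<Longrightarrow> y \<in> carrier N \<Longrightarrow> left_slice M N u (tmul M N x y) = u x \<odot>\<^bsub>N\<^esub> y"
  unfolding left_slice_def
  using assms by (auto intro!: tlift_lin tlift_tmul left_slice_balanced simp: kvs_smult_distrib lin_smult)

text \<open>The interface between the two halves: it is established by means of points of G, and the
  theory of comodules is developed from it without mentioning G.\<close>

locale diff_bialgebra =
  fixes d :: "'k::field \<Rightarrow> 'k" and A :: "('k, 'a) dhopf" (structure)
  assumes dk: "dk_algebra d A"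
    and comult_hom: "comult A \<in> dk_hom A (tensor_dalg A A)"
    and counit_hom: "counit A \<in> dk_hom A (ext_dalg id d)"
    and coassoc: "a \<in> carrier A \<Longrightarrow>
      tensor_assoc A A (tmap A A (tensor A A) A (comult A) id (comult A a)) =
      tmap A A A (tensor A A) id (comult A) (comult A a)"
    and counit_right: "a \<in> carrier A \<Longrightarrow> slice A A (counit A) (comult A a) = a"
    and counit_left: "a \<in> carrier A \<Longrightarrow> left_slice A A (counit A) (comult A a) = a"

lemma tensor_cong:
  assumes "carrier M = carrier M'" "add M = add M'" "module.smult M = module.smult M'"
    and "carrier N = carrier N'" "add N = add N'" "module.smult N = module.smult N'"
  shows "tensor M N = tensor M' N'" "tmul M N = tmul M' N'"
  by (simp_all add: tensor_def tmul_def tensor_rel_def assms fun_eq_iff)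

lemma tlift_cong:
  assumes "tensor M N = tensor M' N'" "tmul M N = tmul M' N'" "carrier M = carrier M'" "carrier N = carrier N'"
  shows "tlift M N = tlift M' N'"
  by (simp add: tlift_def assms fun_eq_iff)

section \<open>The comultiplication and the counit as functions on points\<close>

context diff_group begin

lemma emb_field_embedding: "field_embedding emb"
  by (simp add: field_embedding_def emb_add emb_mult)

lemmas eval2_tmul = tensor_eval_tmul[OF kvs_A kvs_A eval_at_lin_to eval_at_lin_to]
  and eval2_add = tensor_eval_add[OF kvs_A kvs_A eval_at_lin_to eval_at_lin_to]
  and eval2_add_hom = tensor_eval_add_hom[OF kvs_A kvs_A eval_at_lin_to eval_at_lin_to]
  and eval2_mult = tensor_eval_dk(1)[OF dk_algebra_A dk_algebra_A diff_embedding_axioms eval_at_hom eval_at_hom]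
  and eval3_tmul = tensor_eval_tmul[OF kvs_A kvs_tensor[OF kvs_A kvs_A] eval_at_lin_to eval2_lin_to]
  and eval3_add = tensor_eval_add[OF kvs_A kvs_tensor[OF kvs_A kvs_A] eval_at_lin_to eval2_lin_to]
  and eval3_add_hom = tensor_eval_add_hom[OF kvs_A kvs_tensor[OF kvs_A kvs_A] eval_at_lin_to eval2_lin_to]

lemma eval2_der:
  assumes "g \<in> G" "h \<in> G" and z: "z \<in> carrier (tensor A A)"
  shows "eval2 g h (der (tensor_dalg A A) z) = D (eval2 g h z)"
  by (rule tensor_eval_dk(2)[OF dk_algebra_A dk_algebra_A diff_embedding_axioms
        eval_at_hom[OF assms(1)] eval_at_hom[OF assms(2)] z z])

lemma kring_diff: "(a :: 'w::field) \<ominus>\<^bsub>kring\<^esub> b = a - b"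
  by (simp add: a_minus_def)

lemma tensor2_eqI:
  assumes z: "z \<in> carrier (tensor A A)" and w: "w \<in> carrier (tensor A A)"
    and "\<And>g h. g \<in> G \<Longrightarrow> h \<in> G \<Longrightarrow> eval2 g h z = eval2 g h w"
  shows "z = w"
proof -
  have T: "abelian_group (tensor A A)" by simp
  have "z \<ominus>\<^bsub>tensor A A\<^esub> w = \<zero>\<^bsub>tensor A A\<^esub>"
  proof (rule eval2_separates)
    show "eval2 g h (z \<ominus>\<^bsub>tensor A A\<^esub> w) = 0" if "g \<in> G" "h \<in> G" for g h
      using add_hom_diff[OF eval2_add_hom[OF that] T abelian_group_kring z w] assms(3)[OF that]
      by (simp add: kring_diff)
  qed (use T z w in simp)
  then show ?thesis using ag_diff_eq_zero[OF T z w] by simp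
qed

lemma tensor3_eqI:
  assumes z: "z \<in> carrier (tensor A (tensor A A))" and w: "w \<in> carrier (tensor A (tensor A A))"
    and "\<And>g h l. g \<in> G \<Longrightarrow> h \<in> G \<Longrightarrow> l \<in> G \<Longrightarrow> eval3 g h l z = eval3 g h l w"
  shows "z = w"
proof -
  have T: "abelian_group (tensor A (tensor A A))" by simp
  have "z \<ominus>\<^bsub>tensor A (tensor A A)\<^esub> w = \<zero>\<^bsub>tensor A (tensor A A)\<^esub>"
  proof (rule eval3_separates)
    show "eval3 g h l (z \<ominus>\<^bsub>tensor A (tensor A A)\<^esub> w) = 0" if "g \<in> G" "h \<in> G" "l \<in> G" for g h l
      using add_hom_diff[OF eval3_add_hom[OF that] T abelian_group_kring z w] assms(3)[OF that]
      by (simp add: kring_diff)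
  qed (use T z w in simp)
  then show ?thesis using ag_diff_eq_zero[OF T z w] by simp
qed

text \<open>\<open>z\<close> represents the function (g, h) \<mapsto> a(gh) on pairs of points; by
  \<open>tensor2_eqI\<close> it is determined by this.\<close>

definition coproduct_of :: "('k, 'n gl_index) dpoly set \<Rightarrow> (('k, 'n gl_index) dpoly set \<times> ('k, 'n gl_index) dpoly set \<Rightarrow> 'k) set \<Rightarrow> bool" where
  "coproduct_of a z \<longleftrightarrow> z \<in> carrier (tensor A A) \<and> (\<forall>g\<in>G. \<forall>h\<in>G. eval2 g h z = eval_at (g ** h) a)"

lemma coproduct_of_coord: "coproduct_of (coord i j) (finsum (tensor A A) (\<lambda>l. tmul A A (coord i l) (coord l j)) UNIV)"
  unfolding coproduct_of_def
proof (intro conjI ballI)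
  have c: "tmul A A (coord i l) (coord l j) \<in> carrier (tensor A A)" for l by simp
  interpret T: abelian_group "tensor A A" by simp
  show "finsum (tensor A A) (\<lambda>l. tmul A A (coord i l) (coord l j)) UNIV \<in> carrier (tensor A A)"
    using c by (intro T.finsum_closed) auto
  fix g h assume g: "g \<in> G" and h: "h \<in> G"
  have "eval2 g h (finsum (tensor A A) (\<lambda>l. tmul A A (coord i l) (coord l j)) UNIV) =
      (\<Sum>l\<in>UNIV. eval2 g h (tmul A A (coord i l) (coord l j)))"
    by (rule lin_to_finsum(2)[OF eval2_lin_to[OF g h] kvs_tensor[OF kvs_A kvs_A] emb_field_embedding finite c])
  also have "\<dots> = (g ** h) $ i $ j"
    using g h by (simp add: eval2_tmul eval_at_coord matrix_matrix_mult_def del: eval_at_cl)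
  finally show "eval2 g h (finsum (tensor A A) (\<lambda>l. tmul A A (coord i l) (coord l j)) UNIV) = eval_at (g ** h) (coord i j)"
    using eval_at_coord[OF group_closed(2)[OF g h]] by simp
qed

text \<open>The elements whose function of gh is represented by a tensor are closed under the
  operations of a differential algebra, so generators suffice: matrix entries by the formula for
  matrix products, \<open>InvDet\<close> by multiplicativity of the determinant.\<close>

lemma coproduct_exists: "\<exists>z. coproduct_of (cl p) z"
proof (rule dpoly_generate[where d = d and P = "\<lambda>p. \<exists>z. coproduct_of (cl p) z"])
  fix p q assume "\<exists>z. coproduct_of (cl p) z" "\<exists>z. coproduct_of (cl q) z"
  then obtain z w where zw: "coproduct_of (cl p) z" "coproduct_of (cl q) w" by blast
  then show "\<exists>z. coproduct_of (cl (p + q)) z"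
    by (intro exI[of _ "z \<oplus>\<^bsub>tensor A A\<^esub> w"])
      (auto simp: coproduct_of_def eval2_add group_closed(2) dp_eval_add)
  show "\<exists>z. coproduct_of (cl (p * q)) z"
    using zw by (intro exI[of _ "z \<otimes>\<^bsub>tensor_dalg A A\<^esub> w"])
      (auto simp: coproduct_of_def eval2_mult group_closed(2) dp_eval_mult tensor_mult_closed[OF dk_algebra_A dk_algebra_A])
next
  fix p assume "\<exists>z. coproduct_of (cl p) z"
  then obtain z where z: "coproduct_of (cl p) z" by blast
  then show "\<exists>z. coproduct_of (cl (dp_der d p)) z"
    using add_hom_closed[OF tensor_der_hom[OF dk_algebra_A dk_algebra_A]]
    by (intro exI[of _ "der (tensor_dalg A A) z"])
      (auto simp: coproduct_of_def eval2_der group_closed(2) dp_eval_der)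
next
  fix c show "\<exists>z. coproduct_of (cl (dp_const c)) z"
    by (rule exI[of _ "tmul A A (cl (dp_const c)) (cl 1)"])
      (auto simp: coproduct_of_def eval2_tmul group_closed(2))
next
  fix i show "\<exists>z. coproduct_of (cl (dp_var i)) z"
  proof (cases i)
    case (Entry i j)
    then show ?thesis using coproduct_of_coord by blast
  next
    case InvDet
    then show ?thesis
      by (intro exI[of _ "tmul A A (cl (dp_var InvDet)) (cl (dp_var InvDet))"])
        (auto simp: coproduct_of_def eval2_tmul group_closed(2) gl_point_def det_mul)
  qed
qed simp_all

text \<open>The chosen representatives are determined by their values at pairs of points, so every
  law of a homomorphism reduces to a law for values in \<open>'u\<close>.\<close>

lemma coproduct_hom_exists:
  "\<exists>\<Delta>. \<Delta> \<in> dk_hom A (tensor_dalg A A) \<and>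
    (\<forall>i j. \<Delta> (coord i j) = finsum (tensor A A) (\<lambda>l. tmul A A (coord i l) (coord l j)) UNIV)"
proof -
  define \<Delta> where "\<Delta> a = (SOME z. coproduct_of a z)" for a
  have "\<exists>z. coproduct_of a z" if "a \<in> carrier A" for a
    using that coproduct_exists unfolding A_simps(1) by (elim rangeE) simp
  from someI_ex[OF this] have \<Delta>: "coproduct_of a (\<Delta> a)" if "a \<in> carrier A" for a
    using that by (simp add: \<Delta>_def)
  have \<Delta>c: "\<Delta> (cl p) \<in> carrier (tensor A A)" and \<Delta>e: "g \<in> G \<Longrightarrow> h \<in> G \<Longrightarrow> eval2 g h (\<Delta> (cl p)) = ev (g ** h) p" for p g h
    using \<Delta>[of "cl p"] by (simp_all add: coproduct_of_def group_closed(2))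
  have "\<Delta> \<in> dk_hom A (tensor_dalg A A)"
    unfolding dk_hom_iff A_simps(1) tensor_dalg_simps(1)
  proof (intro conjI ballI allI; (elim rangeE)?; (hypsubst)?)
    show "\<Delta> (cl p) \<in> carrier (tensor A A)" for p by (rule \<Delta>c)
    show "\<Delta> \<one>\<^bsub>A\<^esub> = \<one>\<^bsub>tensor_dalg A A\<^esub>"
      by (rule tensor2_eqI) (simp_all add: \<Delta>c \<Delta>e eval2_tmul)
    show "\<Delta> (cl p \<otimes>\<^bsub>A\<^esub> cl q) = \<Delta> (cl p) \<otimes>\<^bsub>tensor_dalg A A\<^esub> \<Delta> (cl q)" for p q
      by (rule tensor2_eqI) (simp_all add: \<Delta>c \<Delta>e eval2_mult dp_eval_mult tensor_mult_closed[OF dk_algebra_A dk_algebra_A])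
    show "\<Delta> (cl p \<oplus>\<^bsub>A\<^esub> cl q) = \<Delta> (cl p) \<oplus>\<^bsub>tensor_dalg A A\<^esub> \<Delta> (cl q)" for p q
      by (rule tensor2_eqI) (simp_all add: \<Delta>c \<Delta>e eval2_add dp_eval_add)
    show "\<Delta> (c \<odot>\<^bsub>A\<^esub> cl p) = c \<odot>\<^bsub>tensor_dalg A A\<^esub> \<Delta> (cl p)" for c p
    proof (rule tensor2_eqI)
      fix g h assume g: "g \<in> G" and h: "h \<in> G"
      have "eval2 g h (c \<odot>\<^bsub>tensor A A\<^esub> \<Delta> (cl p)) = emb c * eval2 g h (\<Delta> (cl p))"
        using eval2_lin_to[OF g h] \<Delta>c[of p] by (simp add: lin_to_def)
      then show "eval2 g h (\<Delta> (c \<odot>\<^bsub>A\<^esub> cl p)) = eval2 g h (c \<odot>\<^bsub>tensor_dalg A A\<^esub> \<Delta> (cl p))"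
        using g h by (simp add: \<Delta>e dp_eval_mult)
    qed (simp_all add: \<Delta>c)
    show "\<Delta> (der A (cl p)) = der (tensor_dalg A A) (\<Delta> (cl p))" for p
      by (rule tensor2_eqI) (simp_all add: \<Delta>c \<Delta>e eval2_der dp_eval_der
          add_hom_closed[OF tensor_der_hom[OF dk_algebra_A dk_algebra_A]])
  qed
  moreover have "\<Delta> (coord i j) = finsum (tensor A A) (\<lambda>l. tmul A A (coord i l) (coord l j)) UNIV" for i j
    using coproduct_of_coord[of i j] \<Delta>[of "coord i j"] by (intro tensor2_eqI) (simp_all add: coproduct_of_def)
  ultimately show ?thesis by blast
qed

text \<open>The unit matrix has entries in k, so the values of elements of A at it lie in the image
  of k; \<epsilon> reads them off.\<close>

lemma counit_hom_exists:
  "\<exists>\<epsilon>. \<epsilon> \<in> dk_hom A (ext_dalg id d) \<and> (\<forall>i j. \<epsilon> (coord i j) = (if i = j then 1 else 0))"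
proof -
  define \<delta> :: "'n gl_index \<Rightarrow> 'k" where "\<delta> x = (case x of Entry i j \<Rightarrow> if i = j then 1 else 0 | InvDet \<Rightarrow> 1)" for x
  have K: "diff_embedding d id d" using diff_embedding_self[OF deriv] by (simp add: id_def)
  have "(\<lambda>x. emb (\<delta> x)) = gl_point (mat 1)"
  proof
    fix x :: "'n gl_index"
    have "(mat 1 :: 'u ^ 'n ^ 'n) $ i $ j = (if i = j then 1 else 0)" for i j by (simp add: mat_def)
    then show "emb (\<delta> x) = gl_point (mat 1) x" by (cases x) (simp_all add: \<delta>_def gl_point_def det_I)
  qed
  then have "emb (dp_eval id d \<delta> p) = ev (mat 1) p" for p
    using dp_eval_hom[of emb d D id emb \<delta> p] by (simp add: emb_add emb_mult D_emb)
  then have ex: "\<exists>c. emb c = eval_at (mat 1) (cl p)" for p using group_closed(1) by (intro exI[of _ "dp_eval id d \<delta> p"]) simp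
  define \<epsilon> where "\<epsilon> a = (SOME c. emb c = eval_at (mat 1) a)" for a
  have \<epsilon>: "emb (\<epsilon> (cl p)) = ev (mat 1) p" for p using someI_ex[OF ex, folded \<epsilon>_def] group_closed(1) by simp
  have inj: "x = y" if "emb x = emb y" for x y
  proof -
    have "emb (x - y) = 0" using that emb_add[of x "- y"] by (simp add: emb_minus)
    then show ?thesis using field_embeddingD(7)[OF emb_field_embedding] by simp
  qed
  have "\<epsilon> \<in> dk_hom A (ext_dalg id d)"
    unfolding dk_hom_iff A_simps(1)
    by (intro conjI ballI allI; (elim rangeE)?; (hypsubst)?; (rule inj)?)
      (simp_all add: \<epsilon> dp_eval_add dp_eval_mult dp_eval_der emb_add emb_mult flip: D_emb)
  moreover have "\<epsilon> (coord i j) = (if i = j then 1 else 0)" for i j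
    by (rule inj) (simp add: \<epsilon> gl_point_def mat_def)
  ultimately show ?thesis by blast
qed

lemma comult_counit_spec:
  "comult A \<in> dk_hom A (tensor_dalg A A)"
  "comult A (coord i j) = finsum (tensor A A) (\<lambda>l. tmul A A (coord i l) (coord l j)) UNIV"
  "counit A \<in> dk_hom A (ext_dalg id d)" "counit A (coord i j) = (if i = j then 1 else 0)"
proof -
  let ?A = "coord_dalg d D emb G"
  \<comment> \<open>\<open>comult\<close> and \<open>counit\<close> are defined over the smaller
    record \<open>coord_dalg\<close>, which has the same operations as \<open>A\<close>; the
    constructions derived from the two records have to be identified first.\<close>
  have fields: "carrier A = carrier ?A" "mult A = mult ?A" "one A = one ?A" "zero A = zero ?A" "add A = add ?A"
    "module.smult A = module.smult ?A" "der A = der ?A"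
    by (simp_all add: coord_ring_def Let_def)
  have cf: "coord_fun d D emb G i j = coord i j" for i j by (simp add: coord_fun_def cl_def)
  have t: "tensor ?A ?A = tensor A A" "tmul ?A ?A = tmul A A"
    by (rule tensor_cong(1)[symmetric]; rule fields) (rule tensor_cong(2)[symmetric]; rule fields)
  have tl: "tlift ?A ?A = tlift A A"
    by (rule tlift_cong[OF t fields(1)[symmetric] fields(1)[symmetric]])
  have td: "tensor_dalg ?A ?A = tensor_dalg A A"
    by (simp only: tensor_dalg_def t tl fields)
  have dh1: "dk_hom ?A (tensor_dalg A A) = dk_hom A (tensor_dalg A A)" "dk_hom ?A (ext_dalg id d) = dk_hom A (ext_dalg id d)"
    by (auto simp: dk_hom_iff fields simp del: A_simps)
  have "comult A = (SOME \<Delta>. \<Delta> \<in> dk_hom A (tensor_dalg A A) \<and>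
    (\<forall>i j. \<Delta> (coord i j) = finsum (tensor A A) (\<lambda>l. tmul A A (coord i l) (coord l j)) UNIV))"
    by (subst coord_ring_def) (simp add: Let_def t td dh1 cf)
  with someI_ex[OF coproduct_hom_exists]
  show "comult A \<in> dk_hom A (tensor_dalg A A)"
    "comult A (coord i j) = finsum (tensor A A) (\<lambda>l. tmul A A (coord i l) (coord l j)) UNIV" by auto
  have "counit A = (SOME \<epsilon>. \<epsilon> \<in> dk_hom A (ext_dalg id d) \<and> (\<forall>i j. \<epsilon> (coord i j) = (if i = j then 1 else 0)))"
    by (subst coord_ring_def) (simp add: Let_def dh1 cf)
  with someI_ex[OF counit_hom_exists]
  show "counit A \<in> dk_hom A (ext_dalg id d)" "counit A (coord i j) = (if i = j then 1 else 0)" by auto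
qed

text \<open>\<Delta> followed by evaluation at (g, h) is a differential homomorphism from A to
  \<open>'u\<close>, so it is a point of G; comparing the x_ij shows that this point is gh.\<close>

lemma eval2_comult:
  assumes g: "g \<in> G" and h: "h \<in> G" and a: "a \<in> carrier A"
  shows "eval2 g h (comult A a) = eval_at (g ** h) a"
proof -
  note c = comult_counit_spec(1)[unfolded dk_hom_iff]
  have cc: "comult A a \<in> carrier (tensor A A)" if "a \<in> carrier A" for a
    using c[THEN conjunct1, THEN bspec, OF that] by simp
  have one: "eval2 g h (tmul A A (cl 1) (cl 1)) = 1" using g h by (simp add: eval2_tmul)
  have sm: "eval2 g h (c \<odot>\<^bsub>tensor A A\<^esub> z) = emb c * eval2 g h z" if "z \<in> carrier (tensor A A)" for c z
    using eval2_lin_to[OF g h] that by (simp add: lin_to_def)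
  have "(\<lambda>a. eval2 g h (comult A a)) \<in> dk_hom A (ext_dalg emb D)"
    unfolding dk_hom_iff
    by (intro conjI ballI allI) (use c one g h in \<open>simp_all del: A_simps(1,2,5,6,7) add: cc eval2_mult eval2_add eval2_der sm\<close>)
  from point_of_hom[OF this] obtain k where k: "k \<in> G" "\<And>a. a \<in> carrier A \<Longrightarrow> eval2 g h (comult A a) = eval_at k a"
    by blast
  have "k $ i $ j = (g ** h) $ i $ j" for i j
    using coproduct_of_coord[of i j] k(2)[of "coord i j"] eval_at_coord[OF k(1), of i j]
      eval_at_coord[OF group_closed(2)[OF g h], of i j] g h
    by (simp add: coproduct_of_def comult_counit_spec(2))
  then have "k = g ** h" by (simp add: vec_eq_iff)
  then show ?thesis using k(2)[OF a] by simp
qed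

lemma emb_counit:
  assumes a: "a \<in> carrier A"
  shows "emb (counit A a) = eval_at (mat 1) a"
proof -
  note c = comult_counit_spec(3)[unfolded dk_hom_iff]
  have "(\<lambda>a. emb (counit A a)) \<in> dk_hom A (ext_dalg emb D)"
    unfolding dk_hom_iff
    by (intro conjI ballI allI) (use c in \<open>simp_all del: A_simps(1,2,5,6,7) add: emb_add emb_mult D_emb\<close>)
  from point_of_hom[OF this] obtain k where k: "k \<in> G" "\<And>a. a \<in> carrier A \<Longrightarrow> emb (counit A a) = eval_at k a"
    by blast
  have "k $ i $ j = mat 1 $ i $ j" for i j
    using k(2)[of "coord i j"] eval_at_coord[OF k(1), of i j] by (simp add: comult_counit_spec(4) mat_def split: if_splits)
  then have "k = mat 1" by (simp add: vec_eq_iff)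
  then show ?thesis using k(2)[OF a] by simp
qed

end

lemma add_hom_comp_ring: "f \<in> add_hom M N \<Longrightarrow> g \<in> add_hom N P \<Longrightarrow> (\<lambda>x. g (f x)) \<in> add_hom M P"
  by (simp add: add_hom_iff)

context diff_group begin

lemma comult_lin: "comult A \<in> lin A (tensor A A)" and counit_lin: "counit A \<in> lin A kmod"
  using comult_counit_spec(1,3) by (simp_all add: dk_hom_def lin_def add_hom_iff)

lemma eval3_assoc:
  assumes g: "g \<in> G" "h \<in> G" "l \<in> G" and z: "z \<in> carrier (tensor (tensor A A) A)"
  shows "eval3 g h l (tensor_assoc A A z) = tensor_eval (tensor A A) A (eval2 g h) (eval_at l) z"
proof -
  note ah = tensor_assoc_hom[OF kvs_A kvs_A]
  have AA: "kvs (tensor A A)" by simp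
  note e = tensor_eval_tmul[OF AA kvs_A eval2_lin_to[OF g(1,2)] eval_at_lin_to[OF g(3)]]
    tensor_eval_add_hom[OF AA kvs_A eval2_lin_to[OF g(1,2)] eval_at_lin_to[OF g(3)]]
  have pure: "eval3 g h l (tensor_assoc A A (tmul (tensor A A) A y b)) = eval2 g h y * eval_at l b"
    if y: "y \<in> carrier (tensor A A)" and b: "b \<in> carrier A" for y b
    using y
  proof (induction y rule: tensor_induct[OF kvs_A kvs_A, consumes 1, case_names tmul add])
    case (tmul x x')
    have t: "tmul A A x' b \<in> carrier (tensor A A)" using tmul b by (simp del: A_simps)
    show ?case
      using tensor_assoc_tmul[OF kvs_A kvs_A tmul b] eval3_tmul[OF g tmul(1) t]
        eval2_tmul[OF g(2,3) tmul(2) b] eval2_tmul[OF g(1,2) tmul] by simp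
  next
    case (add y y')
    have c: "tmul (tensor A A) A y b \<in> carrier (tensor (tensor A A) A)" "tmul (tensor A A) A y' b \<in> carrier (tensor (tensor A A) A)"
      using add.hyps b by (simp_all del: A_simps)
    show ?case
      using add.IH tmul_add_left[OF AA kvs_A add.hyps b] add_hom_add[OF ah c]
        eval3_add[OF g add_hom_closed[OF ah c(1)] add_hom_closed[OF ah c(2)]] eval2_add[OF g(1,2) add.hyps]
      by (simp add: distrib_right)
  qed
  show ?thesis
    by (rule tensor_ext[OF AA kvs_A add_hom_comp_ring[OF ah eval3_add_hom[OF g]] e(2) _ z]) (simp add: pure e(1))
qed

lemma eval3_coassoc:
  assumes g: "g \<in> G" "h \<in> G" "l \<in> G" and z: "z \<in> carrier (tensor A A)"
  shows "eval3 g h l (tensor_assoc A A (tmap A A (tensor A A) A (comult A) id z)) = eval2 (g ** h) l z"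
    and "eval3 g h l (tmap A A A (tensor A A) id (comult A) z) = eval2 g (h ** l) z"
proof -
  have AA: "kvs (tensor A A)" by simp
  note tl = tmap_lin[OF kvs_A kvs_A AA kvs_A comult_lin lin_id(1)]
    and tt = tmap_tmul[OF kvs_A kvs_A AA kvs_A comult_lin lin_id(1)]
  note e = tensor_eval_tmul[OF AA kvs_A eval2_lin_to[OF g(1,2)] eval_at_lin_to[OF g(3)]]
    tensor_eval_add_hom[OF AA kvs_A eval2_lin_to[OF g(1,2)] eval_at_lin_to[OF g(3)]]
  have "tensor_eval (tensor A A) A (eval2 g h) (eval_at l) (tmap A A (tensor A A) A (comult A) id z) = eval2 (g ** h) l z"
  proof (rule tensor_ext[OF kvs_A kvs_A add_hom_comp_ring[OF lin_add_hom[OF tl] e(2)] eval2_add_hom[OF group_closed(2)[OF g(1,2)] g(3)] _ z])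
    fix x y assume xy: "x \<in> carrier A" "y \<in> carrier A"
    show "tensor_eval (tensor A A) A (eval2 g h) (eval_at l) (tmap A A (tensor A A) A (comult A) id (tmul A A x y)) =
        eval2 (g ** h) l (tmul A A x y)"
      unfolding tt[OF xy] id_apply e(1)[OF lin_closed[OF comult_lin xy(1)] xy(2)] eval2_comult[OF g(1,2) xy(1)]
        eval2_tmul[OF group_closed(2)[OF g(1,2)] g(3) xy] ..
  qed
  then show "eval3 g h l (tensor_assoc A A (tmap A A (tensor A A) A (comult A) id z)) = eval2 (g ** h) l z"
    using eval3_assoc[OF g lin_closed[OF tl z]] by simp
  note tl2 = tmap_lin[OF kvs_A kvs_A kvs_A AA lin_id(1) comult_lin]
    and tt2 = tmap_tmul[OF kvs_A kvs_A kvs_A AA lin_id(1) comult_lin]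
  show "eval3 g h l (tmap A A A (tensor A A) id (comult A) z) = eval2 g (h ** l) z"
  proof (rule tensor_ext[OF kvs_A kvs_A add_hom_comp_ring[OF lin_add_hom[OF tl2] eval3_add_hom[OF g]] eval2_add_hom[OF g(1) group_closed(2)[OF g(2,3)]] _ z])
    fix x y assume xy: "x \<in> carrier A" "y \<in> carrier A"
    show "eval3 g h l (tmap A A A (tensor A A) id (comult A) (tmul A A x y)) = eval2 g (h ** l) (tmul A A x y)"
      unfolding tt2[OF xy] id_apply eval3_tmul[OF g xy(1) lin_closed[OF comult_lin xy(2)]] eval2_comult[OF g(2,3) xy(2)]
        eval2_tmul[OF g(1) group_closed(2)[OF g(2,3)] xy] ..
  qed
qed

lemma eval_at_slice:
  assumes g: "g \<in> G" and z: "z \<in> carrier (tensor A A)"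
  shows "eval_at g (slice A A (counit A) z) = eval2 g (mat 1) z"
    and "eval_at g (left_slice A A (counit A) z) = eval2 (mat 1) g z"
proof -
  note s = slice_lin[OF kvs_A kvs_A counit_lin] slice_tmul[OF kvs_A kvs_A counit_lin]
  note l = left_slice_lin[OF kvs_A kvs_A counit_lin] left_slice_tmul[OF kvs_A kvs_A counit_lin]
  note one = group_closed(1)
  have ea: "eval_at g \<in> add_hom A kring" using eval_at_lin_to[OF g] unfolding lin_to_def add_hom_iff by simp
  have es: "eval_at g (c \<odot>\<^bsub>A\<^esub> x) = emb c * eval_at g x" if "x \<in> carrier A" for c x
    using eval_at_lin_to[OF g] that unfolding lin_to_def by blast
  show "eval_at g (slice A A (counit A) z) = eval2 g (mat 1) z"
  proof (rule tensor_ext[OF kvs_A kvs_A add_hom_comp_ring[OF lin_add_hom[OF s(1)] ea] eval2_add_hom[OF g one] _ z])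
    fix x y assume xy: "x \<in> carrier A" "y \<in> carrier A"
    show "eval_at g (slice A A (counit A) (tmul A A x y)) = eval2 g (mat 1) (tmul A A x y)"
      unfolding s(2)[OF xy] es[OF xy(1)] emb_counit[OF xy(2)] eval2_tmul[OF g one xy] by (rule mult.commute)
  qed
  show "eval_at g (left_slice A A (counit A) z) = eval2 (mat 1) g z"
  proof (rule tensor_ext[OF kvs_A kvs_A add_hom_comp_ring[OF lin_add_hom[OF l(1)] ea] eval2_add_hom[OF one g] _ z])
    fix x y assume xy: "x \<in> carrier A" "y \<in> carrier A"
    show "eval_at g (left_slice A A (counit A) (tmul A A x y)) = eval2 (mat 1) g (tmul A A x y)"
      unfolding l(2)[OF xy] es[OF xy(2)] emb_counit[OF xy(1)] eval2_tmul[OF one g xy] ..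
  qed
qed

text \<open>At points of G the axioms become associativity of the matrix product and neutrality of
  the unit matrix.\<close>

theorem diff_bialgebra_A: "diff_bialgebra d A"
proof
  show "dk_algebra d A" by (rule dk_algebra_A)
  show "comult A \<in> dk_hom A (tensor_dalg A A)" "counit A \<in> dk_hom A (ext_dalg id d)"
    by (rule comult_counit_spec)+
  have AA: "kvs (tensor A A)" by simp
  fix a assume a: "a \<in> carrier A"
  note c = lin_closed[OF comult_lin a]
  show "tensor_assoc A A (tmap A A (tensor A A) A (comult A) id (comult A a)) =
      tmap A A A (tensor A A) id (comult A) (comult A a)"
  proof (rule tensor3_eqI)
    show "tensor_assoc A A (tmap A A (tensor A A) A (comult A) id (comult A a)) \<in> carrier (tensor A (tensor A A))"
      by (rule add_hom_closed[OF tensor_assoc_hom[OF kvs_A kvs_A] lin_closed[OF tmap_lin[OF kvs_A kvs_A AA kvs_A comult_lin lin_id(1)] c]])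
    show "tmap A A A (tensor A A) id (comult A) (comult A a) \<in> carrier (tensor A (tensor A A))"
      by (rule lin_closed[OF tmap_lin[OF kvs_A kvs_A kvs_A AA lin_id(1) comult_lin] c])
    fix g h l assume g: "g \<in> G" "h \<in> G" "l \<in> G"
    show "eval3 g h l (tensor_assoc A A (tmap A A (tensor A A) A (comult A) id (comult A a))) =
        eval3 g h l (tmap A A A (tensor A A) id (comult A) (comult A a))"
      unfolding eval3_coassoc[OF g c] eval2_comult[OF group_closed(2)[OF g(1,2)] g(3) a]
        eval2_comult[OF g(1) group_closed(2)[OF g(2,3)] a] by (simp add: matrix_mul_assoc)
  qed
  show "slice A A (counit A) (comult A a) = a"
  proof (rule A_eqI[OF lin_closed[OF slice_lin[OF kvs_A kvs_A counit_lin] c] a])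
    fix g assume g: "g \<in> G"
    show "eval_at g (slice A A (counit A) (comult A a)) = eval_at g a"
      unfolding eval_at_slice(1)[OF g c] eval2_comult[OF g group_closed(1) a] by simp
  qed
  show "left_slice A A (counit A) (comult A a) = a"
  proof (rule A_eqI[OF lin_closed[OF left_slice_lin[OF kvs_A kvs_A counit_lin] c] a])
    fix g assume g: "g \<in> G"
    show "eval_at g (left_slice A A (counit A) (comult A a)) = eval_at g a"
      unfolding eval_at_slice(2)[OF g c] eval2_comult[OF group_closed(1) g a] by simp
  qed
qed

text \<open>The generators are the classes of the indeterminates, 1/det among them. A subalgebra
  with all their derivatives contains every class by \<open>dpoly_generate_jets\<close>.\<close>

lemma finitely_generated_A: "finitely_generated_dk_algebra d A"
  unfolding finitely_generated_dk_algebra_def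
proof (intro conjI dk_algebra_A exI[of _ "range (\<lambda>i. cl (dp_var i))"] allI impI)
  show "finite (range (\<lambda>i. cl (dp_var i)))" using finite_gl_index by (rule finite_imageI)
  show "range (\<lambda>i. cl (dp_var i)) \<subseteq> carrier A" by auto
  fix B assume B: "subring B A \<and> (\<forall>c. \<forall>x\<in>B. c \<odot>\<^bsub>A\<^esub> x \<in> B) \<and>
    (\<forall>s\<in>range (\<lambda>i. cl (dp_var i)). \<forall>m. (der A ^^ m) s \<in> B)"
  then have "subring B A" by blast
  note sr = subringE[OF this]
  have sm: "c \<odot>\<^bsub>A\<^esub> x \<in> B" if "x \<in> B" for c x using B that by blast
  have "cl p \<in> B" for p
  proof (rule dpoly_generate_jets[where d = d and P = "\<lambda>p. cl p \<in> B"])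
    show "cl (p + q) \<in> B" "cl (p * q) \<in> B" if "cl p \<in> B" "cl q \<in> B" for p q
      using sr(6,7)[OF that] by simp_all
    show "cl (dp_const c) \<in> B" for c using sm[of "cl 1" c] sr(3) by simp
    fix r i
    have "(der A ^^ r) (cl p) = cl ((dp_der d ^^ r) p)" for p by (induction r) simp_all
    moreover have "(der A ^^ r) (cl (dp_var i)) \<in> B" using B by blast
    ultimately show "cl ((dp_der d ^^ r) (dp_var i)) \<in> B" by simp
  qed simp_all
  then show "B = carrier A" using sr(1) by auto
qed

end

section \<open>Comodules\<close>

lemma functional_separates:
  fixes M (structure)
  assumes "kvs M" "x \<in> carrier M" "\<And>u. u \<in> lin M kmod \<Longrightarrow> u x = 0"
  shows "x = \<zero>"
proof (rule ccontr)
  assume x: "x \<noteq> \<zero>"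
  have "submodule {\<zero>} kring M" using assms(1) by (simp add: submodule_iff)
  then show False using functional_exists[OF assms(1) _ assms(2), of "{\<zero>}"] assms(3) x by (metis singletonD zero_neq_one)
qed

lemma slice_left_slice:
  assumes M: "kvs M" and N: "kvs N" and u: "u \<in> lin M kmod" and w: "w \<in> lin N kmod" and z: "z \<in> carrier (tensor M N)"
  shows "u (slice M N w z) = w (left_slice M N u z)"
  by (rule tensor_ext[OF M N lin_add_hom[OF lin_comp[OF slice_lin[OF M N w] u]]
        lin_add_hom[OF lin_comp[OF left_slice_lin[OF M N u] w]] _ z])
    (simp add: slice_tmul[OF M N w] left_slice_tmul[OF M N u] lin_smult[OF u] lin_smult[OF w] mult.commute)

text \<open>The functionals may be restricted to a separating family \<open>Y\<close>. This matters
  for tensor products and prolongations of modules, where coefficient functions are computed for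
  functionals of a special form.\<close>

lemma left_slices_separate:
  assumes M: "kvs M" and N: "kvs N" and z: "z \<in> carrier (tensor M N)" and Y: "Y \<subseteq> lin M kmod"
    and sep: "\<And>x. x \<in> carrier M \<Longrightarrow> (\<And>u. u \<in> Y \<Longrightarrow> u x = 0) \<Longrightarrow> x = \<zero>\<^bsub>M\<^esub>"
    and 0: "\<And>u. u \<in> Y \<Longrightarrow> left_slice M N u z = \<zero>\<^bsub>N\<^esub>"
  shows "z = \<zero>\<^bsub>tensor M N\<^esub>"
proof (rule slices_separate[OF M N z], rule sep)
  fix w assume w: "w \<in> lin N kmod"
  show "slice M N w z \<in> carrier M" by (rule lin_closed[OF slice_lin[OF M N w] z])
  fix u assume u: "u \<in> Y"
  show "u (slice M N w z) = 0"
    using slice_left_slice[OF M N subsetD[OF Y u] w z] 0[OF u] add_hom_zero[OF lin_add_hom[OF w]] N by simp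
qed

lemma left_slices_eqI:
  assumes M: "kvs M" and N: "kvs N" and z: "y \<in> carrier (tensor M N)" "z \<in> carrier (tensor M N)" and Y: "Y \<subseteq> lin M kmod"
    and sep: "\<And>x. x \<in> carrier M \<Longrightarrow> (\<And>u. u \<in> Y \<Longrightarrow> u x = 0) \<Longrightarrow> x = \<zero>\<^bsub>M\<^esub>"
    and eq: "\<And>u. u \<in> Y \<Longrightarrow> left_slice M N u y = left_slice M N u z"
  shows "y = z"
proof -
  have T: "abelian_group (tensor M N)" and N': "abelian_group N" using M N by simp_all
  have "y \<ominus>\<^bsub>tensor M N\<^esub> z = \<zero>\<^bsub>tensor M N\<^esub>"
  proof (rule left_slices_separate[OF M N _ Y sep])
    fix u assume u: "u \<in> Y"
    note l = left_slice_lin[OF M N subsetD[OF Y u]]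
    show "left_slice M N u (y \<ominus>\<^bsub>tensor M N\<^esub> z) = \<zero>\<^bsub>N\<^esub>"
      using add_hom_diff[OF lin_add_hom[OF l] T N' z] eq[OF u] N' lin_closed[OF l z(2)] by simp
  qed (use T z in auto)
  then show ?thesis using ag_diff_eq_zero[OF T z] by simp
qed

lemma left_slice_tmap:
  assumes M: "kvs M" and M': "kvs M'" and N: "kvs N" and f: "f \<in> lin M M'" and u: "u \<in> lin M' kmod"
    and z: "z \<in> carrier (tensor M N)"
  shows "left_slice M' N u (tmap M N M' N f id z) = left_slice M N (\<lambda>x. u (f x)) z"
  by (rule tensor_ext[OF M N lin_add_hom[OF lin_comp[OF tmap_lin[OF M N M' N f lin_id(1)] left_slice_lin[OF M' N u]]]
        lin_add_hom[OF left_slice_lin[OF M N lin_comp[OF f u]]] _ z])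
    (simp add: tmap_tmul[OF M N M' N f lin_id(1)] left_slice_tmul[OF M' N u] left_slice_tmul[OF M N lin_comp[OF f u]] lin_closed[OF f])

lemma left_slice_tmap_right:
  assumes M: "kvs M" and N: "kvs N" and N': "kvs N'" and g: "g \<in> lin N N'" and u: "u \<in> lin M kmod"
    and z: "z \<in> carrier (tensor M N)"
  shows "left_slice M N' u (tmap M N M N' id g z) = g (left_slice M N u z)"
  by (rule tensor_ext[OF M N lin_add_hom[OF lin_comp[OF tmap_lin[OF M N M N' lin_id(1) g] left_slice_lin[OF M N' u]]]
        lin_add_hom[OF lin_comp[OF left_slice_lin[OF M N u] g]] _ z])
    (simp add: tmap_tmul[OF M N M N' lin_id(1) g] left_slice_tmul[OF M N' u] left_slice_tmul[OF M N u] lin_closed[OF g] lin_smult[OF g])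

lemma tmul_hom_left: "kvs M \<Longrightarrow> kvs N \<Longrightarrow> y \<in> carrier N \<Longrightarrow> (\<lambda>x. tmul M N x y) \<in> add_hom M (tensor M N)"
  by (rule add_homI) (simp_all add: tmul_add_left)

text \<open>Applying \<open>u\<close> to the first factor leaves an identity in A \<otimes> A, so
  that coassociativity of a coaction \<rho> becomes a statement about the map v \<mapsto> (u
  \<otimes> id)(\<rho> v).\<close>

lemma left_slice_assoc:
  assumes V: "kvs V" and A: "kvs A" and r: "r \<in> lin V (tensor V A)" and u: "u \<in> lin V kmod"
    and s: "s \<in> carrier (tensor V A)"
  shows "left_slice V (tensor A A) u (tensor_assoc V A (tmap V A (tensor V A) A r id s)) =
    tmap V A A A (\<lambda>v. left_slice V A u (r v)) id s"
proof -
  have VA: "kvs (tensor V A)" and AA: "kvs (tensor A A)" using V A by simp_all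
  note l = left_slice_lin[OF V A u] and l2 = left_slice_lin[OF V AA u]
  note th = add_hom_comp[OF tensor_assoc_hom[OF V A] lin_add_hom[OF l2]]
  have pure: "left_slice V (tensor A A) u (tensor_assoc V A (tmul (tensor V A) A y a)) = tmul A A (left_slice V A u y) a"
    if a: "a \<in> carrier A" and y: "y \<in> carrier (tensor V A)" for y a
    by (rule tensor_ext[OF V A add_hom_comp[OF tmul_hom_left[OF VA A a] th] add_hom_comp[OF lin_add_hom[OF l] tmul_hom_left[OF A A a]] _ y])
      (use a A in \<open>simp add: tensor_assoc_tmul[OF V A] left_slice_tmul[OF V AA u] left_slice_tmul[OF V A u] tmul_smult_left\<close>)
  note f = lin_comp[OF r l]
  show ?thesis
    by (rule tensor_ext[OF V A add_hom_comp[OF lin_add_hom[OF tmap_lin[OF V A VA A r lin_id(1)]] th]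
          lin_add_hom[OF tmap_lin[OF V A A A f lin_id(1)]] _ s])
      (simp add: tmap_tmul[OF V A VA A r lin_id(1)] tmap_tmul[OF V A A A f lin_id(1)] pure lin_closed[OF r])
qed

text \<open>For the finiteness theorem, where a functional is applied to the last factor of an
  iterated coproduct.\<close>

lemma slice_assoc:
  assumes A: "kvs A" and w: "w \<in> lin A kmod" and y: "y \<in> carrier (tensor (tensor A A) A)"
  shows "slice (tensor A A) A w y = tmap A (tensor A A) A A id (slice A A w) (tensor_assoc A A y)"
proof -
  have AA: "kvs (tensor A A)" using A by simp
  note s2 = slice_lin[OF AA A w] and s = slice_lin[OF A A w] and t = tmap_lin[OF A AA A A lin_id(1) slice_lin[OF A A w]]
  note th = add_hom_comp[OF tensor_assoc_hom[OF A A] lin_add_hom[OF t]]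
  have pure: "slice (tensor A A) A w (tmul (tensor A A) A z a) = tmap A (tensor A A) A A id (slice A A w) (tensor_assoc A A (tmul (tensor A A) A z a))"
    if a: "a \<in> carrier A" and z: "z \<in> carrier (tensor A A)" for z a
    by (rule tensor_ext[OF A A add_hom_comp[OF tmul_hom_left[OF AA A a] lin_add_hom[OF s2]] add_hom_comp[OF tmul_hom_left[OF AA A a] th] _ z])
      (use a A in \<open>simp add: tensor_assoc_tmul[OF A A] slice_tmul[OF AA A w] slice_tmul[OF A A w]
        tmap_tmul[OF A AA A A lin_id(1) s] tmul_smult_right\<close>)
  show ?thesis
    by (rule tensor_ext[OF AA A lin_add_hom[OF s2] th _ y]) (rule pure)
qed

lemma kvs_embedded:
  fixes M (structure)
  assumes N: "kvs N" and inj: "inj_on \<phi> (carrier M)"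
    and closed: "\<zero> \<in> carrier M" "\<And>x y. x \<in> carrier M \<Longrightarrow> y \<in> carrier M \<Longrightarrow> x \<oplus> y \<in> carrier M"
      "\<And>c x. x \<in> carrier M \<Longrightarrow> c \<odot> x \<in> carrier M"
    and \<phi>: "\<phi> \<in> lin M N" "\<phi> \<zero> = \<zero>\<^bsub>N\<^esub>"
  shows "kvs M"
proof -
  have eqI: "x = y" if "\<phi> x = \<phi> y" "x \<in> carrier M" "y \<in> carrier M" for x y
    using inj_onD[OF inj that] .
  note s = lin_closed[OF \<phi>(1)] lin_add[OF \<phi>(1)] lin_smult[OF \<phi>(1)] \<phi>(2) closed
  have N': "abelian_group N" using N by simp
  show ?thesis
  proof (rule kvsI)
    show "abelian_group M"
    proof (rule abelian_groupI)
      fix x assume x: "x \<in> carrier M"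
      have "(-1) \<odot>\<^bsub>N\<^esub> \<phi> x = \<ominus>\<^bsub>N\<^esub> \<phi> x" using kvs_smult_distrib(4)[OF N s(1)[OF x]] by simp
      then have "(-1) \<odot> x \<oplus> x = \<zero>" by (intro eqI) (simp_all add: s x N')
      then show "\<exists>y\<in>carrier M. y \<oplus> x = \<zero>" using closed(3)[OF x] by blast
    qed (rule closed; assumption | rule eqI; simp add: s ag_ac[OF N'] N')+
  qed (rule closed; assumption | rule eqI; simp add: s kvs_smult_distrib[OF N] N)+
qed

lemma fin_dimI:
  assumes "kvs V" "finite S" "S \<subseteq> carrier V"
    and "\<And>N. submodule N kring V \<Longrightarrow> S \<subseteq> N \<Longrightarrow> carrier V \<subseteq> N"
  shows "fin_dim V"
  unfolding fin_dim_def
  by (intro exI[of _ S] conjI equalityI lspan_subset_carrier assms(1-3) assms(4) submodule_lspan lspan_superset)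

lemma fin_dim_image:
  assumes V: "kvs V" "fin_dim V" and W: "kvs W" and f: "f \<in> lin V W" "f ` carrier V = carrier W"
  shows "fin_dim W"
proof -
  obtain S where S: "finite S" "S \<subseteq> carrier V" "lspan V S = carrier V" using V(2) by (auto simp: fin_dim_def)
  show ?thesis
  proof (rule fin_dimI[OF W, of "f ` S"])
    show "finite (f ` S)" "f ` S \<subseteq> carrier W" using S f(2) by auto
    fix N assume N: "submodule N kring W" "f ` S \<subseteq> N"
    note n = submoduleD[OF W N(1)]
    have "submodule {x \<in> carrier V. f x \<in> N} kring V"
      unfolding submodule_iff[OF V(1)]
      using V(1) W n add_hom_zero[OF lin_add_hom[OF f(1)]] by (auto simp: lin_add[OF f(1)] lin_smult[OF f(1)])
    then have "lspan V S \<subseteq> {x \<in> carrier V. f x \<in> N}" by (rule lspan_minimal) (use S N in auto)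
    then have "f ` carrier V \<subseteq> N" using S(3) by blast
    then show "carrier W \<subseteq> N" using f(2) by simp
  qed
qed

text \<open>A finite spanning set makes V an image of lists of scalars, and a section of this
  surjection embeds V in \<open>'k list\<close>. This is why an injection of \<open>'k list\<close>
  into the carrier type suffices for every module to have a copy there.\<close>

lemma fin_dim_lists:
  fixes V :: "('k::field, 'v, 'm) module_scheme" (structure)
  assumes V: "kvs V" and fd: "fin_dim V"
  obtains \<beta> :: "'v \<Rightarrow> 'k list" where "inj_on \<beta> (carrier V)"
proof -
  obtain S where S: "finite S" "S \<subseteq> carrier V" "lspan V S = carrier V" using fd by (auto simp: fin_dim_def)
  from S(1,2) have "\<exists>g :: 'k list \<Rightarrow> 'v. lspan V S \<subseteq> range g"
  proof (induction S rule: finite_induct)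
    case empty
    have "submodule {\<zero>} kring V" using V by (simp add: submodule_iff)
    then have "lspan V {} \<subseteq> {\<zero>}" by (rule lspan_minimal) simp
    then show ?case by (intro exI[of _ "\<lambda>_. \<zero>"]) auto
  next
    case (insert s S)
    then obtain g :: "'k list \<Rightarrow> 'v" where g: "lspan V S \<subseteq> range g" by auto
    have "lspan V (insert s S) \<subseteq> range (\<lambda>l. hd l \<odot> s \<oplus> g (tl l))"
    proof
      fix x assume "x \<in> lspan V (insert s S)"
      then obtain c y where y: "y \<in> lspan V S" "x = c \<odot> s \<oplus> y"
        using lspan_insert[OF V, of s S] insert.prems by auto
      obtain l where "y = g l" using g y(1) by auto
      then have "x = hd (c # l) \<odot> s \<oplus> g (tl (c # l))" using y(2) by simp
      then show "x \<in> range (\<lambda>l. hd l \<odot> s \<oplus> g (tl l))" by (rule range_eqI)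
    qed
    then show ?case by (intro exI[of _ "\<lambda>l. hd l \<odot> s \<oplus> g (tl l)"])
  qed
  then obtain g :: "'k list \<Rightarrow> 'v" where g: "carrier V \<subseteq> range g" using S(3) by auto
  show thesis
  proof
    show "inj_on (inv_into UNIV g) (carrier V)" using g by (rule inj_on_inv_into)
  qed
qed

text \<open>The map attached to the functional \<open>u\<close> whose value at v is \<psi>(v
  \<otimes> u).\<close>

definition coeff_fun :: "('k::field, 'a) dhopf \<Rightarrow> ('k, 'v, 'a) gmod \<Rightarrow> ('v \<Rightarrow> 'k) \<Rightarrow> 'v \<Rightarrow> 'a" where
  "coeff_fun A V u v = left_slice V A u (coact V v)"

context diff_bialgebra begin

lemma kvs_alg [simp]: "kvs A" using dk_algebraD(1)[OF dk] .

lemma comult_lin: "comult A \<in> lin A (tensor A A)" and counit_lin: "counit A \<in> lin A kmod"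
  using comult_hom counit_hom by (simp_all add: dk_hom_def lin_def add_hom_iff)

text \<open>The last two facts are the comodule axioms seen through \<open>u\<close>:
  coassociativity says that the coefficient function is a comodule map into A, and the counit law
  that \<epsilon> recovers \<open>u\<close> from it.\<close>

lemma gmoduleD:
  assumes "gmodule A V"
  shows "kvs V" "fin_dim V" "coact V \<in> lin V (tensor V A)"
    and "u \<in> lin V kmod \<Longrightarrow> coeff_fun A V u \<in> lin V A"
    and "u \<in> lin V kmod \<Longrightarrow> v \<in> carrier V \<Longrightarrow> comult A (coeff_fun A V u v) = tmap V A A A (coeff_fun A V u) id (coact V v)"
    and "u \<in> lin V kmod \<Longrightarrow> v \<in> carrier V \<Longrightarrow> counit A (coeff_fun A V u v) = u v"
proof -
  show V: "kvs V" and "fin_dim V" and r: "coact V \<in> lin V (tensor V A)" using assms by (simp_all add: gmodule_def)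
  show c: "coeff_fun A V u \<in> lin V A" if u: "u \<in> lin V kmod" for u
    using lin_comp[OF r left_slice_lin[OF V kvs_alg u]] by (simp add: coeff_fun_def[abs_def])
  have AA: "kvs (tensor A A)" by simp
  assume u: "u \<in> lin V kmod" and v: "v \<in> carrier V"
  note rv = lin_closed[OF r v]
  have "tensor_assoc V A (tmap V A (tensor V A) A (coact V) id (coact V v)) = tmap V A V (tensor A A) id (comult A) (coact V v)"
    using assms v by (simp add: gmodule_def)
  from arg_cong[OF this, of "left_slice V (tensor A A) u"]
  show "comult A (coeff_fun A V u v) = tmap V A A A (coeff_fun A V u) id (coact V v)"
    unfolding left_slice_assoc[OF V kvs_alg r u rv] left_slice_tmap_right[OF V kvs_alg AA comult_lin u rv]
    by (simp add: coeff_fun_def[abs_def])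
  have "slice V A (counit A) (coact V v) = v" using assms v by (simp add: gmodule_def slice_def)
  then show "counit A (coeff_fun A V u v) = u v"
    using slice_left_slice[OF V kvs_alg u counit_lin rv] by (simp add: coeff_fun_def)
qed

text \<open>\<open>V\<close> is a comodule iff \<open>v \<mapsto> (u \<otimes> id) (\<rho> v)\<close> is a comodule map \<open>V \<rightarrow> A\<close> for all \<open>u\<close> in a
  separating set of functionals.\<close>

lemma gmoduleI:
  assumes V: "kvs V" and "fin_dim V" and r: "coact V \<in> lin V (tensor V A)" and Y: "Y \<subseteq> lin V kmod"
    and sep: "\<And>x. x \<in> carrier V \<Longrightarrow> (\<And>u. u \<in> Y \<Longrightarrow> u x = 0) \<Longrightarrow> x = \<zero>\<^bsub>V\<^esub>"
    and co: "\<And>u v. u \<in> Y \<Longrightarrow> v \<in> carrier V \<Longrightarrow> comult A (coeff_fun A V u v) = tmap V A A A (coeff_fun A V u) id (coact V v)"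
    and cu: "\<And>u v. u \<in> Y \<Longrightarrow> v \<in> carrier V \<Longrightarrow> counit A (coeff_fun A V u v) = u v"
  shows "gmodule A V"
  unfolding gmodule_def
proof (intro conjI ballI V r assms(2))
  fix v assume v: "v \<in> carrier V"
  have VA: "kvs (tensor V A)" and AA: "kvs (tensor A A)" using V by simp_all
  note rv = lin_closed[OF r v]
  show "tensor_assoc V A (tmap V A (tensor V A) A (coact V) id (coact V v)) = tmap V A V (tensor A A) id (comult A) (coact V v)"
  proof (rule left_slices_eqI[OF V AA _ _ Y sep])
    show "tensor_assoc V A (tmap V A (tensor V A) A (coact V) id (coact V v)) \<in> carrier (tensor V (tensor A A))"
      by (rule add_hom_closed[OF tensor_assoc_hom[OF V kvs_alg] lin_closed[OF tmap_lin[OF V kvs_alg VA kvs_alg r lin_id(1)] rv]])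
    show "tmap V A V (tensor A A) id (comult A) (coact V v) \<in> carrier (tensor V (tensor A A))"
      by (rule lin_closed[OF tmap_lin[OF V kvs_alg V AA lin_id(1) comult_lin] rv])
    fix u assume u: "u \<in> Y"
    note ul = subsetD[OF Y u]
    show "left_slice V (tensor A A) u (tensor_assoc V A (tmap V A (tensor V A) A (coact V) id (coact V v))) =
      left_slice V (tensor A A) u (tmap V A V (tensor A A) id (comult A) (coact V v))"
      unfolding left_slice_assoc[OF V kvs_alg r ul rv] left_slice_tmap_right[OF V kvs_alg AA comult_lin ul rv]
      using co[OF u v] by (simp add: coeff_fun_def[abs_def])
  qed
  have "slice V A (counit A) (coact V v) = v"
  proof -
    note c = lin_closed[OF slice_lin[OF V kvs_alg counit_lin] rv]
    have V': "abelian_group V" using V by simp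
    have "slice V A (counit A) (coact V v) \<ominus>\<^bsub>V\<^esub> v = \<zero>\<^bsub>V\<^esub>"
    proof (rule sep)
      fix u assume u: "u \<in> Y"
      note ul = subsetD[OF Y u]
      have "u (slice V A (counit A) (coact V v)) = u v"
        unfolding slice_left_slice[OF V kvs_alg ul counit_lin rv] using cu[OF u v] by (simp add: coeff_fun_def)
      then show "u (slice V A (counit A) (coact V v) \<ominus>\<^bsub>V\<^esub> v) = 0"
        using add_hom_diff[OF lin_add_hom[OF ul] V' _ c v] by simp
    qed (use c v V' in simp)
    then show ?thesis using ag_diff_eq_zero[OF V' c v] by simp
  qed
  then show "tlift V A V (\<lambda>w a. counit A a \<odot>\<^bsub>V\<^esub> w) (coact V v) = v" by (simp add: slice_def)
qed

lemma gmod_homD: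
  assumes "gmodule A V" "gmodule A W" "\<phi> \<in> gmod_hom A V W" "u \<in> lin W kmod" "v \<in> carrier V"
  shows "coeff_fun A W u (\<phi> v) = coeff_fun A V (\<lambda>x. u (\<phi> x)) v"
  using assms(3,5) left_slice_tmap[OF gmoduleD(1)[OF assms(1)] gmoduleD(1)[OF assms(2)] kvs_alg _ assms(4)]
    lin_closed[OF gmoduleD(3)[OF assms(1)] assms(5)]
  by (simp add: coeff_fun_def gmod_hom_def)

end

subsection \<open>Trivial, tensor product and prolonged modules\<close>

text \<open>The modules built below are records that copy the operations of a vector space and add a
  coaction. Tensor products and linear maps depend only on the copied fields, so a module can be
  replaced by its underlying space.\<close>

lemma module_cong:
  fixes M :: "('k::field, 'a, 'm) module_scheme" and M' :: "('k, 'a, 'n) module_scheme"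
  assumes eq: "carrier M = carrier M'" "zero M = zero M'" "add M = add M'" "module.smult M = module.smult M'"
  shows "tensor M N = tensor M' N" "tmul M N = tmul M' N" "left_slice M N = left_slice M' N"
    "tmap M N P Q = tmap M' N P Q" "lin M P = lin M' P"
    and "kvs M' \<Longrightarrow> kvs M" and "kvs M' \<Longrightarrow> fin_dim M' \<Longrightarrow> fin_dim M"
proof -
  show t: "tensor M N = tensor M' N" "tmul M N = tmul M' N" for N :: "('k, 'b, 'p) module_scheme"
    by (rule tensor_cong; simp add: eq)+
  have tl: "tlift M N = tlift M' N" for N :: "('k, 'b, 'p) module_scheme"
    by (rule tlift_cong) (simp_all add: t eq)
  show "left_slice M N = left_slice M' N" "tmap M N P Q = tmap M' N P Q"
    by (simp_all add: left_slice_def fun_eq_iff tmap_def tl)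
  show "lin M P = lin M' P" by (auto simp: lin_def add_hom_iff eq)
  show k: "kvs M" if "kvs M'"
    by (rule kvs_embedded[OF that, of "\<lambda>x. x"]) (use that in \<open>auto simp: eq intro!: linI\<close>)
  show "fin_dim M" if "kvs M'" "fin_dim M'"
    by (rule fin_dim_image[OF that k[OF that(1)], of "\<lambda>x. x"]) (use that in \<open>auto simp: eq intro!: linI\<close>)
qed

lemma triv_gmod_simps [simp]:
  "carrier (triv_gmod A) = carrier kmod" "zero (triv_gmod A) = zero kmod" "add (triv_gmod A) = add kmod"
  "module.smult (triv_gmod A) = module.smult kmod" "coact (triv_gmod A) c = tmul kmod A c \<one>\<^bsub>A\<^esub>"
  by (simp_all add: triv_gmod_def)

lemmas triv_gmod_cong [simp] =
  module_cong[OF triv_gmod_simps(1-4)]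

lemma tensor_gmod_simps [simp]:
  "carrier (tensor_gmod A V W) = carrier (tensor V W)" "zero (tensor_gmod A V W) = zero (tensor V W)"
  "add (tensor_gmod A V W) = add (tensor V W)" "module.smult (tensor_gmod A V W) = module.smult (tensor V W)"
  by (simp_all add: tensor_gmod_def Let_def)

lemmas tensor_gmod_cong [simp] = module_cong[OF tensor_gmod_simps]

lemma smult_hom: "kvs M \<Longrightarrow> (\<lambda>x. c \<odot>\<^bsub>M\<^esub> x) \<in> add_hom M M"
  by (rule add_homI) (simp_all add: kvs_smult_distrib(2))

lemma tensor_ext2:
  assumes kvs: "kvs M" "kvs N" "kvs M'" "kvs N'"
    and F: "\<And>z'. z' \<in> carrier (tensor M' N') \<Longrightarrow> (\<lambda>z. F z z') \<in> add_hom (tensor M N) P"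
      "\<And>z. z \<in> carrier (tensor M N) \<Longrightarrow> F z \<in> add_hom (tensor M' N') P"
    and H: "\<And>z'. z' \<in> carrier (tensor M' N') \<Longrightarrow> (\<lambda>z. H z z') \<in> add_hom (tensor M N) P"
      "\<And>z. z \<in> carrier (tensor M N) \<Longrightarrow> H z \<in> add_hom (tensor M' N') P"
    and eq: "\<And>x y x' y'. x \<in> carrier M \<Longrightarrow> y \<in> carrier N \<Longrightarrow> x' \<in> carrier M' \<Longrightarrow> y' \<in> carrier N' \<Longrightarrow>
      F (tmul M N x y) (tmul M' N' x' y') = H (tmul M N x y) (tmul M' N' x' y')"
    and z: "z \<in> carrier (tensor M N)" "z' \<in> carrier (tensor M' N')"
  shows "F z z' = H z z'"
proof (rule tensor_ext[OF kvs(1,2) F(1)[OF z(2)] H(1)[OF z(2)] _ z(1)])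
  fix x y assume xy: "x \<in> carrier M" "y \<in> carrier N"
  have t: "tmul M N x y \<in> carrier (tensor M N)" using xy kvs by simp
  show "F (tmul M N x y) z' = H (tmul M N x y) z'"
    by (rule tensor_ext[OF kvs(3,4) F(2)[OF t] H(2)[OF t] eq[OF xy] z(2)])
qed

text \<open>The third form reduces separation by product functionals to separation in each
  factor.\<close>

lemma tensor_functional_lin:
  assumes V: "kvs V" and W: "kvs W" and u: "u \<in> lin V kmod" "t \<in> lin W kmod"
  shows "tensor_functional V W u t \<in> lin (tensor V W) kmod"
    and "v \<in> carrier V \<Longrightarrow> w \<in> carrier W \<Longrightarrow> tensor_functional V W u t (tmul V W v w) = u v * t w"
    and "z \<in> carrier (tensor V W) \<Longrightarrow> tensor_functional V W u t z = t (left_slice V W u z)"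
proof -
  have b: "balanced V W kmod (\<lambda>v w. u v * t w)"
    by (rule balancedI) (simp_all add: lin_add[OF u(1)] lin_add[OF u(2)] lin_smult[OF u(1)] lin_smult[OF u(2)] algebra_simps)
  have l: "tlift V W kmod (\<lambda>v w. u v * t w) \<in> lin (tensor V W) kmod"
    by (rule tlift_lin[OF V W kvs_kmod b]) (simp add: lin_smult[OF u(1)] mult.assoc)
  have T: "kvs (tensor V W)" using V W by simp
  show "tensor_functional V W u t \<in> lin (tensor V W) kmod"
    by (rule linI) (use T in \<open>simp_all add: tensor_functional_def lin_add[OF l] lin_smult[OF l]\<close>)
  show m: "tensor_functional V W u t (tmul V W v w) = u v * t w" if "v \<in> carrier V" "w \<in> carrier W" for v w
    using tlift_tmul[OF V W _ b that] that V W by (simp add: tensor_functional_def)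
  show "tensor_functional V W u t z = t (left_slice V W u z)" if z: "z \<in> carrier (tensor V W)"
    using tensor_ext[OF V W lin_add_hom[OF l] lin_add_hom[OF lin_comp[OF left_slice_lin[OF V W u(1)] u(2)]] _ z] z
      tlift_tmul[OF V W _ b]
    by (simp add: tensor_functional_def left_slice_tmul[OF V W u(1)] lin_smult[OF u(2)])
qed

lemma fin_dim_tensor:
  assumes V: "kvs V" "fin_dim V" and W: "kvs W" "fin_dim W"
  shows "fin_dim (tensor V W)"
proof -
  obtain S R where S: "finite S" "S \<subseteq> carrier V" "lspan V S = carrier V"
    and R: "finite R" "R \<subseteq> carrier W" "lspan W R = carrier W"
    using assms by (auto simp: fin_dim_def)
  have T: "kvs (tensor V W)" using V W by simp
  show ?thesis
  proof (rule fin_dimI[OF T, of "(\<lambda>(s, r). tmul V W s r) ` (S \<times> R)"])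
    show "finite ((\<lambda>(s, r). tmul V W s r) ` (S \<times> R))" using S R by simp
    show "(\<lambda>(s, r). tmul V W s r) ` (S \<times> R) \<subseteq> carrier (tensor V W)" using S(2) R(2) V W by (auto intro!: tmul_closed)
    fix N assume N: "submodule N kring (tensor V W)" "(\<lambda>(s, r). tmul V W s r) ` (S \<times> R) \<subseteq> N"
    note n = submoduleD[OF T N(1)]
    have p1: "tmul V W s w \<in> N" if "s \<in> S" "w \<in> lspan W R" for s w
      using that(2)
      by (induction rule: lspan_induct)
        (use that(1) S R V W N(2) n in \<open>auto simp: tmul_add_right tmul_smult_right\<close>)
    have p2: "tmul V W v w \<in> N" if "w \<in> carrier W" "v \<in> lspan V S" for v w
      using that(2)
      by (induction rule: lspan_induct)
        (use that(1) S R V W p1 n in \<open>auto simp: tmul_add_left tmul_smult_left\<close>)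
    show "carrier (tensor V W) \<subseteq> N"
    proof
      fix z assume "z \<in> carrier (tensor V W)"
      then show "z \<in> N"
        by (induction z rule: tensor_induct[OF V(1) W(1), consumes 1, case_names tmul add]) (use p2 S(3) n(3) in auto)
    qed
  qed
qed

context diff_bialgebra begin

lemma cring_alg: "cring A" using dk_algebraD(2)[OF dk] .

lemmas comult_iff = comult_hom[unfolded dk_hom_iff]
lemmas counit_iff = counit_hom[unfolded dk_hom_iff]

lemma coeff_fun_triv: "coeff_fun A (triv_gmod A) (\<lambda>c. c) c = c \<odot> \<one>"
proof -
  have u: "(\<lambda>c. c) \<in> lin kmod kmod" by (rule linI) simp_all
  show ?thesis
    using left_slice_tmul[OF kvs_kmod kvs_alg u, of c "\<one>"] cring_facts(2)[OF cring_alg] by (simp add: coeff_fun_def)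
qed

lemma gmodule_triv: "gmodule A (triv_gmod A)"
proof (rule gmoduleI[where Y = "{\<lambda>c. c}"])
  note one = cring_facts(2)[OF cring_alg]
  show "kvs (triv_gmod A)" by simp
  have "fin_dim (kmod :: ('k, 'k) module)"
  proof (rule fin_dimI[OF kvs_kmod, of "{1}"])
    fix N assume N: "submodule N kring (kmod :: ('k, 'k) module)" "{1} \<subseteq> N"
    show "carrier kmod \<subseteq> N" using submoduleD(4)[OF kvs_kmod N(1), of 1] N(2) by auto
  qed auto
  then show "fin_dim (triv_gmod A)" by simp
  show "coact (triv_gmod A) \<in> lin (triv_gmod A) (tensor (triv_gmod A) A)"
    by (rule linI) (use one in \<open>simp_all add: tmul_add_left[OF kvs_kmod kvs_alg, simplified] tmul_smult_left[OF kvs_kmod kvs_alg, simplified]\<close>)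
  show "{\<lambda>c. c} \<subseteq> lin (triv_gmod A) kmod" by (auto intro!: linI)
  show "x = \<zero>\<^bsub>triv_gmod A\<^esub>" if "\<And>u. u \<in> {\<lambda>c. c} \<Longrightarrow> u x = 0" for x
    using that by simp
  have l: "(\<lambda>c. c \<odot> \<one>) \<in> lin kmod A" by (rule linI) (use one in \<open>simp_all add: kvs_smult_distrib[OF kvs_alg]\<close>)
  have cf: "coeff_fun A (triv_gmod A) (\<lambda>c. c) = (\<lambda>c. c \<odot> \<one>)" by (rule ext) (rule coeff_fun_triv)
  fix u :: "'k \<Rightarrow> 'k" and v assume "u \<in> {\<lambda>c. c}"
  then have u: "u = (\<lambda>c. c)" by simp
  show "comult A (coeff_fun A (triv_gmod A) u v) = tmap (triv_gmod A) A A A (coeff_fun A (triv_gmod A) u) id (coact (triv_gmod A) v)"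
    using one comult_iff tmap_tmul[OF kvs_kmod kvs_alg kvs_alg kvs_alg l lin_id(1), of v "\<one>"]
    by (simp add: u cf tmul_smult_left)
  show "counit A (coeff_fun A (triv_gmod A) u v) = u v"
    using one counit_iff by (simp add: u cf)
qed

context
  fixes V :: "('k, 'v, 'a) gmod" and W :: "('k, 'w, 'a) gmod"
  assumes GV: "gmodule A V" and GW: "gmodule A W"
begin

private lemmas V = gmoduleD(1)[OF GV] and W = gmoduleD(1)[OF GW]
private lemmas rV = gmoduleD(3)[OF GV] and rW = gmoduleD(3)[OF GW]
private abbreviation (input) "T \<equiv> tensor V W"
private abbreviation (input) "TG \<equiv> tensor_gmod A V W"
private lemma kT: "kvs T" using V W by simp
private lemma kTA: "kvs (tensor T A)" using V W by simp
private lemma TA: "abelian_group (tensor T A)" using V W by simp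
private lemmas ca = cring_facts[OF cring_alg] and al = dk_algebraD[OF dk]

text \<open>The rule by which two coactions are multiplied: V \<otimes> A and W \<otimes> A are
  combined into (V \<otimes> W) \<otimes> A through the product of A.\<close>

private definition "mm s s' = tlift V A (tensor T A) (\<lambda>v' a.
  tlift W A (tensor T A) (\<lambda>w' b. tmul T A (tmul V W v' w') (a \<otimes> b)) s') s"

private lemma mm:
  "s' \<in> carrier (tensor W A) \<Longrightarrow> (\<lambda>s. mm s s') \<in> add_hom (tensor V A) (tensor T A)"
  "s \<in> carrier (tensor V A) \<Longrightarrow> mm s \<in> add_hom (tensor W A) (tensor T A)"
  "v \<in> carrier V \<Longrightarrow> a \<in> carrier A \<Longrightarrow> w \<in> carrier W \<Longrightarrow> b \<in> carrier A \<Longrightarrow>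
    mm (tmul V A v a) (tmul W A w b) = tmul T A (tmul V W v w) (a \<otimes> b)"
proof -
  have b1: "balanced W A (tensor T A) (\<lambda>w' b. tmul T A (tmul V W v' w') (a \<otimes> b))"
    if "v' \<in> carrier V" "a \<in> carrier A" for v' a
    by (rule balancedI) (use that V W al(9) in \<open>simp_all add: ca tmul_add_left tmul_add_right tmul_smult_left tmul_smult_right\<close>)
  have b2: "balanced V A (tensor T A) (\<lambda>v' a. tmul T A (tmul V W v' w') (a \<otimes> b))"
    if "w' \<in> carrier W" "b \<in> carrier A" for w' b
    by (rule balancedI) (use that V W al(4) in \<open>simp_all add: ca tmul_add_left tmul_add_right tmul_smult_left tmul_smult_right\<close>)
  note t = tlift_tlift[where \<beta> = "\<lambda>v' a w' b. tmul T A (tmul V W v' w') (a \<otimes> b)", OF V kvs_alg W kvs_alg TA b1 b2, folded mm_def]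
  show "s' \<in> carrier (tensor W A) \<Longrightarrow> (\<lambda>s. mm s s') \<in> add_hom (tensor V A) (tensor T A)"
    by (rule t(1))
  show "s \<in> carrier (tensor V A) \<Longrightarrow> mm s \<in> add_hom (tensor W A) (tensor T A)"
    using t(2) by (simp add: mm_def[abs_def])
  show "v \<in> carrier V \<Longrightarrow> a \<in> carrier A \<Longrightarrow> w \<in> carrier W \<Longrightarrow> b \<in> carrier A \<Longrightarrow>
    mm (tmul V A v a) (tmul W A w b) = tmul T A (tmul V W v w) (a \<otimes> b)"
    by (rule t(3))
qed

private lemma mm_smult:
  assumes s: "s \<in> carrier (tensor V A)" "s' \<in> carrier (tensor W A)"
  shows "mm (c \<odot>\<^bsub>tensor V A\<^esub> s) s' = c \<odot>\<^bsub>tensor T A\<^esub> mm s s'" "mm s (c \<odot>\<^bsub>tensor W A\<^esub> s') = c \<odot>\<^bsub>tensor T A\<^esub> mm s s'"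
proof -
  have VA: "kvs (tensor V A)" and WA: "kvs (tensor W A)" using V W by simp_all
  note h = add_hom_comp[OF mm(1) smult_hom[OF kTA]] add_hom_comp[OF mm(2) smult_hom[OF kTA]]
  show "mm (c \<odot>\<^bsub>tensor V A\<^esub> s) s' = c \<odot>\<^bsub>tensor T A\<^esub> mm s s'"
  proof (rule tensor_ext2[where F="\<lambda>s s'. mm (c \<odot>\<^bsub>tensor V A\<^esub> s) s'" and H="\<lambda>s s'. c \<odot>\<^bsub>tensor T A\<^esub> mm s s'",
        OF V kvs_alg W kvs_alg add_hom_comp[OF smult_hom[OF VA] mm(1)] mm(2) h _ s])
    fix v a w b assume "v \<in> carrier V" "a \<in> carrier A" "w \<in> carrier W" "b \<in> carrier A"
    then show "mm (c \<odot>\<^bsub>tensor V A\<^esub> tmul V A v a) (tmul W A w b) = c \<odot>\<^bsub>tensor T A\<^esub> mm (tmul V A v a) (tmul W A w b)"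
      using V W kT by (simp add: tmul_smult_left[OF V kvs_alg, symmetric] mm) (simp add: ca tmul_smult_left)
  qed (use VA kvs_smult(1)[OF VA] in blast)+
  show "mm s (c \<odot>\<^bsub>tensor W A\<^esub> s') = c \<odot>\<^bsub>tensor T A\<^esub> mm s s'"
  proof (rule tensor_ext2[where F="\<lambda>s s'. mm s (c \<odot>\<^bsub>tensor W A\<^esub> s')" and H="\<lambda>s s'. c \<odot>\<^bsub>tensor T A\<^esub> mm s s'",
        OF V kvs_alg W kvs_alg mm(1) add_hom_comp[OF smult_hom[OF WA] mm(2)] h _ s])
    fix v a w b assume "v \<in> carrier V" "a \<in> carrier A" "w \<in> carrier W" "b \<in> carrier A"
    then show "mm (tmul V A v a) (c \<odot>\<^bsub>tensor W A\<^esub> tmul W A w b) = c \<odot>\<^bsub>tensor T A\<^esub> mm (tmul V A v a) (tmul W A w b)"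
      using V W kT by (simp add: tmul_smult_left[OF W kvs_alg, symmetric] mm) (simp add: ca tmul_smult_left tmul_smult_right)
  qed (use WA kvs_smult(1)[OF WA] in blast)+
qed

private lemma coact_tensor:
  "coact TG \<in> lin T (tensor T A)"
  "v \<in> carrier V \<Longrightarrow> w \<in> carrier W \<Longrightarrow> coact TG (tmul V W v w) = mm (coact V v) (coact W w)"
proof -
  have c: "coact TG = tlift V W (tensor T A) (\<lambda>v w. mm (coact V v) (coact W w))"
    by (simp add: tensor_gmod_def Let_def mm_def)
  note cl = lin_closed[OF rV] lin_closed[OF rW]
  have b: "balanced V W (tensor T A) (\<lambda>v w. mm (coact V v) (coact W w))"
    by (rule balancedI) (use V W cl add_hom_closed[OF mm(1)] in \<open>simp_all add: lin_add[OF rV] lin_add[OF rW]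
      lin_smult[OF rV] lin_smult[OF rW] mm_smult add_hom_add[OF mm(1)] add_hom_add[OF mm(2)]\<close>)
  show "coact TG \<in> lin T (tensor T A)" unfolding c
    by (rule tlift_lin[OF V W kTA b]) (simp add: lin_smult[OF rV] mm_smult cl)
  show "coact TG (tmul V W v w) = mm (coact V v) (coact W w)" if "v \<in> carrier V" "w \<in> carrier W"
    unfolding c by (rule tlift_tmul[OF V W TA b that])
qed

private lemma mult_hom:
  "y \<in> carrier A \<Longrightarrow> (\<lambda>x. x \<otimes> y) \<in> add_hom A A" "x \<in> carrier A \<Longrightarrow> (\<lambda>y. x \<otimes> y) \<in> add_hom A A"
  by (rule add_homI; simp add: ca)+

private lemma slice_mm:
  assumes u: "u \<in> lin V kmod" and t: "t \<in> lin W kmod" and s: "s \<in> carrier (tensor V A)" "s' \<in> carrier (tensor W A)"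
  shows "left_slice T A (tensor_functional V W u t) (mm s s') = left_slice V A u s \<otimes> left_slice W A t s'"
proof -
  note tf = tensor_functional_lin[OF V W u t]
  note L = left_slice_lin[OF kT kvs_alg tf(1)] and lu = left_slice_lin[OF V kvs_alg u] and lt = left_slice_lin[OF W kvs_alg t]
  show ?thesis
  proof (rule tensor_ext2[where F="\<lambda>s s'. left_slice T A (tensor_functional V W u t) (mm s s')" and
        H="\<lambda>s s'. left_slice V A u s \<otimes> left_slice W A t s'", OF V kvs_alg W kvs_alg
        add_hom_comp[OF mm(1) lin_add_hom[OF L]] add_hom_comp[OF mm(2) lin_add_hom[OF L]]
        add_hom_comp[OF lin_add_hom[OF lu] mult_hom(1)] add_hom_comp[OF lin_add_hom[OF lt] mult_hom(2)] _ s])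
    fix v a w b assume "v \<in> carrier V" "a \<in> carrier A" "w \<in> carrier W" "b \<in> carrier A"
    then show "left_slice T A (tensor_functional V W u t) (mm (tmul V A v a) (tmul W A w b)) =
        left_slice V A u (tmul V A v a) \<otimes> left_slice W A t (tmul W A w b)"
      using V W al(4,9) by (simp add: mm ca left_slice_tmul[OF kT kvs_alg tf(1)] tf(2) left_slice_tmul[OF V kvs_alg u]
          left_slice_tmul[OF W kvs_alg t] kvs_smult_distrib(3) mult.commute)
  qed (use lin_closed[OF lu] lin_closed[OF lt] in simp_all)
qed

text \<open>This is the reason why the product defined on F/R corresponds to the product of
  A.\<close>

lemma coeff_fun_tensor:
  assumes u: "u \<in> lin V kmod" "t \<in> lin W kmod" and v: "v \<in> carrier V" "w \<in> carrier W"
  shows "coeff_fun A TG (tensor_functional V W u t) (tmul V W v w) = coeff_fun A V u v \<otimes> coeff_fun A W t w"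
  using slice_mm[OF u lin_closed[OF rV v(1)] lin_closed[OF rW v(2)]] by (simp add: coeff_fun_def coact_tensor(2)[OF v])

text \<open>Product functionals separate V \<otimes> W and their coefficient functions are products
  on pure tensors, so the comodule conditions follow from those of V and W because \<Delta> and
  \<epsilon> are multiplicative.\<close>

lemma gmodule_tensor: "gmodule A TG"
proof (rule gmoduleI[where Y = "{tensor_functional V W u t | u t. u \<in> lin V kmod \<and> t \<in> lin W kmod}"])
  show "kvs TG" using kT by simp
  show "fin_dim TG" using fin_dim_tensor[OF V gmoduleD(2)[OF GV] W gmoduleD(2)[OF GW]] kT by simp
  show "coact TG \<in> lin TG (tensor TG A)" using coact_tensor(1) by simp
  show "{tensor_functional V W u t | u t. u \<in> lin V kmod \<and> t \<in> lin W kmod} \<subseteq> lin TG kmod"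
    using tensor_functional_lin(1)[OF V W] by auto
  show "z = \<zero>\<^bsub>TG\<^esub>" if z: "z \<in> carrier TG"
    and 0: "\<And>f. f \<in> {tensor_functional V W u t | u t. u \<in> lin V kmod \<and> t \<in> lin W kmod} \<Longrightarrow> f z = 0" for z
  proof -
    have "z = \<zero>\<^bsub>T\<^esub>"
    proof (rule left_slices_separate[OF V W _ subset_refl])
      show "x = \<zero>\<^bsub>V\<^esub>" if "x \<in> carrier V" "\<And>u. u \<in> lin V kmod \<Longrightarrow> u x = 0" for x
        by (rule functional_separates[OF V that(1)]) (rule that(2))
      fix u assume u: "u \<in> lin V kmod"
      show "left_slice V W u z = \<zero>\<^bsub>W\<^esub>"
      proof (rule functional_separates[OF W])
        show "left_slice V W u z \<in> carrier W" using lin_closed[OF left_slice_lin[OF V W u]] z by simp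
        fix t assume t: "t \<in> lin W kmod"
        show "t (left_slice V W u z) = 0"
          using tensor_functional_lin(3)[OF V W u t, of z] z 0[of "tensor_functional V W u t"] u t by auto
      qed
    qed (use z in simp)
    then show ?thesis by simp
  qed
  fix f z assume "f \<in> {tensor_functional V W u t | u t. u \<in> lin V kmod \<and> t \<in> lin W kmod}" and zz: "z \<in> carrier TG"
  then obtain u t where u: "u \<in> lin V kmod" and t: "t \<in> lin W kmod" and f: "f = tensor_functional V W u t" by blast
  have z: "z \<in> carrier T" using zz by simp
  note tf = tensor_functional_lin[OF V W u t] and fu = gmoduleD(4)[OF GV u] and ft = gmoduleD(4)[OF GW t]
  have L: "coeff_fun A TG f \<in> lin T A"
    using lin_comp[OF coact_tensor(1) left_slice_lin[OF kT kvs_alg tf(1)]] by (simp add: coeff_fun_def[abs_def] f)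
  note tL = tmap_lin[OF kT kvs_alg kvs_alg kvs_alg L lin_id(1)]
  note tu = tmap_lin[OF V kvs_alg kvs_alg kvs_alg fu lin_id(1)] and tt = tmap_lin[OF W kvs_alg kvs_alg kvs_alg ft lin_id(1)]
  have tm: "tmap T A A A (coeff_fun A TG f) id (mm s s') =
      tmap V A A A (coeff_fun A V u) id s \<otimes>\<^bsub>tensor_dalg A A\<^esub> tmap W A A A (coeff_fun A W t) id s'"
    if s: "s \<in> carrier (tensor V A)" "s' \<in> carrier (tensor W A)" for s s'
  proof (rule tensor_ext2[where F="\<lambda>s s'. tmap T A A A (coeff_fun A TG f) id (mm s s')" and
        H="\<lambda>s s'. tmap V A A A (coeff_fun A V u) id s \<otimes>\<^bsub>tensor_dalg A A\<^esub> tmap W A A A (coeff_fun A W t) id s'", OF V kvs_alg W kvs_alg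
        add_hom_comp[OF mm(1) lin_add_hom[OF tL]] add_hom_comp[OF mm(2) lin_add_hom[OF tL]]
        add_hom_comp[OF lin_add_hom[OF tu] tensor_mult_hom(1)[OF dk dk]] add_hom_comp[OF lin_add_hom[OF tt] tensor_mult_hom(2)[OF dk dk]] _ s])
    fix v a w b assume *: "v \<in> carrier V" "a \<in> carrier A" "w \<in> carrier W" "b \<in> carrier A"
    show "tmap T A A A (coeff_fun A TG f) id (mm (tmul V A v a) (tmul W A w b)) =
      tmap V A A A (coeff_fun A V u) id (tmul V A v a) \<otimes>\<^bsub>tensor_dalg A A\<^esub> tmap W A A A (coeff_fun A W t) id (tmul W A w b)"
      using * V W lin_closed[OF fu] lin_closed[OF ft]
      by (simp add: mm ca tmap_tmul[OF kT kvs_alg kvs_alg kvs_alg L lin_id(1)] tmap_tmul[OF V kvs_alg kvs_alg kvs_alg fu lin_id(1)]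
          tmap_tmul[OF W kvs_alg kvs_alg kvs_alg ft lin_id(1)] tensor_mult_hom(3)[OF dk dk])
        (simp add: f coeff_fun_tensor[OF u t])
  qed (use lin_closed[OF tu] lin_closed[OF tt] in simp_all)
  show "comult A (coeff_fun A TG f z) = tmap TG A A A (coeff_fun A TG f) id (coact TG z)"
  proof -
    have "comult A (coeff_fun A TG f z) = tmap T A A A (coeff_fun A TG f) id (coact TG z)"
    proof (rule tensor_ext[OF V W lin_add_hom[OF lin_comp[OF L comult_lin]] lin_add_hom[OF lin_comp[OF coact_tensor(1) tL]] _ z])
      fix v w assume vw: "v \<in> carrier V" "w \<in> carrier W"
      have "comult A (coeff_fun A TG f (tmul V W v w)) = comult A (coeff_fun A V u v) \<otimes>\<^bsub>tensor_dalg A A\<^esub> comult A (coeff_fun A W t w)"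
        using comult_iff lin_closed[OF fu vw(1)] lin_closed[OF ft vw(2)] by (simp add: f coeff_fun_tensor[OF u t vw])
      also have "\<dots> = tmap T A A A (coeff_fun A TG f) id (coact TG (tmul V W v w))"
        using tm[OF lin_closed[OF rV vw(1)] lin_closed[OF rW vw(2)]]
        by (simp add: coact_tensor(2)[OF vw] gmoduleD(5)[OF GV u vw(1)] gmoduleD(5)[OF GW t vw(2)])
      finally show "comult A (coeff_fun A TG f (tmul V W v w)) = tmap T A A A (coeff_fun A TG f) id (coact TG (tmul V W v w))" .
    qed
    then show ?thesis by simp
  qed
  show "counit A (coeff_fun A TG f z) = f z"
  proof (rule tensor_ext[OF V W lin_add_hom[OF lin_comp[OF L counit_lin]] lin_add_hom[OF tf(1)[folded f]] _ z])
    fix v w assume vw: "v \<in> carrier V" "w \<in> carrier W"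
    show "counit A (coeff_fun A TG f (tmul V W v w)) = f (tmul V W v w)"
      using counit_iff lin_closed[OF fu vw(1)] lin_closed[OF ft vw(2)] gmoduleD(6)[OF GV u vw(1)] gmoduleD(6)[OF GW t vw(2)]
      by (simp add: f coeff_fun_tensor[OF u t vw] tf(2)[OF vw])
  qed
qed

end

end

section \<open>Prolongation of vector spaces and of modules\<close>

lemma prolong_mod_simps [simp]:
  "carrier (prolong_mod d V) = carrier V \<times> carrier V" "\<zero>\<^bsub>prolong_mod d V\<^esub> = (\<zero>\<^bsub>V\<^esub>, \<zero>\<^bsub>V\<^esub>)"
  "(x, y) \<oplus>\<^bsub>prolong_mod d V\<^esub> (x', y') = (x \<oplus>\<^bsub>V\<^esub> x', y \<oplus>\<^bsub>V\<^esub> y')"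
  by (simp_all add: prolong_mod_def)

lemma prolong_smult:
  fixes V (structure)
  assumes "kvs V" "x \<in> carrier V" "y \<in> carrier V"
  shows "c \<odot>\<^bsub>prolong_mod d V\<^esub> (x, y) = (c \<odot> x \<oplus> (- d c) \<odot> y, c \<odot> y)"
  using assms by (simp add: prolong_mod_def a_minus_def kvs_smult_distrib(3,4))

lemma derivationD:
  assumes "derivation d"
  shows "d (x + y) = d x + d y" "d (x * y) = d x * y + x * d y" "d 0 = 0" "d 1 = 0"
proof -
  show a: "d (x + y) = d x + d y" and m: "d (x * y) = d x * y + x * d y" for x y
    using assms by (auto simp: derivation_def)
  show "d 0 = 0" using a[of 0 0] by (metis add.right_neutral add_cancel_right_right)
  show "d 1 = 0" using m[of 1 1] by (metis add_cancel_right_right mult.left_neutral mult.right_neutral)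
qed

lemma kvs_prolong:
  fixes V (structure)
  assumes V: "kvs V" and d: "derivation d"
  shows "kvs (prolong_mod d V)"
proof -
  have A: "abelian_group V" using V by simp
  note D = derivationD[OF d]
  show ?thesis
  proof (rule kvsI)
    show "abelian_group (prolong_mod d V)"
    proof (rule abelian_groupI)
      fix p assume "p \<in> carrier (prolong_mod d V)"
      then show "\<exists>q\<in>carrier (prolong_mod d V). q \<oplus>\<^bsub>prolong_mod d V\<^esub> p = \<zero>\<^bsub>prolong_mod d V\<^esub>"
        using A by (intro bexI[of _ "(\<ominus> fst p, \<ominus> snd p)"]) auto
    qed (use A in \<open>auto simp: ag_ac\<close>)
    have neg: "(- (p + q)) \<odot> y = (- p) \<odot> y \<oplus> (- q) \<odot> y" if "y \<in> carrier V" for p q y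
      using kvs_smult_distrib(1)[OF V that, of "- p" "- q"] by simp
    fix a b p assume "p \<in> carrier (prolong_mod d V)"
    then obtain x y where p: "p = (x, y)" "x \<in> carrier V" "y \<in> carrier V" by auto
    show "(a + b) \<odot>\<^bsub>prolong_mod d V\<^esub> p = a \<odot>\<^bsub>prolong_mod d V\<^esub> p \<oplus>\<^bsub>prolong_mod d V\<^esub> b \<odot>\<^bsub>prolong_mod d V\<^esub> p"
      using p V A by (simp add: prolong_smult kvs_smult_distrib(1) D(1) neg ag_ac del: minus_add_distrib)
    show "(a * b) \<odot>\<^bsub>prolong_mod d V\<^esub> p = a \<odot>\<^bsub>prolong_mod d V\<^esub> (b \<odot>\<^bsub>prolong_mod d V\<^esub> p)"
      using p V A by (simp add: prolong_smult kvs_smult_distrib(2,3) D(2) neg ag_ac del: minus_add_distrib)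
  qed (use V A D in \<open>auto simp: prolong_smult kvs_smult_distrib(2) ag_ac\<close>)
qed

lemma prolong_incl_lin: "kvs V \<Longrightarrow> prolong_incl V \<in> lin V (prolong_mod d V)"
  by (rule linI) (simp_all add: prolong_incl_def prolong_smult)

lemma prolong_der_hom: "kvs V \<Longrightarrow> prolong_der V \<in> add_hom V (prolong_mod d V)"
  by (rule add_homI) (simp_all add: prolong_der_def)

text \<open>The commutation rule \<partial> c = c \<partial> + \<partial>(c) in the ring of
  differential operators.\<close>

lemma prolong_der_smult:
  assumes "kvs V" "v \<in> carrier V"
  shows "prolong_der V (c \<odot>\<^bsub>V\<^esub> v) = c \<odot>\<^bsub>prolong_mod d V\<^esub> prolong_der V v \<oplus>\<^bsub>prolong_mod d V\<^esub> d c \<odot>\<^bsub>prolong_mod d V\<^esub> prolong_incl V v"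
  using assms by (simp add: prolong_incl_def prolong_der_def prolong_smult kvs_smult_distrib(1)[OF assms, symmetric])

lemma prolong_decomp:
  "kvs V \<Longrightarrow> x \<in> carrier V \<Longrightarrow> y \<in> carrier V \<Longrightarrow> (x, y) = prolong_incl V x \<oplus>\<^bsub>prolong_mod d V\<^esub> prolong_der V y"
  by (simp add: prolong_incl_def prolong_der_def)

lemma fin_dim_prolong:
  assumes V: "kvs V" "fin_dim V" and d: "derivation d"
  shows "fin_dim (prolong_mod d V)"
proof -
  note P = kvs_prolong[OF V(1) d]
  obtain S where S: "finite S" "S \<subseteq> carrier V" "lspan V S = carrier V" using V(2) by (auto simp: fin_dim_def)
  note il = prolong_incl_lin[OF V(1), where d=d] and dh = prolong_der_hom[OF V(1), where d=d]
  show ?thesis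
  proof (rule fin_dimI[OF P, of "prolong_incl V ` S \<union> prolong_der V ` S"])
    show "prolong_incl V ` S \<union> prolong_der V ` S \<subseteq> carrier (prolong_mod d V)"
      using S(2) lin_closed[OF il] add_hom_closed[OF dh] by blast
    fix N assume N: "submodule N kring (prolong_mod d V)" "prolong_incl V ` S \<union> prolong_der V ` S \<subseteq> N"
    note n = submoduleD[OF P N(1)]
    have i: "prolong_incl V v \<in> N" if "v \<in> lspan V S" for v
      using that
      by (induction rule: lspan_induct)
        (use V S(2) N(2) n add_hom_zero[OF lin_add_hom[OF il]] P in \<open>auto simp: lin_add[OF il] lin_smult[OF il] simp del: prolong_mod_simps\<close>)
    have e: "prolong_der V v \<in> N" if "v \<in> lspan V S" for v
      using that
      by (induction rule: lspan_induct)
        (use V S N(2) n i add_hom_zero[OF dh] P in \<open>auto simp: add_hom_add[OF dh] prolong_der_smult[where d=d] simp del: prolong_mod_simps\<close>)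
    show "carrier (prolong_mod d V) \<subseteq> N"
    proof
      fix p assume "p \<in> carrier (prolong_mod d V)"
      then obtain x y where p: "p = (x, y)" "x \<in> carrier V" "y \<in> carrier V" by auto
      show "p \<in> N" unfolding p(1) prolong_decomp[OF V(1) p(2,3), where d=d]
        by (rule n(3)) (use i e p S(3) in auto)
    qed
  qed (use S in simp)
qed

text \<open>Linearity of F(u) is a cancellation: the term -d(c) y in the scalar multiplication of
  the prolongation offsets the one produced by d(c u(y)). The last fact supplies further functionals
  for separation.\<close>

lemma prolong_functional_lin:
  assumes V: "kvs V" and d: "derivation d" and u: "u \<in> lin V kmod"
  shows "prolong_functional d V u \<in> lin (prolong_mod d V) kmod"
    and "v \<in> carrier V \<Longrightarrow> prolong_functional d V u (prolong_incl V v) = u v"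
    and "v \<in> carrier V \<Longrightarrow> prolong_functional d V u (prolong_der V v) = d (u v)"
    and "(\<lambda>p. u (snd p)) \<in> lin (prolong_mod d V) kmod"
proof -
  note D = derivationD[OF d]
  have A: "abelian_group V" using V by simp
  have u0: "u \<zero>\<^bsub>V\<^esub> = 0" using add_hom_zero[OF lin_add_hom[OF u] A] by simp
  show "prolong_functional d V u \<in> lin (prolong_mod d V) kmod"
  proof (rule linI)
    fix c p assume "p \<in> carrier (prolong_mod d V)"
    then show "prolong_functional d V u (c \<odot>\<^bsub>prolong_mod d V\<^esub> p) = c \<odot>\<^bsub>kmod\<^esub> prolong_functional d V u p"
      using V A by (auto simp: prolong_functional_def prolong_smult lin_add[OF u] lin_smult[OF u] D algebra_simps)
  qed (use A in \<open>auto simp: prolong_functional_def lin_add[OF u] D\<close>)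
  show "v \<in> carrier V \<Longrightarrow> prolong_functional d V u (prolong_incl V v) = u v"
    and "v \<in> carrier V \<Longrightarrow> prolong_functional d V u (prolong_der V v) = d (u v)"
    using A by (simp_all add: prolong_functional_def prolong_incl_def prolong_der_def u0 D)
  show "(\<lambda>p. u (snd p)) \<in> lin (prolong_mod d V) kmod"
    by (rule linI) (use V in \<open>auto simp: lin_add[OF u] lin_smult[OF u] prolong_smult\<close>)
qed

lemma prolong_gmod_simps [simp]:
  "carrier (prolong_gmod d A V) = carrier (prolong_mod d V)" "zero (prolong_gmod d A V) = zero (prolong_mod d V)"
  "add (prolong_gmod d A V) = add (prolong_mod d V)" "module.smult (prolong_gmod d A V) = module.smult (prolong_mod d V)"
  by (simp_all add: prolong_gmod_def Let_def)

lemmas prolong_gmod_cong [simp] = module_cong[OF prolong_gmod_simps]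

context diff_bialgebra begin

context
  fixes V :: "('k, 'v, 'a) gmod"
  assumes GV: "gmodule A V" and d: "derivation d"
begin

private lemmas kV = gmoduleD(1)[OF GV] and coact_lin = gmoduleD(3)[OF GV]
private abbreviation (input) "P \<equiv> prolong_mod d V"
private abbreviation (input) "Q \<equiv> tensor (prolong_mod d V) A"
private abbreviation (input) "PG \<equiv> prolong_gmod d A V"
private lemmas P = kvs_prolong[OF kV d] and incl_lin = prolong_incl_lin[OF kV, where d=d] and dh = prolong_der_hom[OF kV, where d=d]
private lemmas dkA = dk_algebraD[OF dk]
private lemma kPA: "kvs Q" and PA: "abelian_group Q" using P by simp_all

private definition "TL = tlift V A Q
  (\<lambda>v a. tmul P A (prolong_der V v) a \<oplus>\<^bsub>Q\<^esub> tmul P A (prolong_incl V v) (der A a))"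
private definition "TI = tmap V A P A (prolong_incl V) id"

private lemmas TI = tmap_lin[OF kV kvs_alg P kvs_alg incl_lin lin_id(1), folded TI_def]
private lemmas TI_tmul = tmap_tmul[OF kV kvs_alg P kvs_alg incl_lin lin_id(1), folded TI_def]
private lemmas cl = lin_closed[OF incl_lin] add_hom_closed[OF dh] dkA(7)

private lemma TL_hom: "TL \<in> add_hom (tensor V A) Q"
  and TL_tmul: "v \<in> carrier V \<Longrightarrow> a \<in> carrier A \<Longrightarrow>
    TL (tmul V A v a) = tmul P A (prolong_der V v) a \<oplus>\<^bsub>Q\<^esub> tmul P A (prolong_incl V v) (der A a)"
proof -
  note ac = ag_ac[OF PA]
  have b: "balanced V A Q
    (\<lambda>v a. tmul P A (prolong_der V v) a \<oplus>\<^bsub>Q\<^esub> tmul P A (prolong_incl V v) (der A a))"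
  proof (rule balancedI)
    fix c v a assume va: "v \<in> carrier V" "a \<in> carrier A"
    then show "tmul P A (prolong_der V (c \<odot>\<^bsub>V\<^esub> v)) a \<oplus>\<^bsub>Q\<^esub> tmul P A (prolong_incl V (c \<odot>\<^bsub>V\<^esub> v)) (der A a) =
      tmul P A (prolong_der V v) (c \<odot> a) \<oplus>\<^bsub>Q\<^esub> tmul P A (prolong_incl V v) (der A (c \<odot> a))"
      using kV P cl by (simp add: prolong_der_smult[where d=d] lin_smult[OF incl_lin] dkA(8) tmul_add_left tmul_add_right
          tmul_smult_left tmul_smult_right ac del: prolong_mod_simps)
  qed (use kV P cl in \<open>simp_all add: add_hom_add[OF dh] lin_add[OF incl_lin] add_hom_add[OF dkA(3)] tmul_add_left tmul_add_right ac del: prolong_mod_simps\<close>)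
  show "TL \<in> add_hom (tensor V A) Q" unfolding TL_def by (rule tlift_add_hom[OF kV kvs_alg PA b])
  show "v \<in> carrier V \<Longrightarrow> a \<in> carrier A \<Longrightarrow>
    TL (tmul V A v a) = tmul P A (prolong_der V v) a \<oplus>\<^bsub>Q\<^esub> tmul P A (prolong_incl V v) (der A a)"
    unfolding TL_def by (rule tlift_tmul[OF kV kvs_alg PA b])
qed

text \<open>The defect of linearity of \<open>TL\<close> is d(c) times \<open>TI\<close>, precisely
  what the twisted scalar multiplication of the prolongation compensates in
  \<open>coact_prolong_lin\<close>.\<close>

private lemma TL_smult:
  assumes s: "s \<in> carrier (tensor V A)"
  shows "TL (c \<odot>\<^bsub>tensor V A\<^esub> s) = c \<odot>\<^bsub>Q\<^esub> TL s \<oplus>\<^bsub>Q\<^esub> d c \<odot>\<^bsub>Q\<^esub> TI s"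
proof (rule tensor_ext[OF kV kvs_alg add_hom_comp[OF smult_hom TL_hom] add_hom_plus[OF add_hom_comp[OF TL_hom smult_hom[OF kPA]]
        add_hom_comp[OF lin_add_hom[OF TI] smult_hom[OF kPA]] PA] _ s])
  fix v a assume va: "v \<in> carrier V" "a \<in> carrier A"
  then show "TL (c \<odot>\<^bsub>tensor V A\<^esub> tmul V A v a) =
      c \<odot>\<^bsub>Q\<^esub> TL (tmul V A v a) \<oplus>\<^bsub>Q\<^esub> d c \<odot>\<^bsub>Q\<^esub> TI (tmul V A v a)"
    using kV P cl by (simp add: tmul_smult_left[OF kV kvs_alg, symmetric] TL_tmul TI_tmul del: prolong_mod_simps)
      (simp add: prolong_der_smult[where d=d] lin_smult[OF incl_lin] tmul_add_left tmul_smult_left kvs_smult_distrib(2)[OF kPA] ag_ac[OF PA] del: prolong_mod_simps)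
qed (use kV in simp)

private lemma coact_prolong:
  assumes "x \<in> carrier V" "y \<in> carrier V"
  shows "coact PG (x, y) = TI (coact V x) \<oplus>\<^bsub>Q\<^esub> TL (coact V y)"
  by (simp add: prolong_gmod_def Let_def TI_def TL_def)

private lemmas rc = lin_closed[OF coact_lin] and TIc = lin_closed[OF TI] and TLc = add_hom_closed[OF TL_hom]

private lemma coact_prolong_lin: "coact PG \<in> lin P Q"
proof (rule linI)
  note ac = ag_ac[OF PA]
  show "coact PG p \<in> carrier Q" if "p \<in> carrier P" for p
    using that PA rc TIc TLc by (auto simp: coact_prolong)
  show "coact PG (p \<oplus>\<^bsub>P\<^esub> q) = coact PG p \<oplus>\<^bsub>Q\<^esub> coact PG q" if "p \<in> carrier P" "q \<in> carrier P" for p q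
    using that kV rc TIc TLc
    by (auto simp: coact_prolong lin_add[OF coact_lin] lin_add[OF TI] add_hom_add[OF TL_hom] ac PA)
  show "coact PG (c \<odot>\<^bsub>P\<^esub> p) = c \<odot>\<^bsub>Q\<^esub> coact PG p" if pc: "p \<in> carrier P" for c p
  proof -
    obtain x y where p: "p = (x, y)" "x \<in> carrier V" "y \<in> carrier V" using pc by auto
    note m = TIc[OF rc[OF p(2)]] TIc[OF rc[OF p(3)]] TLc[OF rc[OF p(3)]]
    have z: "(- d c) \<odot>\<^bsub>Q\<^esub> TI (coact V y) \<oplus>\<^bsub>Q\<^esub> d c \<odot>\<^bsub>Q\<^esub> TI (coact V y) = \<zero>\<^bsub>Q\<^esub>"
      using kvs_smult_distrib(1)[OF kPA m(2), of "- d c" "d c"] kvs_smult(3)[OF kPA m(2)] by simp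
    have "coact PG (c \<odot>\<^bsub>P\<^esub> p) = (c \<odot>\<^bsub>Q\<^esub> TI (coact V x) \<oplus>\<^bsub>Q\<^esub> (- d c) \<odot>\<^bsub>Q\<^esub> TI (coact V y)) \<oplus>\<^bsub>Q\<^esub>
        (c \<odot>\<^bsub>Q\<^esub> TL (coact V y) \<oplus>\<^bsub>Q\<^esub> d c \<odot>\<^bsub>Q\<^esub> TI (coact V y))"
      using p kV rc by (simp add: prolong_smult coact_prolong lin_add[OF coact_lin] lin_smult[OF coact_lin] lin_add[OF TI] lin_smult[OF TI] TL_smult)
    also have "\<dots> = (c \<odot>\<^bsub>Q\<^esub> TI (coact V x) \<oplus>\<^bsub>Q\<^esub> c \<odot>\<^bsub>Q\<^esub> TL (coact V y)) \<oplus>\<^bsub>Q\<^esub>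
        ((- d c) \<odot>\<^bsub>Q\<^esub> TI (coact V y) \<oplus>\<^bsub>Q\<^esub> d c \<odot>\<^bsub>Q\<^esub> TI (coact V y))"
      using m PA kvs_smult(1)[OF kPA] by (simp add: ac)
    also have "\<dots> = c \<odot>\<^bsub>Q\<^esub> coact PG p"
      unfolding z using m PA kvs_smult(1)[OF kPA] by (simp add: p coact_prolong kvs_smult_distrib(2)[OF kPA])
    finally show ?thesis .
  qed
qed

private lemma slice_TI:
  assumes f: "f \<in> lin P kmod" and s: "s \<in> carrier (tensor V A)"
    and fu: "\<And>v. v \<in> carrier V \<Longrightarrow> f (prolong_incl V v) = u v" and u: "u \<in> lin V kmod"
  shows "left_slice P A f (TI s) = left_slice V A u s"
  by (rule tensor_ext[OF kV kvs_alg lin_add_hom[OF lin_comp[OF TI left_slice_lin[OF P kvs_alg f]]]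
        lin_add_hom[OF left_slice_lin[OF kV kvs_alg u]] _ s])
    (simp add: TI_tmul left_slice_tmul[OF P kvs_alg f] left_slice_tmul[OF kV kvs_alg u] cl fu del: prolong_mod_simps)

private lemma slice_TL:
  assumes u: "u \<in> lin V kmod" and s: "s \<in> carrier (tensor V A)"
  shows "left_slice P A (prolong_functional d V u) (TL s) = der A (left_slice V A u s)"
    and "left_slice P A (\<lambda>p. u (snd p)) (TL s) = left_slice V A u s"
proof -
  note pf = prolong_functional_lin[OF kV d u]
  note lf = left_slice_lin[OF P kvs_alg pf(1)] left_slice_tmul[OF P kvs_alg pf(1)]
    and ls = left_slice_lin[OF P kvs_alg pf(4)] left_slice_tmul[OF P kvs_alg pf(4)]
    and lu = left_slice_lin[OF kV kvs_alg u] left_slice_tmul[OF kV kvs_alg u]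
  have u0: "u \<zero>\<^bsub>V\<^esub> = 0" using add_hom_zero[OF lin_add_hom[OF u]] kV by simp
  show "left_slice P A (prolong_functional d V u) (TL s) = der A (left_slice V A u s)"
    by (rule tensor_ext[OF kV kvs_alg add_hom_comp[OF TL_hom lin_add_hom[OF lf(1)]] add_hom_comp[OF lin_add_hom[OF lu(1)] dkA(3)] _ s])
      (use P cl in \<open>simp add: TL_tmul lin_add[OF lf(1)] lf(2) lu(2) pf dkA(8) del: prolong_mod_simps\<close>)
  show "left_slice P A (\<lambda>p. u (snd p)) (TL s) = left_slice V A u s"
    by (rule tensor_ext[OF kV kvs_alg add_hom_comp[OF TL_hom lin_add_hom[OF ls(1)]] lin_add_hom[OF lu(1)] _ s])
      (use P cl u0 in \<open>simp add: TL_tmul lin_add[OF ls(1)] ls(2) lu(2) del: prolong_mod_simps, simp add: prolong_der_def prolong_incl_def\<close>)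
qed

private lemma zero_lin: "(\<lambda>_. 0) \<in> lin V kmod" by (rule linI) simp_all

private lemma slice_zero: "s \<in> carrier (tensor V A) \<Longrightarrow> left_slice V A (\<lambda>_. 0) s = \<zero>"
  by (induction s rule: tensor_induct[OF kV kvs_alg, consumes 1, case_names tmul add])
    (simp_all add: left_slice_tmul[OF kV kvs_alg zero_lin] lin_add[OF left_slice_lin[OF kV kvs_alg zero_lin]])

text \<open>At (0, v) the first formula reads \<psi>(\<partial>v \<otimes> F(u)) = \<partial>
  \<psi>(v \<otimes> u): the derivation of F/R corresponds to that of A.\<close>

lemma coeff_fun_prolong:
  assumes u: "u \<in> lin V kmod" and x: "x \<in> carrier V" "y \<in> carrier V"
  shows "coeff_fun A PG (prolong_functional d V u) (x, y) = coeff_fun A V u x \<oplus> der A (coeff_fun A V u y)"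
    and "coeff_fun A PG (\<lambda>p. u (snd p)) (x, y) = coeff_fun A V u y"
proof -
  note pf = prolong_functional_lin[OF kV d u]
  have u0: "u \<zero>\<^bsub>V\<^esub> = 0" using add_hom_zero[OF lin_add_hom[OF u]] kV by simp
  note c = TIc[OF rc[OF x(1)]] TLc[OF rc[OF x(2)]]
  show "coeff_fun A PG (prolong_functional d V u) (x, y) = coeff_fun A V u x \<oplus> der A (coeff_fun A V u y)"
    using lin_add[OF left_slice_lin[OF P kvs_alg pf(1)] c] slice_TI[OF pf(1) rc[OF x(1)] pf(2) u] slice_TL(1)[OF u rc[OF x(2)]]
    by (simp add: coeff_fun_def coact_prolong[OF x])
  have "left_slice P A (\<lambda>p. u (snd p)) (TI (coact V x)) = left_slice V A (\<lambda>_. 0) (coact V x)"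
    by (rule slice_TI[OF pf(4) rc[OF x(1)] _ zero_lin]) (simp add: prolong_incl_def u0)
  then show "coeff_fun A PG (\<lambda>p. u (snd p)) (x, y) = coeff_fun A V u y"
    using lin_add[OF left_slice_lin[OF P kvs_alg pf(4)] c] slice_TL(2)[OF u rc[OF x(2)]] lin_closed[OF left_slice_lin[OF kV kvs_alg u] rc[OF x(2)]]
    by (simp add: coeff_fun_def coact_prolong[OF x] slice_zero[OF rc[OF x(1)]])
qed

lemma gmodule_prolong: "gmodule A PG"
\<comment> \<open>The functionals F(u) alone need not separate: if \<open>d\<close> is zero they do
  not see the second component. Functionals of that component are therefore added.\<close>
proof (rule gmoduleI[where Y = "prolong_functional d V ` lin V kmod \<union> (\<lambda>u p. u (snd p)) ` lin V kmod"])
  have A': "abelian_group A" by simp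
  show "kvs PG" using P by simp
  show "fin_dim PG" using fin_dim_prolong[OF kV gmoduleD(2)[OF GV] d] P by simp
  show "coact PG \<in> lin PG (tensor PG A)" using coact_prolong_lin by simp
  show "prolong_functional d V ` lin V kmod \<union> (\<lambda>u p. u (snd p)) ` lin V kmod \<subseteq> lin PG kmod"
    using prolong_functional_lin(1,4)[OF kV d] by auto
  show "p = \<zero>\<^bsub>PG\<^esub>" if pc: "p \<in> carrier PG"
    and 0: "\<And>f. f \<in> prolong_functional d V ` lin V kmod \<union> (\<lambda>u p. u (snd p)) ` lin V kmod \<Longrightarrow> f p = 0" for p
  proof -
    obtain x y where p: "p = (x, y)" "x \<in> carrier V" "y \<in> carrier V" using pc by auto
    have y: "y = \<zero>\<^bsub>V\<^esub>" by (rule functional_separates[OF kV p(3)]) (use 0 p in force)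
    have "u x = 0" if u: "u \<in> lin V kmod" for u
      using 0[of "prolong_functional d V u"] u p prolong_functional_lin(2)[OF kV d u p(2)] by (simp add: y prolong_incl_def)
    then have "x = \<zero>\<^bsub>V\<^esub>" by (rule functional_separates[OF kV p(2)])
    then show ?thesis using y p by simp
  qed
  fix f p assume "f \<in> prolong_functional d V ` lin V kmod \<union> (\<lambda>u p. u (snd p)) ` lin V kmod" and pc: "p \<in> carrier PG"
  then obtain u where u: "u \<in> lin V kmod" and f: "f = prolong_functional d V u \<or> f = (\<lambda>p. u (snd p))" by blast
  obtain x y where p: "p = (x, y)" "x \<in> carrier V" "y \<in> carrier V" using pc by auto
  note pf = prolong_functional_lin[OF kV d u] and fu = gmoduleD(4)[OF GV u]
  have u0: "u \<zero>\<^bsub>V\<^esub> = 0" and fu0: "coeff_fun A V u \<zero>\<^bsub>V\<^esub> = \<zero>" and dA0: "der A \<zero> = \<zero>"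
    using add_hom_zero[OF lin_add_hom[OF u]] add_hom_zero[OF lin_add_hom[OF fu]] add_hom_zero[OF dkA(3)] kV by simp_all
  have fl: "f \<in> lin P kmod" using f pf by auto
  have L: "coeff_fun A PG f \<in> lin P A"
    using lin_comp[OF coact_prolong_lin left_slice_lin[OF P kvs_alg fl]] by (simp add: coeff_fun_def[abs_def])
  note tL = tmap_lin[OF P kvs_alg kvs_alg kvs_alg L lin_id(1)] tmap_tmul[OF P kvs_alg kvs_alg kvs_alg L lin_id(1)]
  note tu = tmap_lin[OF kV kvs_alg kvs_alg kvs_alg fu lin_id(1)] tmap_tmul[OF kV kvs_alg kvs_alg kvs_alg fu lin_id(1)]
  note c = TIc[OF rc[OF p(2)]] TLc[OF rc[OF p(3)]] and fc = lin_closed[OF fu p(2)] lin_closed[OF fu p(3)]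
  have V0: "\<zero>\<^bsub>V\<^esub> \<in> carrier V" using kV by simp
  have AA: "abelian_group (tensor A A)" by simp
  have ci: "coeff_fun A PG (prolong_functional d V u) (prolong_incl V v) = coeff_fun A V u v"
    "coeff_fun A PG (prolong_functional d V u) (prolong_der V v) = der A (coeff_fun A V u v)"
    "coeff_fun A PG (\<lambda>p. u (snd p)) (prolong_incl V v) = \<zero>"
    "coeff_fun A PG (\<lambda>p. u (snd p)) (prolong_der V v) = coeff_fun A V u v" if v: "v \<in> carrier V" for v
    using coeff_fun_prolong[OF u v V0] coeff_fun_prolong[OF u V0 v] lin_closed[OF fu v] dkA(7)
    by (simp_all add: prolong_incl_def prolong_der_def fu0 dA0)
  have lhs: "tmap P A A A (coeff_fun A PG f) id (coact PG p) =
      tmap P A A A (coeff_fun A PG f) id (TI (coact V x)) \<oplus>\<^bsub>tensor A A\<^esub> tmap P A A A (coeff_fun A PG f) id (TL (coact V y))"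
    using lin_add[OF tL(1) c] by (simp add: p coact_prolong)
  show "comult A (coeff_fun A PG f p) = tmap PG A A A (coeff_fun A PG f) id (coact PG p)"
    using f
  proof
    assume f: "f = prolong_functional d V u"
    have 1: "tmap P A A A (coeff_fun A PG f) id (TI (coact V x)) = tmap V A A A (coeff_fun A V u) id (coact V x)"
      by (rule tensor_ext[OF kV kvs_alg lin_add_hom[OF lin_comp[OF TI tL(1)]] lin_add_hom[OF tu(1)] _ rc[OF p(2)]])
        (use cl ci in \<open>simp add: TI_tmul tL(2)[unfolded f] tu(2) f del: prolong_mod_simps\<close>)
    have 2: "tmap P A A A (coeff_fun A PG f) id (TL (coact V y)) = der (tensor_dalg A A) (tmap V A A A (coeff_fun A V u) id (coact V y))"
      by (rule tensor_ext[OF kV kvs_alg add_hom_comp[OF TL_hom lin_add_hom[OF tL(1)]] add_hom_comp[OF lin_add_hom[OF tu(1)] tensor_der_hom[OF dk dk]] _ rc[OF p(3)]])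
        (use P cl ci lin_closed[OF fu] in \<open>simp add: TL_tmul lin_add[OF tL(1)[unfolded f]] tL(2)[unfolded f] tu(2) f tensor_der_tmul[OF dk dk] del: prolong_mod_simps\<close>)
    have "comult A (coeff_fun A PG f p) = comult A (coeff_fun A V u x) \<oplus>\<^bsub>tensor A A\<^esub> der (tensor_dalg A A) (comult A (coeff_fun A V u y))"
      using comult_iff fc dkA(7) by (simp add: f p coeff_fun_prolong[OF u p(2,3)])
    then show ?thesis unfolding lhs[unfolded f] f 1[unfolded f] 2[unfolded f] prolong_gmod_cong
      by (simp add: gmoduleD(5)[OF GV u p(2)] gmoduleD(5)[OF GV u p(3)] lhs[unfolded f] 1[unfolded f] 2[unfolded f])
  next
    assume f: "f = (\<lambda>p. u (snd p))"
    have z: "(\<lambda>_. \<zero>\<^bsub>tensor A A\<^esub>) \<in> add_hom (tensor V A) (tensor A A)" by (rule add_homI) (simp_all add: AA)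
    have 1: "tmap P A A A (coeff_fun A PG f) id (TI (coact V x)) = \<zero>\<^bsub>tensor A A\<^esub>"
      by (rule tensor_ext[OF kV kvs_alg lin_add_hom[OF lin_comp[OF TI tL(1)]] z _ rc[OF p(2)]])
        (use cl ci in \<open>simp add: TI_tmul tL(2)[unfolded f] f del: prolong_mod_simps\<close>)
    have 2: "tmap P A A A (coeff_fun A PG f) id (TL (coact V y)) = tmap V A A A (coeff_fun A V u) id (coact V y)"
      by (rule tensor_ext[OF kV kvs_alg add_hom_comp[OF TL_hom lin_add_hom[OF tL(1)]] lin_add_hom[OF tu(1)] _ rc[OF p(3)]])
        (use P cl ci lin_closed[OF fu] in \<open>simp add: TL_tmul lin_add[OF tL(1)[unfolded f]] tL(2)[unfolded f] tu(2) f del: prolong_mod_simps\<close>)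
    have "comult A (coeff_fun A PG f p) = comult A (coeff_fun A V u y)" by (simp add: f p coeff_fun_prolong[OF u p(2,3)])
    then show ?thesis using lin_closed[OF tu(1) rc[OF p(3)]]
      by (simp add: gmoduleD(5)[OF GV u p(3)] lhs 1 2 AA)
  qed
  show "counit A (coeff_fun A PG f p) = f p"
    using f
  proof
    assume f: "f = prolong_functional d V u"
    show ?thesis
      using counit_iff fc dkA(7) p gmoduleD(6)[OF GV u p(2)] gmoduleD(6)[OF GV u p(3)]
      by (simp add: f coeff_fun_prolong[OF u p(2,3)]) (simp add: prolong_functional_def)
  next
    assume f: "f = (\<lambda>p. u (snd p))"
    show ?thesis using p gmoduleD(6)[OF GV u p(3)] by (simp add: f coeff_fun_prolong[OF u p(2,3)])
  qed
qed

end

end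

subsection \<open>Matrix coefficients\<close>

lemma tlift_cong_fun:
  "(\<And>x y. x \<in> carrier M \<Longrightarrow> y \<in> carrier N \<Longrightarrow> \<beta> x y = \<beta>' x y) \<Longrightarrow> tlift M N P \<beta> = tlift M N P \<beta>'"
  by (simp add: tlift_def cong: ball_cong_simp)

lemma left_slice_cong: "(\<And>x. x \<in> carrier M \<Longrightarrow> u x = u' x) \<Longrightarrow> left_slice M N u = left_slice M N u'"
  unfolding left_slice_def by (rule tlift_cong_fun) simp

lemma coeff_fun_cong: "(\<And>x. x \<in> carrier V \<Longrightarrow> u x = u' x) \<Longrightarrow> coeff_fun A V u = coeff_fun A V u'"
  using left_slice_cong[of V u u' A] by (simp add: coeff_fun_def fun_eq_iff)

lemma tmap_left_comp:
  assumes M: "kvs M" and M': "kvs M'" and P: "kvs P" and N: "kvs N" and f: "f \<in> lin M M'" and g: "g \<in> lin M' P" and h: "h \<in> lin M P"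
    and eq: "\<And>x. x \<in> carrier M \<Longrightarrow> g (f x) = h x" and z: "z \<in> carrier (tensor M N)"
  shows "tmap M' N P N g id (tmap M N M' N f id z) = tmap M N P N h id z"
  by (rule tensor_ext[OF M N lin_add_hom[OF lin_comp[OF tmap_lin[OF M N M' N f lin_id(1)] tmap_lin[OF M' N P N g lin_id(1)]]]
        lin_add_hom[OF tmap_lin[OF M N P N h lin_id(1)]] _ z])
    (simp add: tmap_tmul[OF M N M' N f lin_id(1)] tmap_tmul[OF M' N P N g lin_id(1)] tmap_tmul[OF M N P N h lin_id(1)] lin_closed[OF f] eq)

lemma submodule_vimage:
  assumes V: "kvs V" and W: "kvs W" and f: "f \<in> lin V W" and N: "submodule N kring W"
  shows "submodule {x \<in> carrier V. f x \<in> N} kring V"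
  unfolding submodule_iff[OF V]
  using V W submoduleD[OF W N] add_hom_zero[OF lin_add_hom[OF f]] by (auto simp: lin_add[OF f] lin_smult[OF f])

lemma submodule_image:
  fixes V (structure)
  assumes V: "kvs V" and W: "kvs W" and f: "f \<in> lin V W"
  shows "submodule (f ` carrier V) kring W"
  unfolding submodule_iff[OF W]
proof (intro conjI ballI allI)
  show "f ` carrier V \<subseteq> carrier W" using lin_closed[OF f] by blast
  show "\<zero>\<^bsub>W\<^esub> \<in> f ` carrier V" by (rule image_eqI[of _ _ "\<zero>"]) (use V W add_hom_zero[OF lin_add_hom[OF f]] in simp_all)
  fix x assume "x \<in> f ` carrier V"
  then obtain x' where x: "x = f x'" "x' \<in> carrier V" by blast
  show "c \<odot>\<^bsub>W\<^esub> x \<in> f ` carrier V" for c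
    by (rule image_eqI[of _ _ "c \<odot> x'"]) (use V x in \<open>simp_all add: lin_smult[OF f]\<close>)
  fix y assume "y \<in> f ` carrier V"
  then obtain y' where y: "y = f y'" "y' \<in> carrier V" by blast
  show "x \<oplus>\<^bsub>W\<^esub> y \<in> f ` carrier V"
    by (rule image_eqI[of _ _ "x' \<oplus> y'"]) (use V x y in \<open>simp_all add: lin_add[OF f]\<close>)
qed

lemma dual_simps:
  "u \<in> carrier (dual V) \<Longrightarrow> u \<in> lin V kmod" "\<zero>\<^bsub>dual V\<^esub> = (\<lambda>x\<in>carrier V. 0)"
  "u \<oplus>\<^bsub>dual V\<^esub> u' = (\<lambda>x\<in>carrier V. u x + u' x)" "c \<odot>\<^bsub>dual V\<^esub> u = (\<lambda>x\<in>carrier V. c * u x)"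
  by (simp_all add: dual_def)

lemma restrict_dual: "kvs V \<Longrightarrow> u \<in> lin V kmod \<Longrightarrow> restrict u (carrier V) \<in> carrier (dual V)"
  by (auto simp: dual_def lin_add lin_smult intro!: linI)

lemma dual_eqI:
  "u \<in> carrier (dual V) \<Longrightarrow> u' \<in> carrier (dual V) \<Longrightarrow> (\<And>x. x \<in> carrier V \<Longrightarrow> u x = u' x) \<Longrightarrow> u = u'"
  unfolding dual_def by (auto intro: extensionalityI)

lemma kvs_dual [simp]:
  assumes V: "kvs V" shows "kvs (dual V)"
proof -
  have z: "\<zero>\<^bsub>dual V\<^esub> \<in> carrier (dual V)"
    unfolding dual_simps by (rule restrict_dual[OF V], rule linI) simp_all
  have a: "u \<oplus>\<^bsub>dual V\<^esub> u' \<in> carrier (dual V)" if "u \<in> carrier (dual V)" "u' \<in> carrier (dual V)" for u u'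
  proof -
    note l = dual_simps(1)[OF that(1)] dual_simps(1)[OF that(2)]
    show ?thesis unfolding dual_simps
      by (rule restrict_dual[OF V], rule linI) (simp_all add: lin_add[OF l(1)] lin_add[OF l(2)] lin_smult[OF l(1)] lin_smult[OF l(2)] algebra_simps)
  qed
  have s: "c \<odot>\<^bsub>dual V\<^esub> u \<in> carrier (dual V)" if "u \<in> carrier (dual V)" for u c
  proof -
    note l = dual_simps(1)[OF that]
    show ?thesis unfolding dual_simps
      by (rule restrict_dual[OF V], rule linI) (simp_all add: lin_add[OF l] lin_smult[OF l] algebra_simps)
  qed
  show ?thesis
  proof (rule kvsI)
    show "abelian_group (dual V)"
    proof (rule abelian_groupI)
      fix u assume u: "u \<in> carrier (dual V)"
      have "(-1) \<odot>\<^bsub>dual V\<^esub> u \<oplus>\<^bsub>dual V\<^esub> u = \<zero>\<^bsub>dual V\<^esub>"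
        by (rule dual_eqI[where V = V], simp add: a s u, rule z) (simp add: dual_simps(2-4))
      then show "\<exists>u'\<in>carrier (dual V). u' \<oplus>\<^bsub>dual V\<^esub> u = \<zero>\<^bsub>dual V\<^esub>" using s[OF u] by blast
    qed ((simp add: a z; fail) | (rule dual_eqI[where V = V], simp add: a z, simp add: a z, simp add: dual_simps(2-4) algebra_simps))+
  qed ((simp add: s; fail) | (rule dual_eqI[where V = V], simp add: a s, simp add: a s, simp add: dual_simps(2-4) V algebra_simps))+
qed

lemma dual_map_lin:
  assumes V: "kvs V" and W: "kvs W" and f: "f \<in> lin V W"
  shows "dual_map V f \<in> lin (dual W) (dual V)"
proof (rule linI)
  show "dual_map V f u \<in> carrier (dual V)" if "u \<in> carrier (dual W)" for u
    unfolding dual_map_def by (rule restrict_dual[OF V lin_comp[OF f dual_simps(1)[OF that]]])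
qed (use lin_closed[OF f] in \<open>auto simp: dual_map_def dual_simps(2-4)\<close>)

lemma dual_map_apply: "x \<in> carrier V \<Longrightarrow> dual_map V f u x = u (f x)"
  by (simp add: dual_map_def)

definition sub_mod :: "('k::field, 'a, 'm) module_scheme \<Rightarrow> 'a set \<Rightarrow> ('k, 'a) module" where
  "sub_mod M N = \<lparr>carrier = N, mult = mult M, one = one M, zero = zero M, add = add M, module.smult = module.smult M\<rparr>"

lemma sub_mod_simps [simp]:
  "carrier (sub_mod M N) = N" "zero (sub_mod M N) = zero M" "add (sub_mod M N) = add M" "module.smult (sub_mod M N) = module.smult M"
  by (simp_all add: sub_mod_def)

lemma sub_mod_incl: "N \<subseteq> carrier M \<Longrightarrow> id \<in> lin (sub_mod M N) M"
  by (rule linI) auto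

lemma kvs_sub_mod:
  assumes M: "kvs M" and N: "submodule N kring M" shows "kvs (sub_mod M N)"
  by (rule kvs_embedded[OF M _ _ _ _ sub_mod_incl]) (use submoduleD[OF M N] in simp_all)

lemma fin_dim_sub_mod:
  assumes M: "kvs M" and F: "finite F" "F \<subseteq> carrier M"
  shows "fin_dim (sub_mod M (lspan M F))"
proof (rule fin_dimI[OF _ F(1)])
  note S = submodule_lspan[OF M F(2)]
  show k: "kvs (sub_mod M (lspan M F))" by (rule kvs_sub_mod[OF M S])
  show "F \<subseteq> carrier (sub_mod M (lspan M F))" using lspan_superset by simp
  fix N assume N: "submodule N kring (sub_mod M (lspan M F))" "F \<subseteq> N"
  have "submodule N kring M" unfolding submodule_iff[OF M]
    using submoduleD[OF k N(1)] submoduleD(1)[OF M S] by auto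
  then show "carrier (sub_mod M (lspan M F)) \<subseteq> N" using lspan_minimal[OF _ N(2)] by simp
qed

lemma lin_sub_mod: "f \<in> lin V M \<Longrightarrow> f ` carrier V \<subseteq> N \<Longrightarrow> f \<in> lin V (sub_mod M N)"
  by (rule linI) (auto simp: lin_add lin_smult)

text \<open>Over a field N \<otimes> A embeds into A \<otimes> A; the coaction is \<Delta> pulled
  back along this embedding, which makes sense when \<Delta> N lies in its image.\<close>

definition sub_gmod :: "('k::field, 'a) dhopf \<Rightarrow> 'a set \<Rightarrow> ('k, 'a, 'a) gmod" where
  "sub_gmod A N = (let S = sub_mod A N in
     \<lparr>carrier = carrier S, mult = mult S, one = one S, zero = zero S, add = add S, module.smult = module.smult S,
      coact = (\<lambda>w. inv_into (carrier (tensor S A)) (tmap S A A A id id) (comult A w))\<rparr>)"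

lemma sub_gmod_simps [simp]:
  "carrier (sub_gmod A N) = carrier (sub_mod A N)" "zero (sub_gmod A N) = zero (sub_mod A N)"
  "add (sub_gmod A N) = add (sub_mod A N)" "module.smult (sub_gmod A N) = module.smult (sub_mod A N)"
  by (simp_all add: sub_gmod_def Let_def)

lemmas sub_gmod_cong = module_cong[OF sub_gmod_simps]

context diff_bialgebra begin

text \<open>Transport of structure along an injection. It provides modules of any type with
  isomorphic copies on the carrier type over which the direct sum is formed.\<close>

lemma gmod_copy:
  fixes V :: "('k, 'v, 'a) gmod" and \<beta> :: "'v \<Rightarrow> 'e"
  assumes GV: "gmodule A V" and inj: "inj_on \<beta> (carrier V)"
  obtains V' :: "('k, 'e, 'a) gmod" where "gmodule A V'" "\<beta> \<in> gmod_iso A V V'"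
proof -
  note V = gmoduleD(1)[OF GV] and rV = gmoduleD(3)[OF GV]
  define \<gamma> where "\<gamma> = inv_into (carrier V) \<beta>"
  have g: "\<gamma> (\<beta> x) = x" if "x \<in> carrier V" for x using inj that by (simp add: \<gamma>_def)
  define M :: "('k, 'e) module" where "M = \<lparr>carrier = \<beta> ` carrier V, mult = undefined, one = undefined, zero = \<beta> \<zero>\<^bsub>V\<^esub>,
     add = (\<lambda>x y. \<beta> (\<gamma> x \<oplus>\<^bsub>V\<^esub> \<gamma> y)), module.smult = (\<lambda>c x. \<beta> (c \<odot>\<^bsub>V\<^esub> \<gamma> x))\<rparr>"
  have M: "carrier M = \<beta> ` carrier V" "\<zero>\<^bsub>M\<^esub> = \<beta> \<zero>\<^bsub>V\<^esub>" "x \<oplus>\<^bsub>M\<^esub> y = \<beta> (\<gamma> x \<oplus>\<^bsub>V\<^esub> \<gamma> y)" "c \<odot>\<^bsub>M\<^esub> x = \<beta> (c \<odot>\<^bsub>V\<^esub> \<gamma> x)" for x y c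
    by (simp_all add: M_def)
  have \<gamma>l: "\<gamma> \<in> lin M V" and \<beta>l: "\<beta> \<in> lin V M"
    by (rule linI; use V in \<open>auto simp: M g\<close>)+
  have kM: "kvs M"
    by (rule kvs_embedded[OF V _ _ _ _ \<gamma>l]) (use V in \<open>auto simp: M g intro!: inj_onI\<close>)
  have fd: "fin_dim M" by (rule fin_dim_image[OF V gmoduleD(2)[OF GV] kM \<beta>l]) (simp add: M)
  define W :: "('k, 'e, 'a) gmod" where "W = \<lparr>carrier = carrier M, mult = mult M, one = one M, zero = zero M,
    add = add M, module.smult = module.smult M, coact = (\<lambda>x. tmap V A M A \<beta> id (coact V (\<gamma> x)))\<rparr>"
  have Ws: "carrier W = carrier M" "zero W = zero M" "add W = add M" "module.smult W = module.smult M"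
    and cW: "coact W = (\<lambda>x. tmap V A M A \<beta> id (coact V (\<gamma> x)))" by (simp_all add: W_def)
  note Wc = module_cong[OF Ws] and t = tmap_lin[OF V kvs_alg kM kvs_alg \<beta>l lin_id(1)]
  have r: "coact W \<in> lin M (tensor M A)" unfolding cW by (rule lin_comp[OF lin_comp[OF \<gamma>l rV] t])
  have W: "kvs W" by (rule Wc(6)[OF kM])
  have tc: "tmap V A W A = tmap V A M A"
    by (simp add: tmap_def fun_eq_iff Wc(1,2))
  have lW: "lin V W = lin V M" by (auto simp: lin_def add_hom_iff Ws)
  have coeff: "coeff_fun A W u y = coeff_fun A V (\<lambda>x. u (\<beta> x)) (\<gamma> y)" if "u \<in> lin M kmod" "y \<in> carrier M" for u y
    using left_slice_tmap[OF V kM kvs_alg \<beta>l that(1) lin_closed[OF rV lin_closed[OF \<gamma>l that(2)]]] by (simp add: coeff_fun_def Wc(3) cW)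
  have "gmodule A W"
  proof (rule gmoduleI[OF W Wc(7)[OF kM fd] _ subset_refl])
    show "coact W \<in> lin W (tensor W A)" using r by (simp add: Wc)
    show "x = \<zero>\<^bsub>W\<^esub>" if "x \<in> carrier W" "\<And>u. u \<in> lin W kmod \<Longrightarrow> u x = 0" for x
      by (rule functional_separates[OF W that(1)]) (rule that(2))
    fix u y assume uW: "u \<in> lin W kmod" and yW: "y \<in> carrier W"
    have u: "u \<in> lin M kmod" and y: "y \<in> carrier M" using uW yW by (simp_all add: Wc Ws)
    note ub = lin_comp[OF \<beta>l u] and gy = lin_closed[OF \<gamma>l y]
    have L: "coeff_fun A W u \<in> lin M A"
      using lin_comp[OF r left_slice_lin[OF kM kvs_alg u]] by (simp add: coeff_fun_def[abs_def] Wc(3))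
    show "comult A (coeff_fun A W u y) = tmap W A A A (coeff_fun A W u) id (coact W y)"
      unfolding Wc(4) cW coeff[OF u y] gmoduleD(5)[OF GV ub gy]
      by (rule tmap_left_comp[OF V kM kvs_alg kvs_alg \<beta>l L gmoduleD(4)[OF GV ub] _ lin_closed[OF rV gy], symmetric])
        (use lin_closed[OF \<beta>l] in \<open>simp add: coeff[OF u] g\<close>)
    show "counit A (coeff_fun A W u y) = u y"
      using y by (auto simp: coeff[OF u y] gmoduleD(6)[OF GV ub gy] M(1) g)
  qed
  moreover have "\<beta> \<in> gmod_iso A V W"
    unfolding gmod_iso_def gmod_hom_def using \<beta>l inj by (auto simp: lW tc cW g Ws M(1) bij_betw_def)
  ultimately show thesis by (rule that)
qed

lemma coeff_fun_dual:
  assumes GV: "gmodule A V" and u: "u \<in> carrier (dual V)" "u' \<in> carrier (dual V)" and v: "v \<in> carrier V"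
  shows "coeff_fun A V (u \<oplus>\<^bsub>dual V\<^esub> u') v = coeff_fun A V u v \<oplus> coeff_fun A V u' v"
    and "coeff_fun A V (c \<odot>\<^bsub>dual V\<^esub> u) v = c \<odot> coeff_fun A V u v"
proof -
  note V = gmoduleD(1)[OF GV] and rv = lin_closed[OF gmoduleD(3)[OF GV] v]
  note l = dual_simps(1)[OF u(1)] dual_simps(1)[OF u(2)]
  have D: "kvs (dual V)" and A: "abelian_group A" using V by simp_all
  have s: "u \<oplus>\<^bsub>dual V\<^esub> u' \<in> lin V kmod" "c \<odot>\<^bsub>dual V\<^esub> u \<in> lin V kmod" using D u by (simp_all add: dual_simps(1))
  show "coeff_fun A V (u \<oplus>\<^bsub>dual V\<^esub> u') v = coeff_fun A V u v \<oplus> coeff_fun A V u' v" unfolding coeff_fun_def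
    by (rule tensor_ext[OF V kvs_alg lin_add_hom[OF left_slice_lin[OF V kvs_alg s(1)]]
          add_hom_plus[OF lin_add_hom[OF left_slice_lin[OF V kvs_alg l(1)]] lin_add_hom[OF left_slice_lin[OF V kvs_alg l(2)]] A] _ rv])
      (simp add: left_slice_tmul[OF V kvs_alg] s l, simp add: dual_simps(2-4) kvs_smult_distrib(1)[OF kvs_alg])
  show "coeff_fun A V (c \<odot>\<^bsub>dual V\<^esub> u) v = c \<odot> coeff_fun A V u v" unfolding coeff_fun_def
    by (rule tensor_ext[OF V kvs_alg lin_add_hom[OF left_slice_lin[OF V kvs_alg s(2)]]
          add_hom_comp[OF lin_add_hom[OF left_slice_lin[OF V kvs_alg l(1)]] smult_hom[OF kvs_alg]] _ rv])
      (simp add: left_slice_tmul[OF V kvs_alg] s l, simp add: dual_simps(2-4) kvs_smult_distrib(3)[OF kvs_alg])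
qed

lemma
  assumes GV: "gmodule A V"
  shows mat_coeff_lin: "mat_coeff A V \<in> lin (tensor V (dual V)) A"
    and mat_coeff_tmul: "v \<in> carrier V \<Longrightarrow> u \<in> carrier (dual V) \<Longrightarrow> mat_coeff A V (tmul V (dual V) v u) = coeff_fun A V u v"
proof -
  note V = gmoduleD(1)[OF GV]
  have A: "abelian_group A" by simp
  have m: "mat_coeff A V = tlift V (dual V) A (\<lambda>v u. coeff_fun A V u v)"
    by (simp add: mat_coeff_def coeff_fun_def left_slice_def)
  note l = gmoduleD(4)[OF GV dual_simps(1)]
  have b: "balanced V (dual V) A (\<lambda>v u. coeff_fun A V u v)"
    by (rule balancedI) (simp_all add: lin_closed[OF l] lin_add[OF l] lin_smult[OF l] coeff_fun_dual[OF GV])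
  show "mat_coeff A V \<in> lin (tensor V (dual V)) A" unfolding m
    by (rule tlift_lin[OF V kvs_dual[OF V] kvs_alg b]) (simp add: lin_smult[OF l])
  show "v \<in> carrier V \<Longrightarrow> u \<in> carrier (dual V) \<Longrightarrow> mat_coeff A V (tmul V (dual V) v u) = coeff_fun A V u v" unfolding m
    by (rule tlift_tmul[OF V kvs_dual[OF V] A b])
qed

text \<open>Exactly what is needed for the maps \<psi> to kill the generators of
  \<open>Rrel\<close>.\<close>

lemma mat_coeff_natural:
  assumes GV: "gmodule A V" and GW: "gmodule A W" and f: "\<phi> \<in> gmod_hom A V W" and z: "z \<in> carrier (tensor V (dual W))"
  shows "mat_coeff A V (tmap V (dual W) V (dual V) id (dual_map V \<phi>) z) = mat_coeff A W (tmap V (dual W) W (dual W) \<phi> id z)"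
proof -
  note V = gmoduleD(1)[OF GV] and W = gmoduleD(1)[OF GW]
  have fl: "\<phi> \<in> lin V W" using f by (simp add: gmod_hom_def)
  note dl = dual_map_lin[OF V W fl]
  note t1 = tmap_lin[OF V kvs_dual[OF W] V kvs_dual[OF V] lin_id(1) dl] tmap_tmul[OF V kvs_dual[OF W] V kvs_dual[OF V] lin_id(1) dl]
    and t2 = tmap_lin[OF V kvs_dual[OF W] W kvs_dual[OF W] fl lin_id(1)] tmap_tmul[OF V kvs_dual[OF W] W kvs_dual[OF W] fl lin_id(1)]
  show ?thesis
  proof (rule tensor_ext[OF V kvs_dual[OF W] lin_add_hom[OF lin_comp[OF t1(1) mat_coeff_lin[OF GV]]]
        lin_add_hom[OF lin_comp[OF t2(1) mat_coeff_lin[OF GW]]] _ z])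
    fix v u assume vu: "v \<in> carrier V" "u \<in> carrier (dual W)"
    have "coeff_fun A V (dual_map V \<phi> u) v = coeff_fun A V (\<lambda>x. u (\<phi> x)) v"
      using coeff_fun_cong[of V "dual_map V \<phi> u" "\<lambda>x. u (\<phi> x)" A] by (simp add: dual_map_apply)
    then show "mat_coeff A V (tmap V (dual W) V (dual V) id (dual_map V \<phi>) (tmul V (dual W) v u)) =
        mat_coeff A W (tmap V (dual W) W (dual W) \<phi> id (tmul V (dual W) v u))"
      using vu lin_closed[OF fl] lin_closed[OF dl] gmod_homD[OF GV GW f dual_simps(1)[OF vu(2)] vu(1)]
      by (simp add: t1(2) t2(2) mat_coeff_tmul[OF GV] mat_coeff_tmul[OF GW])
  qed
qed

subsection \<open>Subcomodules of the coordinate ring\<close>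

text \<open>N \<otimes> A is not a subset of A \<otimes> A in this encoding, so the inclusion of
  \<Delta> N in N \<otimes> A is expressed through the image of the induced map.\<close>

definition subcomod :: "'a set \<Rightarrow> bool" where
  "subcomod N \<longleftrightarrow> submodule N kring A \<and> fin_dim (sub_mod A N) \<and>
     (\<forall>w\<in>N. comult A w \<in> tmap (sub_mod A N) A A A id id ` carrier (tensor (sub_mod A N) A))"

context
  fixes N assumes N: "subcomod N"
begin

private abbreviation (input) "S \<equiv> sub_mod A N"
private abbreviation (input) "J \<equiv> tmap S A A A id id"
private lemma sN: "submodule N kring A" and S: "kvs S"
  using N kvs_sub_mod[OF kvs_alg] by (auto simp: subcomod_def)
private lemmas NA = submoduleD(1)[OF kvs_alg sN]
private lemmas il = sub_mod_incl[OF NA]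
private lemmas J = tmap_lin[OF S kvs_alg kvs_alg kvs_alg il lin_id(1)]
private lemma J_inj: "inj_on J (carrier (tensor S A))"
  by (rule tmap_inj[OF S kvs_alg kvs_alg il]) simp

private lemma coact_sub:
  assumes "w \<in> N"
  shows "coact (sub_gmod A N) w \<in> carrier (tensor S A)" "J (coact (sub_gmod A N) w) = comult A w"
  using N assms inv_into_into[of "comult A w" J "carrier (tensor S A)"] f_inv_into_f[of "comult A w" J "carrier (tensor S A)"]
  by (simp_all add: subcomod_def sub_gmod_def Let_def)

private lemma coact_sub_lin: "coact (sub_gmod A N) \<in> lin S (tensor S A)"
proof -
  note n = submoduleD[OF kvs_alg sN]
  have k: "kvs (tensor S A)" using S by simp
  show ?thesis
  proof (rule linI)
    fix c x y assume x: "x \<in> carrier S" and y: "y \<in> carrier S"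
    then have xa: "x \<in> N" "y \<in> N" "x \<in> carrier A" "y \<in> carrier A" using NA by auto
    have xy: "x \<oplus> y \<in> N" using n(3) x y by simp
    show "coact (sub_gmod A N) (x \<oplus>\<^bsub>S\<^esub> y) = coact (sub_gmod A N) x \<oplus>\<^bsub>tensor S A\<^esub> coact (sub_gmod A N) y"
      by (rule inj_onD[OF J_inj]) (use xa xy k coact_sub in \<open>simp_all add: lin_add[OF J] lin_add[OF comult_lin]\<close>)
  next
    fix c x assume "x \<in> carrier S"
    then have xa: "x \<in> N" "x \<in> carrier A" "c \<odot> x \<in> N" using NA n(4) by auto
    show "coact (sub_gmod A N) (c \<odot>\<^bsub>S\<^esub> x) = c \<odot>\<^bsub>tensor S A\<^esub> coact (sub_gmod A N) x"
      by (rule inj_onD[OF J_inj]) (use xa k coact_sub in \<open>simp_all add: lin_smult[OF J] lin_smult[OF comult_lin]\<close>)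
  qed (use coact_sub in simp)
qed

private lemma coeff_fun_sub:
  assumes u: "u \<in> lin A kmod" and w: "w \<in> N"
  shows "coeff_fun A (sub_gmod A N) u w = left_slice A A u (comult A w)"
  using left_slice_tmap[OF S kvs_alg kvs_alg il u coact_sub(1)[OF w]] coact_sub(2)[OF w]
  by (simp add: coeff_fun_def sub_gmod_cong)

text \<open>The left counit law: the coefficient function of \<epsilon> on a subcomodule is its
  inclusion into A.\<close>

lemma coeff_fun_sub_counit: "w \<in> N \<Longrightarrow> coeff_fun A (sub_gmod A N) (counit A) w = w"
  using coeff_fun_sub[OF counit_lin] counit_left NA by auto

lemma counit_sub: "restrict (counit A) N \<in> carrier (dual (sub_gmod A N))"
proof -
  have "counit A \<in> lin S kmod" using lin_comp[OF il counit_lin] by (simp add: id_def)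
  then show ?thesis using restrict_dual[OF sub_gmod_cong(6)[OF S], of "counit A"] by (simp add: sub_gmod_cong)
qed

text \<open>Functionals on A separate the elements of N, and their coefficient functions on N are
  computed inside A; the comodule conditions thus become coassociativity and the right counit law of
  A.\<close>

lemma gmodule_sub: "gmodule A (sub_gmod A N)"
proof (rule gmoduleI[where Y = "lin A kmod"])
  show "kvs (sub_gmod A N)" by (rule sub_gmod_cong(6)[OF S])
  show "fin_dim (sub_gmod A N)" by (rule sub_gmod_cong(7)[OF S]) (use N in \<open>simp add: subcomod_def\<close>)
  show "coact (sub_gmod A N) \<in> lin (sub_gmod A N) (tensor (sub_gmod A N) A)" using coact_sub_lin by (simp add: sub_gmod_cong)
  have res: "u \<in> lin S kmod" if "u \<in> lin A kmod" for u using lin_comp[OF il that] by (simp add: id_def)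
  then show "lin A kmod \<subseteq> lin (sub_gmod A N) kmod" by (auto simp: sub_gmod_cong)
  show "x = \<zero>\<^bsub>sub_gmod A N\<^esub>" if "x \<in> carrier (sub_gmod A N)" "\<And>u. u \<in> lin A kmod \<Longrightarrow> u x = 0" for x
    using functional_separates[OF kvs_alg, of x] that NA by auto
  have AA: "kvs (tensor A A)" by simp
  fix u w assume u: "u \<in> lin A kmod" and wS: "w \<in> carrier (sub_gmod A N)"
  then have w: "w \<in> N" "w \<in> carrier A" using NA by auto
  note c = lin_closed[OF comult_lin w(2)]
  note g = lin_comp[OF comult_lin left_slice_lin[OF kvs_alg kvs_alg u]]
  have L: "coeff_fun A (sub_gmod A N) u \<in> lin S A"
    using lin_comp[OF coact_sub_lin left_slice_lin[OF S kvs_alg res[OF u]]] by (simp add: coeff_fun_def[abs_def] sub_gmod_cong)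
  have "tmap S A A A (coeff_fun A (sub_gmod A N) u) id (coact (sub_gmod A N) w) =
      tmap A A A A (\<lambda>a. left_slice A A u (comult A a)) id (comult A w)"
    unfolding coact_sub(2)[OF w(1), symmetric]
    by (rule tmap_left_comp[OF S kvs_alg kvs_alg kvs_alg il g L _ coact_sub(1)[OF w(1)], symmetric]) (simp add: coeff_fun_sub[OF u])
  also have "\<dots> = left_slice A (tensor A A) u (tmap A A A (tensor A A) id (comult A) (comult A w))"
    unfolding left_slice_assoc[OF kvs_alg kvs_alg comult_lin u c, symmetric] coassoc[OF w(2)] ..
  also have "\<dots> = comult A (coeff_fun A (sub_gmod A N) u w)"
    unfolding left_slice_tmap_right[OF kvs_alg kvs_alg AA comult_lin u c] coeff_fun_sub[OF u w(1)] ..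
  finally show "comult A (coeff_fun A (sub_gmod A N) u w) =
      tmap (sub_gmod A N) A A A (coeff_fun A (sub_gmod A N) u) id (coact (sub_gmod A N) w)"
    by (simp add: sub_gmod_cong)
  show "counit A (coeff_fun A (sub_gmod A N) u w) = u w"
    unfolding coeff_fun_sub[OF u w(1)] slice_left_slice[OF kvs_alg kvs_alg u counit_lin c, symmetric] counit_right[OF w(2)] ..
qed

text \<open>Compatibility with the coactions is checked after embedding N \<otimes> A into A
  \<otimes> A, where it is the comodule map property from \<open>gmoduleD\<close>.\<close>

lemma coeff_fun_hom_sub:
  assumes GV: "gmodule A V" and u: "u \<in> lin V kmod" and im: "coeff_fun A V u ` carrier V \<subseteq> N"
  shows "coeff_fun A V u \<in> gmod_hom A V (sub_gmod A N)"
proof -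
  note V = gmoduleD(1)[OF GV] and rV = gmoduleD(3)[OF GV] and f = gmoduleD(4)[OF GV u]
  note fS = lin_sub_mod[OF f im]
  have tc: "tmap V A (sub_gmod A N) A = tmap V A S A" by (simp add: tmap_def fun_eq_iff sub_gmod_cong(1,2))
  have "coact (sub_gmod A N) (coeff_fun A V u v) = tmap V A S A (coeff_fun A V u) id (coact V v)" if v: "v \<in> carrier V" for v
  proof (rule inj_onD[OF J_inj])
    have w: "coeff_fun A V u v \<in> N" using im v by blast
    show "coact (sub_gmod A N) (coeff_fun A V u v) \<in> carrier (tensor S A)" by (rule coact_sub(1)[OF w])
    show "tmap V A S A (coeff_fun A V u) id (coact V v) \<in> carrier (tensor S A)"
      by (rule lin_closed[OF tmap_lin[OF V kvs_alg S kvs_alg fS lin_id(1)] lin_closed[OF rV v]])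
    show "J (coact (sub_gmod A N) (coeff_fun A V u v)) = J (tmap V A S A (coeff_fun A V u) id (coact V v))"
      unfolding coact_sub(2)[OF w] gmoduleD(5)[OF GV u v]
      by (rule tmap_left_comp[OF V S kvs_alg kvs_alg fS il f _ lin_closed[OF rV v], symmetric]) simp
  qed
  moreover have "lin V (sub_gmod A N) = lin V S" by (auto simp: lin_def add_hom_iff)
  ultimately show ?thesis using fS by (simp add: gmod_hom_def tc)
qed

end

lemma subcomod_lspan:
  assumes F: "finite F" "F \<subseteq> carrier A"
    and co: "\<And>w. w \<in> F \<Longrightarrow> comult A w \<in> tmap (sub_mod A (lspan A F)) A A A id id ` carrier (tensor (sub_mod A (lspan A F)) A)"
  shows "subcomod (lspan A F)"
  unfolding subcomod_def
proof (intro conjI fin_dim_sub_mod[OF kvs_alg F])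
  show s: "submodule (lspan A F) kring A" by (rule submodule_lspan[OF kvs_alg F(2)])
  let ?S = "sub_mod A (lspan A F)"
  have S: "kvs ?S" by (rule kvs_sub_mod[OF kvs_alg s])
  have AA: "kvs (tensor A A)" and SA: "kvs (tensor ?S A)" using S by simp_all
  have "submodule (tmap ?S A A A id id ` carrier (tensor ?S A)) kring (tensor A A)"
    by (rule submodule_image[OF SA AA tmap_lin[OF S kvs_alg kvs_alg kvs_alg sub_mod_incl lin_id(1)]])
      (rule submoduleD(1)[OF kvs_alg s])
  from submodule_vimage[OF kvs_alg AA comult_lin this]
  have "lspan A F \<subseteq> {w \<in> carrier A. comult A w \<in> tmap ?S A A A id id ` carrier (tensor ?S A)}"
    by (rule lspan_minimal) (use co F in blast)
  then show "\<forall>w\<in>lspan A F. comult A w \<in> tmap ?S A A A id id ` carrier (tensor ?S A)" by blast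
qed

text \<open>The image of a module under a comodule map into A is a subcomodule; a finite spanning
  set of the module gives the finite set \<open>F\<close>.\<close>

lemma coeff_fun_subcomod:
  assumes GV: "gmodule A V" and u: "u \<in> lin V kmod"
  obtains F where "finite F" "F \<subseteq> carrier A" "subcomod (lspan A F)" "coeff_fun A V u ` carrier V \<subseteq> lspan A F"
proof -
  note V = gmoduleD(1)[OF GV] and rV = gmoduleD(3)[OF GV] and f = gmoduleD(4)[OF GV u]
  obtain R where R: "finite R" "R \<subseteq> carrier V" "lspan V R = carrier V" using gmoduleD(2)[OF GV] by (auto simp: fin_dim_def)
  define F where "F = coeff_fun A V u ` R"
  have F: "finite F" "F \<subseteq> carrier A" using R lin_closed[OF f] by (auto simp: F_def)
  note s = submodule_lspan[OF kvs_alg F(2)]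
  have "lspan V R \<subseteq> {x \<in> carrier V. coeff_fun A V u x \<in> lspan A F}"
    by (rule lspan_minimal[OF submodule_vimage[OF V kvs_alg f s]]) (use R(2) lspan_superset[of F A] in \<open>auto simp: F_def\<close>)
  then have "carrier V \<subseteq> {x \<in> carrier V. coeff_fun A V u x \<in> lspan A F}" using R(3) by simp
  then have im: "coeff_fun A V u ` carrier V \<subseteq> lspan A F" by blast
  let ?S = "sub_mod A (lspan A F)"
  have S: "kvs ?S" by (rule kvs_sub_mod[OF kvs_alg s])
  note fS = lin_sub_mod[OF f im]
  have sc: "subcomod (lspan A F)"
  proof (rule subcomod_lspan[OF F])
    fix w assume "w \<in> F"
    then obtain v where v: "v \<in> carrier V" "w = coeff_fun A V u v" using R(2) by (auto simp: F_def)
    show "comult A w \<in> tmap ?S A A A id id ` carrier (tensor ?S A)"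
    proof (rule image_eqI)
      show "tmap V A ?S A (coeff_fun A V u) id (coact V v) \<in> carrier (tensor ?S A)"
        by (rule lin_closed[OF tmap_lin[OF V kvs_alg S kvs_alg fS lin_id(1)] lin_closed[OF rV v(1)]])
      show "comult A w = tmap ?S A A A id id (tmap V A ?S A (coeff_fun A V u) id (coact V v))"
        unfolding v(2) gmoduleD(5)[OF GV u v(1)]
        by (rule tmap_left_comp[OF V S kvs_alg kvs_alg fS sub_mod_incl[OF submoduleD(1)[OF kvs_alg s]] f _ lin_closed[OF rV v(1)], symmetric]) simp
    qed
  qed
  show thesis by (rule that[OF F sc im])
qed

text \<open>Brings the sections attached to two elements over a common subcomodule. Subcomodules are
  given as spans of finite sets so that their sum is such a span again.\<close>

lemma subcomod_union:
  assumes F: "finite F" "F \<subseteq> carrier A" "subcomod (lspan A F)" and F': "finite F'" "F' \<subseteq> carrier A" "subcomod (lspan A F')"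
  shows "subcomod (lspan A (F \<union> F'))"
proof (rule subcomod_lspan)
  let ?S = "\<lambda>N. sub_mod A N"
  have G: "F \<union> F' \<subseteq> carrier A" using F F' by blast
  note s = submodule_lspan[OF kvs_alg G]
  have S: "kvs (?S (lspan A (F \<union> F')))" by (rule kvs_sub_mod[OF kvs_alg s])
  have *: "comult A w \<in> tmap (?S (lspan A (F \<union> F'))) A A A id id ` carrier (tensor (?S (lspan A (F \<union> F'))) A)"
    if E: "E \<subseteq> F \<union> F'" "subcomod (lspan A E)" and w: "w \<in> E" for E w
  proof -
    have sE: "submodule (lspan A E) kring A" using E(2) by (simp add: subcomod_def)
    have SE: "kvs (?S (lspan A E))" by (rule kvs_sub_mod[OF kvs_alg sE])
    have il: "id \<in> lin (?S (lspan A E)) (?S (lspan A (F \<union> F')))"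
      by (rule linI) (use lspan_mono[OF E(1), of A] in auto)
    have "w \<in> lspan A E" using w lspan_superset[of E A] by blast
    then obtain y where y: "y \<in> carrier (tensor (?S (lspan A E)) A)" "comult A w = tmap (?S (lspan A E)) A A A id id y"
      using E(2) unfolding subcomod_def by blast
    show ?thesis
    proof (rule image_eqI)
      show "tmap (?S (lspan A E)) A (?S (lspan A (F \<union> F'))) A id id y \<in> carrier (tensor (?S (lspan A (F \<union> F'))) A)"
        by (rule lin_closed[OF tmap_lin[OF SE kvs_alg S kvs_alg il lin_id(1)] y(1)])
      show "comult A w = tmap (?S (lspan A (F \<union> F'))) A A A id id (tmap (?S (lspan A E)) A (?S (lspan A (F \<union> F'))) A id id y)"
        unfolding y(2)
        by (rule tmap_left_comp[OF SE S kvs_alg kvs_alg il sub_mod_incl[OF submoduleD(1)[OF kvs_alg s]]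
              sub_mod_incl[OF submoduleD(1)[OF kvs_alg sE]] _ y(1), symmetric]) simp
    qed
  qed
  show "comult A w \<in> tmap (?S (lspan A (F \<union> F'))) A A A id id ` carrier (tensor (?S (lspan A (F \<union> F'))) A)" if w: "w \<in> F \<union> F'" for w
    using w *[of F w] *[of F' w] F(3) F'(3) by blast
qed (use F F' in auto)

text \<open>The finiteness theorem for comodules: \<open>a\<close> lies in the span of the left factors of \<open>\<Delta> a\<close>.\<close>

lemma element_subcomod:
  assumes a: "a \<in> carrier A"
  obtains F where "finite F" "F \<subseteq> carrier A" "subcomod (lspan A F)" "a \<in> lspan A F"
proof -
  note z = lin_closed[OF comult_lin a]
  have AA: "kvs (tensor A A)" by simp
  obtain F where F: "finite F" "F \<subseteq> carrier A" "comult A a \<in> left_span A A F"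
    "\<And>s. s \<in> F \<Longrightarrow> \<exists>u\<in>lin A kmod. s = slice A A u (comult A a)"
    using tensor_left_slices[OF kvs_alg kvs_alg z] by metis
  note s = submodule_lspan[OF kvs_alg F(2)] and sup = lspan_superset[of F A]
  let ?S = "sub_mod A (lspan A F)" and ?K = "tmap (sub_mod A (lspan A F)) A A A id id ` carrier (tensor (sub_mod A (lspan A F)) A)"
  have S: "kvs ?S" by (rule kvs_sub_mod[OF kvs_alg s])
  have SA: "kvs (tensor ?S A)" using S by simp
  note il = sub_mod_incl[OF submoduleD(1)[OF kvs_alg s]]
  note J = tmap_lin[OF S kvs_alg kvs_alg kvs_alg il lin_id(1)] tmap_tmul[OF S kvs_alg kvs_alg kvs_alg il lin_id(1)]
  have K: "submodule ?K kring (tensor A A)" by (rule submodule_image[OF SA AA J(1)])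
  have span: "f y \<in> Q" if f: "f \<in> lin (tensor A A) M" and M: "kvs M" and Q: "submodule Q kring M"
    and b: "\<And>s y. s \<in> F \<Longrightarrow> y \<in> carrier A \<Longrightarrow> f (tmul A A s y) \<in> Q" and y: "y \<in> left_span A A F"
    for f y Q and M :: "('k, 'z) module"
  proof -
    have "left_span A A F \<subseteq> {y \<in> carrier (tensor A A). f y \<in> Q}"
      unfolding left_span_def by (rule lspan_minimal[OF submodule_vimage[OF AA M f Q]]) (use b F(2) in auto)
    then show ?thesis using y by blast
  qed
  have "a \<in> lspan A F"
  proof -
    have "left_span A A F \<subseteq> {y \<in> carrier (tensor A A). slice A A (counit A) y \<in> lspan A F}"
      unfolding left_span_def
      by (rule lspan_minimal[OF submodule_vimage[OF AA kvs_alg slice_lin[OF kvs_alg kvs_alg counit_lin] s]])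
        (use F(2) sup submoduleD(4)[OF kvs_alg s] in \<open>auto simp: slice_tmul[OF kvs_alg kvs_alg counit_lin] subset_iff\<close>)
    then have "slice A A (counit A) (comult A a) \<in> lspan A F" using F(3) by blast
    then show ?thesis by (simp add: counit_right[OF a])
  qed
  moreover have "subcomod (lspan A F)"
  proof (rule subcomod_lspan[OF F(1,2)])
    fix w assume "w \<in> F"
    then obtain u where u: "u \<in> lin A kmod" "w = slice A A u (comult A a)" using F(4) by blast
    note sl = slice_lin[OF kvs_alg kvs_alg u(1)]
    note tc = tmap_lin[OF kvs_alg kvs_alg AA kvs_alg comult_lin lin_id(1)]
    note t1 = tmap_lin[OF kvs_alg kvs_alg kvs_alg AA lin_id(1) comult_lin] tmap_tmul[OF kvs_alg kvs_alg kvs_alg AA lin_id(1) comult_lin]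
    note t2 = tmap_lin[OF kvs_alg AA kvs_alg kvs_alg lin_id(1) sl] tmap_tmul[OF kvs_alg AA kvs_alg kvs_alg lin_id(1) sl]
    \<comment> \<open>For w = (id \<otimes> u)(\<Delta> a), coassociativity rewrites \<Delta> w by
      applying \<open>\<Delta>\<close> and then (id \<otimes> u) to the right factors of \<Delta> a.
      The left factors stay those of \<Delta> a, so they lie in \<open>F\<close>.\<close>
    have "comult A w = tmap A (tensor A A) A A id (slice A A u) (tmap A A A (tensor A A) id (comult A) (comult A a))"
      unfolding u(2) slice_tmap[OF kvs_alg AA kvs_alg comult_lin u(1) z, symmetric] slice_assoc[OF kvs_alg u(1) lin_closed[OF tc z]] coassoc[OF a] ..
    also have "\<dots> \<in> ?K"
    proof (rule span[OF lin_comp[OF t1(1) t2(1)] AA K _ F(3)])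
      fix s y assume sy: "s \<in> F" "y \<in> carrier A"
      note yc = lin_closed[OF comult_lin sy(2)]
      have s': "s \<in> carrier A" "s \<in> carrier ?S" using sy F(2) sup by auto
      show "tmap A (tensor A A) A A id (slice A A u) (tmap A A A (tensor A A) id (comult A) (tmul A A s y)) \<in> ?K"
        by (rule image_eqI[of _ _ "tmul ?S A s (slice A A u (comult A y))"])
          (use S s' sy lin_closed[OF sl yc] yc in \<open>simp_all add: t1(2) t2(2) J(2)\<close>)
    qed
    finally show "comult A w \<in> ?K" .
  qed
  ultimately show thesis using that F by blast
qed

end

section \<open>The space of formal matrix coefficients\<close>

context diff_bialgebra begin

abbreviation (input) FS :: "('k, ('k, 'e, 'a) fsum) module" where "FS \<equiv> Fsum A"
abbreviation (input) FQ :: "('k, ('k, 'e, 'a) fsum set) module" where "FQ \<equiv> FmodR A"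

lemma reps_iff: "V \<in> reps A \<longleftrightarrow> gmodule A V"
  by (simp add: reps_def)

lemma kvs_coeff: "V \<in> reps A \<Longrightarrow> kvs (tensor V (dual V))"
  using kvs_tensor[OF gmoduleD(1) kvs_dual[OF gmoduleD(1)]] by (simp add: reps_def)

lemma Fsum_simps:
  "\<zero>\<^bsub>Fsum A\<^esub> = (\<lambda>V\<in>reps A. \<zero>\<^bsub>tensor V (dual V)\<^esub>)"
  "f \<oplus>\<^bsub>Fsum A\<^esub> g = (\<lambda>V\<in>reps A. f V \<oplus>\<^bsub>tensor V (dual V)\<^esub> g V)"
  "c \<odot>\<^bsub>Fsum A\<^esub> f = (\<lambda>V\<in>reps A. c \<odot>\<^bsub>tensor V (dual V)\<^esub> f V)"
  by (simp_all add: Fsum_def)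

lemma Fsum_carrier:
  "f \<in> carrier (Fsum A) \<longleftrightarrow> (\<forall>V\<in>reps A. f V \<in> carrier (tensor V (dual V))) \<and> f \<in> extensional (reps A) \<and>
    finite {V \<in> reps A. f V \<noteq> \<zero>\<^bsub>tensor V (dual V)\<^esub>}"
  by (auto simp: Fsum_def PiE_iff)

lemma Fsum_eqI:
  "f \<in> carrier (Fsum A) \<Longrightarrow> g \<in> carrier (Fsum A) \<Longrightarrow> (\<And>V. V \<in> reps A \<Longrightarrow> f V = g V) \<Longrightarrow> f = g"
  unfolding Fsum_carrier by (auto intro: extensionalityI)

lemma Fsum_closed:
  shows "\<zero>\<^bsub>Fsum A\<^esub> \<in> carrier (Fsum A)"
    and "f \<in> carrier (Fsum A) \<Longrightarrow> g \<in> carrier (Fsum A) \<Longrightarrow> f \<oplus>\<^bsub>Fsum A\<^esub> g \<in> carrier (Fsum A)"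
    and "f \<in> carrier (Fsum A) \<Longrightarrow> c \<odot>\<^bsub>Fsum A\<^esub> f \<in> carrier (Fsum A)"
    and "V \<in> reps A \<Longrightarrow> z \<in> carrier (tensor V (dual V)) \<Longrightarrow> Finj A V z \<in> carrier (Fsum A)"
proof -
  have s: "finite {V \<in> reps A. (\<lambda>V\<in>reps A. h V) V \<noteq> \<zero>\<^bsub>tensor V (dual V)\<^esub>}"
    if "finite B" "\<And>V. V \<in> reps A \<Longrightarrow> V \<notin> B \<Longrightarrow> h V = \<zero>\<^bsub>tensor V (dual V)\<^esub>"
    for h :: "('k, 'x, 'a) gmod \<Rightarrow> ('x \<times> ('x \<Rightarrow> 'k) \<Rightarrow> 'k) set" and B
    by (rule finite_subset[OF _ that(1)]) (use that(2) in auto)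
  show "\<zero>\<^bsub>Fsum A\<^esub> \<in> carrier (Fsum A)"
    unfolding Fsum_carrier Fsum_simps by (intro conjI s[of "{}"]) (simp_all add: kvs_coeff)
  show "f \<oplus>\<^bsub>Fsum A\<^esub> g \<in> carrier (Fsum A)" if f: "f \<in> carrier (Fsum A)" "g \<in> carrier (Fsum A)"
    unfolding Fsum_carrier Fsum_simps
    by (intro conjI s[of "{V \<in> reps A. f V \<noteq> \<zero>\<^bsub>tensor V (dual V)\<^esub>} \<union> {V \<in> reps A. g V \<noteq> \<zero>\<^bsub>tensor V (dual V)\<^esub>}"])
      (use f in \<open>auto simp: Fsum_carrier kvs_coeff\<close>)
  show "c \<odot>\<^bsub>Fsum A\<^esub> f \<in> carrier (Fsum A)" if f: "f \<in> carrier (Fsum A)"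
    unfolding Fsum_carrier Fsum_simps
    by (intro conjI s[of "{V \<in> reps A. f V \<noteq> \<zero>\<^bsub>tensor V (dual V)\<^esub>}"]) (use f in \<open>auto simp: Fsum_carrier kvs_coeff\<close>)
  show "V \<in> reps A \<Longrightarrow> z \<in> carrier (tensor V (dual V)) \<Longrightarrow> Finj A V z \<in> carrier (Fsum A)"
    unfolding Fsum_carrier Finj_def by (intro conjI s[of "{V}"]) (auto simp: kvs_coeff)
qed

lemma kvs_Fsum [simp]: "kvs (Fsum A :: ('k, ('k, 'e, 'a) fsum) module)"
proof (rule kvsI)
  show "abelian_group (FS :: ('k, ('k, 'e, 'a) fsum) module)"
  proof (rule abelian_groupI)
    fix f :: "('k, 'e, 'a) fsum" assume f: "f \<in> carrier FS"
    have "(-1) \<odot>\<^bsub>FS\<^esub> f \<oplus>\<^bsub>FS\<^esub> f = \<zero>\<^bsub>FS\<^esub>"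
    proof (rule Fsum_eqI)
      fix V :: "('k, 'e, 'a) gmod" assume V: "V \<in> reps A"
      have "f V \<in> carrier (tensor V (dual V))" using f V by (simp add: Fsum_carrier)
      then show "((-1) \<odot>\<^bsub>FS\<^esub> f \<oplus>\<^bsub>FS\<^esub> f) V = \<zero>\<^bsub>FS\<^esub> V"
        using kvs_smult_distrib(4)[OF kvs_coeff[OF V], of "f V", symmetric] V kvs_coeff[OF V] by (simp add: Fsum_simps)
    qed (use f Fsum_closed in blast)+
    then show "\<exists>g\<in>carrier FS. g \<oplus>\<^bsub>FS\<^esub> f = \<zero>\<^bsub>FS\<^esub>" using Fsum_closed(3)[OF f] by blast
  qed ((simp add: Fsum_closed; fail) | (rule Fsum_eqI, simp add: Fsum_closed, simp add: Fsum_closed,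
        simp add: Fsum_carrier Fsum_simps kvs_coeff ag_ac))+
qed ((simp add: Fsum_closed; fail) | (rule Fsum_eqI, simp add: Fsum_closed, simp add: Fsum_closed,
        simp add: Fsum_carrier Fsum_simps kvs_coeff kvs_smult_distrib(1-3)))+

lemma Finj_lin: "V \<in> reps A \<Longrightarrow> Finj A V \<in> lin (tensor V (dual V)) (Fsum A)"
proof (rule linI)
  assume V: "V \<in> reps A"
  note k = kvs_coeff[OF V]
  show "Finj A V x \<in> carrier (Fsum A)" if "x \<in> carrier (tensor V (dual V))" for x by (rule Fsum_closed(4)[OF V that])
  show "Finj A V (x \<oplus>\<^bsub>tensor V (dual V)\<^esub> y) = Finj A V x \<oplus>\<^bsub>Fsum A\<^esub> Finj A V y" for x y
    by (auto simp: Finj_def Fsum_simps kvs_coeff intro!: restrict_ext)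
  show "Finj A V (c \<odot>\<^bsub>tensor V (dual V)\<^esub> x) = c \<odot>\<^bsub>Fsum A\<^esub> Finj A V x" for c x
    by (auto simp: Finj_def Fsum_simps kvs_coeff intro!: restrict_ext)
qed

lemma Fsum_induct [consumes 1, case_names zero inj add]:
  assumes f: "f \<in> carrier (Fsum A)" and 0: "P \<zero>\<^bsub>Fsum A\<^esub>"
    and inj: "\<And>V z. V \<in> reps A \<Longrightarrow> z \<in> carrier (tensor V (dual V)) \<Longrightarrow> P (Finj A V z)"
    and add: "\<And>f g. f \<in> carrier (Fsum A) \<Longrightarrow> g \<in> carrier (Fsum A) \<Longrightarrow> P f \<Longrightarrow> P g \<Longrightarrow> P (f \<oplus>\<^bsub>Fsum A\<^esub> g)"
  shows "P f"
proof -
  have *: "P f" if "finite B" "f \<in> carrier (Fsum A)" "{V \<in> reps A. f V \<noteq> \<zero>\<^bsub>tensor V (dual V)\<^esub>} \<subseteq> B" for B f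
    using that
  proof (induction B arbitrary: f rule: finite_induct)
    case empty
    have "f = \<zero>\<^bsub>Fsum A\<^esub>" by (rule Fsum_eqI) (use empty Fsum_closed in \<open>auto simp: Fsum_simps\<close>)
    then show ?case using 0 by simp
  next
    case (insert W B)
    show ?case
    proof (cases "W \<in> reps A")
      case False
      then show ?thesis using insert by blast
    next
      case True
      have fW: "f W \<in> carrier (tensor W (dual W))" using insert.prems True by (simp add: Fsum_carrier)
      define g where "g = (\<lambda>V\<in>reps A. if V = W then \<zero>\<^bsub>tensor V (dual V)\<^esub> else f V)"
      have g: "g \<in> carrier (Fsum A)"
        unfolding Fsum_carrier
      proof (intro conjI)
        have "{V \<in> reps A. g V \<noteq> \<zero>\<^bsub>tensor V (dual V)\<^esub>} \<subseteq> B" using insert.prems by (auto simp: g_def)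
        then show "finite {V \<in> reps A. g V \<noteq> \<zero>\<^bsub>tensor V (dual V)\<^esub>}" using insert.hyps(1) by (rule finite_subset)
      qed (use insert.prems in \<open>auto simp: g_def Fsum_carrier kvs_coeff\<close>)
      have "f = Finj A W (f W) \<oplus>\<^bsub>Fsum A\<^esub> g"
        by (rule Fsum_eqI[OF insert.prems(1) Fsum_closed(2)[OF Fsum_closed(4)[OF True fW] g]])
          (use insert.prems(1) in \<open>auto simp: Fsum_simps g_def Finj_def Fsum_carrier kvs_coeff\<close>)
      moreover have "P g" by (rule insert.IH[OF g]) (use insert.prems in \<open>auto simp: g_def\<close>)
      ultimately show ?thesis using add[OF Fsum_closed(4)[OF True fW] g inj[OF True fW]] by simp
    qed
  qed
  show ?thesis by (rule *[OF _ f subset_refl]) (use f in \<open>simp add: Fsum_carrier\<close>)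
qed

lemma Rrel_generators:
  assumes "V \<in> reps A" "W \<in> reps A" "\<phi> \<in> gmod_hom A V W" "z \<in> carrier (tensor V (dual W))"
  shows "tmap V (dual W) V (dual V) id (dual_map V \<phi>) z \<in> carrier (tensor V (dual V))"
    and "tmap V (dual W) W (dual W) \<phi> id z \<in> carrier (tensor W (dual W))"
proof -
  have V: "kvs V" and W: "kvs W" and f: "\<phi> \<in> lin V W" using assms gmoduleD(1) by (auto simp: reps_def gmod_hom_def)
  show "tmap V (dual W) V (dual V) id (dual_map V \<phi>) z \<in> carrier (tensor V (dual V))"
    by (rule lin_closed[OF tmap_lin[OF V kvs_dual[OF W] V kvs_dual[OF V] lin_id(1) dual_map_lin[OF V W f]] assms(4)])
  show "tmap V (dual W) W (dual W) \<phi> id z \<in> carrier (tensor W (dual W))"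
    by (rule lin_closed[OF tmap_lin[OF V kvs_dual[OF W] W kvs_dual[OF W] f lin_id(1)] assms(4)])
qed

lemma Rrel_submodule: "submodule (Rrel A) kring (Fsum A)"
  unfolding Rrel_def
  by (rule submodule_lspan[OF kvs_Fsum]) (auto intro!: ag_closed(4)[OF kvs_abelian[OF kvs_Fsum]] Fsum_closed(4) Rrel_generators)

lemma kvs_FmodR [simp]: "kvs (FmodR A :: ('k, ('k, 'e, 'a) fsum set) module)"
  unfolding FmodR_def by (rule kvs_quot_mod[OF kvs_Fsum Rrel_submodule])

lemma rep_coeff_lin: "V \<in> reps A \<Longrightarrow> rep_coeff A V \<in> lin (tensor V (dual V)) (FmodR A)"
  using lin_comp[OF Finj_lin quot_mod_proj[OF kvs_Fsum Rrel_submodule]] by (simp add: rep_coeff_def[abs_def] FmodR_def)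

text \<open>F/R is generated additively by the classes of pure tensors, as scalars can be moved into
  \<open>v\<close>.\<close>

lemma FmodR_induct [consumes 1, case_names zero coeff add]:
  assumes x: "x \<in> carrier (FmodR A)" and 0: "P \<zero>\<^bsub>FmodR A\<^esub>"
    and co: "\<And>V v u. V \<in> reps A \<Longrightarrow> v \<in> carrier V \<Longrightarrow> u \<in> carrier (dual V) \<Longrightarrow> P (rep_coeff A V (tmul V (dual V) v u))"
    and add: "\<And>x y. x \<in> carrier (FmodR A) \<Longrightarrow> y \<in> carrier (FmodR A) \<Longrightarrow> P x \<Longrightarrow> P y \<Longrightarrow> P (x \<oplus>\<^bsub>FmodR A\<^esub> y)"
  shows "P x"
proof -
  note q = quot_mod_simps[OF kvs_Fsum Rrel_submodule, folded FmodR_def]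
  have P: "P (Rrel A +>\<^bsub>Fsum A\<^esub> f)" if "f \<in> carrier (Fsum A)" for f
    using that
  proof (induction f rule: Fsum_induct)
    case zero
    show ?case unfolding q(2)[symmetric] by (rule 0)
  next
    case (inj V z)
    have kV: "kvs V" using inj(1) gmoduleD(1) by (simp add: reps_def)
    note V = kV kvs_dual[OF kV]
    show ?case unfolding rep_coeff_def[symmetric] using inj(2)
    proof (induction z rule: tensor_induct[OF V, consumes 1, case_names tmul add])
      case (tmul v u)
      then show ?case by (rule co[OF inj(1)])
    next
      case (add y z)
      note l = rep_coeff_lin[OF inj(1)]
      show ?case unfolding lin_add[OF l add.hyps] by (rule assms(4)) (use lin_closed[OF l] add in simp_all)
    qed
  next
    case (add f g)
    have "Rrel A +>\<^bsub>Fsum A\<^esub> f \<in> carrier (FmodR A)" "Rrel A +>\<^bsub>Fsum A\<^esub> g \<in> carrier (FmodR A)" using add.hyps by (auto simp: q(1))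
    from assms(4)[OF this add.IH] show ?case unfolding q(3)[OF add.hyps] .
  qed
  obtain f where "f \<in> carrier (Fsum A)" "x = Rrel A +>\<^bsub>Fsum A\<^esub> f" using x unfolding q(1) by auto
  then show ?thesis using P by simp
qed

text \<open>The relation attached to \<phi>, taken at a pure tensor. Every later identification of
  coefficients of different modules rests on this one.\<close>

lemma rep_coeff_natural:
  assumes V: "V \<in> reps A" and W: "W \<in> reps A" and f: "\<phi> \<in> gmod_hom A V W" and v: "v \<in> carrier V" and u: "u \<in> carrier (dual W)"
  shows "rep_coeff A V (tmul V (dual V) v (dual_map V \<phi> u)) = rep_coeff A W (tmul W (dual W) (\<phi> v) u)"
proof -
  have kV: "kvs V" and kW: "kvs W" and fl: "\<phi> \<in> lin V W" using assms gmoduleD(1) by (auto simp: reps_def gmod_hom_def)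
  have z: "tmul V (dual W) v u \<in> carrier (tensor V (dual W))" using kV kW v u by simp
  note g = Rrel_generators[OF V W f z]
  have "Finj A V (tmap V (dual W) V (dual V) id (dual_map V \<phi>) (tmul V (dual W) v u)) \<ominus>\<^bsub>Fsum A\<^esub>
      Finj A W (tmap V (dual W) W (dual W) \<phi> id (tmul V (dual W) v u)) \<in> Rrel A"
    unfolding Rrel_def by (rule subsetD[OF lspan_superset]) (use V W f z in blast)
  then show ?thesis
    using quot_mod_simps(5)[OF kvs_Fsum Rrel_submodule Fsum_closed(4)[OF V g(1)] Fsum_closed(4)[OF W g(2)]]
      tmap_tmul[OF kV kvs_dual[OF kW] kV kvs_dual[OF kV] lin_id(1) dual_map_lin[OF kV kW fl] v u]
      tmap_tmul[OF kV kvs_dual[OF kW] kW kvs_dual[OF kW] fl lin_id(1) v u]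
    by (simp add: rep_coeff_def)
qed

lemma coeff_map_exists:
  "\<exists>\<Phi>. \<Phi> \<in> lin (FmodR A) A \<and>
    (\<forall>V\<in>reps A. \<forall>z\<in>carrier (tensor V (dual V)). \<Phi> (rep_coeff A V z :: ('k, 'e, 'a) fsum set) = mat_coeff A V z)"
proof -
  have A': "abelian_group A" and F': "abelian_group FS" by simp_all
  interpret A: abelian_group A by (rule A')
  \<comment> \<open>Elements of \<open>Fsum\<close> have finite support, so the map out of the
    direct sum is a finite sum over the support. Enlarging the support to any finite set of modules
    does not change it, which is used for additivity.\<close>
  define \<psi> :: "('k, 'e, 'a) fsum \<Rightarrow> 'a" where
    "\<psi> f = finsum A (\<lambda>V. mat_coeff A V (f V)) {V \<in> reps A. f V \<noteq> \<zero>\<^bsub>tensor V (dual V)\<^esub>}" for f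
  have m: "mat_coeff A V \<in> lin (tensor V (dual V)) A" if "V \<in> reps A" for V :: "('k, 'e, 'a) gmod"
    using mat_coeff_lin that by (simp add: reps_def)
  have m0: "mat_coeff A V \<zero>\<^bsub>tensor V (dual V)\<^esub> = \<zero>" if "V \<in> reps A" for V :: "('k, 'e, 'a) gmod"
    using add_hom_zero[OF lin_add_hom[OF m[OF that]] _ A'] kvs_coeff[OF that] by simp
  have fc: "mat_coeff A V (f V) \<in> carrier A" if "f \<in> carrier FS" "V \<in> reps A" for f :: "('k, 'e, 'a) fsum" and V
    using lin_closed[OF m] that by (simp add: Fsum_carrier)
  have \<psi>: "\<psi> f = finsum A (\<lambda>V. mat_coeff A V (f V)) B"
    if "f \<in> carrier FS" "finite B" "B \<subseteq> reps A" "{V \<in> reps A. f V \<noteq> \<zero>\<^bsub>tensor V (dual V)\<^esub>} \<subseteq> B" for f B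
    unfolding \<psi>_def
  proof (rule A.add.finprod_mono_neutral_cong_left[OF that(2,4)])
    show "mat_coeff A V (f V) = \<zero>" if "V \<in> B - {V \<in> reps A. f V \<noteq> \<zero>\<^bsub>tensor V (dual V)\<^esub>}" for V
      using that \<open>B \<subseteq> reps A\<close> m0 by auto
    show "(\<lambda>V. mat_coeff A V (f V)) \<in> B \<rightarrow> carrier A" using fc that by auto
  qed simp
  have ha: "\<psi> \<in> add_hom FS A"
  proof (rule add_homI)
    fix f g :: "('k, 'e, 'a) fsum" assume f: "f \<in> carrier FS" and g: "g \<in> carrier FS"
    let ?B = "{V \<in> reps A. f V \<noteq> \<zero>\<^bsub>tensor V (dual V)\<^esub>} \<union> {V \<in> reps A. g V \<noteq> \<zero>\<^bsub>tensor V (dual V)\<^esub>}"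
    have B: "finite ?B" "?B \<subseteq> reps A" using f g by (auto simp: Fsum_carrier)
    have "\<psi> (f \<oplus>\<^bsub>FS\<^esub> g) = finsum A (\<lambda>V. mat_coeff A V ((f \<oplus>\<^bsub>FS\<^esub> g) V)) ?B"
      by (rule \<psi>[OF Fsum_closed(2)[OF f g] B]) (auto simp: Fsum_simps kvs_coeff)
    also have "\<dots> = finsum A (\<lambda>V. mat_coeff A V (f V) \<oplus> mat_coeff A V (g V)) ?B"
      by (rule A.finsum_cong') (use f g fc in \<open>auto simp: Fsum_simps Fsum_carrier lin_add[OF m]\<close>)
    also have "\<dots> = finsum A (\<lambda>V. mat_coeff A V (f V)) ?B \<oplus> finsum A (\<lambda>V. mat_coeff A V (g V)) ?B"
      by (rule A.finsum_addf) (use f g fc in auto)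
    also have "\<dots> = \<psi> f \<oplus> \<psi> g" using \<psi>[OF f B] \<psi>[OF g B] by simp
    finally show "\<psi> (f \<oplus>\<^bsub>FS\<^esub> g) = \<psi> f \<oplus> \<psi> g" .
  qed (auto simp: \<psi>_def fc intro!: A.finsum_closed)
  have \<psi>inj: "\<psi> (Finj A V z) = mat_coeff A V z" if V: "V \<in> reps A" and z: "z \<in> carrier (tensor V (dual V))" for V z
  proof -
    have "\<psi> (Finj A V z) = finsum A (\<lambda>W. mat_coeff A W (Finj A V z W)) {V}"
      by (rule \<psi>[OF Fsum_closed(4)[OF V z]]) (use V in \<open>auto simp: Finj_def split: if_splits\<close>)
    then show ?thesis using V z lin_closed[OF m[OF V] z] by (simp add: Finj_def)
  qed
  have \<psi>s: "\<psi> (c \<odot>\<^bsub>FS\<^esub> f) = c \<odot> \<psi> f" if "f \<in> carrier FS" for c f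
    using that
  proof (induction f rule: Fsum_induct)
    case zero
    then show ?case using add_hom_zero[OF ha F' A'] by simp
  next
    case (inj V z)
    then show ?case using lin_smult[OF Finj_lin[OF inj(1)] inj(2), symmetric] kvs_coeff[OF inj(1)]
      by (simp add: \<psi>inj lin_smult[OF m])
  next
    case (add f g)
    then show ?case using Fsum_closed(3)
      by (simp add: kvs_smult_distrib(2) add_hom_add[OF ha] add_hom_closed[OF ha])
  qed
  have \<psi>R: "\<psi> f = \<zero>" if "f \<in> Rrel A" for f
    using that unfolding Rrel_def
  proof (induction rule: lspan_induct)
    case subset
    show ?case by (auto intro!: ag_closed(4)[OF kvs_abelian[OF kvs_Fsum]] Fsum_closed(4) Rrel_generators)
  next
    case (base s)
    then obtain V W \<phi> z where s: "s = Finj A V (tmap V (dual W) V (dual V) id (dual_map V \<phi>) z) \<ominus>\<^bsub>FS\<^esub>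
        Finj A W (tmap V (dual W) W (dual W) \<phi> id z)" and r: "V \<in> reps A" "W \<in> reps A" "\<phi> \<in> gmod_hom A V W"
        "z \<in> carrier (tensor V (dual W))" by blast
    note g = Rrel_generators[OF r]
    show ?case
      using add_hom_diff[OF ha F' A' Fsum_closed(4)[OF r(1) g(1)] Fsum_closed(4)[OF r(2) g(2)]]
        mat_coeff_natural[OF r(1,2)[unfolded reps_iff] r(3,4)] lin_closed[OF m[OF r(2)] g(2)] A'
      by (simp add: s \<psi>inj r g)
  qed (simp_all add: add_hom_zero[OF ha F' A'] add_hom_add[OF ha] \<psi>s)
  note q = quot_mod_simps[OF kvs_Fsum Rrel_submodule, folded FmodR_def]
  obtain \<Phi> where \<Phi>: "\<Phi> \<in> add_hom FQ A" "\<And>f. f \<in> carrier FS \<Longrightarrow> \<Phi> (Rrel A +>\<^bsub>Fsum A\<^esub> f) = \<psi> f"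
    using quot_mod_lift[OF kvs_Fsum Rrel_submodule ha A' \<psi>R, folded FmodR_def] by metis
  have "\<Phi> \<in> lin FQ A"
  proof (rule linI[OF add_hom_closed[OF \<Phi>(1)] add_hom_add[OF \<Phi>(1)]])
    fix c and x :: "('k, 'e, 'a) fsum set" assume "x \<in> carrier FQ"
    then obtain f where f: "f \<in> carrier FS" "x = Rrel A +>\<^bsub>Fsum A\<^esub> f" unfolding q(1) by auto
    show "\<Phi> (c \<odot>\<^bsub>FQ\<^esub> x) = c \<odot> \<Phi> x"
      using f Fsum_closed(3)[OF f(1)] by (simp add: q(4) \<Phi>(2) \<psi>s)
  qed
  moreover have "\<Phi> (rep_coeff A V z) = mat_coeff A V z" if "V \<in> reps A" "z \<in> carrier (tensor V (dual V))" for V z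
    using that by (simp add: rep_coeff_def \<Phi>(2) Fsum_closed(4) \<psi>inj)
  ultimately show ?thesis by blast
qed

subsection \<open>Functoriality\<close>

lemma gmod_hom_comp:
  assumes "gmodule A V" "gmodule A W" "gmodule A X'" "\<phi> \<in> gmod_hom A V W" "\<psi> \<in> gmod_hom A W X'"
  shows "(\<lambda>x. \<psi> (\<phi> x)) \<in> gmod_hom A V X'"
proof -
  note V = gmoduleD(1)[OF assms(1)] and W = gmoduleD(1)[OF assms(2)] and X' = gmoduleD(1)[OF assms(3)]
  have l: "\<phi> \<in> lin V W" "\<psi> \<in> lin W X'" using assms by (simp_all add: gmod_hom_def)
  note c = lin_comp[OF l]
  show ?thesis unfolding gmod_hom_def
  proof (intro CollectI conjI c ballI)
    fix v assume v: "v \<in> carrier V"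
    have "coact X' (\<psi> (\<phi> v)) = tmap W A X' A \<psi> id (tmap V A W A \<phi> id (coact V v))"
      using assms(4,5) v lin_closed[OF l(1) v] by (simp add: gmod_hom_def)
    then show "coact X' (\<psi> (\<phi> v)) = tmap V A X' A (\<lambda>x. \<psi> (\<phi> x)) id (coact V v)"
      using tmap_left_comp[OF V W X' kvs_alg l c _ lin_closed[OF gmoduleD(3)[OF assms(1)] v]] by simp
  qed
qed

lemma gmod_isoD:
  assumes GV: "gmodule A V" and GW: "gmodule A W" and \<theta>: "\<theta> \<in> gmod_iso A V W"
  shows "\<theta> \<in> gmod_hom A V W" "inv_into (carrier V) \<theta> \<in> gmod_hom A W V"
    "v \<in> carrier V \<Longrightarrow> inv_into (carrier V) \<theta> (\<theta> v) = v"
proof -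
  note V = gmoduleD(1)[OF GV] and W = gmoduleD(1)[OF GW]
  have bij: "bij_betw \<theta> (carrier V) (carrier W)" using \<theta> by (simp add: gmod_iso_def)
  show h: "\<theta> \<in> gmod_hom A V W" using \<theta> by (simp add: gmod_iso_def)
  then have l: "\<theta> \<in> lin V W" by (simp add: gmod_hom_def)
  show i: "inv_into (carrier V) \<theta> (\<theta> v) = v" if "v \<in> carrier V" for v
    using bij_betw_inv_into_left[OF bij that] .
  have surj: "\<exists>v\<in>carrier V. w = \<theta> v" if "w \<in> carrier W" for w using that bij by (auto simp: bij_betw_def)
  have il: "inv_into (carrier V) \<theta> \<in> lin W V"
  proof (rule linI)
    fix x assume "x \<in> carrier W"
    then obtain x' where x: "x' \<in> carrier V" "x = \<theta> x'" using surj by blast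
    show "inv_into (carrier V) \<theta> x \<in> carrier V" using x i by simp
    show "inv_into (carrier V) \<theta> (c \<odot>\<^bsub>W\<^esub> x) = c \<odot>\<^bsub>V\<^esub> inv_into (carrier V) \<theta> x" for c
      using V x i by (simp add: lin_smult[OF l, symmetric])
    fix y assume "y \<in> carrier W"
    then obtain y' where y: "y' \<in> carrier V" "y = \<theta> y'" using surj by blast
    show "inv_into (carrier V) \<theta> (x \<oplus>\<^bsub>W\<^esub> y) = inv_into (carrier V) \<theta> x \<oplus>\<^bsub>V\<^esub> inv_into (carrier V) \<theta> y"
      using V x y i by (simp add: lin_add[OF l, symmetric])
  qed
  show "inv_into (carrier V) \<theta> \<in> gmod_hom A W V" unfolding gmod_hom_def
  proof (intro CollectI conjI il ballI)
    fix w assume "w \<in> carrier W"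
    then obtain v where v: "v \<in> carrier V" "w = \<theta> v" using surj by blast
    note rv = lin_closed[OF gmoduleD(3)[OF GV] v(1)]
    have "tmap W A V A (inv_into (carrier V) \<theta>) id (coact W w) = tmap V A V A id id (coact V v)"
      using tmap_left_comp[OF V W V kvs_alg l il lin_id(1) _ rv] h v i by (simp add: gmod_hom_def)
    then show "coact V (inv_into (carrier V) \<theta> w) = tmap W A V A (inv_into (carrier V) \<theta>) id (coact W w)"
      using tmap_id[OF V kvs_alg rv] v i by simp
  qed
qed

end

section \<open>Reconstruction of the coordinate ring\<close>

locale tannaka = diff_bialgebra d A for d :: "'k::field \<Rightarrow> 'k" and A :: "('k, 'a) dhopf" (structure) +
  fixes e :: "'k list \<Rightarrow> 'e"
  assumes inj_e: "inj e" and deriv: "derivation d"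
begin

abbreviation (input) FM :: "('k, ('k, 'e, 'a) fsum set) module" where "FM \<equiv> FmodR A"

abbreviation (input) anyc :: "('k, 'v, 'a) gmod \<Rightarrow> 'v \<Rightarrow> ('v \<Rightarrow> 'k) \<Rightarrow> ('k, 'e, 'a) fsum set" where
  "anyc V v u \<equiv> rep_coeff_any A V (tmul V (dual V) v u)"

abbreviation (input) repc :: "('k, 'e, 'a) gmod \<Rightarrow> 'e \<Rightarrow> ('e \<Rightarrow> 'k) \<Rightarrow> ('k, 'e, 'a) fsum set" where
  "repc V v u \<equiv> rep_coeff A V (tmul V (dual V) v u)"

lemma dual_map_dual: "kvs V \<Longrightarrow> kvs W \<Longrightarrow> \<phi> \<in> lin V W \<Longrightarrow> u \<in> carrier (dual W) \<Longrightarrow> dual_map V \<phi> u \<in> carrier (dual V)"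
  by (rule lin_closed[OF dual_map_lin])

lemma gmod_hom_lin: "\<phi> \<in> gmod_hom A V W \<Longrightarrow> \<phi> \<in> lin V W"
  by (simp add: gmod_hom_def)

lemma copy_exists:
  assumes GV: "gmodule A V"
  obtains V' :: "('k, 'e, 'a) gmod" and \<theta> where "V' \<in> reps A" "\<theta> \<in> gmod_iso A V V'"
proof -
  obtain \<beta> :: "_ \<Rightarrow> 'k list" where "inj_on \<beta> (carrier V)" using fin_dim_lists[OF gmoduleD(1,2)[OF GV]] .
  then have "inj_on (\<lambda>x. e (\<beta> x)) (carrier V)" using inj_e by (auto simp: inj_on_def)
  from gmod_copy[OF GV this] show thesis using that unfolding reps_iff by metis
qed

text \<open>\<open>rep_coeff_any\<close> chooses a copy by \<open>SOME\<close>; two copies are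
  joined by the isomorphism through V, and naturality along it identifies the two
  coefficients.\<close>

lemma anyc_eq:
  assumes GV: "gmodule A V" and V': "V' \<in> reps A" "\<theta> \<in> gmod_iso A V V'" and v: "v \<in> carrier V" and u: "u \<in> carrier (dual V)"
  shows "anyc V v u = repc V' (\<theta> v) (dual_map V' (inv_into (carrier V) \<theta>) u)"
proof -
  note V = gmoduleD(1)[OF GV]
  define P where "P x \<longleftrightarrow> (\<exists>V' \<in> reps A. \<exists>\<theta> \<in> gmod_iso A V V'. x = rep_coeff A V'
    (tmap V (dual V) V' (dual V') \<theta> (dual_map V' (inv_into (carrier V) \<theta>)) (tmul V (dual V) v u)))"
    for x :: "('k, 'e, 'a) fsum set"
  have tm: "rep_coeff A W (tmap V (dual V) W (dual W) \<eta> (dual_map W (inv_into (carrier V) \<eta>)) (tmul V (dual V) v u)) =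
      repc W (\<eta> v) (dual_map W (inv_into (carrier V) \<eta>) u)"
    if W: "W \<in> reps A" "\<eta> \<in> gmod_iso A V W" for W :: "('k, 'e, 'a) gmod" and \<eta>
  proof -
    have GW: "gmodule A W" using W by (simp add: reps_iff)
    note kW = gmoduleD(1)[OF GW] and i = gmod_isoD[OF GV GW W(2)]
    show ?thesis
      using tmap_tmul[OF V kvs_dual[OF V] kW kvs_dual[OF kW] gmod_hom_lin[OF i(1)] dual_map_lin[OF kW V gmod_hom_lin[OF i(2)]] v u]
      by simp
  qed
  have uniq: "repc W (\<eta> v) (dual_map W (inv_into (carrier V) \<eta>) u) = repc V' (\<theta> v) (dual_map V' (inv_into (carrier V) \<theta>) u)"
    if W: "W \<in> reps A" "\<eta> \<in> gmod_iso A V W" for W :: "('k, 'e, 'a) gmod" and \<eta>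
  proof -
    have GW: "gmodule A W" and GV': "gmodule A V'" using W V' by (simp_all add: reps_iff)
    note kW = gmoduleD(1)[OF GW] and kV' = gmoduleD(1)[OF GV']
    note i = gmod_isoD[OF GV GW W(2)] and j = gmod_isoD[OF GV GV' V'(2)]
    note h = gmod_hom_comp[OF GW GV GV' i(2) j(1)]
    note du = dual_map_dual[OF kV' V gmod_hom_lin[OF j(2)] u]
    have "dual_map W (\<lambda>x. \<theta> (inv_into (carrier V) \<eta> x)) (dual_map V' (inv_into (carrier V) \<theta>) u) = dual_map W (inv_into (carrier V) \<eta>) u"
      by (rule dual_eqI[OF dual_map_dual[OF kW kV' gmod_hom_lin[OF h] du] dual_map_dual[OF kW V gmod_hom_lin[OF i(2)] u]])
        (use lin_closed[OF gmod_hom_lin[OF i(2)]] lin_closed[OF gmod_hom_lin[OF j(1)]] j(3) in \<open>simp add: dual_map_apply\<close>)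
    then show ?thesis
      using rep_coeff_natural[OF W(1) V'(1) h lin_closed[OF gmod_hom_lin[OF i(1)] v] du] i(3)[OF v] by simp
  qed
  have "P (anyc V v u)" unfolding rep_coeff_any_def P_def[symmetric]
    by (rule someI[of P]) (unfold P_def, use V' in blast)
  then show ?thesis using tm uniq unfolding P_def by (elim bexE) simp
qed

lemma gmod_iso_self:
  assumes GV: "gmodule A V" shows "(\<lambda>x. x) \<in> gmod_iso A V V"
proof -
  have "tmap V A V A (\<lambda>x. x) id (coact V v) = coact V v" if "v \<in> carrier V" for v
    by (rule tmap_id[OF gmoduleD(1)[OF GV] kvs_alg lin_closed[OF gmoduleD(3)[OF GV] that]]) simp_all
  then show ?thesis by (simp add: gmod_iso_def gmod_hom_def lin_id bij_betw_def)
qed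

lemma anyc_reps:
  assumes V: "V \<in> reps A" and v: "v \<in> carrier V" and u: "u \<in> carrier (dual V)"
  shows "anyc V v u = repc V v u"
proof -
  have GV: "gmodule A V" using V by (simp add: reps_iff)
  note i = gmod_isoD[OF GV GV gmod_iso_self[OF GV]]
  have "dual_map V (inv_into (carrier V) (\<lambda>x. x)) u = u"
    by (rule dual_eqI[OF dual_map_dual[OF gmoduleD(1)[OF GV] gmoduleD(1)[OF GV] gmod_hom_lin[OF i(2)] u] u]) (simp add: dual_map_apply i(3))
  then show ?thesis using anyc_eq[OF GV V gmod_iso_self[OF GV] v u] by simp
qed

text \<open>The relations of F/R extend to modules on arbitrary types by conjugating \<phi> with
  isomorphisms to copies. This allows a module V to be compared with a subcomodule of A, which lives
  on another type.\<close>

lemma anyc_natural: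
  assumes GV: "gmodule A V" and GW: "gmodule A W" and f: "\<phi> \<in> gmod_hom A V W" and v: "v \<in> carrier V" and u: "u \<in> carrier (dual W)"
  shows "anyc V v (dual_map V \<phi> u) = anyc W (\<phi> v) u"
proof -
  note V = gmoduleD(1)[OF GV] and W = gmoduleD(1)[OF GW] and fl = gmod_hom_lin[OF f]
  obtain V' :: "('k, 'e, 'a) gmod" and \<theta> where V': "V' \<in> reps A" "\<theta> \<in> gmod_iso A V V'" using copy_exists[OF GV] .
  obtain W' :: "('k, 'e, 'a) gmod" and \<eta> where W': "W' \<in> reps A" "\<eta> \<in> gmod_iso A W W'" using copy_exists[OF GW] .
  have GV': "gmodule A V'" and GW': "gmodule A W'" using V' W' by (simp_all add: reps_iff)
  note kV' = gmoduleD(1)[OF GV'] and kW' = gmoduleD(1)[OF GW']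
  note i = gmod_isoD[OF GV GV' V'(2)] and j = gmod_isoD[OF GW GW' W'(2)]
  note il = gmod_hom_lin[OF i(1)] gmod_hom_lin[OF i(2)] and jl = gmod_hom_lin[OF j(1)] gmod_hom_lin[OF j(2)]
  note h = gmod_hom_comp[OF GV' GW GW' gmod_hom_comp[OF GV' GV GW i(2) f] j(1)]
  note du = dual_map_dual[OF V W fl u] and dj = dual_map_dual[OF kW' W jl(2) u]
  have "dual_map V' (\<lambda>x. \<eta> (\<phi> (inv_into (carrier V) \<theta> x))) (dual_map W' (inv_into (carrier W) \<eta>) u) =
      dual_map V' (inv_into (carrier V) \<theta>) (dual_map V \<phi> u)"
    by (rule dual_eqI[OF dual_map_dual[OF kV' kW' gmod_hom_lin[OF h] dj] dual_map_dual[OF kV' V il(2) du]])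
      (use lin_closed[OF il(2)] lin_closed[OF fl] lin_closed[OF jl(1)] j(3) in \<open>simp add: dual_map_apply\<close>)
  then show ?thesis
    using anyc_eq[OF GV V' v du] anyc_eq[OF GW W' lin_closed[OF fl v] u]
      rep_coeff_natural[OF V'(1) W'(1) h lin_closed[OF il(1) v] dj] i(3)[OF v] by simp
qed

section \<open>The comparison map and its sections\<close>

definition \<Phi> :: "('k, 'e, 'a) fsum set \<Rightarrow> 'a" where
  "\<Phi> = (SOME \<Phi>. \<Phi> \<in> lin FM A \<and> (\<forall>V\<in>reps A. \<forall>z\<in>carrier (tensor V (dual V)). \<Phi> (rep_coeff A V z) = mat_coeff A V z))"

lemma \<Phi>_lin: "\<Phi> \<in> lin FM A"
  and \<Phi>_rep_coeff: "V \<in> reps A \<Longrightarrow> z \<in> carrier (tensor V (dual V)) \<Longrightarrow> \<Phi> (rep_coeff A V z) = mat_coeff A V z"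
proof -
  have "\<exists>\<Phi>. \<Phi> \<in> lin FM A \<and> (\<forall>V\<in>reps A. \<forall>z\<in>carrier (tensor V (dual V)). \<Phi> (rep_coeff A V z) = mat_coeff A V z)"
    by (rule coeff_map_exists)
  note s = someI_ex[OF this, folded \<Phi>_def]
  show "\<Phi> \<in> lin FM A" by (rule s[THEN conjunct1])
  show "V \<in> reps A \<Longrightarrow> z \<in> carrier (tensor V (dual V)) \<Longrightarrow> \<Phi> (rep_coeff A V z) = mat_coeff A V z"
    using s[THEN conjunct2] by blast
qed

text \<open>\<open>rep_coeff_any\<close> may choose a new copy for each tensor, so additivity
  becomes visible only after all values are expressed through one fixed copy.\<close>

lemma anyc_hom:
  assumes GV: "gmodule A V" and u: "u \<in> carrier (dual V)"
  shows "(\<lambda>v. anyc V v u) \<in> add_hom V FM"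
proof -
  note V = gmoduleD(1)[OF GV]
  obtain V' :: "('k, 'e, 'a) gmod" and \<theta> where V': "V' \<in> reps A" "\<theta> \<in> gmod_iso A V V'" using copy_exists[OF GV] .
  have GV': "gmodule A V'" using V' by (simp add: reps_iff)
  note kV' = gmoduleD(1)[OF GV'] and i = gmod_isoD[OF GV GV' V'(2)]
  note du = dual_map_dual[OF kV' V gmod_hom_lin[OF i(2)] u]
  have "(\<lambda>v. repc V' (\<theta> v) (dual_map V' (inv_into (carrier V) \<theta>) u)) \<in> add_hom V FM"
    by (rule add_hom_comp[OF add_hom_comp[OF lin_add_hom[OF gmod_hom_lin[OF i(1)]] tmul_hom_left[OF kV' kvs_dual[OF kV'] du]]
          lin_add_hom[OF rep_coeff_lin[OF V'(1)]]])
  then show ?thesis using V anyc_eq[OF GV V' _ u] by (simp add: add_hom_iff)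
qed

lemma \<Phi>_anyc:
  assumes GV: "gmodule A V" and v: "v \<in> carrier V" and u: "u \<in> carrier (dual V)"
  shows "\<Phi> (anyc V v u) = coeff_fun A V u v"
proof -
  note V = gmoduleD(1)[OF GV]
  obtain V' :: "('k, 'e, 'a) gmod" and \<theta> where V': "V' \<in> reps A" "\<theta> \<in> gmod_iso A V V'" using copy_exists[OF GV] .
  have GV': "gmodule A V'" using V' by (simp add: reps_iff)
  note kV' = gmoduleD(1)[OF GV'] and i = gmod_isoD[OF GV GV' V'(2)]
  note du = dual_map_dual[OF kV' V gmod_hom_lin[OF i(2)] u] and tv = lin_closed[OF gmod_hom_lin[OF i(1)] v]
  have "coeff_fun A V (\<lambda>x. dual_map V' (inv_into (carrier V) \<theta>) u (\<theta> x)) = coeff_fun A V u"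
    by (rule coeff_fun_cong) (use lin_closed[OF gmod_hom_lin[OF i(1)]] i(3) in \<open>simp add: dual_map_apply\<close>)
  then show ?thesis
    using anyc_eq[OF GV V' v u] \<Phi>_rep_coeff[OF V'(1), of "tmul V' (dual V') (\<theta> v) (dual_map V' (inv_into (carrier V) \<theta>) u)"]
      mat_coeff_tmul[OF GV' tv du] gmod_homD[OF GV GV' i(1) dual_simps(1)[OF du] v] kV' tv du by simp
qed

lemma \<Phi>_repc:
  assumes "V \<in> reps A" "v \<in> carrier V" "u \<in> carrier (dual V)"
  shows "\<Phi> (repc V v u) = coeff_fun A V u v"
  unfolding anyc_reps[OF assms, symmetric] by (rule \<Phi>_anyc[OF assms(1)[unfolded reps_iff] assms(2,3)])

text \<open>For a finite-dimensional subcomodule \<open>N\<close> of \<open>A\<close> the coefficients \<open>w \<otimes> \<epsilon>\<close> with \<open>w \<in> N\<close>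
  are a section of \<open>\<Phi>\<close> over \<open>N\<close>, and every formal coefficient is of this kind, since
  \<open>a\<^sub>V (v \<otimes> u)\<close> is carried to \<open>f v \<otimes> \<epsilon>\<close> by the comodule map \<open>f : V \<rightarrow> A\<close> attached to \<open>u\<close>.\<close>

definition sect :: "'a set \<Rightarrow> 'a \<Rightarrow> ('k, 'e, 'a) fsum set" where
  "sect N w = anyc (sub_gmod A N) w (restrict (counit A) N)"

lemma sect_coeff:
  assumes N: "subcomod N" and GV: "gmodule A V" and u: "u \<in> carrier (dual V)"
    and im: "coeff_fun A V u ` carrier V \<subseteq> N" and v: "v \<in> carrier V"
  shows "anyc V v u = sect N (coeff_fun A V u v)"
proof -
  note ul = dual_simps(1)[OF u] and GS = gmodule_sub[OF N]
  note h = coeff_fun_hom_sub[OF N GV ul im]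
  have "dual_map V (coeff_fun A V u) (restrict (counit A) N) = u"
  proof (rule dual_eqI[OF dual_map_dual[OF gmoduleD(1)[OF GV] gmoduleD(1)[OF GS] gmod_hom_lin[OF h] counit_sub[OF N]] u])
    fix x assume x: "x \<in> carrier V"
    then have "coeff_fun A V u x \<in> N" using im by blast
    then show "dual_map V (coeff_fun A V u) (restrict (counit A) N) x = u x"
      using gmoduleD(6)[OF GV ul x] x by (simp add: dual_map_apply)
  qed
  then show ?thesis using anyc_natural[OF GV GS h v counit_sub[OF N]] by (simp add: sect_def)
qed

lemma coeff_fun_sub_restrict: "subcomod N \<Longrightarrow> w \<in> N \<Longrightarrow> coeff_fun A (sub_gmod A N) (restrict (counit A) N) w = w"
  using coeff_fun_sub_counit[of N w] coeff_fun_cong[of "sub_gmod A N" "restrict (counit A) N" "counit A" A] by simp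

text \<open>This is \<open>sect_coeff\<close> for the module \<open>N\<close> and the functional
  \<epsilon>, whose coefficient function is the inclusion.\<close>

lemma sect_mono:
  assumes N: "subcomod N" and N': "subcomod N'" and sub: "N \<subseteq> N'" and w: "w \<in> N"
  shows "sect N w = sect N' w"
  using sect_coeff[OF N' gmodule_sub[OF N] counit_sub[OF N] _, of w] w sub
  by (auto simp: coeff_fun_sub_restrict[OF N] sect_def[of N])

lemma sect_hom: "subcomod N \<Longrightarrow> sect N \<in> add_hom (sub_gmod A N) FM"
  using anyc_hom[OF gmodule_sub counit_sub] by (simp add: sect_def[abs_def])

lemma \<Phi>_sect: "subcomod N \<Longrightarrow> w \<in> N \<Longrightarrow> \<Phi> (sect N w) = w"
  using \<Phi>_anyc[OF gmodule_sub _ counit_sub, of N w] by (simp add: sect_def coeff_fun_sub_restrict)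

text \<open>Sections over different subcomodules agree on smaller ones, so the property is additive:
  for a sum one passes to the span of the union of the two finite sets.\<close>

lemma sect_surj:
  assumes "x \<in> carrier FM"
  shows "\<exists>F. finite F \<and> F \<subseteq> carrier A \<and> subcomod (lspan A F) \<and> \<Phi> x \<in> lspan A F \<and> x = sect (lspan A F) (\<Phi> x)"
  using assms
proof (induction x rule: FmodR_induct)
  case zero
  have z: "\<Phi> \<zero>\<^bsub>FM\<^esub> = \<zero>" using add_hom_zero[OF lin_add_hom[OF \<Phi>_lin]] by simp
  obtain F where F: "finite F" "F \<subseteq> carrier A" "subcomod (lspan A F)" "\<zero> \<in> lspan A F"
    using element_subcomod[of "\<zero>"] by auto
  have "sect (lspan A F) \<zero> = \<zero>\<^bsub>FM\<^esub>"
    using add_hom_zero[OF sect_hom[OF F(3)]] gmoduleD(1)[OF gmodule_sub[OF F(3)]] by simp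
  then show ?case using F z by auto
next
  case (coeff V v u)
  have GV: "gmodule A V" using coeff by (simp add: reps_iff)
  obtain F where F: "finite F" "F \<subseteq> carrier A" "subcomod (lspan A F)" "coeff_fun A V u ` carrier V \<subseteq> lspan A F"
    using coeff_fun_subcomod[OF GV dual_simps(1)[OF coeff(3)]] .
  have "repc V v u = sect (lspan A F) (\<Phi> (repc V v u))"
    using sect_coeff[OF F(3) GV coeff(3) F(4) coeff(2)] anyc_reps[OF coeff] \<Phi>_repc[OF coeff] by simp
  moreover have "\<Phi> (repc V v u) \<in> lspan A F" using F(4) coeff \<Phi>_repc[OF coeff] by auto
  ultimately show ?case using F by blast
next
  case (add x y)
  obtain F where F: "finite F" "F \<subseteq> carrier A" "subcomod (lspan A F)" "\<Phi> x \<in> lspan A F" "x = sect (lspan A F) (\<Phi> x)"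
    using add.IH by blast
  obtain F' where F': "finite F'" "F' \<subseteq> carrier A" "subcomod (lspan A F')" "\<Phi> y \<in> lspan A F'" "y = sect (lspan A F') (\<Phi> y)"
    using add.IH by blast
  let ?N = "lspan A (F \<union> F')"
  have N: "subcomod ?N" by (rule subcomod_union[OF F(1-3) F'(1-3)])
  have sub: "lspan A F \<subseteq> ?N" "lspan A F' \<subseteq> ?N" by (rule lspan_mono, blast)+
  have c: "\<Phi> x \<in> ?N" "\<Phi> y \<in> ?N" using sub F(4) F'(4) by auto
  have sm: "submodule ?N kring A" using N by (simp add: subcomod_def)
  have "x = sect ?N (\<Phi> x)" "y = sect ?N (\<Phi> y)"
    using F(5) F'(5) sect_mono[OF F(3) N sub(1) F(4)] sect_mono[OF F'(3) N sub(2) F'(4)] by simp_all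
  then have "x \<oplus>\<^bsub>FM\<^esub> y = sect ?N (\<Phi> (x \<oplus>\<^bsub>FM\<^esub> y))"
    using add_hom_add[OF sect_hom[OF N], of "\<Phi> x" "\<Phi> y"] c lin_add[OF \<Phi>_lin add.hyps] by simp
  moreover have "\<Phi> (x \<oplus>\<^bsub>FM\<^esub> y) \<in> ?N" using submoduleD(3)[OF kvs_alg sm c] lin_add[OF \<Phi>_lin add.hyps] by simp
  ultimately show ?case using F F' N by (intro exI[of _ "F \<union> F'"]) auto
qed

text \<open>An element of the kernel is the value of a section at 0, and sections are
  additive.\<close>

lemma \<Phi>_bij: "bij_betw \<Phi> (carrier FM) (carrier A)"
  unfolding bij_betw_def
proof
  have ker: "x = \<zero>\<^bsub>FM\<^esub>" if x: "x \<in> carrier FM" "\<Phi> x = \<zero>" for x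
  proof -
    obtain F where F: "subcomod (lspan A F)" "x = sect (lspan A F) \<zero>" using sect_surj[OF x(1)] x(2) by auto
    then show ?thesis
      using add_hom_zero[OF sect_hom[OF F(1)]] gmoduleD(1)[OF gmodule_sub[OF F(1)]] by simp
  qed
  have ab: "abelian_group FM" "abelian_group A" by simp_all
  show "inj_on \<Phi> (carrier FM)"
  proof (rule inj_onI)
    fix x y assume xy: "x \<in> carrier FM" "y \<in> carrier FM" and eq: "\<Phi> x = \<Phi> y"
    have "x \<ominus>\<^bsub>FM\<^esub> y = \<zero>\<^bsub>FM\<^esub>"
      by (rule ker) (use ab xy eq lin_closed[OF \<Phi>_lin] add_hom_diff[OF lin_add_hom[OF \<Phi>_lin] ab xy] in simp_all)
    then show "x = y" using ag_diff_eq_zero[OF ab(1) xy] by simp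
  qed
  show "\<Phi> ` carrier FM = carrier A"
  proof
    show "\<Phi> ` carrier FM \<subseteq> carrier A" using lin_closed[OF \<Phi>_lin] by blast
    show "carrier A \<subseteq> \<Phi> ` carrier FM"
    proof
      fix a assume "a \<in> carrier A"
      then obtain F where F: "subcomod (lspan A F)" "a \<in> lspan A F" using element_subcomod by metis
      show "a \<in> \<Phi> ` carrier FM"
        by (rule image_eqI[of _ _ "sect (lspan A F) a"]) (use F \<Phi>_sect add_hom_closed[OF sect_hom[OF F(1)]] in simp_all)
    qed
  qed
qed

definition \<Psi> :: "'a \<Rightarrow> ('k, 'e, 'a) fsum set" where "\<Psi> = inv_into (carrier FM) \<Phi>"

lemma \<Psi>: "a \<in> carrier A \<Longrightarrow> \<Psi> a \<in> carrier FM" "a \<in> carrier A \<Longrightarrow> \<Phi> (\<Psi> a) = a" "x \<in> carrier FM \<Longrightarrow> \<Psi> (\<Phi> x) = x"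
  using \<Phi>_bij inv_into_into[of a \<Phi> "carrier FM"] f_inv_into_f[of a \<Phi> "carrier FM"] inv_into_f_f[of \<Phi> "carrier FM" x]
  by (auto simp: \<Psi>_def bij_betw_def)

lemma \<Psi>_hom: "\<Psi> \<in> add_hom A FM"
proof (rule add_homI)
  fix a b assume ab: "a \<in> carrier A" "b \<in> carrier A"
  have "\<Psi> (\<Phi> (\<Psi> a \<oplus>\<^bsub>FM\<^esub> \<Psi> b)) = \<Psi> a \<oplus>\<^bsub>FM\<^esub> \<Psi> b" using ab \<Psi>(1) by (intro \<Psi>(3)) simp
  then show "\<Psi> (a \<oplus> b) = \<Psi> a \<oplus>\<^bsub>FM\<^esub> \<Psi> b" using ab \<Psi> lin_add[OF \<Phi>_lin] by simp
qed (rule \<Psi>)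

lemma anyc_closed: "gmodule A V \<Longrightarrow> v \<in> carrier V \<Longrightarrow> u \<in> carrier (dual V) \<Longrightarrow> anyc V v u \<in> carrier FM"
  by (rule add_hom_closed[OF anyc_hom])

lemma repc_closed: "V \<in> reps A \<Longrightarrow> v \<in> carrier V \<Longrightarrow> u \<in> carrier (dual V) \<Longrightarrow> repc V v u \<in> carrier FM"
  using anyc_closed[of V v u] anyc_reps[of V v u] by (simp add: reps_iff)

lemma tensor_functional_dual:
  assumes "V \<in> reps A" "W \<in> reps A" "u \<in> carrier (dual V)" "t \<in> carrier (dual W)"
  shows "tensor_functional V W u t \<in> carrier (dual (tensor_gmod A V W))"
  using tensor_functional_lin(1)[OF gmoduleD(1) gmoduleD(1) dual_simps(1) dual_simps(1), of V W u t] assms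
  by (simp add: dual_def reps_iff) (simp add: tensor_functional_def)

lemma prolong_functional_dual:
  assumes "V \<in> reps A" "u \<in> carrier (dual V)"
  shows "prolong_functional d V u \<in> carrier (dual (prolong_gmod d A V))"
  using prolong_functional_lin(1)[OF gmoduleD(1) deriv dual_simps(1), of V u] assms
  by (simp add: dual_def reps_iff) (simp add: prolong_functional_def)

lemma \<Phi>_tensor:
  assumes V: "V \<in> reps A" and W: "W \<in> reps A" and v: "v \<in> carrier V" "u \<in> carrier (dual V)" and w: "w \<in> carrier W" "t \<in> carrier (dual W)"
  shows "anyc (tensor_gmod A V W) (tmul V W v w) (tensor_functional V W u t) \<in> carrier FM"
    and "\<Phi> (anyc (tensor_gmod A V W) (tmul V W v w) (tensor_functional V W u t)) = \<Phi> (repc V v u) \<otimes> \<Phi> (repc W w t)"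
proof -
  have GV: "gmodule A V" and GW: "gmodule A W" using V W by (simp_all add: reps_iff)
  note GT = gmodule_tensor[OF GV GW] and f = tensor_functional_dual[OF V W v(2) w(2)]
  have c: "tmul V W v w \<in> carrier (tensor_gmod A V W)" using gmoduleD(1)[OF GV] gmoduleD(1)[OF GW] v w by simp
  show "anyc (tensor_gmod A V W) (tmul V W v w) (tensor_functional V W u t) \<in> carrier FM" by (rule anyc_closed[OF GT c f])
  show "\<Phi> (anyc (tensor_gmod A V W) (tmul V W v w) (tensor_functional V W u t)) = \<Phi> (repc V v u) \<otimes> \<Phi> (repc W w t)"
    unfolding \<Phi>_anyc[OF GT c f] \<Phi>_repc[OF V v] \<Phi>_repc[OF W w]
    by (rule coeff_fun_tensor[OF GV GW dual_simps(1)[OF v(2)] dual_simps(1)[OF w(2)] v(1) w(1)])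
qed

lemma \<Phi>_prolong:
  assumes V: "V \<in> reps A" and v: "v \<in> carrier V" "u \<in> carrier (dual V)"
  shows "anyc (prolong_gmod d A V) (prolong_der V v) (prolong_functional d V u) \<in> carrier FM"
    and "\<Phi> (anyc (prolong_gmod d A V) (prolong_der V v) (prolong_functional d V u)) = der A (\<Phi> (repc V v u))"
proof -
  have GV: "gmodule A V" using V by (simp add: reps_iff)
  note kV = gmoduleD(1)[OF GV] and GP = gmodule_prolong[OF GV deriv] and f = prolong_functional_dual[OF V v(2)] and ul = dual_simps(1)[OF v(2)]
  have c: "prolong_der V v \<in> carrier (prolong_gmod d A V)" and z: "\<zero>\<^bsub>V\<^esub> \<in> carrier V" using kV v by (simp_all add: prolong_der_def)
  show "anyc (prolong_gmod d A V) (prolong_der V v) (prolong_functional d V u) \<in> carrier FM" by (rule anyc_closed[OF GP c f])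
  have "coeff_fun A V u \<zero>\<^bsub>V\<^esub> = \<zero>" using add_hom_zero[OF lin_add_hom[OF gmoduleD(4)[OF GV ul]]] kV by simp
  then have "coeff_fun A (prolong_gmod d A V) (prolong_functional d V u) (prolong_der V v) = der A (coeff_fun A V u v)"
    using coeff_fun_prolong(1)[OF GV deriv ul z v(1)] dk_algebraD(7)[OF dk lin_closed[OF gmoduleD(4)[OF GV ul] v(1)]]
    by (simp add: prolong_der_def)
  then show "\<Phi> (anyc (prolong_gmod d A V) (prolong_der V v) (prolong_functional d V u)) = der A (\<Phi> (repc V v u))"
    unfolding \<Phi>_anyc[OF GP c f] \<Phi>_repc[OF V v] .
qed

text \<open>The predicate under \<open>SOME\<close> in \<open>tannaka_mult\<close>, named so that
  \<open>someI\<close> can be applied.\<close>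

definition mult_spec :: "(('k, 'e, 'a) fsum set \<Rightarrow> ('k, 'e, 'a) fsum set \<Rightarrow> ('k, 'e, 'a) fsum set) \<Rightarrow> bool" where
  "mult_spec m \<longleftrightarrow> (\<forall>x \<in> carrier FM. m x \<in> add_hom FM FM) \<and> (\<forall>y \<in> carrier FM. (\<lambda>x. m x y) \<in> add_hom FM FM) \<and>
    (\<forall>V \<in> reps A. \<forall>W \<in> reps A. \<forall>v \<in> carrier V. \<forall>u \<in> carrier (dual V). \<forall>w \<in> carrier W. \<forall>t \<in> carrier (dual W).
        m (repc V v u) (repc W w t) = anyc (tensor_gmod A V W) (tmul V W v w) (tensor_functional V W u t))"

text \<open>Existence is the issue. The product of A, transported along the bijection \<Phi>, meets
  the specification by \<open>\<Phi>_tensor\<close>, so the formula for the product is never checked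
  directly modulo \<open>Rrel\<close>.\<close>

lemma mult_spec: "mult_spec (tannaka_mult A)"
proof -
  note ca = cring_facts[OF cring_alg] and cl = lin_closed[OF \<Phi>_lin] and ad = lin_add[OF \<Phi>_lin]
  have "mult_spec (\<lambda>x y. \<Psi> (\<Phi> x \<otimes> \<Phi> y))" unfolding mult_spec_def
  proof (intro conjI ballI)
    show "(\<lambda>y. \<Psi> (\<Phi> x \<otimes> \<Phi> y)) \<in> add_hom FM FM" "(\<lambda>y. \<Psi> (\<Phi> y \<otimes> \<Phi> x)) \<in> add_hom FM FM" if "x \<in> carrier FM" for x
      by (rule add_homI; use that \<Psi>(1) cl in \<open>simp add: ca ad add_hom_add[OF \<Psi>_hom]\<close>)+
    fix V W :: "('k, 'e, 'a) gmod" and v u w t assume *: "V \<in> reps A" "W \<in> reps A" "v \<in> carrier V" "u \<in> carrier (dual V)" "w \<in> carrier W" "t \<in> carrier (dual W)"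
    show "\<Psi> (\<Phi> (repc V v u) \<otimes> \<Phi> (repc W w t)) = anyc (tensor_gmod A V W) (tmul V W v w) (tensor_functional V W u t)"
      using \<Phi>_tensor[OF *] \<Psi>(3) by metis
  qed
  then have "mult_spec (SOME m. mult_spec m)" by (rule someI[of mult_spec])
  then show ?thesis by (simp add: tannaka_mult_def mult_spec_def Let_def)
qed

lemmas tannaka_mult_spec = mult_spec[unfolded mult_spec_def, THEN conjunct1, rule_format]
  mult_spec[unfolded mult_spec_def, THEN conjunct2, THEN conjunct1, rule_format]
  mult_spec[unfolded mult_spec_def, THEN conjunct2, THEN conjunct2, rule_format]

definition der_spec :: "(('k, 'e, 'a) fsum set \<Rightarrow> ('k, 'e, 'a) fsum set) \<Rightarrow> bool" where
  "der_spec m \<longleftrightarrow> m \<in> add_hom FM FM \<and> (\<forall>V \<in> reps A. \<forall>v \<in> carrier V. \<forall>u \<in> carrier (dual V).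
        m (repc V v u) = anyc (prolong_gmod d A V) (prolong_der V v) (prolong_functional d V u))"

lemma der_spec: "der_spec (tannaka_der d A)"
proof -
  have "der_spec (\<lambda>x. \<Psi> (der A (\<Phi> x)))" unfolding der_spec_def
  proof (intro conjI ballI)
    show "(\<lambda>x. \<Psi> (der A (\<Phi> x))) \<in> add_hom FM FM"
      by (rule add_hom_comp[OF add_hom_comp[OF lin_add_hom[OF \<Phi>_lin] dk_algebraD(3)[OF dk]] \<Psi>_hom])
    fix V :: "('k, 'e, 'a) gmod" and v u assume *: "V \<in> reps A" "v \<in> carrier V" "u \<in> carrier (dual V)"
    show "\<Psi> (der A (\<Phi> (repc V v u))) = anyc (prolong_gmod d A V) (prolong_der V v) (prolong_functional d V u)"
      using \<Phi>_prolong[OF *] \<Psi>(3) by metis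
  qed
  then have "der_spec (SOME m. der_spec m)" by (rule someI[of der_spec])
  then show ?thesis by (simp add: tannaka_der_def der_spec_def Let_def)
qed

lemmas tannaka_der_spec = der_spec[unfolded der_spec_def, THEN conjunct1]
  der_spec[unfolded der_spec_def, THEN conjunct2, rule_format]

text \<open>What is known of \<open>tannaka_mult\<close> is its specification, which the transported
  product merely shows to be satisfiable; biadditivity and the values on generators determine it on
  the carrier.\<close>

lemma \<Phi>_mult:
  assumes x: "x \<in> carrier FM" and y: "y \<in> carrier FM"
  shows "\<Phi> (tannaka_mult A x y) = \<Phi> x \<otimes> \<Phi> y"
proof -
  note ca = cring_facts[OF cring_alg] and cl = lin_closed[OF \<Phi>_lin] and ad = lin_add[OF \<Phi>_lin]
  interpret A: cring A by (rule cring_alg)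
  have ab: "abelian_group FM" "abelian_group A" by simp_all
  have z: "\<Phi> \<zero>\<^bsub>FM\<^esub> = \<zero>" by (rule add_hom_zero[OF lin_add_hom[OF \<Phi>_lin] ab])
  note m = tannaka_mult_spec
  show ?thesis using x
  proof (induction x rule: FmodR_induct)
    case zero
    show ?case using add_hom_zero[OF m(2)[OF y] ab(1) ab(1)] cl[OF y] by (simp add: z)
  next
    case (coeff V v u)
    note r = repc_closed[OF coeff]
    show ?case using y
    proof (induction y rule: FmodR_induct)
      case zero
      show ?case using add_hom_zero[OF m(1)[OF r] ab(1) ab(1)] cl[OF r] by (simp add: z)
    next
      case (coeff W w t)
      show ?case using m(3) \<Phi>_tensor(2) coeff \<open>V \<in> reps A\<close> \<open>v \<in> carrier V\<close> \<open>u \<in> carrier (dual V)\<close> by simp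
    next
      case (add y y')
      show ?case using add add_hom_closed[OF m(1)[OF r]] cl r by (simp add: add_hom_add[OF m(1)[OF r]] ad ca)
    qed
  next
    case (add x x')
    show ?case using add add_hom_closed[OF m(2)[OF y]] cl y by (simp add: add_hom_add[OF m(2)[OF y]] ad ca)
  qed
qed

lemma \<Phi>_der:
  assumes "x \<in> carrier FM"
  shows "\<Phi> (tannaka_der d A x) = der A (\<Phi> x)"
  using assms
proof (induction x rule: FmodR_induct)
  case zero
  have ab: "abelian_group FM" "abelian_group A" by simp_all
  show ?case
    using add_hom_zero[OF lin_add_hom[OF \<Phi>_lin] ab] add_hom_zero[OF tannaka_der_spec(1) ab(1) ab(1)]
      add_hom_zero[OF dk_algebraD(3)[OF dk] ab(2) ab(2)] by simp
next
  case (coeff V v u)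
  then show ?case using \<Phi>_prolong(2)[OF coeff] tannaka_der_spec(2)[OF coeff] by simp
next
  case (add x y)
  then show ?case using add_hom_closed[OF tannaka_der_spec(1)] lin_closed[OF \<Phi>_lin]
    by (simp add: add_hom_add[OF tannaka_der_spec(1)] lin_add[OF \<Phi>_lin] add_hom_add[OF dk_algebraD(3)[OF dk]])
qed

abbreviation (input) TA :: "('k, ('k, 'e, 'a) fsum set) dalg" where "TA \<equiv> tannaka_algebra d A"

lemma tannaka_algebra_simps:
  "carrier TA = carrier FM" "\<zero>\<^bsub>TA\<^esub> = \<zero>\<^bsub>FM\<^esub>" "x \<oplus>\<^bsub>TA\<^esub> y = x \<oplus>\<^bsub>FM\<^esub> y" "c \<odot>\<^bsub>TA\<^esub> x = c \<odot>\<^bsub>FM\<^esub> x"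
  "x \<otimes>\<^bsub>TA\<^esub> y = tannaka_mult A x y" "der TA = tannaka_der d A" "\<one>\<^bsub>TA\<^esub> = anyc (triv_gmod A) 1 (\<lambda>c. c)"
  by (simp_all add: tannaka_algebra_def Let_def)

lemma \<Phi>_one: "\<one>\<^bsub>TA\<^esub> \<in> carrier FM" "\<Phi> \<one>\<^bsub>TA\<^esub> = \<one>"
proof -
  have u: "(\<lambda>c. c) \<in> carrier (dual (triv_gmod A))" by (auto simp: dual_def intro!: linI)
  have c: "1 \<in> carrier (triv_gmod A)" by simp
  show "\<one>\<^bsub>TA\<^esub> \<in> carrier FM" unfolding tannaka_algebra_simps by (rule anyc_closed[OF gmodule_triv c u])
  show "\<Phi> \<one>\<^bsub>TA\<^esub> = \<one>" unfolding tannaka_algebra_simps \<Phi>_anyc[OF gmodule_triv c u] coeff_fun_triv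
    using cring_facts(2)[OF cring_alg] by simp
qed

text \<open>The laws are inherited from A through the injective map \<Phi>.\<close>

lemma dk_algebra_tannaka: "dk_algebra d TA"
proof (rule dk_algebra_embedded[OF dk, where I = "{()}" and \<Phi> = "\<lambda>_. \<Phi>"])
  note m = tannaka_mult_spec
  show "x = y" if "x \<in> carrier TA" "y \<in> carrier TA" "\<And>i. i \<in> {()} \<Longrightarrow> \<Phi> x = \<Phi> y" for x y
    using that \<Phi>_bij by (auto simp: tannaka_algebra_simps bij_betw_def dest: inj_onD)
  show "x \<otimes>\<^bsub>TA\<^esub> y \<in> carrier TA" if "x \<in> carrier TA" "y \<in> carrier TA" for x y
    using that add_hom_closed[OF m(1)] by (simp add: tannaka_algebra_simps)
  show "der TA x \<in> carrier TA" if "x \<in> carrier TA" for x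
    using that add_hom_closed[OF tannaka_der_spec(1)] by (simp add: tannaka_algebra_simps)
  show "\<Phi> \<zero>\<^bsub>TA\<^esub> = \<zero>"
    using add_hom_zero[OF lin_add_hom[OF \<Phi>_lin]] by (simp add: tannaka_algebra_simps)
qed (use \<Phi>_one in \<open>simp_all add: tannaka_algebra_simps \<Phi>_mult \<Phi>_der lin_closed[OF \<Phi>_lin] lin_add[OF \<Phi>_lin] lin_smult[OF \<Phi>_lin]\<close>)

lemma \<Phi>_dk_iso: "\<Phi> \<in> dk_iso TA A"
proof -
  have "\<Phi> \<in> dk_hom TA A"
    unfolding dk_hom_iff
    by (intro conjI ballI allI \<Phi>_one(2))
      (simp_all add: tannaka_algebra_simps \<Phi>_mult \<Phi>_der lin_closed[OF \<Phi>_lin] lin_add[OF \<Phi>_lin] lin_smult[OF \<Phi>_lin])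
  then show ?thesis using \<Phi>_bij by (simp add: dk_iso_def tannaka_algebra_simps(1))
qed

end

text \<open>Generators are pulled back along the bijection, and a subalgebra of B is tested by its
  image in A.\<close>

lemma finitely_generated_dk_iso:
  fixes A (structure)
  assumes A: "finitely_generated_dk_algebra d A" and B: "dk_algebra d B" and f: "f \<in> dk_iso B A"
  shows "finitely_generated_dk_algebra d B"
proof -
  have dA: "dk_algebra d A" using A by (simp add: finitely_generated_dk_algebra_def)
  obtain S where S: "finite S" "S \<subseteq> carrier A" and gen: "\<forall>C. subring C A \<and> (\<forall>c. \<forall>x\<in>C. c \<odot> x \<in> C) \<and>
      (\<forall>s\<in>S. \<forall>m. (der A ^^ m) s \<in> C) \<longrightarrow> C = carrier A"
    using A unfolding finitely_generated_dk_algebra_def by (elim conjE exE)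
  have bij: "bij_betw f (carrier B) (carrier A)" and h: "f \<in> dk_hom B A" using f by (simp_all add: dk_iso_def)
  interpret A: cring A by (rule dk_algebraD(2)[OF dA])
  interpret B: cring B by (rule dk_algebraD(2)[OF B])
  interpret f: ring_hom_ring B A f
    by (intro ring_hom_ringI2 A.ring_axioms B.ring_axioms) (use h in \<open>simp add: dk_hom_def\<close>)
  let ?g = "inv_into (carrier B) f"
  have g: "?g a \<in> carrier B" "f (?g a) = a" if "a \<in> carrier A" for a
    using that bij inv_into_into[of a f "carrier B"] f_inv_into_f[of a f "carrier B"] by (auto simp: bij_betw_def)
  have dc: "(der B ^^ m) b \<in> carrier B \<and> f ((der B ^^ m) b) = (der A ^^ m) (f b)" if "b \<in> carrier B" for m b
    using that by (induction m) (use dk_algebraD(7)[OF B] h in \<open>auto simp: dk_hom_def\<close>)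
  show ?thesis unfolding finitely_generated_dk_algebra_def
  proof (intro conjI B exI[of _ "?g ` S"] allI impI)
    show "finite (?g ` S)" "?g ` S \<subseteq> carrier B" using S(1,2) g by auto
    fix C assume C: "subring C B \<and> (\<forall>c. \<forall>x\<in>C. c \<odot>\<^bsub>B\<^esub> x \<in> C) \<and> (\<forall>s\<in>?g ` S. \<forall>m. (der B ^^ m) s \<in> C)"
    then have sub: "C \<subseteq> carrier B" by (intro subringE(1)) (rule conjunct1)
    have "f ` C = carrier A"
    proof (rule gen[rule_format], intro conjI allI ballI)
      show "subring (f ` C) A" by (rule f.img_is_subring[OF C[THEN conjunct1]])
      show "c \<odot> x \<in> f ` C" if x: "x \<in> f ` C" for c x
      proof -
        obtain y where y: "y \<in> C" "x = f y" using x by blast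
        have "f (c \<odot>\<^bsub>B\<^esub> y) = c \<odot> x" using h y sub by (auto simp: dk_hom_def lin_def)
        moreover have "c \<odot>\<^bsub>B\<^esub> y \<in> C" using C y(1) by blast
        ultimately show ?thesis by (metis imageI)
      qed
      show "(der A ^^ m) s \<in> f ` C" if s: "s \<in> S" for s m
      proof -
        have "s \<in> carrier A" using s S(2) by blast
        then have "(der A ^^ m) s = f ((der B ^^ m) (?g s))" using dc g by metis
        moreover have "(der B ^^ m) (?g s) \<in> C" using C s by blast
        ultimately show ?thesis by blast
      qed
    qed
    then show "C = carrier B" using sub bij by (metis bij_betw_def inj_on_image_eq_iff subset_refl)
  qed
qed

theorem theorem3:
  fixes d :: "'k::field_char_0 \<Rightarrow> 'k"
    and D :: "'u::field \<Rightarrow> 'u"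
    and emb :: "'k \<Rightarrow> 'u"
    and G :: "('u ^ 'n ^ 'n) set"
    and A :: "('k, ('k, 'n gl_index) dpoly set) dhopf"
    and \<A> :: "('k, ('k, 'e, ('k, 'n gl_index) dpoly set) fsum set) dalg"
  assumes "derivation d"
    and "semi_universal d D emb"
    and "linear_diff_alg_group D emb G"
    and large: "\<exists>f :: 'k list \<Rightarrow> 'e. inj f"
    and A: "A = coord_ring d D emb G"
    and \<A>: "\<A> = tannaka_algebra d A"
  shows "finitely_generated_dk_algebra d \<A> \<and>
    (\<exists>\<Phi>. \<Phi> \<in> dk_hom \<A> A \<and> \<Phi> ` carrier \<A> = carrier A \<and>
       (\<forall>V \<in> reps A. \<forall>z \<in> carrier (tensor V (dual V)). \<Phi> (rep_coeff A V z) = mat_coeff A V z) \<and>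
       \<Phi> \<in> dk_iso \<A> A)"
proof -
  interpret G: diff_group d D emb G by (rule diff_group.intro) fact+
  \<comment> \<open>The injection serves to place copies of finite-dimensional modules on the type
    \<open>'e\<close>.\<close>
  obtain e :: "'k list \<Rightarrow> 'e" where "inj e" using large by blast
  with assms(1) G.diff_bialgebra_A interpret T: tannaka d A e
    unfolding A by (intro tannaka.intro tannaka_axioms.intro)
  note iso = T.\<Phi>_dk_iso[folded \<A>]
  have "finitely_generated_dk_algebra d \<A>"
    by (rule finitely_generated_dk_iso[OF _ T.dk_algebra_tannaka[folded \<A>] iso]) (use G.finitely_generated_A in \<open>simp add: A\<close>)
  moreover have "T.\<Phi> \<in> dk_hom \<A> A" "T.\<Phi> ` carrier \<A> = carrier A"
    using iso by (simp_all add: dk_iso_def bij_betw_def)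
  ultimately show ?thesis using iso T.\<Phi>_rep_coeff by blast
qed

end
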